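(* Let $\mu\in\mathbb{R}^d$, $\mathcal{C}\in\mathbb{R}$, let $\Sigma\in\mathbb{R}^{d\times d}$ be symmetric and strictly positive definite, and put $V_0(x)=\frac12 (x-\mu)\cdot\Sigma^{-1}(x-\mu)$. Let $V\in L^\infty_{\mathrm{loc}}(\mathbb{R}^d)$ satisfy $V\ge 0$ a.e. and $V(x)\ge \mathcal{C}+V_0(x)$, and let $\rho_\infty=\frac1Z e^{-V}$ with $Z=\int_{\mathbb{R}^d}e^{-V}\,dx$. Then for any kernel $k\in L^1(\mathbb{R}^d)+L^2(\mathbb{R}^d)$ such that $\hat k\in W^{1,\infty}(\mathbb{R}^d)$ and, for some constant $D_k\ge 1$, $$\frac{1}{D_k}\frac{1}{1+|\xi|^2}\le \hat k(\xi)\le D_k\frac{1}{1+|\xi|^2}\qquad\text{for all }\xi\in\mathbb{R}^d ,$$ there exists a constant $\lambda>0$ depending on $V$, $\Sigma$, $\mathcal{C}$ and $D_k$, such that for every $\rho$ satisfying condition (H) (stated in the context), $$\lambda\int_{\mathbb{R}^d}\left|\rho\, e^{V-\frac{V_0}{2}}-\tau\, e^{-\frac{V_0}{2}}\right|^2dx\le \mathbb{D}_k^2(\rho\|\rho_\infty),$$ where $\tau\in\mathbb{R}$ is given by $$\tau=\frac{\int_{B_\varepsilon}\mathcal{F}\big(\rho\, e^{V-\frac{V_0}{2}}\big)\,d\xi}{\int_{B_\varepsilon}\mathcal{F}\big(e^{-\frac{V_0}{2}}\big)\,d\xi},\qquad B_\varepsilon=\{\xi\in\mathbb{R}^d:|\xi|<\varepsilon\},$$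 for some fixed $\varepsilon>0$ depending on $k$ and $d$. If additionally $\rho$ is a probability measure on $\mathbb{R}^d$, then also $$\lambda\,\mathrm{KL}(\rho\|\rho_\infty)\le \mathbb{D}_k^2(\rho\|\rho_\infty).$$ Moreover, there exists a constant $C>0$ depending on $k$ and $\rho_\infty$ such that for all $\rho$ satisfying (H), $$\left\|\rho\, e^{V-\frac{V_0}{2}}\right\|_{L^2}^2+\left\|\rho\, e^{V-\frac{V_0}{2}}\nabla V_0\right\|_{H^{-1}}^2\le C\left(\|\rho\|_{L^1}^2+\mathbb{D}_k^2(\rho\|\rho_\infty)\right).$$
   Context: Functions $\rho$, $V$, $k$ on $\mathbb{R}^d$ are real-valued. The Fourier transform is $\mathcal{F}f(\xi)=\hat f(\xi)=\int_{\mathbb{R}^d}e^{-2\pi i x\cdot\xi}f(x)\,dx$, extended to tempered distributions. $H^s(\mathbb{R}^d)=\{u\in\mathcal{S}'(\mathbb{R}^d): (1+|\xi|^2)^{s/2}\hat u\in L^2(\mathbb{R}^d)\}$ with the corresponding norm (componentwise for vector fields), and $\langle\cdot,\cdot\rangle_{H^{-s},H^s}$ is the duality pairing extending the $L^2$ inner product $\langle f,g\rangle=\int f\cdot\overline{g}\,dx$. $k\in L^1+L^2$ means $k=k_1+k_2$ with $k_1\in L^1$, $k_2\in L^2$. Condition (H) on $\rho$: $\rho\in L^1(\mathbb{R}^d)$, $\ \rho\, e^{V-V_0/2}\in L^2(\mathbb{R}^d)$, and $\ \rho\, e^{V-V_0/2}\,\nabla V_0\in H^{-1}(\mathbb{R}^d)$.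 Under (H) the distribution $\nabla(\rho e^V)e^{-V_0/2}=\nabla(\rho e^{V-V_0/2})+\frac12\rho e^{V-V_0/2}\nabla V_0$ belongs to $H^{-1}(\mathbb{R}^d)$. Since $|\hat k(\xi)|\le D_k(1+|\xi|^2)^{-1}$, the map $f\mapsto k\ast f$ extends uniquely to a bounded linear map $H^{-1}(\mathbb{R}^d)\to H^1(\mathbb{R}^d)$ (multiplication of $\hat f$ by $\hat k$). The dissipation (Stein–Fisher information) is $$\mathbb{D}_k^2(\rho\|\rho_\infty)=\left\langle \nabla(\rho e^V)e^{-\frac{V_0}{2}},\;k\ast\left(\nabla(\rho e^V)e^{-\frac{V_0}{2}}\right)\right\rangle_{H^{-1}(\mathbb{R}^d),H^1(\mathbb{R}^d)} .$$ The Kullback–Leibler divergence is $\mathrm{KL}(\rho\|\rho_\infty)=\int \ln\big(\frac{d\rho}{d\rho_\infty}\big)\frac{d\rho}{d\rho_\infty}\,d\rho_\infty$ if $\rho\ll\rho_\infty$ and $\frac{d\rho}{d\rho_\infty}\ln\big(\frac{d\rho}{d\rho_\infty}\big)\in L^1(\mathbb{R}^d,\rho_\infty)$, and $+\infty$ otherwise.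
   Formalization: Where the denominator of τ vanishes for the ε depending on k and d (τ is then undefined), another radius depending on μ and Σ is used; λ may also depend on μ, and the last constant C on μ, Σ, 𝒞, V, D_k as well as k, since the stated dependences fail. *)

theory Defs
  imports "HOL-Probability.Probability"
begin

section \<open>Function spaces\<close>

text \<open>
  Elements of Lebesgue and Sobolev classes are represented by Borel functions with respect to
  \<^term>\<open>lborel\<close>.  Nothing below depends on the choice of the representative.
\<close>

definition square_integrable :: "('a::euclidean_space \<Rightarrow> 'b::{real_normed_vector, second_countable_topology}) \<Rightarrow> bool" where
  "square_integrable f \<longleftrightarrow> f \<in> borel_measurable lborel \<and> integrable lborel (\<lambda>x. (norm (f x))\<^sup>2)"

definition ess_bounded :: "('a::euclidean_space \<Rightarrow> 'b::real_normed_vector) \<Rightarrow> bool" where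
  "ess_bounded f \<longleftrightarrow> f \<in> borel_measurable lborel \<and> (\<exists>B. AE x in lborel. norm (f x) \<le> B)"

definition loc_ess_bounded :: "('a::euclidean_space \<Rightarrow> 'b::real_normed_vector) \<Rightarrow> bool" where
  "loc_ess_bounded f \<longleftrightarrow> f \<in> borel_measurable lborel \<and>
     (\<forall>K. compact K \<longrightarrow> (\<exists>B. AE x in lborel. x \<in> K \<longrightarrow> norm (f x) \<le> B))"

definition L1_plus_L2 :: "('a::euclidean_space \<Rightarrow> real) \<Rightarrow> bool" where
  "L1_plus_L2 k \<longleftrightarrow>
     (\<exists>k1 k2. integrable lborel k1 \<and> square_integrable k2 \<and> (\<forall>x. k x = k1 x + k2 x))"

definition partial :: "'d::finite \<Rightarrow> (real^'d \<Rightarrow> 'b::real_normed_vector) \<Rightarrow> real^'d \<Rightarrow> 'b" where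
  "partial i f x = frechet_derivative f (at x) (axis i 1)"

text \<open>Iterated partial derivatives; a list of indices plays the role of a multi-index.\<close>

definition partials :: "'d::finite list \<Rightarrow> (real^'d \<Rightarrow> 'b::real_normed_vector) \<Rightarrow> real^'d \<Rightarrow> 'b" where
  "partials is f = foldr partial is f"

definition smooth :: "(real^'d::finite \<Rightarrow> complex) \<Rightarrow> bool" where
  "smooth f \<longleftrightarrow> (\<forall>is x. partials is f differentiable (at x))"

definition test_functions :: "(real^'d::finite \<Rightarrow> complex) set" where
  "test_functions = {\<phi>. smooth \<phi> \<and> compact (closure {x. \<phi> x \<noteq> 0})}"

definition W1inf :: "(real^'d::finite \<Rightarrow> complex) \<Rightarrow> bool" where
  "W1inf f \<longleftrightarrow> ess_bounded f \<and>
     (\<forall>i. \<exists>g. ess_bounded g \<and>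
        (\<forall>\<phi>\<in>test_functions.
           (LINT x|lborel. f x * partial i \<phi> x) = - (LINT x|lborel. g x * \<phi> x)))"

section \<open>Tempered distributions and the Fourier transform\<close>

definition schwartz :: "(real^'d::finite \<Rightarrow> complex) set" where
  "schwartz = {\<phi>. smooth \<phi> \<and>
     (\<forall>is N. bounded (range (\<lambda>x. (1 + norm x) ^ N * cmod (partials is \<phi> x))))}"

definition schwartz_seminorm :: "nat \<Rightarrow> (real^'d::finite \<Rightarrow> complex) \<Rightarrow> real" where
  "schwartz_seminorm N \<phi> =
     (SUP p \<in> {is. length is \<le> N} \<times> UNIV. (1 + norm (snd p)) ^ N * cmod (partials (fst p) \<phi> (snd p)))"

text \<open>
  A distribution is a functional on all functions, but only its values on
  \<^const>\<open>schwartz\<close> are meaningful.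
\<close>

type_synonym 'd distr = "(real^'d \<Rightarrow> complex) \<Rightarrow> complex"

definition tempered :: "'d::finite distr \<Rightarrow> bool" where
  "tempered T \<longleftrightarrow>
     (\<forall>\<phi>\<in>schwartz. \<forall>\<psi>\<in>schwartz. \<forall>a b.
        T (\<lambda>x. a * \<phi> x + b * \<psi> x) = a * T \<phi> + b * T \<psi>) \<and>
     (\<exists>N B. \<forall>\<phi>\<in>schwartz. cmod (T \<phi>) \<le> B * schwartz_seminorm N \<phi>)"

definition distr_of :: "(real^'d::finite \<Rightarrow> complex) \<Rightarrow> 'd distr" where
  "distr_of f \<phi> = (LINT x|lborel. f x * \<phi> x)"

definition distr_of_real :: "(real^'d::finite \<Rightarrow> real) \<Rightarrow> 'd distr" where
  "distr_of_real f = distr_of (\<lambda>x. complex_of_real (f x))"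

definition distr_partial :: "'d::finite \<Rightarrow> 'd distr \<Rightarrow> 'd distr" where
  "distr_partial i T \<phi> = - T (partial i \<phi>)"

definition fourier_integral :: "(real^'d::finite \<Rightarrow> complex) \<Rightarrow> real^'d \<Rightarrow> complex" where
  "fourier_integral f \<xi> = (LINT x|lborel. cis (- 2 * pi * (x \<bullet> \<xi>)) * f x)"

definition inv_fourier_integral :: "(real^'d::finite \<Rightarrow> complex) \<Rightarrow> real^'d \<Rightarrow> complex" where
  "inv_fourier_integral f x = (LINT \<xi>|lborel. cis (2 * pi * (x \<bullet> \<xi>)) * f \<xi>)"

definition fourier_distr :: "'d::finite distr \<Rightarrow> 'd distr" where
  "fourier_distr T \<phi> = T (fourier_integral \<phi>)"

text \<open>\<open>fourier_rep T g\<close>: the Fourier transform of \<open>T\<close> is (the regular distribution given by) \<open>g\<close>.\<close>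

definition fourier_rep :: "'d::finite distr \<Rightarrow> (real^'d \<Rightarrow> complex) \<Rightarrow> bool" where
  "fourier_rep T g \<longleftrightarrow> g \<in> borel_measurable lborel \<and>
     (\<forall>\<phi>\<in>schwartz. integrable lborel (\<lambda>\<xi>. g \<xi> * \<phi> \<xi>) \<and> fourier_distr T \<phi> = distr_of g \<phi>)"

text \<open>A representative, unique up to null sets, when one exists.\<close>

definition fourier_fun :: "'d::finite distr \<Rightarrow> real^'d \<Rightarrow> complex" where
  "fourier_fun T = (SOME g. fourier_rep T g)"

section \<open>Sobolev spaces and the duality pairing\<close>

definition sobolev :: "real \<Rightarrow> 'd::finite distr set" where
  "sobolev s = {T. tempered T \<and>
     (\<exists>g. fourier_rep T g \<and>
        square_integrable (\<lambda>\<xi>. complex_of_real ((1 + (norm \<xi>)\<^sup>2) powr (s / 2)) * g \<xi>))}"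

definition sobolev_norm :: "real \<Rightarrow> 'd::finite distr \<Rightarrow> real" where
  "sobolev_norm s T =
     sqrt (LINT \<xi>|lborel. (cmod (complex_of_real ((1 + (norm \<xi>)\<^sup>2) powr (s / 2)) * fourier_fun T \<xi>))\<^sup>2)"

text \<open>
  The pairing of \<open>f\<close> in \<open>H\<^sup>-\<^sup>s\<close> with \<open>g\<close> in \<open>H\<^sup>s\<close> is the extension, by continuity in the second
  argument with respect to the \<open>H\<^sup>s\<close> norm, of \<open>(f, \<phi>) \<mapsto> f (cnj \<circ> \<phi>)\<close> for Schwartz \<open>\<phi>\<close>, which is
  the \<open>L\<^sup>2\<close> inner product (antilinear in the second argument) when \<open>f\<close> is an \<open>L\<^sup>2\<close> function.
\<close>

definition sobolev_pairing :: "real \<Rightarrow> 'd::finite distr \<Rightarrow> 'd distr \<Rightarrow> complex" where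
  "sobolev_pairing s f g =
     (THE z. \<forall>\<phi>. (\<forall>n::nat. \<phi> n \<in> schwartz) \<and>
                 (\<lambda>n. sobolev_norm s (\<lambda>\<psi>. g \<psi> - distr_of (\<phi> n) \<psi>)) \<longlonglongrightarrow> 0
             \<longrightarrow> (\<lambda>n. f (\<lambda>x. cnj (\<phi> n x))) \<longlonglongrightarrow> z)"

text \<open>
  The map \<open>T \<mapsto> k \<star> T\<close> from \<open>H\<^sup>-\<^sup>1\<close> to \<open>H\<^sup>1\<close>: the distribution whose Fourier transform is the product
  of the Fourier transforms of \<open>k\<close> and \<open>T\<close>.
\<close>

definition convolve :: "(real^'d::finite \<Rightarrow> real) \<Rightarrow> 'd distr \<Rightarrow> 'd distr" where
  "convolve k T \<phi> =
     (LINT \<xi>|lborel. fourier_fun (distr_of_real k) \<xi> * fourier_fun T \<xi> * inv_fourier_integral \<phi> \<xi>)"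

section \<open>The Stein--Fisher information and the Kullback--Leibler divergence\<close>

definition sym_pos_def :: "real^'d^'d::finite \<Rightarrow> bool" where
  "sym_pos_def A \<longleftrightarrow> transpose A = A \<and> (\<forall>x. x \<noteq> 0 \<longrightarrow> x \<bullet> (A *v x) > 0)"

definition quad_potential :: "real^'d \<Rightarrow> real^'d^'d \<Rightarrow> real^'d::finite \<Rightarrow> real" where
  "quad_potential \<mu> A x = 1 / 2 * ((x - \<mu>) \<bullet> (matrix_inv A *v (x - \<mu>)))"

definition rho_inf :: "(real^'d::finite \<Rightarrow> real) \<Rightarrow> real^'d \<Rightarrow> real" where
  "rho_inf V x = exp (- V x) / (LINT y|lborel. exp (- V y))"

text \<open>
  The two-sided bound is imposed at every point on some representative \<open>\<kappa>\<close> of the Fourier transform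
  of \<open>k\<close>; it includes that \<open>\<kappa>\<close> is real-valued.
\<close>

definition stein_kernel :: "real \<Rightarrow> (real^'d::finite \<Rightarrow> real) \<Rightarrow> bool" where
  "stein_kernel D k \<longleftrightarrow> L1_plus_L2 k \<and>
     (\<exists>\<kappa>. fourier_rep (distr_of_real k) \<kappa> \<and> W1inf \<kappa> \<and>
        (\<forall>\<xi>. \<kappa> \<xi> \<in> \<real> \<and> 1 / D * (1 / (1 + (norm \<xi>)\<^sup>2)) \<le> Re (\<kappa> \<xi>) \<and>
                            Re (\<kappa> \<xi>) \<le> D * (1 / (1 + (norm \<xi>)\<^sup>2))))"

definition weighted :: "(real^'d::finite \<Rightarrow> real) \<Rightarrow> (real^'d \<Rightarrow> real) \<Rightarrow> (real^'d \<Rightarrow> real) \<Rightarrow> real^'d \<Rightarrow> real" where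
  "weighted V V0 \<rho> x = \<rho> x * exp (V x - V0 x / 2)"

text \<open>The \<open>i\<close>-th component of the vector field \<open>\<rho> e\<^sup>V\<^sup>-\<^sup>V\<^sup>0\<^sup>/\<^sup>2 \<nabla>V\<^sub>0\<close>.\<close>

definition weighted_grad ::
    "(real^'d::finite \<Rightarrow> real) \<Rightarrow> (real^'d \<Rightarrow> real) \<Rightarrow> (real^'d \<Rightarrow> real) \<Rightarrow> 'd \<Rightarrow> 'd distr" where
  "weighted_grad V V0 \<rho> i = distr_of_real (\<lambda>x. weighted V V0 \<rho> x * partial i V0 x)"

definition condition_H :: "(real^'d::finite \<Rightarrow> real) \<Rightarrow> (real^'d \<Rightarrow> real) \<Rightarrow> (real^'d \<Rightarrow> real) \<Rightarrow> bool" where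
  "condition_H V V0 \<rho> \<longleftrightarrow> integrable lborel \<rho> \<and> square_integrable (weighted V V0 \<rho>) \<and>
     (\<forall>i. weighted_grad V V0 \<rho> i \<in> sobolev (-1))"

text \<open>
  The \<open>i\<close>-th component of \<open>\<nabla>(\<rho> e\<^sup>V) e\<^sup>-\<^sup>V\<^sup>0\<^sup>/\<^sup>2\<close>, understood as
  \<open>\<nabla>(\<rho> e\<^sup>V\<^sup>-\<^sup>V\<^sup>0\<^sup>/\<^sup>2) + 1/2 \<rho> e\<^sup>V\<^sup>-\<^sup>V\<^sup>0\<^sup>/\<^sup>2 \<nabla>V\<^sub>0\<close>.
\<close>

definition stein_field ::
    "(real^'d::finite \<Rightarrow> real) \<Rightarrow> (real^'d \<Rightarrow> real) \<Rightarrow> (real^'d \<Rightarrow> real) \<Rightarrow> 'd \<Rightarrow> 'd distr" where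
  "stein_field V V0 \<rho> i \<phi> =
     distr_partial i (distr_of_real (weighted V V0 \<rho>)) \<phi> + 1 / 2 * weighted_grad V V0 \<rho> i \<phi>"

text \<open>The pairing is a real number for the kernels considered here, since their Fourier transform is real.\<close>

definition stein_fisher ::
    "(real^'d::finite \<Rightarrow> real) \<Rightarrow> (real^'d \<Rightarrow> real) \<Rightarrow> (real^'d \<Rightarrow> real) \<Rightarrow> (real^'d \<Rightarrow> real) \<Rightarrow> real" where
  "stein_fisher k V V0 \<rho> =
     Re (\<Sum>i\<in>UNIV. sobolev_pairing 1 (stein_field V V0 \<rho> i) (convolve k (stein_field V V0 \<rho> i)))"

definition fourier_ball :: "real \<Rightarrow> (real^'d::finite \<Rightarrow> real) \<Rightarrow> complex" where
  "fourier_ball \<epsilon> f = (LINT \<xi>:ball 0 \<epsilon>|lborel. fourier_fun (distr_of_real f) \<xi>)"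

text \<open>Here \<open>0 ln 0 = 0\<close>, by the library convention \<open>ln 0 = 0\<close>.\<close>

definition KL :: "'a measure \<Rightarrow> 'a measure \<Rightarrow> ereal" where
  "KL P Q =
     (if absolutely_continuous Q P \<and>
         integrable Q (\<lambda>x. enn2real (RN_deriv Q P x) * ln (enn2real (RN_deriv Q P x)))
      then ereal (LINT x|Q. ln (enn2real (RN_deriv Q P x)) * enn2real (RN_deriv Q P x))
      else \<infinity>)"

definition measure_of_density :: "(real^'d::finite \<Rightarrow> real) \<Rightarrow> (real^'d) measure" where
  "measure_of_density f = density lborel (\<lambda>x. ennreal (f x))"

definition probability_density :: "(real^'d::finite \<Rightarrow> real) \<Rightarrow> bool" where
  "probability_density \<rho> \<longleftrightarrow> (AE x in lborel. \<rho> x \<ge> 0) \<and> prob_space (measure_of_density \<rho>)"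

end

theory Submission
  imports Defs
begin

text \<open>
  Put \<open>f = \<rho> e\<^sup>V\<^sup>-\<^sup>V\<^sup>0\<^sup>/\<^sup>2\<close> and let \<open>u\<close> be its Fourier transform. The field \<open>\<nabla>f + 1/2 f \<nabla>V\<^sub>0\<close> lies in \<open>H\<^sup>-\<^sup>1\<close>;
  with \<open>G\<close> its Fourier transform, the bounds on the transform of \<open>k\<close> make the Stein--Fisher information
  comparable to \<open>\<integral> |G|\<^sup>2 / (1 + |\<xi>|\<^sup>2)\<close>. Since \<open>\<nabla>V\<^sub>0\<close> is affine, \<open>G\<close> is, up to an invertible matrix, the result of
  applying to \<open>u\<close> the first order operators \<open>\<partial>\<^sub>l + 8 \<pi>\<^sup>2 (S \<xi>)\<^sub>l + 2 \<pi> \<i> \<mu>\<^sub>l\<close>, which annihilate the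
  transform \<open>E\<close> of the Gaussian \<open>e\<^sup>-\<^sup>V\<^sup>0\<^sup>/\<^sup>2\<close>. What is needed is therefore a Poincare inequality for these
  operators in which the right-hand side carries the weight \<open>1 / (1 + |\<xi>|\<^sup>2)\<close> and the left-hand side does not.
  On a ball it is the ordinary Poincare inequality for \<open>u / E\<close>. Far out, the radial part of the drift is
  coercive: integrating the divergence of \<open>\<xi> |u|\<^sup>2 / (1 + |\<xi>|\<^sup>2)\<close> recovers the lost weight. Functions \<open>u\<close>
  for which the operators only act weakly are mollified by a Gaussian; the commutator with the linear
  drift vanishes in the limit.

  Plancherel turns this into the \<open>L\<^sup>2\<close> bound. The relative entropy is at most the \<open>\<chi>\<^sup>2\<close>-divergence, which
  \<open>V \<ge> C + V\<^sub>0\<close> bounds by the \<open>L\<^sup>2\<close> distance, and pairing with \<open>e\<^sup>-\<^sup>V\<^sup>+\<^sup>V\<^sup>0\<^sup>/\<^sup>2\<close> controls \<open>\<tau>\<close> by the mass of \<open>\<rho>\<close>.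
\<close>

section \<open>Schwartz functions\<close>

text \<open>The two-sided bound on the transform of \<open>k\<close> sees only the
  \<open>H^-1\<close> norm of the field, while the claim concerns the unweighted \<open>L^2\<close>
  norm. A full factor \<open>1 + |xi|^2\<close> must be gained, and an estimate on a ball cannot
  supply it; it comes from the linear growth of the Gaussian drift.

  The kernel of the operators is spanned by \<open>E\<close>, and \<open>tau\<close> fixes the
  multiple to subtract. It is given by a ball average rather than by an inner product with
  \<open>E\<close>; all that matters is that this functional is continuous on \<open>L^2\<close>, so
  that it passes to the limit of mollified solutions, and that it does not vanish on
  \<open>E\<close>. The latter is delicate: \<open>E\<close> carries the phase of the mean
  \<open>mu\<close>, and its average over a given ball may vanish. A sufficiently small ball always
  works since \<open>E\<close> is continuous with value 1 at the origin.

  The Poincare constant depends on \<open>mu\<close>, \<open>Sigma\<close> and the radius alone, and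
  \<open>D\<close> enters as a factor; the potential \<open>V\<close> is seen only through
  \<open>f\<close>. It affects the constants when \<open>f\<close> is translated back into entropy
  and mass.\<close>

lemma partial_eq:
  assumes "(f has_derivative f') (at x)"
  shows "partial i f x = f' (axis i 1)"
  using frechet_derivative_at[OF assms] by (simp add: partial_def)

lemma has_derivative_partial:
  assumes "f differentiable (at x)"
  shows "(f has_derivative (\<lambda>h. \<Sum>i\<in>UNIV. (h $ i) *\<^sub>R partial i f x)) (at x)"
proof -
  let ?D = "frechet_derivative f (at x)"
  have D: "(f has_derivative ?D) (at x)"
    using assms frechet_derivative_works by blast
  then have lin: "linear ?D"
    using has_derivative_linear by blast
  have "?D h = (\<Sum>i\<in>UNIV. (h $ i) *\<^sub>R partial i f x)" for h
  proof -
    have "?D h = ?D (\<Sum>i\<in>UNIV. (h $ i) *\<^sub>R axis i 1)"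
      using basis_expansion[of h] by (simp add: scalar_mult_eq_scaleR)
    also have "\<dots> = (\<Sum>i\<in>UNIV. (h $ i) *\<^sub>R partial i f x)"
      by (simp only: linear_sum[OF lin] linear_scale[OF lin] partial_def)
    finally show ?thesis .
  qed
  with D show ?thesis
    by (metis (no_types, lifting) ext)
qed

lemma partial_add:
  assumes "f differentiable (at x)" "g differentiable (at x)"
  shows "partial i (\<lambda>x. f x + g x) x = partial i f x + partial i g x"
  using partial_eq[OF has_derivative_add[OF assms(1)[unfolded frechet_derivative_works] assms(2)[unfolded frechet_derivative_works]]]
  by (simp add: partial_def)

lemma partial_cmult:
  fixes f :: "real^'d::finite \<Rightarrow> 'b::real_normed_algebra"
  assumes "f differentiable (at x)"
  shows "partial i (\<lambda>x. c * f x) x = c * partial i f x"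
  using partial_eq[OF has_derivative_mult_right[OF assms[unfolded frechet_derivative_works]]]
  by (simp add: partial_def)

lemma partial_mult:
  fixes f :: "real^'d::finite \<Rightarrow> 'b::real_normed_algebra"
  assumes "f differentiable (at x)" "g differentiable (at x)"
  shows "partial i (\<lambda>x. f x * g x) x = f x * partial i g x + partial i f x * g x"
  using partial_eq[OF has_derivative_mult[OF assms(1)[unfolded frechet_derivative_works] assms(2)[unfolded frechet_derivative_works]]]
  by (simp add: partial_def)

lemma has_derivative_coord:
  "((\<lambda>x::real^'d::finite. complex_of_real (x $ j)) has_derivative (\<lambda>h. complex_of_real (h $ j))) (at x)"
  by (rule bounded_linear_imp_has_derivative[OF bounded_linear_compose[OF bounded_linear_of_real bounded_linear_vec_nth]])

lemma differentiable_coord: "(\<lambda>x::real^'d::finite. complex_of_real (x $ j)) differentiable (at x)"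
  using has_derivative_coord by (auto simp: differentiable_def)

lemma partial_coord:
  "partial i (\<lambda>x::real^'d::finite. complex_of_real (x $ j)) x = (if i = j then 1 else 0)"
  unfolding partial_eq[OF has_derivative_coord] by (simp add: axis_def eq_commute)

lemma partial_cnj:
  assumes "f differentiable (at x)"
  shows "partial i (\<lambda>x. cnj (f x)) x = cnj (partial i f x)"
  using partial_eq[OF has_derivative_cnj[OF assms[unfolded frechet_derivative_works]]]
  by (simp add: partial_def)

text \<open>Iterated partials of a member never leave the class, so one differentiability and one
  decay statement for the class give all the seminorm bounds at once. Membership proofs need not
  touch lists of indices: it is enough to exhibit a class closed under
  \<open>partial\<close>.\<close>

lemma schwartz_coinduct:
  fixes P :: "(real^'d::finite \<Rightarrow> complex) set"
  assumes diff: "\<And>f x. f \<in> P \<Longrightarrow> f differentiable (at x)"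
    and bd: "\<And>f N. f \<in> P \<Longrightarrow> \<exists>B. \<forall>x. (1 + norm x) ^ N * cmod (f x) \<le> B"
    and part: "\<And>f i. f \<in> P \<Longrightarrow> partial i f \<in> P"
  shows "P \<subseteq> schwartz"
proof
  fix f assume f: "f \<in> P"
  have P: "partials is f \<in> P" for "is"
    by (induction "is") (use f part in \<open>auto simp: partials_def\<close>)
  have "bounded (range (\<lambda>x. (1 + norm x) ^ N * cmod (partials is f x)))" for "is" N
  proof -
    obtain B where "\<forall>x. (1 + norm x) ^ N * cmod (partials is f x) \<le> B"
      using bd[OF P] by blast
    then show ?thesis
      by (auto simp: bounded_iff intro!: exI[of _ B])
  qed
  then show "f \<in> schwartz"
    using diff[OF P] by (auto simp: schwartz_def smooth_def)
qed

lemma schwartz_differentiable: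
  assumes "f \<in> schwartz"
  shows "f differentiable (at x)"
proof -
  have "partials [] f differentiable (at x)"
    using assms unfolding schwartz_def smooth_def by blast
  then show ?thesis by (simp add: partials_def)
qed

lemma schwartz_decay:
  assumes "f \<in> schwartz"
  shows "\<exists>B. \<forall>x. (1 + norm x) ^ N * cmod (f x) \<le> B"
proof -
  have "bounded (range (\<lambda>x. (1 + norm x) ^ N * cmod (partials [] f x)))"
    using assms by (auto simp: schwartz_def)
  then obtain B where "\<forall>x. norm ((1 + norm x) ^ N * cmod (f x)) \<le> B"
    by (auto simp: bounded_iff partials_def)
  then show ?thesis
    by (intro exI[of _ B]) (auto simp: abs_le_iff)
qed

lemma schwartz_partial:
  assumes "f \<in> schwartz"
  shows "partial i f \<in> schwartz"
proof -
  have "partials is (partial i f) = partials (is @ [i]) f" for "is"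
    by (simp add: partials_def)
  with assms show ?thesis
    by (auto simp: schwartz_def smooth_def)
qed

lemma continuous_on_schwartz:
  assumes "f \<in> schwartz"
  shows "continuous_on A f"
  by (simp add: assms continuous_at_imp_continuous_on differentiable_imp_continuous_within
      schwartz_differentiable)

text \<open>The product rule turns a partial of a coordinate multiple into a sum, so the operations
  cannot be treated one at a time. The closure under all of them together is a class to which
  \<open>schwartz_coinduct\<close> applies, and \<open>schwartz_alg_eq\<close> shows that it
  contains nothing new.\<close>

inductive_set schwartz_alg :: "(real^'d::finite \<Rightarrow> complex) set" where
  base: "f \<in> schwartz \<Longrightarrow> f \<in> schwartz_alg"
| add: "f \<in> schwartz_alg \<Longrightarrow> g \<in> schwartz_alg \<Longrightarrow> (\<lambda>x. f x + g x) \<in> schwartz_alg"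
| scale: "f \<in> schwartz_alg \<Longrightarrow> (\<lambda>x. c * f x) \<in> schwartz_alg"
| coord: "f \<in> schwartz_alg \<Longrightarrow> (\<lambda>x. complex_of_real (x $ j) * f x) \<in> schwartz_alg"
| cnj: "f \<in> schwartz_alg \<Longrightarrow> (\<lambda>x. cnj (f x)) \<in> schwartz_alg"

lemma schwartz_alg_props:
  assumes "f \<in> schwartz_alg"
  shows "(\<forall>x. f differentiable (at x)) \<and> (\<forall>N. \<exists>B. \<forall>x. (1 + norm x) ^ N * cmod (f x) \<le> B) \<and>
    (\<forall>i. partial i f \<in> schwartz_alg)"
  using assms
proof induction
  case (base f)
  then show ?case
    using schwartz_differentiable schwartz_decay schwartz_partial schwartz_alg.base by metis
next
  case (add f g)
  have "\<exists>B. \<forall>x. (1 + norm x) ^ N * cmod (f x + g x) \<le> B" for N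
  proof -
    obtain B1 B2 where "\<forall>x. (1 + norm x) ^ N * cmod (f x) \<le> B1" "\<forall>x. (1 + norm x) ^ N * cmod (g x) \<le> B2"
      using add by meson
    moreover have "(1 + norm x) ^ N * cmod (f x + g x) \<le> (1 + norm x) ^ N * cmod (f x) + (1 + norm x) ^ N * cmod (g x)" for x
      by (metis (no_types, opaque_lifting) add_nonneg_nonneg distrib_left mult_left_mono norm_ge_zero norm_triangle_ineq zero_le_one zero_le_power)
    ultimately show ?thesis
      by (intro exI[of _ "B1 + B2"]) (meson add_mono order_trans)
  qed
  moreover have "partial i (\<lambda>x. f x + g x) = (\<lambda>x. partial i f x + partial i g x)" for i
    using add by (intro ext partial_add) auto
  ultimately show ?case
    using add by (simp add: schwartz_alg.add)
next
  case (scale f c)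
  have "\<exists>B. \<forall>x. (1 + norm x) ^ N * cmod (c * f x) \<le> B" for N
  proof -
    obtain B1 where B1: "\<forall>x. (1 + norm x) ^ N * cmod (f x) \<le> B1"
      using scale by meson
    have "(1 + norm x) ^ N * cmod (c * f x) \<le> cmod c * B1" for x
      using mult_left_mono[OF B1[rule_format, of x], of "cmod c"] by (simp add: norm_mult mult_ac)
    then show ?thesis by blast
  qed
  moreover have "partial i (\<lambda>x. c * f x) = (\<lambda>x. c * partial i f x)" for i
    using scale by (intro ext partial_cmult) auto
  ultimately show ?case
    using scale by (simp add: schwartz_alg.scale)
next
  case (coord f j)
  have "\<exists>B. \<forall>x. (1 + norm x) ^ N * cmod (complex_of_real (x $ j) * f x) \<le> B" for N
  proof -
    \<comment> \<open>One extra power of the weight is spent on the coordinate factor.\<close>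
    obtain B1 where B1: "\<forall>x. (1 + norm x) ^ (Suc N) * cmod (f x) \<le> B1"
      using coord by meson
    have "(1 + norm x) ^ N * cmod (complex_of_real (x $ j) * f x) \<le> B1" for x
    proof -
      have "\<bar>x $ j\<bar> \<le> 1 + norm x"
        using component_le_norm_cart[of x j] by simp
      then have "(1 + norm x) ^ N * (\<bar>x $ j\<bar> * cmod (f x)) \<le> (1 + norm x) ^ N * ((1 + norm x) * cmod (f x))"
        by (intro mult_left_mono mult_right_mono) auto
      also have "\<dots> \<le> B1"
        using B1[rule_format, of x] by (simp add: mult_ac)
      finally show ?thesis
        by (simp add: norm_mult)
    qed
    then show ?thesis by blast
  qed
  moreover have "partial i (\<lambda>x. complex_of_real (x $ j) * f x)
      = (\<lambda>x. complex_of_real (x $ j) * partial i f x + (if i = j then 1 else 0) * f x)" for i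
  proof
    fix x
    show "partial i (\<lambda>x. complex_of_real (x $ j) * f x) x
      = complex_of_real (x $ j) * partial i f x + (if i = j then 1 else 0) * f x"
      using coord by (simp add: partial_mult partial_coord differentiable_coord)
  qed
  moreover have "(\<lambda>x. complex_of_real (x $ j) * f x) differentiable (at x)" for x
    using coord by (intro differentiable_mult differentiable_coord) auto
  moreover have "(\<lambda>x. complex_of_real (x $ j) * partial i f x + (if i = j then 1 else 0) * f x) \<in> schwartz_alg" for i
    by (intro schwartz_alg.add schwartz_alg.coord schwartz_alg.scale) (use coord in auto)
  ultimately show ?case
    by simp
next
  case (cnj f)
  have "partial i (\<lambda>x. cnj (f x)) = (\<lambda>x. cnj (partial i f x))" for i
    using cnj by (intro ext partial_cnj) auto
  moreover have "(\<lambda>x. cnj (f x)) differentiable (at x)" for x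
    using cnj has_derivative_cnj unfolding differentiable_def by blast
  ultimately show ?case
    using cnj by (simp add: schwartz_alg.cnj)
qed

lemma schwartz_alg_eq: "schwartz_alg = schwartz"
  using schwartz_coinduct[of schwartz_alg] schwartz_alg_props schwartz_alg.base by blast

lemmas schwartz_add = schwartz_alg.add[unfolded schwartz_alg_eq]
  and schwartz_cmult = schwartz_alg.scale[unfolded schwartz_alg_eq]
  and schwartz_coord_mult = schwartz_alg.coord[unfolded schwartz_alg_eq]
  and schwartz_cnj = schwartz_alg.cnj[unfolded schwartz_alg_eq]

lemma schwartz_zero: "(\<lambda>x. 0) \<in> (schwartz :: (real^'d::finite \<Rightarrow> complex) set)"
proof -
  have "partial i (\<lambda>x::real^'d. 0::complex) = (\<lambda>x. 0)" for i
    by (rule ext) (simp add: partial_eq[OF has_derivative_const])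
  then have "{\<lambda>x::real^'d. 0::complex} \<subseteq> schwartz"
    by (intro schwartz_coinduct) auto
  then show ?thesis by simp
qed

lemma schwartz_sum:
  fixes f :: "'i \<Rightarrow> real^'d::finite \<Rightarrow> complex"
  assumes "\<And>i. i \<in> I \<Longrightarrow> f i \<in> schwartz"
  shows "(\<lambda>x. \<Sum>i\<in>I. f i x) \<in> schwartz"
  using assms by (induction I rule: infinite_finite_induct) (simp_all add: schwartz_zero schwartz_add)

lemma schwartz_diff:
  assumes "f \<in> schwartz" "g \<in> schwartz"
  shows "(\<lambda>x. f x - g x) \<in> schwartz"
  using schwartz_add[OF assms(1) schwartz_cmult[OF assms(2), of "-1"]] by simp

section \<open>Polynomials times exponentials of coercive polynomials\<close>

lemma real_polynomial_function_partial:
  fixes p :: "real^'d::finite \<Rightarrow> real"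
  assumes "real_polynomial_function p"
  shows "(\<forall>x. p differentiable (at x)) \<and> (\<forall>i. real_polynomial_function (partial i p))"
  using assms
proof induction
  case (linear f)
  then have "(f has_derivative f) (at x)" for x
    using bounded_linear_imp_has_derivative by blast
  then have "partial i f = (\<lambda>x. f (axis i 1))" for i
    using partial_eq by (intro ext) blast
  with linear show ?case
    by (auto intro: bounded_linear_imp_differentiable real_polynomial_function.intros(2))
next
  case (const c)
  have "partial i (\<lambda>x::real^'d. c) = (\<lambda>x. 0)" for i
    by (rule ext) (simp add: partial_eq[OF has_derivative_const])
  then show ?case
    by (auto intro: real_polynomial_function.intros(2))
next
  case (add f g)
  have "partial i (\<lambda>x. f x + g x) = (\<lambda>x. partial i f x + partial i g x)" for i
    using add by (intro ext partial_add) auto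
  then show ?case
    using add by (auto intro: real_polynomial_function.intros(3))
next
  case (mult f g)
  have "partial i (\<lambda>x. f x * g x) = (\<lambda>x. f x * partial i g x + partial i f x * g x)" for i
    using mult by (intro ext partial_mult) auto
  then show ?case
    using mult by (simp add: real_polynomial_function.intros(3,4))
qed

lemma real_polynomial_function_growth:
  fixes p :: "'a::real_normed_vector \<Rightarrow> real"
  assumes "real_polynomial_function p"
  shows "\<exists>c N. c \<ge> 0 \<and> (\<forall>x. \<bar>p x\<bar> \<le> c * (1 + norm x) ^ N)"
  using assms
proof induction
  case (linear f)
  then obtain K where "K > 0" "\<And>x. norm (f x) \<le> norm x * K"
    using bounded_linear.pos_bounded by blast
  then have "\<bar>f x\<bar> \<le> K * (1 + norm x) ^ 1" for x
    by (simp add: algebra_simps add_increasing)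
  then show ?case using \<open>K > 0\<close> by (metis less_imp_le)
next
  case (const c)
  have "\<bar>c\<bar> \<le> \<bar>c\<bar> * (1 + norm (x::'a)) ^ 0" for x by simp
  then show ?case by (metis abs_ge_zero)
next
  case (add f g)
  then obtain c N d M where *: "c \<ge> 0" "\<And>x. \<bar>f x\<bar> \<le> c * (1 + norm x) ^ N" "d \<ge> 0" "\<And>x. \<bar>g x\<bar> \<le> d * (1 + norm x) ^ M"
    by blast
  have "\<bar>f x + g x\<bar> \<le> (c + d) * (1 + norm x) ^ (N + M)" for x
  proof -
    have "\<bar>f x\<bar> \<le> c * (1 + norm x) ^ (N + M)" "\<bar>g x\<bar> \<le> d * (1 + norm x) ^ (N + M)"
      using *(2)[of x] *(4)[of x] mult_left_mono[OF power_increasing[of N "N + M" "1 + norm x"] *(1)]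
       mult_left_mono[OF power_increasing[of M "N + M" "1 + norm x"] *(3)] by auto
    then show ?thesis by (simp add: algebra_simps)
  qed
  then show ?case using * by (metis add_nonneg_nonneg)
next
  case (mult f g)
  then obtain c N d M where *: "c \<ge> 0" "\<And>x. \<bar>f x\<bar> \<le> c * (1 + norm x) ^ N" "d \<ge> 0" "\<And>x. \<bar>g x\<bar> \<le> d * (1 + norm x) ^ M"
    by blast
  have "\<bar>f x * g x\<bar> \<le> (c * d) * (1 + norm x) ^ (N + M)" for x
  proof -
    have "\<bar>f x\<bar> * \<bar>g x\<bar> \<le> (c * (1 + norm x) ^ N) * (d * (1 + norm x) ^ M)"
      using * by (intro mult_mono) auto
    then show ?thesis by (simp add: abs_mult power_add mult_ac)
  qed
  then show ?case using * by (metis mult_nonneg_nonneg)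
qed

text \<open>The power is at most \<open>exp (K t)\<close>; completing the square in
  \<open>K t - a t^2\<close> gives the maximum, attained at \<open>t = K / (2 a)\<close>.\<close>

lemma power_exp_bounded:
  fixes t a :: real
  assumes "a > 0" "t \<ge> 0"
  shows "(1 + t) ^ K * exp (- a * t\<^sup>2) \<le> exp ((real K)\<^sup>2 / (4 * a))"
proof -
  have "(1 + t) ^ K \<le> exp t ^ K"
    using assms by (intro power_mono exp_ge_add_one_self) auto
  also have "\<dots> = exp (real K * t)"
    by (simp add: exp_of_nat_mult)
  finally have "(1 + t) ^ K * exp (- a * t\<^sup>2) \<le> exp (real K * t) * exp (- a * t\<^sup>2)"
    by simp
  also have "\<dots> = exp (real K * t - a * t\<^sup>2)"
    by (simp add: exp_add[symmetric])
  also have "\<dots> \<le> exp ((real K)\<^sup>2 / (4 * a))"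
  proof -
    have "0 \<le> (2 * a * t - real K)\<^sup>2" by simp
    then have "4 * a * (real K * t - a * t\<^sup>2) \<le> (real K)\<^sup>2"
      by (simp add: power2_eq_square algebra_simps)
    then show ?thesis
      using assms by (simp add: field_simps)
  qed
  finally show ?thesis .
qed

text \<open>A partial of \<open>p exp (- q)\<close> is
  \<open>(partial p - p partial q) exp (- q)\<close>. For fixed \<open>q\<close> the products with
  arbitrary polynomials \<open>p\<close> therefore form a class closed under \<open>partial\<close>,
  and coercivity of \<open>q\<close> lets a Gaussian absorb every polynomial weight. Gaussians and
  the smooth approximations of boxes are both instances.\<close>

lemma poly_exp_schwartz:
  fixes p q :: "real^'d::finite \<Rightarrow> real"
  assumes p: "real_polynomial_function p" and q: "real_polynomial_function q"
    and a: "a > 0" and coercive: "\<And>x. q x \<ge> a * (norm x)\<^sup>2 - b"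
  shows "(\<lambda>x. complex_of_real (p x * exp (- q x))) \<in> schwartz"
proof -
  define P where "P = {\<lambda>x. complex_of_real (p x * exp (- q x)) | p. real_polynomial_function p}"
  have "P \<subseteq> schwartz"
  proof (rule schwartz_coinduct)
    fix f assume "f \<in> P"
    then obtain p where f: "f = (\<lambda>x. complex_of_real (p x * exp (- q x)))" and p: "real_polynomial_function p"
      by (auto simp: P_def)
    have dp: "(p has_derivative frechet_derivative p (at x)) (at x)" for x
      using real_polynomial_function_partial[OF p] frechet_derivative_works by blast
    have dq: "(q has_derivative frechet_derivative q (at x)) (at x)" for x
      using real_polynomial_function_partial[OF q] frechet_derivative_works by blast
    have df: "(f has_derivative (\<lambda>h. complex_of_real (p x * (exp (- q x) * - frechet_derivative q (at x) h) +
          frechet_derivative p (at x) h * exp (- q x)))) (at x)" for x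
      unfolding f by (auto intro!: derivative_eq_intros dp dq)
    then show "f differentiable (at x)" for x
      by (auto simp: differentiable_def)
    show "\<exists>B. \<forall>x. (1 + norm x) ^ N * cmod (f x) \<le> B" for N
    proof -
      obtain c M where c: "c \<ge> 0" "\<And>x. \<bar>p x\<bar> \<le> c * (1 + norm x) ^ M"
        using real_polynomial_function_growth[OF p] by blast
      have "(1 + norm x) ^ N * cmod (f x) \<le> c * exp b * exp ((real (N + M))\<^sup>2 / (4 * a))" for x
      proof -
        have "(1 + norm x) ^ N * cmod (f x) = (1 + norm x) ^ N * (\<bar>p x\<bar> * exp (- q x))"
          by (simp add: f norm_mult abs_mult)
        also have "\<dots> \<le> (1 + norm x) ^ N * ((c * (1 + norm x) ^ M) * exp (b - a * (norm x)\<^sup>2))"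
          using c(2)[of x] coercive[of x] c(1) by (intro mult_left_mono mult_mono) auto
        also have "\<dots> = c * exp b * ((1 + norm x) ^ (N + M) * exp (- a * (norm x)\<^sup>2))"
          by (simp add: power_add exp_diff exp_minus field_simps)
        also have "\<dots> \<le> c * exp b * exp ((real (N + M))\<^sup>2 / (4 * a))"
          using c(1) by (intro mult_left_mono power_exp_bounded a) auto
        finally show ?thesis .
      qed
      then show ?thesis by blast
    qed
    show "partial i f \<in> P" for i
    proof -
      have "partial i f = (\<lambda>x. complex_of_real ((partial i p x - p x * partial i q x) * exp (- q x)))"
        using partial_eq[OF df] by (auto simp: partial_def algebra_simps)
      moreover have "real_polynomial_function (\<lambda>x. partial i p x - p x * partial i q x)"
        using p real_polynomial_function_partial[OF p] real_polynomial_function_partial[OF q]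
        by (intro real_polynomial_function_diff real_polynomial_function.intros(4)) auto
      ultimately show ?thesis
        unfolding P_def mem_Collect_eq by metis
    qed
  qed
  with p show ?thesis
    unfolding P_def by blast
qed

section \<open>Affine change of variables, integrability from decay, integrals of partial
  derivatives\<close>

lemma nn_integral_lborel_affine:
  fixes t :: "'a::euclidean_space"
  assumes [measurable]: "f \<in> borel_measurable borel" and c: "c \<noteq> 0"
  shows "(\<integral>\<^sup>+x. f x \<partial>lborel) = ennreal (\<bar>c\<bar> ^ DIM('a)) * (\<integral>\<^sup>+x. f (t + c *\<^sub>R x) \<partial>lborel)"
  by (subst lborel_affine[OF c, of t])
    (simp add: nn_integral_density nn_integral_distr nn_integral_cmult)

lemma integrable_lborel_affine:
  fixes f :: "'a::euclidean_space \<Rightarrow> 'b::{banach, second_countable_topology}"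
  assumes f: "integrable lborel f"
  shows "c \<noteq> 0 \<Longrightarrow> integrable lborel (\<lambda>x. f (t + c *\<^sub>R x))"
  using f f[THEN borel_measurable_integrable] unfolding integrable_iff_bounded
  by (subst (asm) nn_integral_lborel_affine[where c=c and t=t]) (auto simp: ennreal_mult_less_top)

lemma integral_lborel_affine:
  fixes f :: "'a::euclidean_space \<Rightarrow> 'b::{banach, second_countable_topology}"
  assumes f: "integrable lborel f" and c: "c \<noteq> 0"
  shows "(LINT x|lborel. f x) = (\<bar>c\<bar> ^ DIM('a)) *\<^sub>R (LINT x|lborel. f (t + c *\<^sub>R x))"
  using c f f[THEN borel_measurable_integrable] f[THEN integrable_lborel_affine, of c t]
  by (subst lborel_affine[OF c, of t]) (simp add: integral_density integral_distr)

text \<open>The arctangent is a primitive on the right half-line; the left half-line follows by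
  reflection.\<close>

lemma nn_integral_inverse_one_plus_square: "(\<integral>\<^sup>+t. ennreal (1 / (1 + t\<^sup>2)) \<partial>lborel) < \<infinity>"
proof -
  let ?f = "\<lambda>t::real. ennreal (1 / (1 + t\<^sup>2))"
  have half: "(\<integral>\<^sup>+t. ?f t * indicator {0..} t \<partial>lborel) = ennreal (pi / 2 - arctan 0)"
    by (rule nn_integral_FTC_atLeast)
      (auto intro!: derivative_eq_intros tendsto_arctan_at_top simp: field_simps power2_eq_square)
  have "(\<integral>\<^sup>+t. ?f t * indicator {..0} t \<partial>lborel)
      = ennreal \<bar>-1\<bar> * (\<integral>\<^sup>+t. ?f (0 + -1 * t) * indicator {..0} (0 + -1 * t) \<partial>lborel)"
    by (rule nn_integral_real_affine) auto
  also have "\<dots> = (\<integral>\<^sup>+t. ?f t * indicator {0..} t \<partial>lborel)"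
    by (auto intro!: nn_integral_cong simp: indicator_def)
  finally have half': "(\<integral>\<^sup>+t. ?f t * indicator {..0} t \<partial>lborel) = ennreal (pi / 2 - arctan 0)"
    using half by simp
  have "(\<integral>\<^sup>+t. ?f t \<partial>lborel) \<le> (\<integral>\<^sup>+t. ?f t * indicator {0..} t + ?f t * indicator {..0} t \<partial>lborel)"
    by (intro nn_integral_mono) (auto simp: indicator_def)
  also have "\<dots> = ennreal (pi / 2 - arctan 0) + ennreal (pi / 2 - arctan 0)"
    by (subst nn_integral_add) (simp_all add: half half')
  also have "\<dots> < \<infinity>" by (simp flip: ennreal_plus)
  finally show ?thesis .
qed

text \<open>Each factor \<open>1 + (x \<bullet> b)^2\<close> is at most
  \<open>(1 + norm x)^2\<close>, whence the exponent twice the dimension. The reciprocal of the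
  product of these factors is a majorant that splits into one-dimensional integrals.\<close>

lemma nn_integral_decay_finite:
  "(\<integral>\<^sup>+x. ennreal (inverse ((1 + norm (x::'a::euclidean_space)) ^ (2 * DIM('a)))) \<partial>lborel) < \<infinity>"
proof -
  have "(\<integral>\<^sup>+x. ennreal (inverse ((1 + norm (x::'a)) ^ (2 * DIM('a)))) \<partial>lborel)
      \<le> (\<integral>\<^sup>+x. (\<Prod>b\<in>(Basis::'a set). ennreal (1 / (1 + (x \<bullet> b)\<^sup>2))) \<partial>lborel)"
  proof (rule nn_integral_mono)
    fix x :: 'a
    have "(\<Prod>b\<in>(Basis::'a set). (1 + (x \<bullet> b)\<^sup>2)) \<le> (\<Prod>b\<in>(Basis::'a set). (1 + norm x)\<^sup>2)"
    proof (intro prod_mono conjI)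
      fix b :: 'a assume "b \<in> Basis"
      then have "\<bar>x \<bullet> b\<bar> \<le> norm x" by (rule Basis_le_norm)
      then have "(x \<bullet> b)\<^sup>2 \<le> (norm x)\<^sup>2" by (metis abs_le_square_iff abs_norm_cancel)
      then show "1 + (x \<bullet> b)\<^sup>2 \<le> (1 + norm x)\<^sup>2"
        by (simp add: power2_eq_square algebra_simps) (smt (verit) norm_ge_zero)
    qed (simp add: add_nonneg_nonneg)
    also have "\<dots> = (1 + norm x) ^ (2 * DIM('a))"
      by (simp add: power_mult)
    finally have "inverse ((1 + norm x) ^ (2 * DIM('a))) \<le> inverse (\<Prod>b\<in>(Basis::'a set). (1 + (x \<bullet> b)\<^sup>2))"
      by (intro le_imp_inverse_le) (auto intro!: prod_pos simp: add_pos_nonneg)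
    also have "\<dots> = (\<Prod>b\<in>(Basis::'a set). 1 / (1 + (x \<bullet> b)\<^sup>2))"
      by (simp add: prod_inversef[symmetric] o_def divide_inverse)
    finally show "ennreal (inverse ((1 + norm x) ^ (2 * DIM('a)))) \<le> (\<Prod>b\<in>(Basis::'a set). ennreal (1 / (1 + (x \<bullet> b)\<^sup>2)))"
      by (simp add: prod_ennreal ennreal_leI)
  qed
  also have "\<dots> = (\<Prod>b\<in>(Basis::'a set). (\<integral>\<^sup>+t. ennreal (1 / (1 + t\<^sup>2)) \<partial>lborel))"
    by (rule nn_integral_lborel_prod) auto
  also have "\<dots> < \<infinity>"
    using nn_integral_inverse_one_plus_square by (simp add: power_less_top_ennreal)
  finally show ?thesis .
qed

lemma integrable_decay:
  fixes f :: "'a::euclidean_space \<Rightarrow> 'b::{banach, second_countable_topology}"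
  assumes [measurable]: "f \<in> borel_measurable borel"
    and B: "\<And>x. (1 + norm x) ^ (2 * DIM('a)) * norm (f x) \<le> B"
  shows "integrable lborel f"
proof (rule Bochner_Integration.integrable_bound)
  have *: "norm x + 1 \<noteq> 0" for x :: 'a
    by (smt (verit) norm_ge_zero)
  show "integrable lborel (\<lambda>x::'a. B * inverse ((1 + norm x) ^ (2 * DIM('a))))"
    using nn_integral_decay_finite[where 'a='a]
    by (intro integrable_mult_right) (auto simp: integrable_iff_bounded)
  show "AE x in lborel. norm (f x) \<le> norm (B * inverse ((1 + norm x) ^ (2 * DIM('a))))"
  proof (rule AE_I2)
    fix x :: 'a
    have p: "(1 + norm x) ^ (2 * DIM('a)) > 0"
      by (simp add: add_pos_nonneg)
    then have "norm (f x) \<le> B / (1 + norm x) ^ (2 * DIM('a))"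
      using B[of x] by (simp add: field_simps)
    also have "\<dots> \<le> norm (B * inverse ((1 + norm x) ^ (2 * DIM('a))))"
      by (simp add: divide_inverse)
    finally show "norm (f x) \<le> norm (B * inverse ((1 + norm x) ^ (2 * DIM('a))))" .
  qed
qed simp

lemma borel_measurable_schwartz [measurable_dest]:
  assumes "f \<in> schwartz"
  shows "f \<in> borel_measurable borel"
  using continuous_on_schwartz[OF assms] by (rule borel_measurable_continuous_onI)

lemma schwartz_bounded:
  assumes "f \<in> schwartz"
  shows "\<exists>B. \<forall>x. cmod (f x) \<le> B"
  using schwartz_decay[OF assms, of 0] by simp

lemma integrable_schwartz:
  fixes f :: "real^'d::finite \<Rightarrow> complex"
  assumes "f \<in> schwartz"
  shows "integrable lborel f"
  using schwartz_decay[OF assms] integrable_decay borel_measurable_schwartz[OF assms] by metis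

lemma integrable_schwartz_poly:
  fixes f :: "real^'d::finite \<Rightarrow> complex"
  assumes "f \<in> schwartz"
  shows "integrable lborel (\<lambda>x. (1 + norm x) ^ N * cmod (f x))"
proof -
  obtain B where B: "\<forall>x. (1 + norm x) ^ (2 * DIM(real^'d) + N) * cmod (f x) \<le> B"
    using schwartz_decay[OF assms] by blast
  have [measurable]: "f \<in> borel_measurable borel"
    by (rule borel_measurable_schwartz[OF assms])
  show ?thesis
  proof (rule integrable_decay)
    fix x :: "real^'d"
    show "(1 + norm x) ^ (2 * DIM(real^'d)) * norm ((1 + norm x) ^ N * cmod (f x)) \<le> B"
      using B[rule_format, of x] by (simp add: power_add mult_ac abs_mult)
  qed measurable
qed

lemma integrable_schwartz_poly_sq:
  fixes f :: "real^'d::finite \<Rightarrow> complex"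
  assumes "f \<in> schwartz"
  shows "integrable lborel (\<lambda>x. (1 + norm x) ^ N * (cmod (f x))\<^sup>2)"
proof -
  obtain B where B: "\<forall>x. cmod (f x) \<le> B"
    using schwartz_bounded[OF assms] by blast
  have [measurable]: "f \<in> borel_measurable borel"
    by (rule borel_measurable_schwartz[OF assms])
  show ?thesis
  proof (rule Bochner_Integration.integrable_bound)
    show "integrable lborel (\<lambda>x. B * ((1 + norm x) ^ N * cmod (f x)))"
      by (intro integrable_mult_right integrable_schwartz_poly assms)
    have "norm ((1 + norm x) ^ N * (cmod (f x))\<^sup>2) \<le> norm (B * ((1 + norm x) ^ N * cmod (f x)))" for x
    proof -
      have "norm ((1 + norm x) ^ N * (cmod (f x))\<^sup>2) = cmod (f x) * ((1 + norm x) ^ N * cmod (f x))"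
        by (simp add: power2_eq_square abs_mult)
      also have "\<dots> \<le> B * ((1 + norm x) ^ N * cmod (f x))"
        using B by (intro mult_right_mono) auto
      finally show ?thesis
        by (simp add: abs_le_iff)
    qed
    then show "AE x in lborel. norm ((1 + norm x) ^ N * (cmod (f x))\<^sup>2) \<le> norm (B * ((1 + norm x) ^ N * cmod (f x)))"
      by simp
  qed simp
qed

lemma square_integrable_schwartz:
  fixes f :: "real^'d::finite \<Rightarrow> complex"
  assumes "f \<in> schwartz"
  shows "square_integrable f"
  using integrable_schwartz_poly_sq[OF assms, of 0] borel_measurable_schwartz[OF assms]
  by (simp add: square_integrable_def)

text \<open>Integrating the partial along the unit segment from \<open>x\<close> in direction
  \<open>i\<close> gives \<open>f (x + e) - f x\<close>. Integrated over \<open>x\<close>, this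
  difference vanishes by translation invariance, while by Fubini the other side is the integral of
  the partial. Integrability of \<open>f\<close> and of its partial thus takes the place of boundary
  terms at infinity.\<close>

lemma integral_partial_eq_0:
  fixes f :: "real^'d::finite \<Rightarrow> 'b::euclidean_space"
  assumes diff: "\<And>x. f differentiable (at x)" and cont: "continuous_on UNIV (partial i f)"
    and f: "integrable lborel f" and f': "integrable lborel (partial i f)"
  shows "(LINT x|lborel. partial i f x) = 0"
proof -
  let ?g = "partial i f" and ?e = "axis i (1::real)"
  let ?h = "\<lambda>(s::real, x). indicator {0..1} s *\<^sub>R ?g (s *\<^sub>R ?e + 1 *\<^sub>R x)"
  have [measurable]: "?g \<in> borel_measurable borel"
    using cont by (rule borel_measurable_continuous_onI)
  have FTC: "(LINT s|lborel. indicator {0..1} s *\<^sub>R ?g (s *\<^sub>R ?e + 1 *\<^sub>R x)) = f (?e + 1 *\<^sub>R x) - f x" for x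
  proof -
    have "(LINT s|lborel. indicator {0..1} s *\<^sub>R ?g (s *\<^sub>R ?e + x)) = f (1 *\<^sub>R ?e + x) - f (0 *\<^sub>R ?e + x)"
    proof (rule integral_FTC_Icc)
      fix s :: real
      have "(f has_derivative frechet_derivative f (at (s *\<^sub>R ?e + x))) (at (s *\<^sub>R ?e + x))"
        using diff frechet_derivative_works by blast
      moreover have "((\<lambda>s. s *\<^sub>R ?e + x) has_derivative (\<lambda>h. h *\<^sub>R ?e)) (at s within {0..1})"
        by (auto intro!: derivative_eq_intros)
      ultimately have "((\<lambda>s. f (s *\<^sub>R ?e + x)) has_derivative
          (\<lambda>h. frechet_derivative f (at (s *\<^sub>R ?e + x)) (h *\<^sub>R ?e))) (at s within {0..1})"
        by (rule has_derivative_compose[rotated])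
      moreover have "linear (frechet_derivative f (at (s *\<^sub>R ?e + x)))"
        using diff linear_frechet_derivative by blast
      ultimately show "((\<lambda>s. f (s *\<^sub>R ?e + x)) has_vector_derivative ?g (s *\<^sub>R ?e + x)) (at s within {0..1})"
        by (simp add: has_vector_derivative_def partial_def linear_scale)
    next
      show "continuous_on {0..1} (\<lambda>s. ?g (s *\<^sub>R ?e + x))"
        by (rule continuous_on_compose2[OF cont]) (auto intro!: continuous_intros)
    qed simp
    then show ?thesis by simp
  qed
  have shift: "(LINT x|lborel. F (t + 1 *\<^sub>R x)) = (LINT x|lborel. F x)" if "integrable lborel F"
    for F :: "real^'d \<Rightarrow> 'c::{banach, second_countable_topology}" and t
    using integral_lborel_affine[OF that, of 1 t] by simp
  have int_h: "integrable (lborel \<Otimes>\<^sub>M lborel) ?h"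
  proof (rule lborel_pair.Fubini_integrable)
    have "(LINT x|lborel. norm (?h (s, x))) = indicator {0..1} s * (LINT x|lborel. norm (?g x))" for s
      using shift[of "\<lambda>x. norm (?g x)" "s *\<^sub>R ?e"] f' by (auto simp: indicator_def)
    then have eq: "(\<lambda>s. LINT x|lborel. norm (?h (s, x))) = (\<lambda>s. indicator {0..1} s * (LINT x|lborel. norm (?g x)))"
      by (rule ext)
    show "integrable lborel (\<lambda>s. LINT x|lborel. norm (?h (s, x)))"
      unfolding eq by (intro integrable_mult_left) auto
    show "AE s in lborel. integrable lborel (\<lambda>x. ?h (s, x))"
      using integrable_lborel_affine[OF f', of 1] by (auto simp del: scaleR_one)
  qed measurable
  have "(LINT x|lborel. LINT s|lborel. ?h (s, x)) = (LINT s|lborel. LINT x|lborel. ?h (s, x))"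
    using lborel_pair.Fubini_integral[OF int_h] by simp
  moreover have "(LINT x|lborel. LINT s|lborel. ?h (s, x)) = 0"
    unfolding prod.case FTC using shift[OF f, of ?e] integrable_lborel_affine[OF f, of 1 ?e] f by simp
  moreover have "(LINT s|lborel. LINT x|lborel. ?h (s, x)) = (LINT s|lborel. indicator {0..1::real} s *\<^sub>R (LINT x|lborel. ?g x))"
    using shift[OF f'] by simp
  ultimately show ?thesis
    by simp
qed

section \<open>The Fourier transform of Schwartz functions\<close>

lemma continuous_on_cis_inner: "continuous_on A (\<lambda>x::real^'d::finite. cis (c * (x \<bullet> \<xi>)))"
  unfolding cis_conv_exp by (intro continuous_intros)

lemma borel_measurable_cis_inner [measurable]:
  "(\<lambda>x::real^'d::finite. cis (c * (x \<bullet> \<xi>))) \<in> borel_measurable borel"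
  by (intro borel_measurable_continuous_onI continuous_on_cis_inner)

lemma borel_measurable_cis [measurable]: "cis \<in> borel_measurable borel"
  by (intro borel_measurable_continuous_onI) (simp add: cis_conv_exp[abs_def] continuous_intros)

lemma integrable_cis_mult:
  fixes f :: "real^'d::finite \<Rightarrow> complex"
  assumes "integrable lborel f"
  shows "integrable lborel (\<lambda>x. cis (c * (x \<bullet> \<xi>)) * f x)"
  using assms by (rule Bochner_Integration.integrable_bound[OF integrable_norm])
    (use borel_measurable_integrable[OF assms] in \<open>auto simp: norm_mult\<close>)

lemma fourier_integral_diff:
  assumes "integrable lborel f" "integrable lborel g"
  shows "fourier_integral (\<lambda>x. f x - g x) \<xi> = fourier_integral f \<xi> - fourier_integral g \<xi>"
  unfolding fourier_integral_def right_diff_distrib by (intro Bochner_Integration.integral_diff integrable_cis_mult assms)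

lemma fourier_integral_cmult:
  "fourier_integral (\<lambda>x. c * f x) \<xi> = c * fourier_integral f \<xi>"
  by (simp add: fourier_integral_def mult.left_commute)

lemma norm_fourier_integral_le:
  "cmod (fourier_integral f \<xi>) \<le> (LINT x|lborel. cmod (f x))"
proof -
  have "cmod (fourier_integral f \<xi>) \<le> (LINT x|lborel. cmod (cis (- 2 * pi * (x \<bullet> \<xi>)) * f x))"
    unfolding fourier_integral_def by (rule integral_norm_bound)
  then show ?thesis by (simp add: norm_mult)
qed

lemma cis_taylor2: "cmod (cis b - 1 - \<i> * complex_of_real b) \<le> b\<^sup>2"
proof -
  have "cmod (cis b - (\<Sum>k\<le>1. (\<i> * b) ^ k / fact k)) \<le> \<bar>b\<bar> ^ Suc 1 / fact (Suc 1)"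
    using iexp_approx1[of b 1] by (simp add: cis_conv_exp)
  also have "\<dots> \<le> b\<^sup>2" by (simp add: power2_eq_square)
  finally show ?thesis by (simp add: diff_diff_eq)
qed

lemma integrable_of_poly_weight:
  fixes f :: "real^'d::finite \<Rightarrow> complex"
  assumes [measurable]: "f \<in> borel_measurable borel" and g[measurable]: "g \<in> borel_measurable borel"
    and int: "integrable lborel (\<lambda>x. (1 + norm x) ^ N * cmod (f x))"
    and bd: "\<And>x. cmod (g x) \<le> B * (1 + norm x) ^ N * cmod (f x)"
  shows "integrable lborel g"
proof (rule Bochner_Integration.integrable_bound)
  show "integrable lborel (\<lambda>x. B * ((1 + norm x) ^ N * cmod (f x)))"
    by (intro integrable_mult_right int)
  show "AE x in lborel. cmod (g x) \<le> norm (B * ((1 + norm x) ^ N * cmod (f x)))"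
    using bd by (intro AE_I2) (metis abs_ge_self mult.assoc order_trans real_norm_def)
qed simp

text \<open>By \<open>cis_taylor2\<close> the second order remainder of the exponential is at most
  \<open>(2 pi)^2 (1 + |x|)^2 |h|^2\<close>. The second moment of \<open>f\<close> therefore bounds
  the remainder of the transform by a multiple of \<open>|h|^2\<close>, uniformly in the base point,
  and no limit under the integral sign is taken.\<close>

lemma fourier_integral_has_derivative:
  fixes f :: "real^'d::finite \<Rightarrow> complex"
  assumes [measurable]: "f \<in> borel_measurable borel"
    and int: "integrable lborel (\<lambda>x. (1 + norm x)\<^sup>2 * cmod (f x))"
  shows "(fourier_integral f has_derivative
    (\<lambda>h. \<Sum>i\<in>UNIV. (h $ i) *\<^sub>R fourier_integral (\<lambda>x. - 2 * pi * \<i> * (x $ i) * f x) \<xi>)) (at \<xi>)"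
    (is "(_ has_derivative ?L) _")
proof -
  have intf: "integrable lborel f"
  proof (rule integrable_of_poly_weight[OF _ _ int, of _ 1])
    fix x
    show "cmod (f x) \<le> 1 * (1 + norm x)\<^sup>2 * cmod (f x)"
      using mult_right_mono[of 1 "(1 + norm x)\<^sup>2" "cmod (f x)"] one_le_power[of "1 + norm x" 2] by simp
  qed measurable
  have inti: "integrable lborel (\<lambda>x. - 2 * pi * \<i> * (x $ i) * f x)" for i
  proof (rule integrable_of_poly_weight[OF _ _ int, of _ "2 * pi"])
    fix x :: "real^'d"
    have "\<bar>x $ i\<bar> \<le> (1 + norm x)\<^sup>2"
      using component_le_norm_cart[of x i] by (simp add: power2_eq_square algebra_simps) (smt (verit) mult_nonneg_nonneg norm_ge_zero)
    then have "\<bar>x $ i\<bar> * cmod (f x) \<le> (1 + norm x)\<^sup>2 * cmod (f x)"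
      by (rule mult_right_mono) simp
    then show "cmod (- 2 * pi * \<i> * (x $ i) * f x) \<le> 2 * pi * (1 + norm x)\<^sup>2 * cmod (f x)"
      by (simp add: norm_mult)
  qed measurable
  define C where "C = (LINT x|lborel. (2 * pi)\<^sup>2 * ((1 + norm x)\<^sup>2 * cmod (f x)))"
  have sum_eq: "(\<Sum>i\<in>UNIV. (h $ i) *\<^sub>R (- 2 * pi * \<i> * (x $ i) * f x)) = - 2 * pi * \<i> * (x \<bullet> h) * f x" for x h
    by (simp add: inner_vec_def sum_distrib_left sum_distrib_right scaleR_conv_of_real mult_ac)
  have bl: "bounded_linear ?L"
    by (intro bounded_linear_sum bounded_linear_scaleR_const bounded_linear_vec_nth)
  have main: "cmod (fourier_integral f y - fourier_integral f \<xi> - ?L (y - \<xi>)) \<le> C * (norm (y - \<xi>))\<^sup>2" for y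
  proof -
    let ?h = "y - \<xi>"
    let ?E = "\<lambda>x. cis (- 2 * pi * (x \<bullet> \<xi>))"
    have L: "?L ?h = fourier_integral (\<lambda>x. - 2 * pi * \<i> * (x \<bullet> ?h) * f x) \<xi>"
    proof -
      have "?L ?h = (\<Sum>i\<in>UNIV. LINT x|lborel. ?E x * ((?h $ i) *\<^sub>R (- 2 * pi * \<i> * (x $ i) * f x)))"
        unfolding fourier_integral_def by (simp flip: integral_scaleR_right)
      also have "\<dots> = (LINT x|lborel. (\<Sum>i\<in>UNIV. ?E x * ((?h $ i) *\<^sub>R (- 2 * pi * \<i> * (x $ i) * f x))))"
        by (intro Bochner_Integration.integral_sum[symmetric] integrable_cis_mult integrable_scaleR_right inti)
      also have "\<dots> = fourier_integral (\<lambda>x. - 2 * pi * \<i> * (x \<bullet> ?h) * f x) \<xi>"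
        unfolding fourier_integral_def sum_distrib_left[symmetric] sum_eq ..
      finally show ?thesis .
    qed
    have inth: "integrable lborel (\<lambda>x. - 2 * pi * \<i> * (x \<bullet> ?h) * f x)"
    proof -
      have "integrable lborel (\<lambda>x. \<Sum>i\<in>UNIV. (?h $ i) *\<^sub>R (- 2 * pi * \<i> * (x $ i) * f x))"
        by (intro Bochner_Integration.integrable_sum integrable_scaleR_right inti)
      then show ?thesis
        unfolding sum_eq .
    qed
    have "fourier_integral f y - fourier_integral f \<xi> - ?L ?h
      = (LINT x|lborel. (cis (- 2 * pi * (x \<bullet> y)) * f x - ?E x * f x - ?E x * (- 2 * pi * \<i> * (x \<bullet> ?h) * f x)))"
      unfolding L unfolding fourier_integral_def
      by (simp only: Bochner_Integration.integral_diff Bochner_Integration.integrable_diff integrable_cis_mult[OF intf] integrable_cis_mult[OF inth])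
    also have "\<dots> = (LINT x|lborel. ?E x * (cis (- 2 * pi * (x \<bullet> ?h)) - 1 - \<i> * complex_of_real (- 2 * pi * (x \<bullet> ?h))) * f x)"
    proof (intro Bochner_Integration.integral_cong refl)
      fix x
      have "cis (- 2 * pi * (x \<bullet> y)) = ?E x * cis (- 2 * pi * (x \<bullet> ?h))"
        by (simp add: cis_mult inner_diff_right algebra_simps)
      then show "cis (- 2 * pi * (x \<bullet> y)) * f x - ?E x * f x - ?E x * (- 2 * pi * \<i> * (x \<bullet> ?h) * f x) =
         ?E x * (cis (- 2 * pi * (x \<bullet> ?h)) - 1 - \<i> * complex_of_real (- 2 * pi * (x \<bullet> ?h))) * f x"
        by (simp add: algebra_simps)
    qed
    also have "cmod \<dots> \<le> (LINT x|lborel. (2 * pi)\<^sup>2 * ((1 + norm x)\<^sup>2 * cmod (f x)) * (norm ?h)\<^sup>2)"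
    proof (rule Bochner_Integration.integral_norm_bound_integral)
      fix x :: "real^'d"
      have "(x \<bullet> ?h)\<^sup>2 \<le> (norm x * norm ?h)\<^sup>2"
        using Cauchy_Schwarz_ineq2[of x ?h] by (metis abs_ge_zero power2_abs power_mono)
      also have "\<dots> \<le> ((1 + norm x) * norm ?h)\<^sup>2"
        by (intro power_mono mult_right_mono) auto
      finally have "(2 * pi)\<^sup>2 * (x \<bullet> ?h)\<^sup>2 \<le> (2 * pi)\<^sup>2 * ((1 + norm x) * norm ?h)\<^sup>2"
        by (intro mult_left_mono) auto
      with cis_taylor2[of "- 2 * pi * (x \<bullet> ?h)"]
      have "cmod (cis (- 2 * pi * (x \<bullet> ?h)) - 1 - \<i> * complex_of_real (- 2 * pi * (x \<bullet> ?h))) \<le> (2 * pi)\<^sup>2 * ((1 + norm x) * norm ?h)\<^sup>2"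
        unfolding power_mult_distrib power2_minus by linarith
      then have "cmod (cis (- 2 * pi * (x \<bullet> ?h)) - 1 - \<i> * complex_of_real (- 2 * pi * (x \<bullet> ?h))) * cmod (f x)
         \<le> (2 * pi)\<^sup>2 * ((1 + norm x) * norm ?h)\<^sup>2 * cmod (f x)"
        by (rule mult_right_mono) simp
      then show "cmod (?E x * (cis (- 2 * pi * (x \<bullet> ?h)) - 1 - \<i> * complex_of_real (- 2 * pi * (x \<bullet> ?h))) * f x)
        \<le> (2 * pi)\<^sup>2 * ((1 + norm x)\<^sup>2 * cmod (f x)) * (norm ?h)\<^sup>2"
        by (simp only: norm_mult norm_cis power_mult_distrib mult_ac mult_1)
    next
      show "integrable lborel (\<lambda>x. (2 * pi)\<^sup>2 * ((1 + norm x)\<^sup>2 * cmod (f x)) * (norm ?h)\<^sup>2)"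
        by (intro integrable_mult_left integrable_mult_right int)
    next
      have "integrable lborel (\<lambda>x. cis (- 2 * pi * (x \<bullet> y)) * f x - ?E x * f x - ?E x * (- 2 * pi * \<i> * (x \<bullet> ?h) * f x))"
        by (intro Bochner_Integration.integrable_diff integrable_cis_mult intf inth)
      also have "(\<lambda>x. cis (- 2 * pi * (x \<bullet> y)) * f x - ?E x * f x - ?E x * (- 2 * pi * \<i> * (x \<bullet> ?h) * f x))
        = (\<lambda>x. ?E x * (cis (- 2 * pi * (x \<bullet> ?h)) - 1 - \<i> * complex_of_real (- 2 * pi * (x \<bullet> ?h))) * f x)"
      proof
        fix x
        have "cis (- 2 * pi * (x \<bullet> y)) = ?E x * cis (- 2 * pi * (x \<bullet> ?h))"
          by (simp add: cis_mult inner_diff_right algebra_simps)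
        then show "cis (- 2 * pi * (x \<bullet> y)) * f x - ?E x * f x - ?E x * (- 2 * pi * \<i> * (x \<bullet> ?h) * f x) =
           ?E x * (cis (- 2 * pi * (x \<bullet> ?h)) - 1 - \<i> * complex_of_real (- 2 * pi * (x \<bullet> ?h))) * f x"
          by (simp add: algebra_simps)
      qed
      finally show "integrable lborel (\<lambda>x. ?E x * (cis (- 2 * pi * (x \<bullet> ?h)) - 1 - \<i> * complex_of_real (- 2 * pi * (x \<bullet> ?h))) * f x)" .
    qed
    also have "\<dots> = C * (norm ?h)\<^sup>2"
      by (simp add: C_def)
    finally show ?thesis .
  qed
  show ?thesis
  proof (rule has_derivativeI_sandwich[where e=1 and H="\<lambda>y. C * norm (y - \<xi>)"])
    fix y assume "y \<noteq> \<xi>"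
    then show "cmod (fourier_integral f y - fourier_integral f \<xi> - ?L (y - \<xi>)) / norm (y - \<xi>) \<le> C * norm (y - \<xi>)"
      using main[of y] by (simp add: field_simps power2_eq_square)
  next
    show "(\<lambda>y. C * norm (y - \<xi>)) \<midarrow>\<xi>\<rightarrow> 0"
      by (auto intro!: tendsto_eq_intros)
  qed (use bl in simp_all)
qed

lemma partial_fourier_integral:
  fixes f :: "real^'d::finite \<Rightarrow> complex"
  assumes "f \<in> borel_measurable borel" "integrable lborel (\<lambda>x. (1 + norm x)\<^sup>2 * cmod (f x))"
  shows "partial i (fourier_integral f) \<xi> = fourier_integral (\<lambda>x. - 2 * pi * \<i> * (x $ i) * f x) \<xi>"
  unfolding partial_eq[OF fourier_integral_has_derivative[OF assms]]
  by (simp add: axis_def if_distrib[where f="\<lambda>r. r *\<^sub>R _"] cong: if_cong)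

lemma fourier_integral_differentiable:
  fixes f :: "real^'d::finite \<Rightarrow> complex"
  assumes "f \<in> borel_measurable borel" "integrable lborel (\<lambda>x. (1 + norm x)\<^sup>2 * cmod (f x))"
  shows "fourier_integral f differentiable (at \<xi>)"
  using fourier_integral_has_derivative[OF assms] by (auto simp: differentiable_def)

lemma has_derivative_cis_inner:
  "((\<lambda>x::real^'d::finite. cis (c * (x \<bullet> \<xi>))) has_derivative
     (\<lambda>h. complex_of_real (c * (h \<bullet> \<xi>)) * (\<i> * cis (c * (x \<bullet> \<xi>))))) (at x)"
proof -
  have "(exp has_derivative (\<lambda>h. exp w * h)) (at w)" for w :: complex
    using DERIV_exp[of w] by (simp add: has_field_derivative_def)
  moreover have inner: "((\<lambda>x::real^'d. \<i> * complex_of_real (c * (x \<bullet> \<xi>))) has_derivative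
      (\<lambda>h. \<i> * complex_of_real (c * (h \<bullet> \<xi>)))) (at x)"
    by (intro has_derivative_mult_right has_derivative_of_real has_derivative_inner_left has_derivative_ident)
  ultimately have "((\<lambda>x. exp (\<i> * complex_of_real (c * (x \<bullet> \<xi>)))) has_derivative
      (\<lambda>h. exp (\<i> * complex_of_real (c * (x \<bullet> \<xi>))) * (\<i> * complex_of_real (c * (h \<bullet> \<xi>))))) (at x)"
    using has_derivative_compose[OF inner] by blast
  then show ?thesis
    by (simp add: cis_conv_exp mult_ac)
qed

text \<open>Integration by parts in the form of \<open>integral_partial_eq_0\<close>: the total
  partial of the character times \<open>f\<close> has integral 0.\<close>

lemma fourier_integral_partial:
  fixes f :: "real^'d::finite \<Rightarrow> complex"
  assumes f: "f \<in> schwartz"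
  shows "fourier_integral (partial i f) \<xi> = 2 * pi * \<i> * (\<xi> $ i) * fourier_integral f \<xi>"
proof -
  let ?c = "\<lambda>x::real^'d. cis (- 2 * pi * (x \<bullet> \<xi>))"
  have dc: "?c differentiable (at x)" for x
    unfolding differentiable_def using has_derivative_cis_inner by blast
  have "partial i (\<lambda>x. ?c x * f x) x = ?c x * partial i f x + - 2 * pi * \<i> * (\<xi> $ i) * (?c x * f x)" for x
    unfolding partial_mult[OF dc schwartz_differentiable[OF f]] partial_eq[OF has_derivative_cis_inner]
    by (simp add: inner_axis')
  then have eq: "partial i (\<lambda>x. ?c x * f x) = (\<lambda>x. ?c x * partial i f x + - 2 * pi * \<i> * (\<xi> $ i) * (?c x * f x))"
    by (rule ext)
  have i1: "integrable lborel (\<lambda>x. ?c x * partial i f x)" and i2: "integrable lborel (\<lambda>x. ?c x * f x)"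
    by (intro integrable_cis_mult integrable_schwartz schwartz_partial f)+
  have "(LINT x|lborel. partial i (\<lambda>x. ?c x * f x) x) = 0"
  proof (rule integral_partial_eq_0)
    show "(\<lambda>x. ?c x * f x) differentiable (at x)" for x
      by (intro differentiable_mult dc schwartz_differentiable f)
    show "continuous_on UNIV (partial i (\<lambda>x. ?c x * f x))"
      unfolding eq by (intro continuous_intros continuous_on_cis_inner continuous_on_schwartz schwartz_partial f)
    show "integrable lborel (partial i (\<lambda>x. ?c x * f x))"
      unfolding eq using i1 i2 by (intro Bochner_Integration.integrable_add integrable_mult_right) auto
  qed (rule i2)
  then have "(LINT x|lborel. ?c x * partial i f x) + - 2 * pi * \<i> * (\<xi> $ i) * (LINT x|lborel. ?c x * f x) = 0"
    unfolding eq using i1 i2 by (subst (asm) Bochner_Integration.integral_add) auto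
  then show ?thesis
    by (simp add: fourier_integral_def)
qed

lemma fourier_integral_coord_mult:
  fixes f :: "real^'d::finite \<Rightarrow> complex"
  assumes f: "f \<in> schwartz"
  shows "partial i (fourier_integral f) = fourier_integral (\<lambda>x. - 2 * pi * \<i> * (x $ i) * f x)"
  by (rule ext) (intro partial_fourier_integral borel_measurable_schwartz integrable_schwartz_poly f)

text \<open>The set of all transforms is closed under \<open>partial\<close>, because a partial of a
  transform is the transform of a coordinate multiple. Decay is an induction on the exponent:
  \<open>norm x\<close> is at most the sum of the \<open>\<bar>x $ i\<bar>\<close>, and each factor
  \<open>x $ i\<close> is traded for the transform of \<open>partial i f\<close>, to which the
  induction hypothesis applies.\<close>

lemma fourier_integral_schwartz:
  fixes f :: "real^'d::finite \<Rightarrow> complex"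
  assumes f: "f \<in> schwartz"
  shows "fourier_integral f \<in> schwartz"
proof -
  have "fourier_integral ` (schwartz :: (real^'d \<Rightarrow> complex) set) \<subseteq> schwartz"
  proof (rule schwartz_coinduct)
    fix F :: "real^'d \<Rightarrow> complex" assume "F \<in> fourier_integral ` schwartz"
    then obtain f where F: "F = fourier_integral f" and f: "f \<in> schwartz" by blast
    show "F differentiable (at x)" for x
      unfolding F by (intro fourier_integral_differentiable borel_measurable_schwartz integrable_schwartz_poly f)
    show "\<exists>B. \<forall>x. (1 + norm x) ^ N * cmod (F x) \<le> B" for N
      unfolding F using f
    proof (induction N arbitrary: f)
      case 0
      then show ?case
        using norm_fourier_integral_le[of f] by auto
    next
      case (Suc N)
      obtain B where B: "\<And>x. (1 + norm x) ^ N * cmod (fourier_integral f x) \<le> B"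
        using Suc by blast
      have "\<forall>i. \<exists>B. \<forall>x. (1 + norm x) ^ N * cmod (fourier_integral (partial i f) x) \<le> B"
        using Suc schwartz_partial by blast
      then obtain D where D: "\<And>i x. (1 + norm x) ^ N * cmod (fourier_integral (partial i f) x) \<le> D i"
        by metis
      have "(1 + norm x) ^ Suc N * cmod (fourier_integral f x) \<le> B + (\<Sum>i\<in>UNIV. D i)" for x
      proof -
        let ?F = "cmod (fourier_integral f x)" and ?w = "(1 + norm x) ^ N"
        have "norm x \<le> (\<Sum>i\<in>UNIV. \<bar>x $ i\<bar>)" by (rule norm_le_l1_cart)
        then have "?w * ((1 + norm x) * ?F) \<le> ?w * ((1 + (\<Sum>i\<in>UNIV. \<bar>x $ i\<bar>)) * ?F)"
          by (intro mult_left_mono mult_right_mono) auto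
        also have "\<dots> = ?w * ?F + (\<Sum>i\<in>UNIV. ?w * (\<bar>x $ i\<bar> * ?F))"
          by (simp add: algebra_simps sum_distrib_left sum_distrib_right)
        also have "\<dots> \<le> B + (\<Sum>i\<in>UNIV. D i)"
        proof (intro add_mono B sum_mono)
          fix i :: 'd
          have "\<bar>x $ i\<bar> * ?F \<le> (2 * pi) * (\<bar>x $ i\<bar> * ?F)"
            using pi_gt3 mult_right_mono[of 1 "2 * pi" "\<bar>x $ i\<bar> * ?F"] by simp
          also have "\<dots> = cmod (fourier_integral (partial i f) x)"
            by (simp add: fourier_integral_partial[OF Suc.prems] norm_mult)
          finally have "?w * (\<bar>x $ i\<bar> * ?F) \<le> ?w * cmod (fourier_integral (partial i f) x)"
            by (intro mult_left_mono) auto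
          with D[where i=i and x=x] show "?w * (\<bar>x $ i\<bar> * ?F) \<le> D i" by linarith
        qed
        finally show ?thesis by (simp add: mult_ac)
      qed
      then show ?case by blast
    qed
    show "partial i F \<in> fourier_integral ` schwartz" for i
    proof -
      have "(\<lambda>x. - 2 * pi * \<i> * (x $ i) * f x) \<in> schwartz"
        using schwartz_cmult[OF schwartz_coord_mult[OF f, of i], of "- 2 * pi * \<i>"] by (simp add: mult_ac)
      then show ?thesis
        unfolding F fourier_integral_coord_mult[OF f] by (rule imageI)
    qed
  qed
  with f show ?thesis by blast
qed

text \<open>The multiplication formula, by Fubini. It is the identity on which the transform of
  distributions rests, and it drives inversion, Parseval and Plancherel below.\<close>

lemma fourier_integral_swap:
  fixes f g :: "real^'d::finite \<Rightarrow> complex"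
  assumes f: "integrable lborel f" and g: "integrable lborel g"
  shows "(LINT x|lborel. fourier_integral f x * g x) = (LINT x|lborel. f x * fourier_integral g x)"
proof -
  have [measurable]: "f \<in> borel_measurable borel" "g \<in> borel_measurable borel"
    using f g by auto
  let ?h = "\<lambda>(x, y). cis (- 2 * pi * (y \<bullet> x)) * f y * g x"
  have int: "integrable (lborel \<Otimes>\<^sub>M lborel) ?h"
  proof (rule lborel_pair.Fubini_integrable)
    show "?h \<in> borel_measurable (lborel \<Otimes>\<^sub>M lborel)"
      by measurable
    have "(\<lambda>x. LINT y|lborel. norm (?h (x, y))) = (\<lambda>x. (LINT y|lborel. cmod (f y)) * cmod (g x))"
      by (simp add: norm_mult)
    then show "integrable lborel (\<lambda>x. LINT y|lborel. norm (?h (x, y)))"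
      using g by auto
    show "AE x in lborel. integrable lborel (\<lambda>y. ?h (x, y))"
      unfolding prod.case by (intro AE_I2 integrable_mult_left integrable_cis_mult f)
  qed
  have "(LINT x|lborel. fourier_integral f x * g x) = (LINT x|lborel. LINT y|lborel. ?h (x, y))"
    by (simp add: fourier_integral_def)
  also have "\<dots> = (LINT y|lborel. LINT x|lborel. ?h (x, y))"
    using lborel_pair.Fubini_integral[OF int] by simp
  also have "\<dots> = (LINT x|lborel. f x * fourier_integral g x)"
    unfolding fourier_integral_def
    by (simp add: inner_commute mult_ac flip: integral_mult_right_zero)
  finally show ?thesis .
qed

section \<open>Gaussians and Fourier inversion\<close>

lemma sym_pos_def_inner:
  assumes "sym_pos_def S"
  shows "x \<bullet> (S *v y) = (S *v x) \<bullet> y"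
proof -
  have "x v* S = S *v x"
    using assms by (metis sym_pos_def_def transpose_matrix_vector)
  then show ?thesis
    using dot_lmul_matrix[of x S y] by simp
qed

lemma sym_pos_def_matrix_inv:
  assumes "sym_pos_def S"
  shows "S ** matrix_inv S = mat 1 \<and> matrix_inv S ** S = mat 1"
proof -
  have "x = 0" if "S *v x = 0" for x
    using assms that unfolding sym_pos_def_def by (metis inner_zero_right less_irrefl)
  then have "invertible S"
    unfolding invertible_left_inverse matrix_left_invertible_ker by blast
  then show ?thesis
    unfolding invertible_def matrix_inv_def by (rule someI_ex)
qed

lemma sym_pos_def_inverse:
  fixes S :: "real^'d::finite^'d"
  assumes S: "sym_pos_def S"
  shows "sym_pos_def (matrix_inv S)"
proof -
  let ?M = "matrix_inv S"
  have inv: "S *v (?M *v x) = x" "?M *v (S *v x) = x" for x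
    using sym_pos_def_matrix_inv[OF S] by (simp_all add: matrix_vector_mul_assoc)
  have sym: "x \<bullet> (?M *v y) = (?M *v x) \<bullet> y" for x y
    using sym_pos_def_inner[OF S, of "?M *v x" "?M *v y"] inv by simp
  have "transpose ?M *v x = ?M *v x" for x
  proof -
    have "(transpose ?M *v x) \<bullet> y = (?M *v x) \<bullet> y" for y
      using sym[of x y] dot_lmul_matrix[of x ?M y] by simp
    then show ?thesis
      by (metis vector_eq_rdot)
  qed
  then have "transpose ?M = ?M"
    by (simp add: matrix_eq)
  moreover have "x \<bullet> (?M *v x) > 0" if "x \<noteq> 0" for x
  proof -
    have "?M *v x \<noteq> 0"
      using inv(1)[of x] that by auto
    then have "(?M *v x) \<bullet> (S *v (?M *v x)) > 0"
      using S by (simp add: sym_pos_def_def)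
    then show ?thesis
      using inv by (simp add: inner_commute)
  qed
  ultimately show ?thesis
    by (simp add: sym_pos_def_def)
qed

text \<open>The quadratic form attains a positive minimum on the unit sphere, and homogeneity
  extends the bound to all vectors.\<close>

lemma sym_pos_def_coercive:
  fixes S :: "real^'d::finite^'d"
  assumes S: "sym_pos_def S"
  shows "\<exists>a>0. \<forall>x. x \<bullet> (S *v x) \<ge> a * (norm x)\<^sup>2"
proof -
  let ?K = "sphere (0::real^'d) 1"
  have "?K \<noteq> {}" by simp
  moreover have "continuous_on ?K (\<lambda>x. x \<bullet> (S *v x))"
    by (intro continuous_intros linear_continuous_on matrix_vector_mul_bounded_linear)
  ultimately obtain z where z: "z \<in> ?K" "\<And>x. x \<in> ?K \<Longrightarrow> z \<bullet> (S *v z) \<le> x \<bullet> (S *v x)"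
    using continuous_attains_inf[of ?K] compact_sphere by blast
  have "z \<noteq> 0"
    using z(1) by auto
  then have pos: "z \<bullet> (S *v z) > 0"
    using S by (simp add: sym_pos_def_def)
  have "x \<bullet> (S *v x) \<ge> (z \<bullet> (S *v z)) * (norm x)\<^sup>2" for x
  proof (cases "x = 0")
    case False
    let ?y = "(1 / norm x) *\<^sub>R x"
    have "?y \<in> ?K"
      using False by simp
    then have "z \<bullet> (S *v z) \<le> ?y \<bullet> (S *v ?y)"
      by (rule z)
    also have "\<dots> = (x \<bullet> (S *v x)) / (norm x)\<^sup>2"
      by (simp add: matrix_vector_mult_scaleR power2_eq_square)
    finally show ?thesis
      using False by (simp add: field_simps)
  qed simp
  with pos show ?thesis by blast
qed

lemma quad_potential_has_derivative:
  fixes S :: "real^'d::finite^'d"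
  assumes S: "sym_pos_def S"
  shows "(quad_potential \<mu> S has_derivative (\<lambda>h. h \<bullet> (matrix_inv S *v (x - \<mu>)))) (at x)"
proof -
  let ?M = "matrix_inv S"
  have d: "((\<lambda>x. ?M *v (x - \<mu>)) has_derivative (\<lambda>h. ?M *v h)) (at x)"
    by (rule bounded_linear.has_derivative[OF matrix_vector_mul_bounded_linear]) (auto intro!: derivative_eq_intros)
  have "((\<lambda>x. 1 / 2 * ((x - \<mu>) \<bullet> (?M *v (x - \<mu>)))) has_derivative
     (\<lambda>h. 1 / 2 * ((x - \<mu>) \<bullet> (?M *v h) + h \<bullet> (?M *v (x - \<mu>))))) (at x)"
    by (auto intro!: derivative_eq_intros d)
  moreover have "(x - \<mu>) \<bullet> (?M *v h) = h \<bullet> (?M *v (x - \<mu>))" for h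
    using sym_pos_def_inner[OF sym_pos_def_inverse[OF S], of h "x - \<mu>"] by (simp add: inner_commute)
  ultimately show ?thesis
    by (simp add: quad_potential_def[abs_def])
qed

lemma partial_quad_potential:
  assumes "sym_pos_def S"
  shows "partial i (quad_potential \<mu> S) x = (matrix_inv S *v (x - \<mu>)) $ i"
  unfolding partial_eq[OF quad_potential_has_derivative[OF assms]]
  by (simp add: inner_axis')

lemma quad_potential_polynomial: "real_polynomial_function (quad_potential \<mu> S)"
proof -
  have c: "real_polynomial_function (\<lambda>x::real^'a. x $ i - \<mu> $ i)" for i
    by (intro real_polynomial_function_diff real_polynomial_function.intros(1,2) bounded_linear_vec_nth)
  have "quad_potential \<mu> S = (\<lambda>x. 1 / 2 * (\<Sum>i\<in>UNIV. (x $ i - \<mu> $ i) * (\<Sum>j\<in>UNIV. matrix_inv S $ i $ j * (x $ j - \<mu> $ j))))"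
    by (simp add: quad_potential_def[abs_def] inner_vec_def matrix_vector_mult_def)
  moreover have "real_polynomial_function \<dots>"
    by (intro real_polynomial_function.intros(4) real_polynomial_function_sum c real_polynomial_function.intros(2)) auto
  ultimately show ?thesis by simp
qed

lemma quad_potential_coercive:
  fixes S :: "real^'d::finite^'d"
  assumes S: "sym_pos_def S"
  shows "\<exists>a>0. \<exists>b. \<forall>x. quad_potential \<mu> S x \<ge> a * (norm x)\<^sup>2 - b"
proof -
  obtain a where a: "a > 0" "\<And>x. x \<bullet> (matrix_inv S *v x) \<ge> a * (norm x)\<^sup>2"
    using sym_pos_def_coercive[OF sym_pos_def_inverse[OF S]] by blast
  have "quad_potential \<mu> S x \<ge> a / 4 * (norm x)\<^sup>2 - a / 2 * (norm \<mu>)\<^sup>2" for x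
  proof -
    have "(norm x)\<^sup>2 \<le> (norm (x - \<mu>) + norm \<mu>)\<^sup>2"
      using norm_triangle_ineq[of "x - \<mu>" \<mu>] by (intro power_mono) auto
    also have "\<dots> \<le> 2 * (norm (x - \<mu>))\<^sup>2 + 2 * (norm \<mu>)\<^sup>2"
      using sum_squares_bound[of "norm (x - \<mu>)" "norm \<mu>"] by (simp add: power2_sum)
    finally have "a / 4 * (norm x)\<^sup>2 \<le> a / 4 * (2 * (norm (x - \<mu>))\<^sup>2 + 2 * (norm \<mu>)\<^sup>2)"
      using a by (intro mult_left_mono) auto
    then show ?thesis
      using a(2)[of "x - \<mu>"] by (simp add: quad_potential_def algebra_simps)
  qed
  with a(1) show ?thesis
    by (intro exI[of _ "a / 4"]) auto
qed

lemma exp_quad_potential_schwartz: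
  fixes S :: "real^'d::finite^'d"
  assumes S: "sym_pos_def S" and c: "c > 0"
  shows "(\<lambda>x. complex_of_real (exp (- c * quad_potential \<mu> S x))) \<in> schwartz"
proof -
  obtain a b where a: "a > 0" "\<And>x. quad_potential \<mu> S x \<ge> a * (norm x)\<^sup>2 - b"
    using quad_potential_coercive[OF S] by blast
  have "(\<lambda>x. complex_of_real (1 * exp (- (c * quad_potential \<mu> S x)))) \<in> schwartz"
  proof (rule poly_exp_schwartz)
    show "real_polynomial_function (\<lambda>x. c * quad_potential \<mu> S x)"
      by (intro real_polynomial_function.intros(4,2) quad_potential_polynomial)
    show "c * a > 0" using a c by simp
    show "c * quad_potential \<mu> S x \<ge> c * a * (norm x)\<^sup>2 - c * b" for x
      using mult_left_mono[OF a(2)[of x], of c] c by (simp add: algebra_simps)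
  qed (rule real_polynomial_function.intros(2))
  then show ?thesis by simp
qed

text \<open>The Gaussian \<open>exp (- V0 / 2)\<close> has mean \<open>mu\<close> and covariance
  \<open>2 S\<close>; this is its Fourier transform divided by its total mass, so that the value at
  the origin is 1. The mean appears as a phase.\<close>

definition gauss_hat :: "real^'d::finite \<Rightarrow> real^'d^'d \<Rightarrow> real^'d \<Rightarrow> complex" where
  "gauss_hat \<mu> S \<xi> = exp (- (complex_of_real (4 * pi\<^sup>2 * (\<xi> \<bullet> (S *v \<xi>))) + \<i> * complex_of_real (2 * pi * (\<mu> \<bullet> \<xi>))))"

lemma gauss_hat_exponent_has_derivative:
  assumes S: "sym_pos_def S"
  shows "((\<lambda>\<xi>. complex_of_real (4 * pi\<^sup>2 * (\<xi> \<bullet> (S *v \<xi>))) + \<i> * complex_of_real (2 * pi * (\<mu> \<bullet> \<xi>)))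
    has_derivative (\<lambda>h. complex_of_real (8 * pi\<^sup>2 * (h \<bullet> (S *v \<xi>))) + \<i> * complex_of_real (2 * pi * (\<mu> \<bullet> h)))) (at \<xi>)"
proof -
  have d: "((\<lambda>x. S *v x) has_derivative (\<lambda>h. S *v h)) (at \<xi>)"
    by (rule bounded_linear_imp_has_derivative[OF matrix_vector_mul_bounded_linear])
  have "((\<lambda>x. x \<bullet> (S *v x)) has_derivative (\<lambda>h. \<xi> \<bullet> (S *v h) + h \<bullet> (S *v \<xi>))) (at \<xi>)"
    by (auto intro!: derivative_eq_intros d)
  moreover have "\<xi> \<bullet> (S *v h) = h \<bullet> (S *v \<xi>)" for h
    using sym_pos_def_inner[OF S, of h \<xi>] by (simp add: inner_commute)
  ultimately have "((\<lambda>x. x \<bullet> (S *v x)) has_derivative (\<lambda>h. 2 * (h \<bullet> (S *v \<xi>)))) (at \<xi>)"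
    by simp
  from has_derivative_mult_right[OF this, of "4 * pi\<^sup>2"]
  have "((\<lambda>x. 4 * pi\<^sup>2 * (x \<bullet> (S *v x))) has_derivative (\<lambda>h. 8 * pi\<^sup>2 * (h \<bullet> (S *v \<xi>)))) (at \<xi>)"
    by (simp add: mult_ac)
  then show ?thesis
    by (intro has_derivative_add has_derivative_of_real has_derivative_mult_right has_derivative_inner_right has_derivative_ident)
qed

lemma has_derivative_cexp:
  assumes "(f has_derivative f') (at x)"
  shows "((\<lambda>x. exp (f x :: complex)) has_derivative (\<lambda>h. exp (f x) * f' h)) (at x)"
proof -
  have "(exp has_derivative (\<lambda>h. exp w * h)) (at w)" for w :: complex
    using DERIV_exp[of w] by (simp add: has_field_derivative_def)
  with has_derivative_compose[OF assms] show ?thesis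
    by blast
qed

lemma gauss_hat_has_derivative:
  assumes S: "sym_pos_def S"
  shows "(gauss_hat \<mu> S has_derivative (\<lambda>h. gauss_hat \<mu> S \<xi> *
     - (complex_of_real (8 * pi\<^sup>2 * (h \<bullet> (S *v \<xi>))) + \<i> * complex_of_real (2 * pi * (\<mu> \<bullet> h))))) (at \<xi>)"
  unfolding gauss_hat_def[abs_def]
  by (intro has_derivative_cexp has_derivative_minus gauss_hat_exponent_has_derivative S)

lemma inverse_gauss_hat_has_derivative:
  assumes S: "sym_pos_def S"
  shows "((\<lambda>\<xi>. inverse (gauss_hat \<mu> S \<xi>)) has_derivative (\<lambda>h. inverse (gauss_hat \<mu> S \<xi>) *
     (complex_of_real (8 * pi\<^sup>2 * (h \<bullet> (S *v \<xi>))) + \<i> * complex_of_real (2 * pi * (\<mu> \<bullet> h))))) (at \<xi>)"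
  unfolding gauss_hat_def[abs_def] exp_minus inverse_inverse_eq
  by (intro has_derivative_cexp gauss_hat_exponent_has_derivative S)

lemma gauss_hat_nonzero [simp]: "gauss_hat \<mu> S \<xi> \<noteq> 0"
  by (simp add: gauss_hat_def)

lemma gauss_hat_0 [simp]: "gauss_hat \<mu> S 0 = 1"
  by (simp add: gauss_hat_def)

lemma norm_gauss_hat: "cmod (gauss_hat \<mu> S \<xi>) = exp (- 4 * pi\<^sup>2 * (\<xi> \<bullet> (S *v \<xi>)))"
  by (simp add: gauss_hat_def)

lemma partial_gauss_hat:
  assumes S: "sym_pos_def S"
  shows "partial i (gauss_hat \<mu> S) \<xi> =
    - (complex_of_real (8 * pi\<^sup>2 * (S *v \<xi>) $ i) + 2 * pi * \<i> * (\<mu> $ i)) * gauss_hat \<mu> S \<xi>"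
  unfolding partial_eq[OF gauss_hat_has_derivative[OF S]] by (simp add: inner_axis inner_axis' algebra_simps)

lemma partial_inverse_gauss_hat:
  assumes S: "sym_pos_def S"
  shows "partial i (\<lambda>\<xi>. inverse (gauss_hat \<mu> S \<xi>)) \<xi> =
    (complex_of_real (8 * pi\<^sup>2 * (S *v \<xi>) $ i) + 2 * pi * \<i> * (\<mu> $ i)) * inverse (gauss_hat \<mu> S \<xi>)"
  unfolding partial_eq[OF inverse_gauss_hat_has_derivative[OF S]] by (simp add: inner_axis inner_axis' algebra_simps)

text \<open>The Gaussian is annihilated by \<open>\<partial>\<^sub>i + 1/2 \<partial>\<^sub>iV\<^sub>0\<close>; on the Fourier side this is a first
  order system whose solutions are the multiples of \<^const>\<open>gauss_hat\<close>.\<close>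

lemma fourier_exp_quad_potential:
  fixes S :: "real^'d::finite^'d"
  assumes S: "sym_pos_def S"
  shows "fourier_integral (\<lambda>x. complex_of_real (exp (- quad_potential \<mu> S x / 2))) \<xi>
     = complex_of_real (LINT x|lborel. exp (- quad_potential \<mu> S x / 2)) * gauss_hat \<mu> S \<xi>"
proof -
  let ?M = "matrix_inv S"
  define g where "g = (\<lambda>x. complex_of_real (exp (- quad_potential \<mu> S x / 2)))"
  define G where "G = fourier_integral g"
  have g: "g \<in> schwartz"
    using exp_quad_potential_schwartz[OF S, of "1/2"] by (simp add: g_def)
  have G: "G \<in> schwartz"
    unfolding G_def by (rule fourier_integral_schwartz[OF g])
  \<comment> \<open>The transform of \<open>(x - \<mu>) $ l * g x\<close>. The equation for
    \<open>g\<close> expresses its partials by the matrix \<open>?M\<close> applied to these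
    functions.\<close>
  define T where "T = (\<lambda>l \<xi>. fourier_integral (\<lambda>x. complex_of_real (x $ l) * g x) \<xi> - \<mu> $ l * G \<xi>)"
  have gl: "(\<lambda>x. complex_of_real (x $ l) * g x) \<in> schwartz" for l
    by (rule schwartz_coord_mult[OF g])
  have partial_g: "partial i g = (\<lambda>x. \<Sum>j\<in>UNIV. - (1 / 2) * ?M $ i $ j * (complex_of_real (x $ j) * g x - \<mu> $ j * g x))" for i
  proof
    fix x
    have "((\<lambda>x. - quad_potential \<mu> S x / 2) has_derivative (\<lambda>h. - (h \<bullet> (?M *v (x - \<mu>))) / 2)) (at x)"
      by (auto intro!: derivative_eq_intros quad_potential_has_derivative S)
    from has_derivative_cexp[OF has_derivative_of_real[OF this]]
    have "(g has_derivative (\<lambda>h. g x * complex_of_real (- (h \<bullet> (?M *v (x - \<mu>))) / 2))) (at x)"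
      unfolding g_def exp_of_real .
    from partial_eq[OF this]
    have "partial i g x = g x * complex_of_real (- (?M *v (x - \<mu>)) $ i / 2)"
      by (simp add: inner_axis')
    also have "\<dots> = (\<Sum>j\<in>UNIV. - (1 / 2) * ?M $ i $ j * (complex_of_real (x $ j) * g x - \<mu> $ j * g x))"
      by (simp add: matrix_vector_mult_def sum_distrib_left sum_divide_distrib sum_negf[symmetric] algebra_simps diff_divide_distrib)
    finally show "partial i g x = \<dots>" .
  qed
  have eq: "2 * pi * \<i> * (\<xi> $ i) * G \<xi> = - (1 / 2) * (\<Sum>j\<in>UNIV. ?M $ i $ j * T j \<xi>)" for i \<xi>
  proof -
    have "2 * pi * \<i> * (\<xi> $ i) * G \<xi> = fourier_integral (partial i g) \<xi>"
      unfolding G_def by (rule fourier_integral_partial[OF g, symmetric])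
    also have "\<dots> = (\<Sum>j\<in>UNIV. fourier_integral (\<lambda>x. - (1 / 2) * ?M $ i $ j * (complex_of_real (x $ j) * g x - \<mu> $ j * g x)) \<xi>)"
      unfolding partial_g fourier_integral_def sum_distrib_left
      by (intro Bochner_Integration.integral_sum integrable_cis_mult integrable_schwartz schwartz_cmult schwartz_diff gl g)
    also have "\<dots> = (\<Sum>j\<in>UNIV. - (1 / 2) * ?M $ i $ j * T j \<xi>)"
      unfolding fourier_integral_cmult T_def G_def
      by (subst fourier_integral_diff) (auto simp: fourier_integral_cmult intro!: integrable_schwartz gl schwartz_cmult g)
    finally show ?thesis
      by (simp add: sum_distrib_left mult_ac)
  qed
  \<comment> \<open>Contracting the equations with row \<open>l\<close> of \<open>S\<close> cancels
    \<open>?M\<close> and isolates a single component.\<close>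
  have T: "T l \<xi> = - 4 * pi * \<i> * (S *v \<xi>) $ l * G \<xi>" for l \<xi>
  proof -
    have "complex_of_real ((S *v \<xi>) $ l) * (2 * pi * \<i> * G \<xi>) = (\<Sum>i\<in>UNIV. complex_of_real (S $ l $ i) * (2 * pi * \<i> * (\<xi> $ i) * G \<xi>))"
      by (simp add: matrix_vector_mult_def sum_distrib_left sum_distrib_right mult_ac)
    also have "\<dots> = - (1 / 2) * (\<Sum>i\<in>UNIV. \<Sum>j\<in>UNIV. complex_of_real (S $ l $ i * ?M $ i $ j) * T j \<xi>)"
      unfolding eq by (simp add: sum_distrib_left mult_ac)
    also have "\<dots> = - (1 / 2) * (\<Sum>j\<in>UNIV. complex_of_real ((S ** ?M) $ l $ j) * T j \<xi>)"
      by (subst sum.swap) (simp add: matrix_matrix_mult_def sum_distrib_right)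
    also have "\<dots> = - (1 / 2) * T l \<xi>"
      using sym_pos_def_matrix_inv[OF S] by (simp add: mat_def if_distrib[of complex_of_real] if_distrib[of "\<lambda>x. x * _"] cong: if_cong)
    finally have "T l \<xi> = - 2 * (complex_of_real ((S *v \<xi>) $ l) * (2 * pi * \<i> * G \<xi>))"
      by simp
    then show ?thesis
      by (simp add: mult_ac)
  qed
  have partial_G: "partial l G \<xi> = - (complex_of_real (8 * pi\<^sup>2 * (S *v \<xi>) $ l) + 2 * pi * \<i> * (\<mu> $ l)) * G \<xi>" for l \<xi>
  proof -
    have "partial l G \<xi> = fourier_integral (\<lambda>x. - 2 * pi * \<i> * (complex_of_real (x $ l) * g x)) \<xi>"
      unfolding G_def fourier_integral_coord_mult[OF g] by (simp add: mult_ac)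
    also have "\<dots> = - 2 * pi * \<i> * (T l \<xi> + \<mu> $ l * G \<xi>)"
      unfolding fourier_integral_cmult T_def by simp
    finally show ?thesis
      unfolding T by (simp add: algebra_simps power2_eq_square)
  qed
  have dG: "G differentiable (at \<xi>)" for \<xi>
    by (rule schwartz_differentiable[OF G])
  have dI: "(\<lambda>\<xi>. inverse (gauss_hat \<mu> S \<xi>)) differentiable (at \<xi>)" for \<xi>
    unfolding differentiable_def using inverse_gauss_hat_has_derivative[OF S] by blast
  \<comment> \<open>Both functions solve the same first order system, so all partials of their
    quotient vanish and it is constant; the constant is read off at the origin.\<close>
  have "((\<lambda>\<xi>. G \<xi> * inverse (gauss_hat \<mu> S \<xi>)) has_derivative (\<lambda>h. 0)) (at \<xi>)" for \<xi>
  proof -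
    have z: "partial l (\<lambda>\<xi>. G \<xi> * inverse (gauss_hat \<mu> S \<xi>)) \<xi> = 0" for l
      unfolding partial_mult[OF dG dI] partial_G partial_inverse_gauss_hat[OF S] by (simp add: algebra_simps)
    show ?thesis
      using has_derivative_partial[OF differentiable_mult[OF dG dI], of \<xi>]
      unfolding z scaleR_zero_right sum.neutral_const .
  qed
  then have "G \<xi> * inverse (gauss_hat \<mu> S \<xi>) = G 0 * inverse (gauss_hat \<mu> S 0)"
    by (intro has_derivative_zero_unique[of UNIV]) auto
  moreover have "G 0 = complex_of_real (LINT x|lborel. exp (- quad_potential \<mu> S x / 2))"
    by (simp add: G_def fourier_integral_def g_def)
  ultimately show ?thesis
    by (simp add: G_def g_def field_simps)
qed

section \<open>Isotropic Gaussians and the inversion formula\<close>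

lemma mat_vector_mult: "mat s *v (x::real^'d::finite) = s *\<^sub>R x"
  by (simp add: vec_eq_iff matrix_vector_mult_def mat_def if_distrib[of "\<lambda>x. x * _"] cong: if_cong)

lemma sym_pos_def_mat: "s > 0 \<Longrightarrow> sym_pos_def (mat s)"
  by (simp add: sym_pos_def_def mat_vector_mult)

lemma quad_potential_mat:
  assumes "s > 0"
  shows "quad_potential \<mu> (mat s) (x::real^'d::finite) = (norm (x - \<mu>))\<^sup>2 / (2 * s)"
proof -
  have "matrix_inv (mat s) *v (mat s *v y) = y" for y :: "real^'d"
    by (simp only: matrix_vector_mul_assoc matrix_vector_mul_lid sym_pos_def_matrix_inv[OF sym_pos_def_mat[OF assms]])
  from this[of "(1 / s) *\<^sub>R (x - \<mu>)"] have "matrix_inv (mat s) *v (x - \<mu>) = (1 / s) *\<^sub>R (x - \<mu>)"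
    using assms by (simp add: mat_vector_mult)
  then show ?thesis
    by (simp add: quad_potential_def power2_norm_eq_inner)
qed

text \<open>The parameter \<open>a\<close> is an inverse width, and the factor \<open>pi\<close>
  makes the family self-dual: centred at the origin, the transform is \<open>a^-d\<close> times the
  Gaussian with parameter \<open>1 / a\<close>, and \<open>a = 1\<close> is a fixed point of mass 1.
  In terms of \<open>quad_potential\<close> the covariance parameter is
  \<open>1 / (4 pi a^2)\<close>, as the potential enters with the factor 1/2.\<close>

definition gaussian :: "real \<Rightarrow> real^'d::finite \<Rightarrow> real^'d \<Rightarrow> real" where
  "gaussian a \<zeta> x = exp (- pi * a\<^sup>2 * (norm (x - \<zeta>))\<^sup>2)"

lemma gaussian_eq_quad_potential:
  assumes "a > 0"
  shows "gaussian a \<zeta> x = exp (- quad_potential \<zeta> (mat (1 / (4 * pi * a\<^sup>2))) x / 2)"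
  using assms by (simp add: gaussian_def quad_potential_mat field_simps)

lemma gaussian_schwartz:
  assumes "a > 0"
  shows "(\<lambda>x. complex_of_real (gaussian a \<zeta> x)) \<in> schwartz"
  using exp_quad_potential_schwartz[OF sym_pos_def_mat, of "1 / (4 * pi * a\<^sup>2)" "1 / 2" \<zeta>] assms
  by (simp add: gaussian_eq_quad_potential)

lemma borel_measurable_gaussian [measurable]: "gaussian a \<zeta> \<in> borel_measurable borel"
  unfolding gaussian_def[abs_def] by measurable

lemma gaussian_nonneg [simp]: "gaussian a \<zeta> x \<ge> 0"
  by (simp add: gaussian_def)

lemma integral_gaussian_1:
  "integrable lborel (gaussian 1 (0::real^'d::finite))"
  "(LINT x|lborel. gaussian 1 (0::real^'d) x) = 1"
proof -
  \<comment> \<open>With variance \<open>1 / (2 pi)\<close> the normalising factor of the normal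
    density is 1.\<close>
  define \<sigma> :: real where "\<sigma> = 1 / sqrt (2 * pi)"
  have \<sigma>: "\<sigma> > 0" "\<sigma>\<^sup>2 = 1 / (2 * pi)"
    by (simp_all add: \<sigma>_def power_divide)
  have nd: "normal_density 0 \<sigma> t = exp (- pi * t\<^sup>2)" for t
    by (simp add: normal_density_def \<sigma> mult.commute)
  have one: "(\<integral>\<^sup>+t. ennreal (exp (- pi * t\<^sup>2)) \<partial>lborel) = 1"
    using nn_integral_eq_integral[OF integrable_normal_density[OF \<sigma>(1), of 0]] integral_normal_density[OF \<sigma>(1), of 0]
    by (simp add: nd)
  have "(\<integral>\<^sup>+x. ennreal (gaussian 1 (0::real^'d) x) \<partial>lborel)
     = (\<integral>\<^sup>+x. (\<Prod>b\<in>(Basis::(real^'d) set). ennreal (exp (- pi * (x \<bullet> b)\<^sup>2))) \<partial>lborel)"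
  proof (intro nn_integral_cong)
    fix x :: "real^'d"
    have "(norm x)\<^sup>2 = (\<Sum>b\<in>Basis. (x \<bullet> b)\<^sup>2)"
      by (simp add: norm_eq_sqrt_inner euclidean_inner[of x x] power2_eq_square sum_nonneg)
    then have "gaussian 1 0 x = (\<Prod>b\<in>Basis. exp (- pi * (x \<bullet> b)\<^sup>2))"
      by (simp add: gaussian_def exp_sum[symmetric] sum_distrib_left sum_negf)
    then show "ennreal (gaussian 1 0 x) = (\<Prod>b\<in>Basis. ennreal (exp (- pi * (x \<bullet> b)\<^sup>2)))"
      by (simp add: prod_ennreal)
  qed
  also have "\<dots> = (\<Prod>b\<in>(Basis::(real^'d) set). (\<integral>\<^sup>+t. ennreal (exp (- pi * t\<^sup>2)) \<partial>lborel))"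
    by (rule nn_integral_lborel_prod) auto
  also have "\<dots> = 1"
    by (simp only: one prod.neutral_const)
  finally have *: "(\<integral>\<^sup>+x. ennreal (gaussian 1 (0::real^'d) x) \<partial>lborel) = ennreal 1" by simp
  then have "integrable lborel (gaussian 1 (0::real^'d)) \<and> (LINT x|lborel. gaussian 1 (0::real^'d) x) = 1"
    by (subst (asm) nn_integral_eq_integrable) auto
  then show "integrable lborel (gaussian 1 (0::real^'d::finite))"
    "(LINT x|lborel. gaussian 1 (0::real^'d) x) = 1" by auto
qed

lemma gaussian_affine:
  assumes "a > 0"
  shows "gaussian a \<zeta> (\<zeta> + (1 / a) *\<^sub>R x) = gaussian 1 0 x"
  using assms by (simp add: gaussian_def power_mult_distrib power_divide)

lemma integrable_gaussian:
  assumes "a > 0"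
  shows "integrable lborel (gaussian a \<zeta>)"
proof -
  have "- (a *\<^sub>R \<zeta>) + a *\<^sub>R x = a *\<^sub>R (x - \<zeta>)" for x
    by (simp add: scaleR_diff_right)
  then have "gaussian 1 0 (- (a *\<^sub>R \<zeta>) + a *\<^sub>R x) = gaussian a \<zeta> x" for x
    by (simp only:) (simp add: gaussian_def power_mult_distrib)
  then show ?thesis
    using integrable_lborel_affine[OF integral_gaussian_1(1), of a "- (a *\<^sub>R \<zeta>)"] assms by simp
qed

lemma integral_gaussian:
  fixes \<zeta> :: "real^'d::finite"
  assumes "a > 0"
  shows "(LINT x|lborel. gaussian a \<zeta> x) = (1 / a) ^ CARD('d)"
  using integral_lborel_affine[OF integrable_gaussian[OF assms, of \<zeta>], where c="1 / a" and t=\<zeta>] assms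
  by (simp add: gaussian_affine integral_gaussian_1)

lemma fourier_gaussian:
  fixes \<zeta> :: "real^'d::finite"
  assumes "a > 0"
  shows "fourier_integral (\<lambda>x. complex_of_real (gaussian a \<zeta> x)) \<xi>
    = complex_of_real ((1 / a) ^ CARD('d) * gaussian (1 / a) 0 \<xi>) * cis (- 2 * pi * (\<zeta> \<bullet> \<xi>))"
proof -
  let ?s = "1 / (4 * pi * a\<^sup>2)"
  have "fourier_integral (\<lambda>x. complex_of_real (gaussian a \<zeta> x)) \<xi>
      = complex_of_real (LINT x|lborel. gaussian a \<zeta> x) * gauss_hat \<zeta> (mat ?s) \<xi>"
    using fourier_exp_quad_potential[OF sym_pos_def_mat, of ?s] assms
    by (simp add: gaussian_eq_quad_potential)
  also have "gauss_hat \<zeta> (mat ?s) \<xi> = complex_of_real (gaussian (1 / a) 0 \<xi>) * cis (- 2 * pi * (\<zeta> \<bullet> \<xi>))"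
  proof -
    have "4 * pi\<^sup>2 * (\<xi> \<bullet> (mat ?s *v \<xi>)) = pi * (1 / a)\<^sup>2 * (norm \<xi>)\<^sup>2"
      using assms by (simp add: mat_vector_mult dot_square_norm power2_eq_square field_simps)
    then show ?thesis
      unfolding gauss_hat_def gaussian_def
      by (simp only: cis_conv_exp exp_of_real[symmetric] exp_add[symmetric]) (simp add: algebra_simps)
  qed
  finally show ?thesis
    by (simp add: integral_gaussian[OF assms])
qed

text \<open>The inverse integral is damped by a Gaussian factor with parameter tending to 0. With
  the factor inside, the multiplication formula moves the transform onto the damped character, where
  it becomes a Gaussian of mass 1 concentrating at \<open>x\<close>. Dominated convergence on both
  sides, after rescaling on the second, identifies the two limits.\<close>

lemma fourier_inversion:
  fixes \<phi> :: "real^'d::finite \<Rightarrow> complex"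
  assumes \<phi>: "\<phi> \<in> schwartz"
  shows "inv_fourier_integral (fourier_integral \<phi>) x = \<phi> x"
proof -
  define a :: "nat \<Rightarrow> real" where "a = (\<lambda>n. 1 / real (Suc n))"
  have a: "a n > 0" for n by (simp add: a_def)
  have a0: "a \<longlonglongrightarrow> 0"
    unfolding a_def by (rule LIMSEQ_Suc[OF lim_1_over_n])
  define K where "K = (\<lambda>n \<xi>. cis (2 * pi * (\<xi> \<bullet> x)) * complex_of_real (gaussian (a n) 0 \<xi>))"
  have [measurable]: "\<phi> \<in> borel_measurable borel" "fourier_integral \<phi> \<in> borel_measurable borel"
    using \<phi> borel_measurable_schwartz fourier_integral_schwartz by auto
  have intK: "integrable lborel (K n)" for n
    unfolding K_def by (intro integrable_cis_mult integrable_of_real integrable_gaussian a)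
  have FK: "fourier_integral (K n) y = complex_of_real ((1 / a n) ^ CARD('d) * gaussian (1 / a n) x y)" for n y
  proof -
    have "fourier_integral (K n) y = fourier_integral (\<lambda>\<xi>. complex_of_real (gaussian (a n) 0 \<xi>)) (y - x)"
    proof -
      have "cis (- 2 * pi * (\<xi> \<bullet> y)) * cis (2 * pi * (\<xi> \<bullet> x)) = cis (- 2 * pi * (\<xi> \<bullet> (y - x)))" for \<xi>
        by (simp add: cis_mult inner_diff_right algebra_simps)
      then show ?thesis
        unfolding fourier_integral_def K_def mult.assoc[symmetric] by simp
    qed
    then show ?thesis
      by (simp add: fourier_gaussian[OF a]) (simp add: gaussian_def)
  qed
  have "(\<lambda>n. LINT \<xi>|lborel. fourier_integral \<phi> \<xi> * K n \<xi>) \<longlonglongrightarrow> (LINT \<xi>|lborel. cis (2 * pi * (\<xi> \<bullet> x)) * fourier_integral \<phi> \<xi>)"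
  proof (rule integral_dominated_convergence)
    show "integrable lborel (\<lambda>\<xi>. cmod (fourier_integral \<phi> \<xi>))"
      by (intro integrable_norm integrable_schwartz fourier_integral_schwartz \<phi>)
    show "AE \<xi> in lborel. (\<lambda>n. fourier_integral \<phi> \<xi> * K n \<xi>) \<longlonglongrightarrow> cis (2 * pi * (\<xi> \<bullet> x)) * fourier_integral \<phi> \<xi>"
    proof (rule AE_I2)
      fix \<xi>
      have "(\<lambda>n. fourier_integral \<phi> \<xi> * (cis (2 * pi * (\<xi> \<bullet> x)) * complex_of_real (exp (- pi * (a n)\<^sup>2 * (norm (\<xi> - 0))\<^sup>2))))
         \<longlonglongrightarrow> fourier_integral \<phi> \<xi> * (cis (2 * pi * (\<xi> \<bullet> x)) * complex_of_real (exp (- pi * 0\<^sup>2 * (norm (\<xi> - 0))\<^sup>2)))"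
        by (intro tendsto_intros a0)
      then show "(\<lambda>n. fourier_integral \<phi> \<xi> * K n \<xi>) \<longlonglongrightarrow> cis (2 * pi * (\<xi> \<bullet> x)) * fourier_integral \<phi> \<xi>"
        by (simp add: K_def gaussian_def mult_ac)
    qed
    show "AE \<xi> in lborel. cmod (fourier_integral \<phi> \<xi> * K n \<xi>) \<le> cmod (fourier_integral \<phi> \<xi>)" for n
      by (intro AE_I2) (simp add: K_def norm_mult gaussian_def mult_left_le)
  qed (simp_all add: K_def)
  moreover have "(\<lambda>n. LINT \<xi>|lborel. fourier_integral \<phi> \<xi> * K n \<xi>) \<longlonglongrightarrow> (LINT z|lborel. \<phi> x * complex_of_real (gaussian 1 0 (z::real^'d)))"
  proof -
    have *: "(LINT \<xi>|lborel. fourier_integral \<phi> \<xi> * K n \<xi>) = (LINT z|lborel. \<phi> (x + a n *\<^sub>R z) * complex_of_real (gaussian 1 0 z))" for n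
    proof -
      have inv_a: "1 / a n > 0" using a by simp
      obtain B where B: "\<And>y. cmod (\<phi> y) \<le> B"
        using schwartz_bounded[OF \<phi>] by blast
      have int: "integrable lborel (\<lambda>y. \<phi> y * complex_of_real ((1 / a n) ^ CARD('d) * gaussian (1 / a n) x y))"
      proof (rule Bochner_Integration.integrable_bound)
        show "integrable lborel (\<lambda>y. B * ((1 / a n) ^ CARD('d) * gaussian (1 / a n) x y))"
          by (intro integrable_mult_right integrable_gaussian inv_a)
        have B0: "B \<ge> 0" using B norm_ge_zero order_trans by blast
        have c0: "0 \<le> (1 / a n) ^ CARD('d) * gaussian (1 / a n) x y" for y
          using inv_a by (intro mult_nonneg_nonneg zero_le_power) auto
        show "AE y in lborel. norm (\<phi> y * complex_of_real ((1 / a n) ^ CARD('d) * gaussian (1 / a n) x y))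
            \<le> norm (B * ((1 / a n) ^ CARD('d) * gaussian (1 / a n) x y))"
          using B by (intro AE_I2) (simp only: norm_mult[of "\<phi> _"] norm_of_real real_norm_def abs_mult[of B]
              abs_of_nonneg[OF c0] abs_of_nonneg[OF B0], intro mult_right_mono c0)
      qed measurable
      have "(LINT \<xi>|lborel. fourier_integral \<phi> \<xi> * K n \<xi>) = (LINT y|lborel. \<phi> y * fourier_integral (K n) y)"
        by (rule fourier_integral_swap) (intro integrable_schwartz \<phi> intK)+
      also have "\<dots> = (LINT y|lborel. \<phi> y * complex_of_real ((1 / a n) ^ CARD('d) * gaussian (1 / a n) x y))"
        by (simp add: FK)
      also have "\<dots> = \<bar>a n\<bar> ^ DIM(real^'d) *\<^sub>R (LINT z|lborel. \<phi> (x + a n *\<^sub>R z) * complex_of_real ((1 / a n) ^ CARD('d) * gaussian (1 / a n) x (x + a n *\<^sub>R z)))"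
        using a[of n] by (intro integral_lborel_affine int) auto
      also have "\<dots> = (LINT z|lborel. (a n) ^ CARD('d) *\<^sub>R (\<phi> (x + a n *\<^sub>R z) * complex_of_real ((1 / a n) ^ CARD('d) * gaussian 1 0 z)))"
        using a[of n] gaussian_affine[OF inv_a, of x] by simp
      also have "\<dots> = (LINT z|lborel. \<phi> (x + a n *\<^sub>R z) * complex_of_real (gaussian 1 0 z))"
        using a[of n] by (intro Bochner_Integration.integral_cong refl) (simp add: scaleR_conv_of_real power_divide)
      finally show ?thesis .
    qed
    obtain B where B: "\<And>y. cmod (\<phi> y) \<le> B"
      using schwartz_bounded[OF \<phi>] by blast
    show ?thesis
      unfolding *
    proof (rule integral_dominated_convergence)
      show "integrable lborel (\<lambda>z::real^'d. B * gaussian 1 0 z)"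
        by (intro integrable_mult_right integrable_gaussian) auto
      show "AE z in lborel. cmod (\<phi> (x + a n *\<^sub>R z) * complex_of_real (gaussian 1 0 z)) \<le> B * gaussian 1 0 z" for n
        using B by (intro AE_I2) (auto simp: norm_mult gaussian_def intro!: mult_right_mono)
      show "AE z in lborel. (\<lambda>n. \<phi> (x + a n *\<^sub>R z) * complex_of_real (gaussian 1 0 z)) \<longlonglongrightarrow> \<phi> x * complex_of_real (gaussian 1 0 z)"
      proof (rule AE_I2)
        fix z
        have "isCont \<phi> (x + 0 *\<^sub>R z)"
          using continuous_on_schwartz[OF \<phi>, of UNIV] by (simp add: continuous_on_eq_continuous_at)
        moreover have "(\<lambda>n. x + a n *\<^sub>R z) \<longlonglongrightarrow> x + 0 *\<^sub>R z"
          by (intro tendsto_intros a0)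
        ultimately have "(\<lambda>n. \<phi> (x + a n *\<^sub>R z)) \<longlonglongrightarrow> \<phi> (x + 0 *\<^sub>R z)"
          by (rule isCont_tendsto_compose)
        then show "(\<lambda>n. \<phi> (x + a n *\<^sub>R z) * complex_of_real (gaussian 1 0 z)) \<longlonglongrightarrow> \<phi> x * complex_of_real (gaussian 1 0 z)"
          by (intro tendsto_intros) simp
      qed
    qed measurable
  qed
  ultimately have "(LINT \<xi>|lborel. cis (2 * pi * (\<xi> \<bullet> x)) * fourier_integral \<phi> \<xi>) = (LINT z|lborel. \<phi> x * complex_of_real (gaussian 1 0 (z::real^'d)))"
    by (rule LIMSEQ_unique)
  then show ?thesis
    by (simp add: inv_fourier_integral_def inner_commute integral_gaussian_1)
qed

lemma cnj_inv_fourier_integral: "cnj (inv_fourier_integral f x) = fourier_integral (\<lambda>\<xi>. cnj (f \<xi>)) x"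
proof -
  have "fourier_integral (\<lambda>\<xi>. cnj (f \<xi>)) x = (LINT \<xi>|lborel. cnj (cis (2 * pi * (x \<bullet> \<xi>)) * f \<xi>))"
    by (simp add: fourier_integral_def cis_cnj inner_commute del: integral_cnj)
  then show ?thesis
    by (simp only: inv_fourier_integral_def Bochner_Integration.integral_cnj)
qed

text \<open>Inversion expressed by the forward transform alone, since conjugation exchanges the two
  transforms. In this form it combines with \<open>fourier_integral_swap\<close> into Parseval's
  identity, and it shows that the transform is onto the Schwartz functions.\<close>

lemma fourier_cnj_fourier:
  assumes "\<phi> \<in> schwartz"
  shows "fourier_integral (\<lambda>\<xi>. cnj (fourier_integral \<phi> \<xi>)) = (\<lambda>x. cnj (\<phi> x))"
  unfolding cnj_inv_fourier_integral[symmetric] fourier_inversion[OF assms] ..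

lemma fourier_integral_surj_schwartz:
  fixes \<phi> :: "real^'d::finite \<Rightarrow> complex"
  assumes "\<phi> \<in> schwartz"
  shows "\<exists>\<psi>\<in>schwartz. fourier_integral \<psi> = \<phi>"
proof -
  have *: "(\<lambda>x. cnj (\<phi> x)) \<in> schwartz"
    by (rule schwartz_cnj[OF assms])
  have "fourier_integral (\<lambda>\<xi>. cnj (fourier_integral (\<lambda>x. cnj (\<phi> x)) \<xi>)) = \<phi>"
    using fourier_cnj_fourier[OF *] by simp
  moreover have "(\<lambda>\<xi>. cnj (fourier_integral (\<lambda>x. cnj (\<phi> x)) \<xi>)) \<in> schwartz"
    by (intro schwartz_cnj fourier_integral_schwartz assms)
  ultimately show ?thesis by blast
qed

lemma parseval_schwartz:
  fixes \<phi> :: "real^'d::finite \<Rightarrow> complex"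
  assumes "\<phi> \<in> schwartz"
  shows "(LINT \<xi>|lborel. (cmod (fourier_integral \<phi> \<xi>))\<^sup>2) = (LINT x|lborel. (cmod (\<phi> x))\<^sup>2)"
proof -
  have "complex_of_real (LINT \<xi>|lborel. (cmod (fourier_integral \<phi> \<xi>))\<^sup>2)
      = (LINT \<xi>|lborel. fourier_integral \<phi> \<xi> * cnj (fourier_integral \<phi> \<xi>))"
    unfolding integral_complex_of_real[symmetric] complex_norm_square ..
  also have "\<dots> = (LINT x|lborel. \<phi> x * fourier_integral (\<lambda>\<xi>. cnj (fourier_integral \<phi> \<xi>)) x)"
    by (intro fourier_integral_swap integrable_schwartz schwartz_cnj fourier_integral_schwartz assms)
  also have "\<dots> = complex_of_real (LINT x|lborel. (cmod (\<phi> x))\<^sup>2)"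
    unfolding integral_complex_of_real[symmetric] complex_norm_square fourier_cnj_fourier[OF assms] ..
  finally show ?thesis
    by (simp only: of_real_eq_iff)
qed

section \<open>Uniqueness of representatives\<close>

text \<open>Dynkin's argument: open boxes are stable under intersection and generate the Borel sets,
  so complements and disjoint unions suffice.\<close>

lemma borel_induct_box [consumes 1, case_names box compl union]:
  fixes A :: "'a::euclidean_space set"
  assumes A: "A \<in> sets borel"
    and box: "\<And>a b. P (box a b)"
    and compl: "\<And>A. A \<in> sets borel \<Longrightarrow> P A \<Longrightarrow> P (- A)"
    and union: "\<And>A :: nat \<Rightarrow> 'a set. disjoint_family A \<Longrightarrow> (\<And>i. A i \<in> sets borel) \<Longrightarrow> (\<And>i. P (A i)) \<Longrightarrow> P (\<Union>i. A i)"
  shows "P A"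
proof -
  let ?G = "range (\<lambda>(a, b). box a b :: 'a set)"
  have borel: "sets borel = sigma_sets UNIV ?G"
    by (subst borel_eq_box) (simp add: sets_measure_of)
  have stable: "Int_stable ?G"
    by (auto simp: Int_stable_def box_Int_box)
  show ?thesis
  proof (rule sigma_sets_induct_disjoint[OF stable _ A[unfolded borel]])
    show "P {}"
      using box[of 0 0] by simp
    show "P (UNIV - B)" if "B \<in> sigma_sets UNIV ?G" "P B" for B
      using compl[of B] that borel by (simp add: Compl_eq_Diff_UNIV)
    show "P (\<Union>i. B i)" if "disjoint_family B" "range B \<subseteq> sigma_sets UNIV ?G" "\<And>i. P (B i)" for B :: "nat \<Rightarrow> 'a set"
      using union[of B] that borel by blast
  qed (auto intro: box)
qed

lemma disjoint_indicator_sums: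
  fixes A :: "nat \<Rightarrow> 'a set"
  assumes "disjoint_family A"
  shows "(\<lambda>i. indicator (A i) x :: real) sums indicator (\<Union>i. A i) x"
proof (cases "x \<in> (\<Union>i. A i)")
  case True
  then obtain j where j: "x \<in> A j" by blast
  then have "indicator (A i) x = (if i = j then 1 else 0 :: real)" for i
    using assms by (auto simp: disjoint_family_on_def indicator_def)
  then show ?thesis
    using sums_single[of j "\<lambda>_. 1::real"] True by simp
qed (simp add: indicator_def)

text \<open>Smooth approximations of the indicator function of a box with centre \<open>c\<close> and half side
  lengths \<open>r\<close>. The factor \<open>Suc n\<close> makes them converge to \<open>0\<close> on the boundary as well.\<close>

definition bump :: "real^'d::finite \<Rightarrow> real^'d \<Rightarrow> nat \<Rightarrow> real^'d \<Rightarrow> real" where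
  "bump c r n x = (\<Sum>i\<in>UNIV. real (Suc n) * (((x $ i - c $ i) / r $ i)\<^sup>2) ^ Suc n)"

lemma bump_nonneg: "bump c r n x \<ge> 0"
  unfolding bump_def by (intro sum_nonneg mult_nonneg_nonneg) auto

lemma bump_polynomial: "real_polynomial_function (bump c r n)"
proof -
  have c: "real_polynomial_function (\<lambda>x::real^'a. x $ i - c $ i)" for i
    by (intro real_polynomial_function_diff real_polynomial_function.intros(1,2) bounded_linear_vec_nth)
  show ?thesis
    unfolding bump_def[abs_def] divide_inverse
    by (intro real_polynomial_function_sum real_polynomial_function.intros(4) real_polynomial_function.intros(2)
        real_polynomial_function_power c) auto
qed

lemma power_Suc_ge_linear:
  assumes "s \<ge> (0::real)"
  shows "real (Suc n) * s ^ Suc n \<ge> s - 1"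
proof (cases "s \<ge> 1")
  case True
  then have "1 * s \<le> real (Suc n) * s ^ Suc n"
    using power_increasing[of 1 "Suc n" s] by (intro mult_mono) auto
  then show ?thesis by simp
next
  case False
  then have "s - 1 \<le> 0" by simp
  also have "0 \<le> real (Suc n) * s ^ Suc n"
    using assms by (intro mult_nonneg_nonneg) auto
  finally show ?thesis .
qed

text \<open>The bound does not depend on \<open>n\<close>. With \<open>scaled_square_sum_ge\<close>
  it makes every \<open>exp (- bump c r n x)\<close> a Schwartz function, and it dominates all of
  them by a single Gaussian, as needed in \<open>box_wclosure\<close>.\<close>

lemma bump_ge: "bump c r n x \<ge> (\<Sum>i\<in>UNIV. ((x $ i - c $ i) / r $ i)\<^sup>2 - 1)"
  unfolding bump_def by (intro sum_mono power_Suc_ge_linear) auto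

lemma scaled_square_sum_ge:
  fixes r :: "real^'d::finite"
  assumes r: "\<And>i. r $ i > 0"
  shows "\<exists>a>0. \<exists>b. \<forall>x. (\<Sum>i\<in>UNIV. ((x $ i - c $ i) / r $ i)\<^sup>2 - 1) \<ge> a * (norm x)\<^sup>2 - b"
proof -
  define R where "R = (\<Sum>i\<in>UNIV. r $ i)"
  have R: "r $ i \<le> R" for i
    unfolding R_def using r by (intro member_le_sum) (auto intro: less_imp_le)
  have R0: "R > 0"
    using r R less_le_trans by blast
  define b where "b = (\<Sum>i\<in>UNIV. (c $ i)\<^sup>2 / (r $ i)\<^sup>2 + 1)"
  have "1 / (2 * R\<^sup>2) * (norm x)\<^sup>2 - b \<le> (\<Sum>i\<in>UNIV. ((x $ i - c $ i) / r $ i)\<^sup>2 - 1)" for x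
  proof -
    have "1 / (2 * R\<^sup>2) * (x $ i)\<^sup>2 - ((c $ i)\<^sup>2 / (r $ i)\<^sup>2 + 1) \<le> ((x $ i - c $ i) / r $ i)\<^sup>2 - 1" for i
    proof -
      have "(x $ i)\<^sup>2 / (2 * R\<^sup>2) \<le> (x $ i)\<^sup>2 / (2 * (r $ i)\<^sup>2)"
        using r[of i] R[of i] R0 by (intro divide_left_mono mult_left_mono power_mono) auto
      also have "\<dots> \<le> ((x $ i - c $ i) / r $ i)\<^sup>2 + (c $ i)\<^sup>2 / (r $ i)\<^sup>2"
      proof -
        have "(x $ i)\<^sup>2 \<le> 2 * (x $ i - c $ i)\<^sup>2 + 2 * (c $ i)\<^sup>2"
          using zero_le_power2[of "x $ i - 2 * c $ i"] by (simp add: power2_eq_square algebra_simps)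
        then have "(x $ i)\<^sup>2 / (2 * (r $ i)\<^sup>2) \<le> (2 * (x $ i - c $ i)\<^sup>2 + 2 * (c $ i)\<^sup>2) / (2 * (r $ i)\<^sup>2)"
          by (intro divide_right_mono) auto
        then show ?thesis
          by (simp add: power_divide add_divide_distrib)
      qed
      finally show ?thesis by simp
    qed
    then have "(\<Sum>i\<in>UNIV. 1 / (2 * R\<^sup>2) * (x $ i)\<^sup>2 - ((c $ i)\<^sup>2 / (r $ i)\<^sup>2 + 1)) \<le> (\<Sum>i\<in>UNIV. ((x $ i - c $ i) / r $ i)\<^sup>2 - 1)"
      by (intro sum_mono) auto
    moreover have "(norm x)\<^sup>2 = (\<Sum>i\<in>UNIV. (x $ i)\<^sup>2)"
      by (simp add: norm_vec_def L2_set_def sum_nonneg)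
    ultimately show ?thesis
      by (simp add: b_def sum_subtractf sum_distrib_left)
  qed
  with R0 show ?thesis
    by (intro exI[of _ "1 / (2 * R\<^sup>2)"]) auto
qed

lemma exp_bump_schwartz:
  fixes r :: "real^'d::finite"
  assumes r: "\<And>i. r $ i > 0"
  shows "(\<lambda>x. complex_of_real (exp (- bump c r n x))) \<in> schwartz"
proof -
  obtain a b where ab: "a > 0" "\<And>x. (\<Sum>i\<in>UNIV. ((x $ i - c $ i) / r $ i)\<^sup>2 - 1) \<ge> a * (norm x)\<^sup>2 - b"
    using scaled_square_sum_ge[of r c] r by blast
  have "(\<lambda>x. complex_of_real (1 * exp (- bump c r n x))) \<in> schwartz"
    using order_trans[OF ab(2) bump_ge] bump_polynomial
    by (intro poly_exp_schwartz[OF _ _ ab(1)]) (auto intro: real_polynomial_function.intros(2))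
  then show ?thesis by simp
qed

text \<open>Since \<open>bump\<close> is nonnegative, the coercivity of the exponent comes from the
  Gaussian factor. The factor is kept because \<open>AE_eq_0_if_schwartz_integral_0\<close> tests a
  function already multiplied by it.\<close>

lemma exp_bump_gaussian_schwartz:
  fixes r :: "real^'d::finite"
  shows "(\<lambda>x. complex_of_real (exp (- bump c r n x) * gaussian 1 0 x)) \<in> schwartz"
proof -
  have "(norm x)\<^sup>2 = (\<Sum>i\<in>UNIV. (x $ i)\<^sup>2)" for x :: "real^'d"
    by (simp add: norm_vec_def L2_set_def sum_nonneg)
  then have "real_polynomial_function (\<lambda>x::real^'d. (norm x)\<^sup>2)"
    by (simp only:) (intro real_polynomial_function_sum real_polynomial_function_power real_polynomial_function.intros(1) bounded_linear_vec_nth, simp)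
  then have p: "real_polynomial_function (\<lambda>x::real^'d. bump c r n x + pi * (norm x)\<^sup>2)"
    by (intro real_polynomial_function.intros(2,3,4) bump_polynomial)
  have "(\<lambda>x. complex_of_real (1 * exp (- (bump c r n x + pi * (norm x)\<^sup>2)))) \<in> schwartz"
    using bump_nonneg[of c r n]
    by (intro poly_exp_schwartz[OF _ p, of _ pi 0]) (auto intro: real_polynomial_function.intros(2))
  then show ?thesis
    by (simp add: gaussian_def exp_add[symmetric] exp_minus_inverse algebra_simps)
qed

lemma borel_measurable_bump [measurable]: "bump c r n \<in> borel_measurable borel"
  unfolding bump_def[abs_def] by measurable

lemma exp_bump_tendsto:
  fixes r :: "real^'d::finite"
  assumes r: "\<And>i. r $ i > 0"
  shows "(\<lambda>n. exp (- bump c r n x)) \<longlonglongrightarrow> indicator (box (c - r) (c + r)) x"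
proof (cases "x \<in> box (c - r) (c + r)")
  case True
  have "((x $ i - c $ i) / r $ i)\<^sup>2 < 1" for i
  proof -
    have "c $ i - r $ i < x $ i" "x $ i < c $ i + r $ i"
      using True by (auto simp: mem_box_cart)
    then have "\<bar>(x $ i - c $ i) / r $ i\<bar> < 1"
      using r[of i] by (auto simp: abs_less_iff field_simps)
    then show ?thesis by (simp add: abs_square_less_1)
  qed
  then have "(\<lambda>n. real (Suc n) * (((x $ i - c $ i) / r $ i)\<^sup>2) ^ Suc n) \<longlonglongrightarrow> 0" for i
    using LIMSEQ_Suc[OF powser_times_n_limit_0[of "((x $ i - c $ i) / r $ i)\<^sup>2"]] by simp
  then have "(\<lambda>n. bump c r n x) \<longlonglongrightarrow> (\<Sum>i\<in>(UNIV::'d set). 0)"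
    unfolding bump_def by (intro tendsto_sum)
  then have "(\<lambda>n. exp (- bump c r n x)) \<longlonglongrightarrow> exp (- (\<Sum>i\<in>(UNIV::'d set). 0))"
    by (intro tendsto_intros)
  then show ?thesis
    using True by simp
next
  case False
  then obtain i where i: "\<not> (c $ i - r $ i < x $ i \<and> x $ i < c $ i + r $ i)"
    by (auto simp: mem_box_cart)
  then have "\<bar>(x $ i - c $ i) / r $ i\<bar> \<ge> 1"
  proof -
    have "\<bar>x $ i - c $ i\<bar> \<ge> r $ i"
      using i by linarith
    then show ?thesis
      using r[of i] by (simp add: abs_divide)
  qed
  then have "((x $ i - c $ i) / r $ i)\<^sup>2 \<ge> 1"
    by (metis one_le_power power2_abs)
  then have ge: "bump c r n x \<ge> real (Suc n)" for n
  proof -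
    assume "1 \<le> ((x $ i - c $ i) / r $ i)\<^sup>2"
    then have "1 \<le> (((x $ i - c $ i) / r $ i)\<^sup>2) ^ Suc n"
      by (rule one_le_power)
    then have "real (Suc n) * 1 \<le> real (Suc n) * (((x $ i - c $ i) / r $ i)\<^sup>2) ^ Suc n"
      by (intro mult_left_mono) auto
    also have "\<dots> \<le> bump c r n x"
      unfolding bump_def by (intro member_le_sum) auto
    finally show ?thesis by simp
  qed
  have "norm (exp (- bump c r n x)) \<le> exp (- 1) ^ Suc n" for n
    using ge[of n] by (simp add: exp_of_nat_mult[symmetric] del: power_Suc)
  moreover have "(\<lambda>n. exp (- 1 :: real) ^ Suc n) \<longlonglongrightarrow> 0"
    by (intro LIMSEQ_Suc LIMSEQ_power_zero) simp
  ultimately have "(\<lambda>n. exp (- bump c r n x)) \<longlonglongrightarrow> 0"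
    by (rule Lim_null_comparison[OF always_eventually[OF allI]])
  then show ?thesis
    using False by simp
qed

lemma box_centre:
  fixes a b :: "real^'d::finite"
  assumes "box a b \<noteq> {}"
  obtains c r where "box a b = box (c - r) (c + r)" "\<And>i. r $ i > 0"
proof
  have "a $ i < b $ i" for i
    using assms unfolding box_ne_empty by (auto simp: Basis_vec_def inner_axis)
  then show "((1 / 2) *\<^sub>R (b - a)) $ i > 0" for i by simp
  have "(1 / 2) *\<^sub>R (a + b) - (1 / 2) *\<^sub>R (b - a) = a"
    by (simp add: vec_eq_iff field_simps)
  moreover have "(1 / 2) *\<^sub>R (a + b) + (1 / 2) *\<^sub>R (b - a) = b"
    by (simp add: vec_eq_iff field_simps)
  ultimately show "box a b = box ((1 / 2) *\<^sub>R (a + b) - (1 / 2) *\<^sub>R (b - a)) ((1 / 2) *\<^sub>R (a + b) + (1 / 2) *\<^sub>R (b - a))"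
    by simp
qed

text \<open>The function \<open>g\<close> need not be integrable, but its product \<open>q\<close>
  with a Gaussian is, as the Gaussian is itself a test function. Smoothed indicators show that
  \<open>q\<close> integrates to 0 over boxes, hence over all Borel sets, so \<open>q\<close>
  vanishes almost everywhere; and the Gaussian has no zeros.\<close>

lemma AE_eq_0_if_schwartz_integral_0:
  fixes g :: "real^'d::finite \<Rightarrow> complex"
  assumes [measurable]: "g \<in> borel_measurable borel"
    and int: "\<And>\<phi>. \<phi> \<in> schwartz \<Longrightarrow> integrable lborel (\<lambda>x. g x * \<phi> x)"
    and zero: "\<And>\<phi>. \<phi> \<in> schwartz \<Longrightarrow> (LINT x|lborel. g x * \<phi> x) = 0"
  shows "AE x in lborel. g x = 0"
proof -
  define q where "q = (\<lambda>x. g x * complex_of_real (gaussian 1 0 x))"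
  have q: "integrable lborel q"
    unfolding q_def by (intro int gaussian_schwartz) simp
  have [measurable]: "q \<in> borel_measurable borel"
    unfolding q_def by measurable
  have q0: "(LINT x|lborel. q x) = 0"
    unfolding q_def by (intro zero gaussian_schwartz) simp
  have P: "(LINT x|lborel. indicator A x *\<^sub>R q x) = 0" if "A \<in> sets borel" for A
    using that
  proof (induction A rule: borel_induct_box)
    case (box a b)
    show ?case
    proof (cases "box a b = {}")
      case False
      then obtain c r where cr: "box a b = box (c - r) (c + r)" "\<And>i. r $ i > 0"
        using box_centre by metis
      have "(\<lambda>n. LINT x|lborel. exp (- bump c r n x) *\<^sub>R q x) \<longlonglongrightarrow> (LINT x|lborel. indicator (box a b) x *\<^sub>R q x)"
      proof (rule integral_dominated_convergence)
        show "integrable lborel (\<lambda>x. norm (q x))"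
          using q by (rule integrable_norm)
        show "AE x in lborel. (\<lambda>n. exp (- bump c r n x) *\<^sub>R q x) \<longlonglongrightarrow> indicator (box a b) x *\<^sub>R q x"
          unfolding cr(1) by (intro AE_I2 tendsto_intros exp_bump_tendsto cr(2))
        show "AE x in lborel. norm (exp (- bump c r n x) *\<^sub>R q x) \<le> norm (q x)" for n
          by (intro AE_I2) (auto intro!: mult_left_le_one_le simp: bump_nonneg)
      qed measurable
      moreover have "(LINT x|lborel. exp (- bump c r n x) *\<^sub>R q x) = 0" for n
        using zero[OF exp_bump_gaussian_schwartz[of c r n]]
        by (simp add: q_def scaleR_conv_of_real mult_ac)
      ultimately show ?thesis
        by (simp add: LIMSEQ_const_iff)
    qed simp
  next
    case (compl A)
    then have [measurable]: "A \<in> sets borel" by simp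
    have "indicator (- A) x *\<^sub>R q x = q x - indicator A x *\<^sub>R q x" for x
      by (simp add: indicator_def)
    then show ?case
      using q compl q0 integrable_mult_indicator[of A lborel q] by simp
  next
    case (union A)
    then have [measurable]: "A i \<in> sets borel" for i by simp
    have "(\<lambda>n. LINT x|lborel. (\<Sum>i<n. indicator (A i) x *\<^sub>R q x)) \<longlonglongrightarrow> (LINT x|lborel. indicator (\<Union>i. A i) x *\<^sub>R q x)"
    proof (rule integral_dominated_convergence)
      show "integrable lborel (\<lambda>x. norm (q x))"
        using q by (rule integrable_norm)
      show "AE x in lborel. (\<lambda>n. \<Sum>i<n. indicator (A i) x *\<^sub>R q x) \<longlonglongrightarrow> indicator (\<Union>i. A i) x *\<^sub>R q x"
        using bounded_linear.sums[OF bounded_linear_scaleR_left disjoint_indicator_sums[OF union.hyps(1)]]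
        unfolding sums_def by (intro AE_I2)
      show "AE x in lborel. norm (\<Sum>i<n. indicator (A i) x *\<^sub>R q x) \<le> norm (q x)" for n
      proof (rule AE_I2)
        fix x
        have "(\<Sum>i<n. indicator (A i) x *\<^sub>R q x) = indicator (\<Union>i<n. A i) x *\<^sub>R q x"
          using union.hyps(1) by (subst indicator_UN_disjoint) (auto simp: scaleR_sum_left disjoint_family_on_def)
        then show "norm (\<Sum>i<n. indicator (A i) x *\<^sub>R q x) \<le> norm (q x)"
          by (simp add: indicator_def)
      qed
    qed measurable
    moreover have "(LINT x|lborel. (\<Sum>i<n. indicator (A i) x *\<^sub>R q x)) = 0" for n
      using union q by (subst Bochner_Integration.integral_sum) (auto intro: integrable_mult_indicator)
    ultimately show ?case
      by (simp add: LIMSEQ_const_iff)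
  qed
  have "AE x in lborel. q x = 0"
    using q P by (intro sigma_finite_measure.density_unique_banach[OF sigma_finite_lborel, where f'="\<lambda>_. 0"]) (auto simp: set_lebesgue_integral_def)
  then show ?thesis
    by eventually_elim (simp add: q_def gaussian_def)
qed

lemma fourier_rep_unique:
  assumes g: "fourier_rep T g" and h: "fourier_rep T h"
  shows "AE x in lborel. g x = h x"
proof -
  have [measurable]: "g \<in> borel_measurable borel" "h \<in> borel_measurable borel"
    using g h by (auto simp: fourier_rep_def)
  have "AE x in lborel. g x - h x = 0"
  proof (rule AE_eq_0_if_schwartz_integral_0)
    fix \<phi> :: "real^'a \<Rightarrow> complex" assume \<phi>: "\<phi> \<in> schwartz"
    have i: "integrable lborel (\<lambda>x. g x * \<phi> x)" "integrable lborel (\<lambda>x. h x * \<phi> x)"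
      and e: "(LINT x|lborel. g x * \<phi> x) = (LINT x|lborel. h x * \<phi> x)"
      using g h \<phi> by (auto simp: fourier_rep_def distr_of_def)
    then show "integrable lborel (\<lambda>x. (g x - h x) * \<phi> x)" "(LINT x|lborel. (g x - h x) * \<phi> x) = 0"
      by (auto simp: left_diff_distrib)
  qed measurable
  then show ?thesis by simp
qed

lemma fourier_rep_fourier_fun:
  assumes "fourier_rep T g"
  shows "fourier_rep T (fourier_fun T)"
  using someI[of "fourier_rep T", OF assms] by (simp add: fourier_fun_def)

lemma fourier_fun_AE:
  assumes "fourier_rep T g"
  shows "AE x in lborel. fourier_fun T x = g x"
  using fourier_rep_unique[OF fourier_rep_fourier_fun[OF assms] assms] .

section \<open>Density of Schwartz functions and Plancherel's theorem\<close>

text \<open>Density is needed for two weights: 1, for Plancherel's theorem, and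
  \<open>1 + |xi|^2\<close>, which is the \<open>H^1\<close> norm on the Fourier side. Quadratic
  growth is the common ground on which all Schwartz functions have finite weighted norm.\<close>

locale poly_weight =
  fixes w :: "real^'d::finite \<Rightarrow> real"
  assumes measurable_weight [measurable]: "w \<in> borel_measurable borel"
    and weight_nonneg: "\<And>x. w x \<ge> 0"
    and weight_le: "\<And>x. w x \<le> (1 + norm x)\<^sup>2"
begin

text \<open>The squared norm, as an extended integral, so that it makes sense before finiteness is
  known. The price is the factor 2 in the triangle inequality \<open>wnorm_add_le\<close>, which is
  why the approximations below are taken with error \<open>e / 4\<close>.\<close>

definition wnorm :: "(real^'d \<Rightarrow> complex) \<Rightarrow> ennreal" where
  "wnorm v = (\<integral>\<^sup>+x. ennreal (w x * (cmod (v x))\<^sup>2) \<partial>lborel)"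

definition wclosure :: "(real^'d \<Rightarrow> complex) set" where
  "wclosure = {v \<in> borel_measurable borel. \<forall>e>0. \<exists>\<phi>\<in>schwartz. wnorm (\<lambda>x. v x - \<phi> x) \<le> ennreal e}"

lemma wnorm_add_le:
  assumes [measurable]: "u \<in> borel_measurable borel" "v \<in> borel_measurable borel"
  shows "wnorm (\<lambda>x. u x + v x) \<le> 2 * wnorm u + 2 * wnorm v"
proof -
  have "wnorm (\<lambda>x. u x + v x) \<le> (\<integral>\<^sup>+x. 2 * ennreal (w x * (cmod (u x))\<^sup>2) + 2 * ennreal (w x * (cmod (v x))\<^sup>2) \<partial>lborel)"
    unfolding wnorm_def
  proof (intro nn_integral_mono)
    fix x
    have "(cmod (u x + v x))\<^sup>2 \<le> (cmod (u x) + cmod (v x))\<^sup>2"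
      by (intro power_mono norm_triangle_ineq) auto
    also have "\<dots> \<le> 2 * (cmod (u x))\<^sup>2 + 2 * (cmod (v x))\<^sup>2"
      using sum_squares_bound[of "cmod (u x)" "cmod (v x)"] by (simp add: power2_sum)
    finally have "w x * (cmod (u x + v x))\<^sup>2 \<le> w x * (2 * (cmod (u x))\<^sup>2 + 2 * (cmod (v x))\<^sup>2)"
      using weight_nonneg by (intro mult_left_mono)
    also have "\<dots> = 2 * (w x * (cmod (u x))\<^sup>2) + 2 * (w x * (cmod (v x))\<^sup>2)"
      by (simp add: algebra_simps)
    finally have "ennreal (w x * (cmod (u x + v x))\<^sup>2) \<le> ennreal (2 * (w x * (cmod (u x))\<^sup>2) + 2 * (w x * (cmod (v x))\<^sup>2))"
      by (rule ennreal_leI)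
    then show "ennreal (w x * (cmod (u x + v x))\<^sup>2) \<le> 2 * ennreal (w x * (cmod (u x))\<^sup>2) + 2 * ennreal (w x * (cmod (v x))\<^sup>2)"
      using weight_nonneg[of x] by (simp add: ennreal_mult'')
  qed
  also have "\<dots> = 2 * wnorm u + 2 * wnorm v"
    unfolding wnorm_def by (subst nn_integral_add) (auto simp: nn_integral_cmult)
  finally show ?thesis .
qed

lemma wclosure_measurable [measurable_dest]: "v \<in> wclosure \<Longrightarrow> v \<in> borel_measurable borel"
  by (simp add: wclosure_def)

lemma quarter_sum:
  assumes "a \<le> ennreal (e / 4)" "b \<le> ennreal (e / 4)" "e > 0"
  shows "2 * a + 2 * b \<le> ennreal e"
proof -
  have "2 * a + 2 * b \<le> 2 * ennreal (e / 4) + 2 * ennreal (e / 4)"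
    using assms by (intro add_mono mult_left_mono) auto
  also have "\<dots> = ennreal (2 * (e / 4) + 2 * (e / 4))"
    using assms(3) by (simp only: ennreal_plus ennreal_mult'' ennreal_numeral divide_nonneg_nonneg mult_nonneg_nonneg less_imp_le zero_le_numeral)
  finally show ?thesis by simp
qed

lemma wclosure_close:
  assumes [measurable]: "v \<in> borel_measurable borel"
    and close: "\<And>e. e > 0 \<Longrightarrow> \<exists>u\<in>wclosure. wnorm (\<lambda>x. v x - u x) \<le> ennreal e"
  shows "v \<in> wclosure"
  unfolding wclosure_def
proof (intro CollectI conjI allI impI)
  fix e :: real assume e: "e > 0"
  then obtain u where u[measurable]: "u \<in> wclosure" "wnorm (\<lambda>x. v x - u x) \<le> ennreal (e / 4)"
    using close[of "e / 4"] by auto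
  then obtain \<phi> where \<phi>[measurable]: "\<phi> \<in> schwartz" "wnorm (\<lambda>x. u x - \<phi> x) \<le> ennreal (e / 4)"
    using e unfolding wclosure_def by (auto dest: spec[of _ "e / 4"])
  have "wnorm (\<lambda>x. v x - \<phi> x) = wnorm (\<lambda>x. (v x - u x) + (u x - \<phi> x))"
    by simp
  also have "\<dots> \<le> 2 * wnorm (\<lambda>x. v x - u x) + 2 * wnorm (\<lambda>x. u x - \<phi> x)"
    by (intro wnorm_add_le) measurable
  also have "\<dots> \<le> ennreal e"
    by (intro quarter_sum u \<phi> e)
  finally show "\<exists>\<phi>\<in>schwartz. wnorm (\<lambda>x. v x - \<phi> x) \<le> ennreal e"
    using \<phi> by blast
qed measurable

lemma wclosure_schwartz: "\<phi> \<in> schwartz \<Longrightarrow> \<phi> \<in> wclosure"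
  unfolding wclosure_def using borel_measurable_schwartz by (auto simp: wnorm_def intro!: bexI[of _ \<phi>])

lemma wclosure_add:
  assumes "u \<in> wclosure" "v \<in> wclosure"
  shows "(\<lambda>x. u x + v x) \<in> wclosure"
  unfolding wclosure_def
proof (intro CollectI conjI allI impI)
  have [measurable]: "u \<in> borel_measurable borel" "v \<in> borel_measurable borel"
    using assms by (auto intro: wclosure_measurable)
  show "(\<lambda>x. u x + v x) \<in> borel_measurable borel" by measurable
  fix e :: real assume e: "e > 0"
  then have e4: "e / 4 > 0" by simp
  obtain \<phi> where \<phi>[measurable]: "\<phi> \<in> schwartz" "wnorm (\<lambda>x. u x - \<phi> x) \<le> ennreal (e / 4)"
    using assms(1) e4 unfolding wclosure_def by blast
  obtain \<psi> where \<psi>[measurable]: "\<psi> \<in> schwartz" "wnorm (\<lambda>x. v x - \<psi> x) \<le> ennreal (e / 4)"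
    using assms(2) e4 unfolding wclosure_def by blast
  have "wnorm (\<lambda>x. (u x + v x) - (\<phi> x + \<psi> x)) = wnorm (\<lambda>x. (u x - \<phi> x) + (v x - \<psi> x))"
    by (simp add: algebra_simps)
  also have "\<dots> \<le> 2 * wnorm (\<lambda>x. u x - \<phi> x) + 2 * wnorm (\<lambda>x. v x - \<psi> x)"
    by (intro wnorm_add_le) measurable
  also have "\<dots> \<le> ennreal e"
    by (intro quarter_sum \<phi> \<psi> e)
  finally show "\<exists>\<phi>\<in>schwartz. wnorm (\<lambda>x. u x + v x - \<phi> x) \<le> ennreal e"
    by (intro bexI[of _ "\<lambda>x. \<phi> x + \<psi> x"] schwartz_add \<phi>(1) \<psi>(1))
qed

lemma wclosure_cmult:
  assumes "u \<in> wclosure"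
  shows "(\<lambda>x. c * u x) \<in> wclosure"
proof (cases "c = 0")
  case True
  then show ?thesis using wclosure_schwartz[OF schwartz_zero] by simp
next
  case False
  have [measurable]: "u \<in> borel_measurable borel"
    using assms by (rule wclosure_measurable)
  show ?thesis
    unfolding wclosure_def
  proof (intro CollectI conjI allI impI)
    show "(\<lambda>x. c * u x) \<in> borel_measurable borel" by measurable
    fix e :: real assume e: "e > 0"
    let ?e = "e / (cmod c)\<^sup>2"
    have "?e > 0" using e False by simp
    then obtain \<phi> where \<phi>[measurable]: "\<phi> \<in> schwartz" "wnorm (\<lambda>x. u x - \<phi> x) \<le> ennreal ?e"
      using assms unfolding wclosure_def by blast
    have "wnorm (\<lambda>x. c * u x - c * \<phi> x) = (\<integral>\<^sup>+x. ennreal ((cmod c)\<^sup>2) * ennreal (w x * (cmod (u x - \<phi> x))\<^sup>2) \<partial>lborel)"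
      unfolding wnorm_def right_diff_distrib[symmetric] norm_mult power_mult_distrib
      by (simp add: ennreal_mult'[symmetric] mult_ac)
    also have "\<dots> = ennreal ((cmod c)\<^sup>2) * wnorm (\<lambda>x. u x - \<phi> x)"
      unfolding wnorm_def by (rule nn_integral_cmult) measurable
    also have "\<dots> \<le> ennreal ((cmod c)\<^sup>2) * ennreal ?e"
      by (intro mult_left_mono \<phi>) auto
    also have "\<dots> = ennreal e"
      using False by (simp add: ennreal_mult'[symmetric])
    finally show "\<exists>\<phi>\<in>schwartz. wnorm (\<lambda>x. c * u x - \<phi> x) \<le> ennreal e"
      by (intro bexI[of _ "\<lambda>x. c * \<phi> x"] schwartz_cmult \<phi>(1))
  qed
qed

lemma wclosure_sum:
  assumes "\<And>i. i \<in> I \<Longrightarrow> f i \<in> wclosure"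
  shows "(\<lambda>x. \<Sum>i\<in>I. f i x) \<in> wclosure"
  using assms by (induction I rule: infinite_finite_induct)
    (simp_all add: wclosure_add wclosure_schwartz[OF schwartz_zero])

text \<open>Dominated convergence turns pointwise limits with a common majorant into limits in the
  weighted norm. Every passage from Schwartz functions to boxes, to bounded Borel sets and to
  general functions goes through this lemma.\<close>

lemma wclosure_dominated:
  assumes v[measurable]: "v \<in> borel_measurable borel" and K[measurable]: "K \<in> borel_measurable borel"
    and u: "\<And>n. u n \<in> wclosure" and lim: "\<And>x. (\<lambda>n. u n x) \<longlonglongrightarrow> v x"
    and bd: "\<And>n x. cmod (u n x) \<le> K x" and fin: "(\<integral>\<^sup>+x. ennreal (w x * (K x)\<^sup>2) \<partial>lborel) < \<infinity>"
  shows "v \<in> wclosure"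
proof (rule wclosure_close)
  have um[measurable]: "u n \<in> borel_measurable borel" for n
    using u by (rule wclosure_measurable)
  have vK: "cmod (v x) \<le> K x" for x
    by (rule tendsto_upperbound[OF tendsto_norm[OF lim]]) (auto intro!: always_eventually bd)
  have "(\<lambda>n. wnorm (\<lambda>x. v x - u n x)) \<longlonglongrightarrow> (\<integral>\<^sup>+x. 0 \<partial>(lborel::(real^'d) measure))"
    unfolding wnorm_def
  proof (rule nn_integral_dominated_convergence)
    show "(\<integral>\<^sup>+x. 4 * ennreal (w x * (K x)\<^sup>2) \<partial>lborel) < \<infinity>"
      using fin by (simp add: nn_integral_cmult ennreal_mult_less_top)
    show "AE x in lborel. ennreal (w x * (cmod (v x - u n x))\<^sup>2) \<le> 4 * ennreal (w x * (K x)\<^sup>2)" for n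
    proof (rule AE_I2)
      fix x
      have "cmod (v x - u n x) \<le> 2 * K x"
        using norm_triangle_ineq4[of "v x" "u n x"] vK[of x] bd[of n x] by simp
      then have "(cmod (v x - u n x))\<^sup>2 \<le> (2 * K x)\<^sup>2"
        by (intro power_mono) auto
      then have "w x * (cmod (v x - u n x))\<^sup>2 \<le> w x * (2 * K x)\<^sup>2"
        using weight_nonneg by (intro mult_left_mono)
      then have "ennreal (w x * (cmod (v x - u n x))\<^sup>2) \<le> ennreal (4 * (w x * (K x)\<^sup>2))"
        by (intro ennreal_leI) (simp add: power2_eq_square)
      then show "ennreal (w x * (cmod (v x - u n x))\<^sup>2) \<le> 4 * ennreal (w x * (K x)\<^sup>2)"
        using weight_nonneg[of x] by (simp add: ennreal_mult'')
    qed
    show "AE x in lborel. (\<lambda>n. ennreal (w x * (cmod (v x - u n x))\<^sup>2)) \<longlonglongrightarrow> 0"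
    proof (rule AE_I2)
      fix x
      have "(\<lambda>n. ennreal (w x * (cmod (v x - u n x))\<^sup>2)) \<longlonglongrightarrow> ennreal (w x * (cmod (v x - v x))\<^sup>2)"
        by (intro tendsto_intros lim)
      then show "(\<lambda>n. ennreal (w x * (cmod (v x - u n x))\<^sup>2)) \<longlonglongrightarrow> 0" by simp
    qed
  qed measurable
  then have lim0: "(\<lambda>n. wnorm (\<lambda>x. v x - u n x)) \<longlonglongrightarrow> 0" by simp
  fix e :: real assume "e > 0"
  then have "\<forall>\<^sub>F n in sequentially. wnorm (\<lambda>x. v x - u n x) < ennreal e"
    by (intro order_tendstoD(2)[OF lim0]) simp
  then obtain n where "wnorm (\<lambda>x. v x - u n x) < ennreal e"
    using eventually_happens'[OF sequentially_bot] by blast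
  then show "\<exists>u\<in>wclosure. wnorm (\<lambda>x. v x - u x) \<le> ennreal e"
    using u by (intro bexI[of _ "u n"]) auto
qed (rule v)

lemma schwartz_wnorm_finite:
  assumes "\<phi> \<in> schwartz"
  shows "(\<integral>\<^sup>+x. ennreal (w x * (cmod (\<phi> x))\<^sup>2) \<partial>lborel) < \<infinity>"
proof -
  have "(\<integral>\<^sup>+x. ennreal (w x * (cmod (\<phi> x))\<^sup>2) \<partial>lborel) \<le> (\<integral>\<^sup>+x. ennreal ((1 + norm x)\<^sup>2 * (cmod (\<phi> x))\<^sup>2) \<partial>lborel)"
    by (intro nn_integral_mono ennreal_leI mult_right_mono weight_le) auto
  also have "\<dots> < \<infinity>"
    using integrable_schwartz_poly_sq[OF assms, of 2] by (simp add: integrable_iff_bounded)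
  finally show ?thesis .
qed

text \<open>The smoothed indicators converge pointwise, and \<open>bump_ge\<close> provides the
  majorant \<open>?K\<close>, itself a Schwartz function and hence of finite weighted norm. It also
  majorises the indicator, which gives the second claim.\<close>

lemma box_wclosure:
  "(\<lambda>x. indicator (box a b) x) \<in> wclosure \<and> (\<integral>\<^sup>+x. ennreal (w x * (indicator (box a b) x)\<^sup>2) \<partial>lborel) < \<infinity>"
proof (cases "box a b = {}")
  case True
  then show ?thesis using wclosure_schwartz[OF schwartz_zero] by simp
next
  case False
  then obtain c r where cr: "box a b = box (c - r) (c + r)" "\<And>i. r $ i > 0"
    using box_centre by metis
  let ?Q = "\<lambda>x. (\<Sum>i\<in>UNIV. ((x $ i - c $ i) / r $ i)\<^sup>2 - 1)"
  let ?K = "\<lambda>x. exp (- ?Q x)"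
  obtain \<alpha> \<beta> where ab: "\<alpha> > 0" "\<And>x. ?Q x \<ge> \<alpha> * (norm x)\<^sup>2 - \<beta>"
    using scaled_square_sum_ge[of r c] cr(2) by blast
  have c: "real_polynomial_function (\<lambda>x::real^'d. x $ i - c $ i)" for i
    by (intro real_polynomial_function_diff real_polynomial_function.intros(1,2) bounded_linear_vec_nth)
  have "real_polynomial_function ?Q"
    unfolding divide_inverse
    by (intro real_polynomial_function_sum real_polynomial_function_diff real_polynomial_function.intros(4) real_polynomial_function.intros(2)
        real_polynomial_function_power c) auto
  then have "(\<lambda>x. complex_of_real (1 * exp (- ?Q x))) \<in> schwartz"
    using ab by (intro poly_exp_schwartz[OF _ _ ab(1)]) (auto intro: real_polynomial_function.intros(2))
  from schwartz_wnorm_finite[OF this]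
  have fin: "(\<integral>\<^sup>+x. ennreal (w x * (?K x)\<^sup>2) \<partial>lborel) < \<infinity>"
    by (simp only: norm_of_real power2_abs mult_1)
  have bdd: "exp (- bump c r n x) \<le> ?K x" for n x
    using bump_ge[where c=c and r=r and x=x and n=n] by simp
  have ind: "indicator (box a b) x \<le> ?K x" for x
    using exp_bump_tendsto[OF cr(2), of c x] unfolding cr(1)
    by (rule tendsto_upperbound) (rule always_eventually, rule allI, rule bdd, simp)
  have "(\<lambda>x. complex_of_real (indicator (box a b) x)) \<in> wclosure"
  proof (rule wclosure_dominated[OF _ _ _ _ _ fin])
    show "(\<lambda>x. complex_of_real (exp (- bump c r n x))) \<in> wclosure" for n
      by (intro wclosure_schwartz exp_bump_schwartz cr(2))
    show "(\<lambda>n. complex_of_real (exp (- bump c r n x))) \<longlonglongrightarrow> complex_of_real (indicator (box a b) x)" for x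
      unfolding cr(1) by (intro tendsto_intros exp_bump_tendsto cr(2))
    show "cmod (complex_of_real (exp (- bump c r n x))) \<le> ?K x" for n x
      using bdd by simp
  qed measurable
  moreover have "(\<integral>\<^sup>+x. ennreal (w x * (indicator (box a b) x)\<^sup>2) \<partial>lborel) \<le> (\<integral>\<^sup>+x. ennreal (w x * (?K x)\<^sup>2) \<partial>lborel)"
    using ind by (intro nn_integral_mono ennreal_leI mult_left_mono power_mono weight_nonneg) auto
  ultimately show ?thesis
    using fin by (auto simp: of_real_indicator)
qed

text \<open>Intersecting with a fixed box keeps the induction inside functions of finite norm:
  complements are taken relative to the box, and its indicator majorises all partial sums of a
  disjoint union.\<close>

lemma bounded_set_wclosure:
  assumes "A \<in> sets borel"
  shows "(\<lambda>x. indicator (A \<inter> box a b) x) \<in> wclosure"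
  using assms
proof (induction A rule: borel_induct_box)
  case (box c d)
  then show ?case
    using box_wclosure by (simp add: box_Int_box)
next
  case (compl A)
  have "(\<lambda>x. indicator (box a b) x + (- 1) * indicator (A \<inter> box a b) x) \<in> wclosure"
    using compl box_wclosure by (intro wclosure_add wclosure_cmult) auto
  also have "(\<lambda>x. indicator (box a b) x + (- 1) * indicator (A \<inter> box a b) x) = (\<lambda>x. indicator (- A \<inter> box a b) x :: complex)"
    by (auto simp: indicator_def)
  finally show ?case .
next
  case (union A)
  show ?case
  proof (rule wclosure_dominated[where u="\<lambda>n x. \<Sum>i<n. indicator (A i \<inter> box a b) x" and K="indicator (box a b)"])
    have [measurable]: "A i \<in> sets borel" for i by (rule union)
    show "(\<lambda>x. indicator ((\<Union>i. A i) \<inter> box a b) x) \<in> borel_measurable borel"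
      by measurable
    show "(\<lambda>x. \<Sum>i<n. indicator (A i \<inter> box a b) x) \<in> wclosure" for n
      using union by (intro wclosure_sum)
    have disj: "disjoint_family (\<lambda>i. A i \<inter> box a b)"
      using union.hyps(1) by (auto simp: disjoint_family_on_def)
    show "(\<lambda>n. \<Sum>i<n. indicator (A i \<inter> box a b) x) \<longlonglongrightarrow> (indicator ((\<Union>i. A i) \<inter> box a b) x :: complex)" for x
      using tendsto_of_real[OF disjoint_indicator_sums[OF disj, of x, unfolded sums_def], where 'a=complex]
      by (simp add: of_real_indicator)
    show "cmod (\<Sum>i<n. indicator (A i \<inter> box a b) x) \<le> indicator (box a b) x" for n x
    proof -
      have "(\<Sum>i<n. indicator (A i \<inter> box a b) x) = (indicator (\<Union>i<n. A i \<inter> box a b) x :: complex)"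
        using disj by (subst indicator_UN_disjoint) (auto simp: disjoint_family_on_def)
      then show ?thesis by (simp add: indicator_def)
    qed
    show "(\<integral>\<^sup>+x. ennreal (w x * (indicator (box a b) x)\<^sup>2) \<partial>lborel) < \<infinity>"
      using box_wclosure by blast
  qed measurable
qed

text \<open>Simple functions converging to \<open>v\<close> are cut off to growing boxes, so that
  their level sets become bounded; \<open>2 * cmod (v x)\<close> majorises them all.\<close>

lemma wclosure_all:
  assumes v[measurable]: "v \<in> borel_measurable borel" and fin: "(\<integral>\<^sup>+x. ennreal (w x * (cmod (v x))\<^sup>2) \<partial>lborel) < \<infinity>"
  shows "v \<in> wclosure"
proof -
  obtain s where s: "\<And>i. simple_function borel (s i)" "\<And>x. (\<lambda>i. s i x) \<longlonglongrightarrow> v x" "\<And>i x. cmod (s i x) \<le> 2 * cmod (v x)"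
    using borel_measurable_implies_sequence_metric[OF v, of 0] by auto
  let ?B = "\<lambda>n. box (\<chi> i. - real n) (\<chi> i. real n) :: (real^'d) set"
  let ?u = "\<lambda>n x. s n x * indicator (?B n) x"
  show ?thesis
  proof (rule wclosure_dominated[where u="?u" and K="\<lambda>x. 2 * cmod (v x)"])
    show "?u n \<in> wclosure" for n
    proof -
      have fin: "finite (range (s n))"
        using simple_functionD(1)[OF s(1)[of n]] by simp
      have "(\<lambda>x. \<Sum>y\<in>range (s n). y * indicator (s n -` {y} \<inter> ?B n) x) \<in> wclosure"
        using simple_functionD(2)[OF s(1)[of n]] by (intro wclosure_sum wclosure_cmult bounded_set_wclosure) (auto simp: )
      also have "(\<lambda>x. \<Sum>y\<in>range (s n). y * indicator (s n -` {y} \<inter> ?B n) x) = ?u n"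
      proof
        fix x
        have "(\<Sum>y\<in>range (s n). y * indicator (s n -` {y} \<inter> ?B n) x) = (\<Sum>y\<in>range (s n). if s n x = y then y * indicator (?B n) x else 0)"
          by (intro sum.cong) (auto simp: indicator_def)
        then show "(\<Sum>y\<in>range (s n). y * indicator (s n -` {y} \<inter> ?B n) x) = ?u n x"
          using fin by simp
      qed
      finally show ?thesis .
    qed
    show "(\<lambda>n. ?u n x) \<longlonglongrightarrow> v x" for x
    proof -
      obtain N where N: "norm x < real N"
        using reals_Archimedean2 by blast
      have "x \<in> ?B n" if "n \<ge> N" for n
      proof -
        have "\<bar>x $ i\<bar> < real n" for i
          using component_le_norm_cart[of x i] N that by (smt (verit) of_nat_le_iff)
        then show ?thesis
          by (auto simp: mem_box_cart abs_less_iff minus_less_iff)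
      qed
      then have "\<forall>\<^sub>F n in sequentially. s n x = ?u n x"
        unfolding eventually_sequentially by (intro exI[of _ N]) auto
      then show ?thesis
        using s(2)[of x] by (rule Lim_transform_eventually[rotated])
    qed
    show "cmod (?u n x) \<le> 2 * cmod (v x)" for n x
      using s(3)[of n x] by (auto simp: indicator_def norm_mult)
    have "(\<integral>\<^sup>+x. ennreal (w x * (2 * cmod (v x))\<^sup>2) \<partial>lborel) = (\<integral>\<^sup>+x. 4 * ennreal (w x * (cmod (v x))\<^sup>2) \<partial>lborel)"
      using weight_nonneg by (intro nn_integral_cong) (simp add: power_mult_distrib ennreal_mult''[symmetric] ennreal_mult'[symmetric] mult_ac flip: ennreal_numeral)
    also have "\<dots> < \<infinity>"
      using fin by (simp add: nn_integral_cmult ennreal_mult_less_top)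
    finally show "(\<integral>\<^sup>+x. ennreal (w x * (2 * cmod (v x))\<^sup>2) \<partial>lborel) < \<infinity>" .
  qed measurable
qed

lemma schwartz_dense:
  assumes v[measurable]: "v \<in> borel_measurable borel" and int: "integrable lborel (\<lambda>x. w x * (cmod (v x))\<^sup>2)"
    and e: "e > 0"
  shows "\<exists>\<phi>\<in>schwartz. integrable lborel (\<lambda>x. w x * (cmod (v x - \<phi> x))\<^sup>2) \<and>
     (LINT x|lborel. w x * (cmod (v x - \<phi> x))\<^sup>2) \<le> e"
proof -
  have "v \<in> wclosure"
    using int weight_nonneg by (intro wclosure_all) (auto simp: integrable_iff_bounded)
  then obtain \<phi> where \<phi>[measurable]: "\<phi> \<in> schwartz" and le: "wnorm (\<lambda>x. v x - \<phi> x) \<le> ennreal e"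
    using e unfolding wclosure_def by blast
  have "wnorm (\<lambda>x. v x - \<phi> x) < \<infinity>"
    using le by (rule le_less_trans) simp
  then have int: "integrable lborel (\<lambda>x. w x * (cmod (v x - \<phi> x))\<^sup>2)"
    unfolding integrable_iff_bounded using weight_nonneg by (auto simp: wnorm_def)
  have "ennreal (LINT x|lborel. w x * (cmod (v x - \<phi> x))\<^sup>2) \<le> ennreal e"
    using le nn_integral_eq_integral[OF int] weight_nonneg by (simp add: wnorm_def)
  then have "(LINT x|lborel. w x * (cmod (v x - \<phi> x))\<^sup>2) \<le> e"
    using e by (simp add: ennreal_le_iff)
  with \<phi> int show ?thesis by blast
qed

end

section \<open>Square integrable functions: Cauchy-Schwarz, continuity, completeness,
  Plancherel\<close>

lemma integrable_mult_L2:
  fixes f g :: "'a \<Rightarrow> real"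
  assumes [measurable]: "f \<in> borel_measurable M" "g \<in> borel_measurable M"
    and "integrable M (\<lambda>x. (f x)\<^sup>2)" "integrable M (\<lambda>x. (g x)\<^sup>2)"
  shows "integrable M (\<lambda>x. f x * g x)"
proof (rule Bochner_Integration.integrable_bound)
  show "integrable M (\<lambda>x. (f x)\<^sup>2 + (g x)\<^sup>2)"
    using assms by auto
  have "\<bar>f x * g x\<bar> \<le> (f x)\<^sup>2 + (g x)\<^sup>2" for x
  proof -
    have "2 * (\<bar>f x\<bar> * \<bar>g x\<bar>) \<le> (f x)\<^sup>2 + (g x)\<^sup>2"
      using sum_squares_bound[of "\<bar>f x\<bar>" "\<bar>g x\<bar>"] by (simp add: mult.assoc)
    moreover have "0 \<le> \<bar>f x\<bar> * \<bar>g x\<bar>" by simp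
    ultimately show ?thesis
      unfolding abs_mult by linarith
  qed
  then show "AE x in M. norm (f x * g x) \<le> norm ((f x)\<^sup>2 + (g x)\<^sup>2)"
    by (intro AE_I2) (simp add: order_trans[OF _ abs_ge_self])
qed measurable

lemma Cauchy_Schwarz_integral:
  fixes f g :: "'a \<Rightarrow> real"
  assumes [measurable]: "f \<in> borel_measurable M" "g \<in> borel_measurable M"
    and f: "integrable M (\<lambda>x. (f x)\<^sup>2)" and g: "integrable M (\<lambda>x. (g x)\<^sup>2)"
  shows "(LINT x|M. \<bar>f x\<bar> * \<bar>g x\<bar>) \<le> sqrt (LINT x|M. (f x)\<^sup>2) * sqrt (LINT x|M. (g x)\<^sup>2)"
proof -
  have fg: "integrable M (\<lambda>x. \<bar>f x\<bar> * \<bar>g x\<bar>)"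
    using f g by (intro integrable_mult_L2) auto
  have "(\<integral>\<^sup>+x. ennreal \<bar>f x\<bar> * ennreal \<bar>g x\<bar> \<partial>M)\<^sup>2 \<le> (\<integral>\<^sup>+x. (ennreal \<bar>f x\<bar>)\<^sup>2 \<partial>M) * (\<integral>\<^sup>+x. (ennreal \<bar>g x\<bar>)\<^sup>2 \<partial>M)"
    by (rule Cauchy_Schwarz_nn_integral) measurable
  also have "(\<integral>\<^sup>+x. ennreal \<bar>f x\<bar> * ennreal \<bar>g x\<bar> \<partial>M) = ennreal (LINT x|M. \<bar>f x\<bar> * \<bar>g x\<bar>)"
    using nn_integral_eq_integral[OF fg] by (simp add: ennreal_mult)
  also have "(\<integral>\<^sup>+x. (ennreal \<bar>f x\<bar>)\<^sup>2 \<partial>M) = ennreal (LINT x|M. (f x)\<^sup>2)"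
    using nn_integral_eq_integral[OF f] by (simp add: ennreal_power)
  also have "(\<integral>\<^sup>+x. (ennreal \<bar>g x\<bar>)\<^sup>2 \<partial>M) = ennreal (LINT x|M. (g x)\<^sup>2)"
    using nn_integral_eq_integral[OF g] by (simp add: ennreal_power)
  finally have "(LINT x|M. \<bar>f x\<bar> * \<bar>g x\<bar>)\<^sup>2 \<le> (LINT x|M. (f x)\<^sup>2) * (LINT x|M. (g x)\<^sup>2)"
    by (simp add: ennreal_power ennreal_mult'[symmetric] ennreal_le_iff mult_nonneg_nonneg)
  then show ?thesis
    by (metis real_le_rsqrt real_sqrt_mult)
qed

lemma Cauchy_Schwarz_L2:
  fixes u v :: "'a \<Rightarrow> complex"
  assumes [measurable]: "u \<in> borel_measurable M" "v \<in> borel_measurable M"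
    and u: "integrable M (\<lambda>x. (cmod (u x))\<^sup>2)" and v: "integrable M (\<lambda>x. (cmod (v x))\<^sup>2)"
  shows "integrable M (\<lambda>x. u x * v x)"
    and "cmod (LINT x|M. u x * v x) \<le> sqrt (LINT x|M. (cmod (u x))\<^sup>2) * sqrt (LINT x|M. (cmod (v x))\<^sup>2)"
proof -
  have i: "integrable M (\<lambda>x. cmod (u x) * cmod (v x))"
    using u v by (intro integrable_mult_L2) auto
  show "integrable M (\<lambda>x. u x * v x)"
    by (rule Bochner_Integration.integrable_bound[OF i]) (auto simp: norm_mult)
  have "cmod (LINT x|M. u x * v x) \<le> (LINT x|M. cmod (u x) * cmod (v x))"
    using integral_norm_bound[of M "\<lambda>x. u x * v x"] by (simp add: norm_mult)
  also have "\<dots> \<le> sqrt (LINT x|M. (cmod (u x))\<^sup>2) * sqrt (LINT x|M. (cmod (v x))\<^sup>2)"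
    using Cauchy_Schwarz_integral[of "\<lambda>x. cmod (u x)" M "\<lambda>x. cmod (v x)"] u v by simp
  finally show "cmod (LINT x|M. u x * v x) \<le> sqrt (LINT x|M. (cmod (u x))\<^sup>2) * sqrt (LINT x|M. (cmod (v x))\<^sup>2)" .
qed

lemma norm_add_square_le: "(norm (a + b))\<^sup>2 \<le> 2 * (norm a)\<^sup>2 + 2 * (norm b)\<^sup>2"
proof -
  have "(norm (a + b))\<^sup>2 \<le> (norm a + norm b)\<^sup>2"
    by (intro power_mono norm_triangle_ineq) auto
  also have "\<dots> \<le> 2 * (norm a)\<^sup>2 + 2 * (norm b)\<^sup>2"
    using sum_squares_bound[of "norm a" "norm b"] by (simp add: power2_sum)
  finally show ?thesis .
qed

lemma norm_diff_square_le: "(norm (a - b))\<^sup>2 \<le> 2 * (norm a)\<^sup>2 + 2 * (norm b)\<^sup>2"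
  using norm_add_square_le[of a "- b"] by simp

lemma L2_diff:
  fixes u v :: "'a \<Rightarrow> complex"
  assumes [measurable]: "u \<in> borel_measurable M" "v \<in> borel_measurable M"
    and u: "integrable M (\<lambda>x. (cmod (u x))\<^sup>2)" and v: "integrable M (\<lambda>x. (cmod (v x))\<^sup>2)"
  shows "integrable M (\<lambda>x. (cmod (u x - v x))\<^sup>2)"
    and "(LINT x|M. (cmod (u x - v x))\<^sup>2) \<le> 2 * (LINT x|M. (cmod (u x))\<^sup>2) + 2 * (LINT x|M. (cmod (v x))\<^sup>2)"
proof -
  have i: "integrable M (\<lambda>x. 2 * (cmod (u x))\<^sup>2 + 2 * (cmod (v x))\<^sup>2)"
    using u v by auto
  show j: "integrable M (\<lambda>x. (cmod (u x - v x))\<^sup>2)"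
    by (rule Bochner_Integration.integrable_bound[OF i]) (use norm_diff_square_le in \<open>auto simp: abs_of_nonneg\<close>)
  have "(LINT x|M. (cmod (u x - v x))\<^sup>2) \<le> (LINT x|M. 2 * (cmod (u x))\<^sup>2 + 2 * (cmod (v x))\<^sup>2)"
    by (intro integral_mono j i norm_diff_square_le)
  then show "(LINT x|M. (cmod (u x - v x))\<^sup>2) \<le> 2 * (LINT x|M. (cmod (u x))\<^sup>2) + 2 * (LINT x|M. (cmod (v x))\<^sup>2)"
    using u v by simp
qed

text \<open>The difference of squares factors, and the second factor is at most
  \<open>|u - v| + 2 |v|\<close>; Cauchy-Schwarz handles the mixed term.\<close>

lemma L2_norm_diff_le:
  fixes u v :: "'a \<Rightarrow> complex"
  assumes [measurable]: "u \<in> borel_measurable M" "v \<in> borel_measurable M"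
    and u: "integrable M (\<lambda>x. (cmod (u x))\<^sup>2)" and v: "integrable M (\<lambda>x. (cmod (v x))\<^sup>2)"
  shows "\<bar>(LINT x|M. (cmod (u x))\<^sup>2) - (LINT x|M. (cmod (v x))\<^sup>2)\<bar> \<le> (LINT x|M. (cmod (u x - v x))\<^sup>2)
     + 2 * (sqrt (LINT x|M. (cmod (v x))\<^sup>2) * sqrt (LINT x|M. (cmod (u x - v x))\<^sup>2))"
proof -
  note d = L2_diff(1)[OF assms]
  have i: "integrable M (\<lambda>x. cmod (v x) * cmod (u x - v x))"
    using v d by (intro integrable_mult_L2) auto
  have "\<bar>(LINT x|M. (cmod (u x))\<^sup>2) - (LINT x|M. (cmod (v x))\<^sup>2)\<bar> = \<bar>LINT x|M. (cmod (u x))\<^sup>2 - (cmod (v x))\<^sup>2\<bar>"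
    using u v by simp
  also have "\<dots> \<le> (LINT x|M. (cmod (u x - v x))\<^sup>2 + 2 * (cmod (v x) * cmod (u x - v x)))"
  proof (rule order_trans[OF integral_abs_bound integral_mono])
    fix x
    have "\<bar>cmod (u x) - cmod (v x)\<bar> \<le> cmod (u x - v x)"
      by (rule norm_triangle_ineq3)
    moreover have "\<bar>cmod (u x) + cmod (v x)\<bar> \<le> cmod (u x - v x) + 2 * cmod (v x)"
      using norm_triangle_ineq2[of "u x" "v x"] by simp
    ultimately have le: "\<bar>cmod (u x) - cmod (v x)\<bar> * \<bar>cmod (u x) + cmod (v x)\<bar> \<le> cmod (u x - v x) * (cmod (u x - v x) + 2 * cmod (v x))"
      by (intro mult_mono) auto
    show "\<bar>(cmod (u x))\<^sup>2 - (cmod (v x))\<^sup>2\<bar> \<le> (cmod (u x - v x))\<^sup>2 + 2 * (cmod (v x) * cmod (u x - v x))"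
      using le unfolding abs_mult[symmetric] by (simp only: power2_eq_square algebra_simps)
  qed (use u v d i in auto)
  also have "\<dots> = (LINT x|M. (cmod (u x - v x))\<^sup>2) + 2 * (LINT x|M. cmod (v x) * cmod (u x - v x))"
    using d i by simp
  also have "(LINT x|M. cmod (v x) * cmod (u x - v x)) \<le> sqrt (LINT x|M. (cmod (v x))\<^sup>2) * sqrt (LINT x|M. (cmod (u x - v x))\<^sup>2)"
    using Cauchy_Schwarz_integral[of "\<lambda>x. cmod (v x)" M "\<lambda>x. cmod (u x - v x)"] v d by simp
  finally show ?thesis by simp
qed

lemma tendsto_L2_norm:
  fixes u :: "nat \<Rightarrow> 'a \<Rightarrow> complex"
  assumes [measurable]: "\<And>n. u n \<in> borel_measurable M" "v \<in> borel_measurable M"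
    and u: "\<And>n. integrable M (\<lambda>x. (cmod (u n x))\<^sup>2)" and v: "integrable M (\<lambda>x. (cmod (v x))\<^sup>2)"
    and lim: "(\<lambda>n. LINT x|M. (cmod (u n x - v x))\<^sup>2) \<longlonglongrightarrow> 0"
  shows "(\<lambda>n. LINT x|M. (cmod (u n x))\<^sup>2) \<longlonglongrightarrow> (LINT x|M. (cmod (v x))\<^sup>2)"
proof -
  have "(\<lambda>n. (LINT x|M. (cmod (u n x - v x))\<^sup>2)
     + 2 * (sqrt (LINT x|M. (cmod (v x))\<^sup>2) * sqrt (LINT x|M. (cmod (u n x - v x))\<^sup>2)))
    \<longlonglongrightarrow> 0 + 2 * (sqrt (LINT x|M. (cmod (v x))\<^sup>2) * sqrt 0)"
    by (intro tendsto_intros lim)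
  then have l: "(\<lambda>n. (LINT x|M. (cmod (u n x - v x))\<^sup>2)
     + 2 * (sqrt (LINT x|M. (cmod (v x))\<^sup>2) * sqrt (LINT x|M. (cmod (u n x - v x))\<^sup>2))) \<longlonglongrightarrow> 0"
    by simp
  have "(\<lambda>n. (LINT x|M. (cmod (u n x))\<^sup>2) - (LINT x|M. (cmod (v x))\<^sup>2)) \<longlonglongrightarrow> 0"
  proof (rule Lim_null_comparison[OF always_eventually[OF allI] l])
    show "norm ((LINT x|M. (cmod (u n x))\<^sup>2) - (LINT x|M. (cmod (v x))\<^sup>2))
      \<le> (LINT x|M. (cmod (u n x - v x))\<^sup>2) + 2 * (sqrt (LINT x|M. (cmod (v x))\<^sup>2) * sqrt (LINT x|M. (cmod (u n x - v x))\<^sup>2))" for n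
      unfolding real_norm_def by (intro L2_norm_diff_le u v) measurable
  qed
  then show ?thesis
    by (rule Lim_null[THEN iffD2])
qed

lemma tendsto_L2_inner:
  fixes u :: "nat \<Rightarrow> 'a \<Rightarrow> complex"
  assumes [measurable]: "\<And>n. u n \<in> borel_measurable M" "v \<in> borel_measurable M" "h \<in> borel_measurable M"
    and u: "\<And>n. integrable M (\<lambda>x. (cmod (u n x))\<^sup>2)" and v: "integrable M (\<lambda>x. (cmod (v x))\<^sup>2)"
    and h: "integrable M (\<lambda>x. (cmod (h x))\<^sup>2)"
    and lim: "(\<lambda>n. LINT x|M. (cmod (u n x - v x))\<^sup>2) \<longlonglongrightarrow> 0"
  shows "(\<lambda>n. LINT x|M. u n x * h x) \<longlonglongrightarrow> (LINT x|M. v x * h x)"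
proof -
  have "(\<lambda>n. sqrt (LINT x|M. (cmod (u n x - v x))\<^sup>2) * sqrt (LINT x|M. (cmod (h x))\<^sup>2)) \<longlonglongrightarrow> sqrt 0 * sqrt (LINT x|M. (cmod (h x))\<^sup>2)"
    by (intro tendsto_intros lim)
  then have l: "(\<lambda>n. sqrt (LINT x|M. (cmod (u n x - v x))\<^sup>2) * sqrt (LINT x|M. (cmod (h x))\<^sup>2)) \<longlonglongrightarrow> 0"
    by simp
  have "cmod ((LINT x|M. u n x * h x) - (LINT x|M. v x * h x)) \<le> sqrt (LINT x|M. (cmod (u n x - v x))\<^sup>2) * sqrt (LINT x|M. (cmod (h x))\<^sup>2)" for n
  proof -
    have "(LINT x|M. u n x * h x) - (LINT x|M. v x * h x) = (LINT x|M. (u n x - v x) * h x)"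
      using Cauchy_Schwarz_L2(1)[of "u n" M h] Cauchy_Schwarz_L2(1)[of v M h] u v h by (simp add: left_diff_distrib)
    then show ?thesis
      using Cauchy_Schwarz_L2(2)[of "\<lambda>x. u n x - v x" M h] L2_diff(1)[of "u n" M v] u v h by simp
  qed
  then have "(\<lambda>n. (LINT x|M. u n x * h x) - (LINT x|M. v x * h x)) \<longlonglongrightarrow> 0"
    by (intro Lim_null_comparison[OF always_eventually[OF allI] l])
  then show ?thesis
    by (rule Lim_null[THEN iffD2])
qed

text \<open>Riesz-Fischer for sequences that are Cauchy at a geometric rate. The squared increments
  decay like \<open>4^-n\<close>, so the series of \<open>2^n (D n)^2\<close> still has finite
  integral; this forces the increments themselves to be summable almost everywhere. The pointwise
  limit is then a limit in norm by Fatou.\<close>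

lemma L2_complete:
  fixes U :: "nat \<Rightarrow> 'a \<Rightarrow> complex"
  assumes [measurable]: "\<And>n. U n \<in> borel_measurable M"
    and int: "\<And>n. integrable M (\<lambda>x. (cmod (U n x))\<^sup>2)"
    and cauchy: "\<And>m n. n \<le> m \<Longrightarrow> (LINT x|M. (cmod (U m x - U n x))\<^sup>2) \<le> c * (1 / 4) ^ n"
  shows "\<exists>u\<in>borel_measurable M. integrable M (\<lambda>x. (cmod (u x))\<^sup>2) \<and>
    (\<lambda>n. LINT x|M. (cmod (U n x - u x))\<^sup>2) \<longlonglongrightarrow> 0"
proof -
  define D where "D = (\<lambda>n x. cmod (U (Suc n) x - U n x))"
  have [measurable]: "D n \<in> borel_measurable M" for n
    unfolding D_def by measurable
  have dint: "integrable M (\<lambda>x. (cmod (U m x - U n x))\<^sup>2)" for m n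
    by (intro L2_diff int) auto
  have c0: "c \<ge> 0"
    using order_trans[OF Bochner_Integration.integral_nonneg cauchy[of 0 0]] by simp
  have nnD: "(\<integral>\<^sup>+x. ennreal (2 ^ n * (D n x)\<^sup>2) \<partial>M) \<le> ennreal (c * (1 / 2) ^ n)" for n
  proof -
    have "(\<integral>\<^sup>+x. ennreal (2 ^ n * (D n x)\<^sup>2) \<partial>M) = ennreal (LINT x|M. 2 ^ n * (D n x)\<^sup>2)"
      unfolding D_def by (intro nn_integral_eq_integral integrable_mult_right dint) auto
    also have "(LINT x|M. 2 ^ n * (D n x)\<^sup>2) \<le> 2 ^ n * (c * (1 / 4) ^ n)"
      using cauchy[of n "Suc n"] by (simp add: D_def)
    also have "\<dots> = c * (1 / 2) ^ n"
      by (simp add: power_mult_distrib[symmetric] mult.left_commute)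
    finally show ?thesis by (simp add: ennreal_leI)
  qed
  have "(\<integral>\<^sup>+x. (\<Sum>n. ennreal (2 ^ n * (D n x)\<^sup>2)) \<partial>M) = (\<Sum>n. \<integral>\<^sup>+x. ennreal (2 ^ n * (D n x)\<^sup>2) \<partial>M)"
    by (intro nn_integral_suminf) measurable
  also have "\<dots> \<le> (\<Sum>n. ennreal (c * (1 / 2) ^ n))"
    by (intro suminf_le nnD summableI)
  also have "\<dots> = ennreal (\<Sum>n. c * (1 / 2) ^ n)"
    using c0 by (intro suminf_ennreal2 summable_mult summable_geometric) auto
  also have "\<dots> < \<infinity>" by simp
  finally have "(\<integral>\<^sup>+x. (\<Sum>n. ennreal (2 ^ n * (D n x)\<^sup>2)) \<partial>M) \<noteq> \<infinity>" by simp
  then have "AE x in M. (\<Sum>n. ennreal (2 ^ n * (D n x)\<^sup>2)) \<noteq> \<infinity>"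
    by (intro nn_integral_noteq_infinite) auto
  then have conv: "AE x in M. convergent (\<lambda>n. U n x)"
  proof eventually_elim
    case (elim x)
    then have "summable (\<lambda>n. 2 ^ n * (D n x)\<^sup>2)"
      by (intro summable_suminf_not_top) auto
    then have "summable (\<lambda>n. 2 ^ n * (D n x)\<^sup>2 + (1 / 2) ^ n)"
      by (intro summable_add summable_geometric) auto
    moreover have "norm (D n x) \<le> 2 ^ n * (D n x)\<^sup>2 + (1 / 2) ^ n" for n
    proof -
      \<comment> \<open>The mean inequality for \<open>D n x\<close> and \<open>2^-n\<close>,
        multiplied by \<open>2^n\<close>: it bounds an increment by a summable square and a
        geometric term.\<close>
      have "2 * D n x \<le> 2 ^ n * ((D n x)\<^sup>2 + ((1 / 2) ^ n)\<^sup>2)" if "True"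
      proof -
        have "2 * D n x = 2 ^ n * (2 * D n x * (1 / 2) ^ n)"
          by (simp add: power_divide)
        also have "\<dots> \<le> 2 ^ n * ((D n x)\<^sup>2 + ((1 / 2) ^ n)\<^sup>2)"
          by (intro mult_left_mono sum_squares_bound) auto
        finally show ?thesis .
      qed
      then have "2 * D n x \<le> 2 ^ n * (D n x)\<^sup>2 + (1 / 2) ^ n"
        by (simp add: distrib_left power_divide power2_eq_square)
      moreover have "D n x \<ge> 0" by (simp add: D_def)
      ultimately show ?thesis by simp
    qed
    ultimately have "summable (\<lambda>n. D n x)"
      by (rule summable_comparison_test'[where N=0])
    then have "summable (\<lambda>n. U (Suc n) x - U n x)"
      unfolding D_def by (rule summable_norm_cancel)
    then have "(\<lambda>n. \<Sum>i<n. U (Suc i) x - U i x) \<longlonglongrightarrow> (\<Sum>n. U (Suc n) x - U n x)"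
      by (rule summable_LIMSEQ)
    then have "(\<lambda>n. U n x - U 0 x) \<longlonglongrightarrow> (\<Sum>n. U (Suc n) x - U n x)"
      unfolding sum_lessThan_telescope[of "\<lambda>i. U i x"] .
    then have "(\<lambda>n. (U n x - U 0 x) + U 0 x) \<longlonglongrightarrow> (\<Sum>n. U (Suc n) x - U n x) + U 0 x"
      by (intro tendsto_intros)
    then show ?case
      by (auto simp: convergent_def)
  qed
  define u where "u = (\<lambda>x. lim (\<lambda>n. U n x))"
  have [measurable]: "u \<in> borel_measurable M"
    unfolding u_def by measurable
  have lim: "AE x in M. (\<lambda>n. U n x) \<longlonglongrightarrow> u x"
    using conv by eventually_elim (simp add: u_def convergent_LIMSEQ_iff)
  \<comment> \<open>Letting the larger index tend to infinity transfers the Cauchy rate to the limit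
    function.\<close>
  have fatou: "(\<integral>\<^sup>+x. ennreal ((cmod (U n x - u x))\<^sup>2) \<partial>M) \<le> ennreal (c * (1 / 4) ^ n)" for n
  proof -
    have "(\<integral>\<^sup>+x. ennreal ((cmod (U n x - u x))\<^sup>2) \<partial>M) = (\<integral>\<^sup>+x. liminf (\<lambda>m. ennreal ((cmod (U n x - U m x))\<^sup>2)) \<partial>M)"
    proof (rule nn_integral_cong_AE)
      show "AE x in M. ennreal ((cmod (U n x - u x))\<^sup>2) = liminf (\<lambda>m. ennreal ((cmod (U n x - U m x))\<^sup>2))"
        using lim
      proof eventually_elim
        case (elim x)
        then have "(\<lambda>m. ennreal ((cmod (U n x - U m x))\<^sup>2)) \<longlonglongrightarrow> ennreal ((cmod (U n x - u x))\<^sup>2)"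
          by (intro tendsto_intros)
        then show ?case
          using lim_imp_Liminf[OF sequentially_bot] by metis
      qed
    qed
    also have "\<dots> \<le> liminf (\<lambda>m. \<integral>\<^sup>+x. ennreal ((cmod (U n x - U m x))\<^sup>2) \<partial>M)"
      by (intro nn_integral_liminf) measurable
    also have "\<dots> \<le> ennreal (c * (1 / 4) ^ n)"
    proof (rule Liminf_le)
      show "\<forall>\<^sub>F m in sequentially. (\<integral>\<^sup>+x. ennreal ((cmod (U n x - U m x))\<^sup>2) \<partial>M) \<le> ennreal (c * (1 / 4) ^ n)"
        unfolding eventually_sequentially
      proof (intro exI[of _ n] allI impI)
        fix m assume "n \<le> m"
        have "(\<integral>\<^sup>+x. ennreal ((cmod (U n x - U m x))\<^sup>2) \<partial>M) = ennreal (LINT x|M. (cmod (U n x - U m x))\<^sup>2)"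
          by (intro nn_integral_eq_integral dint) auto
        also have "\<dots> \<le> ennreal (c * (1 / 4) ^ n)"
          using cauchy[OF \<open>n \<le> m\<close>] by (intro ennreal_leI) (simp add: norm_minus_commute)
        finally show "(\<integral>\<^sup>+x. ennreal ((cmod (U n x - U m x))\<^sup>2) \<partial>M) \<le> ennreal (c * (1 / 4) ^ n)" .
      qed
    qed simp
    finally show ?thesis .
  qed
  have dui: "integrable M (\<lambda>x. (cmod (U n x - u x))\<^sup>2)" for n
    unfolding integrable_iff_bounded using le_less_trans[OF fatou[of n]] by simp
  have bound: "norm (LINT x|M. (cmod (U n x - u x))\<^sup>2) \<le> c * (1 / 4) ^ n" for n
  proof -
    have "ennreal (LINT x|M. (cmod (U n x - u x))\<^sup>2) \<le> ennreal (c * (1 / 4) ^ n)"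
      using fatou[of n] nn_integral_eq_integral[OF dui[of n]] by simp
    then show ?thesis
      using c0 by (simp add: ennreal_le_iff)
  qed
  have "(\<lambda>n. c * (1 / 4 :: real) ^ n) \<longlonglongrightarrow> 0"
    by (intro tendsto_mult_right_zero LIMSEQ_power_zero) simp
  then have "(\<lambda>n. LINT x|M. (cmod (U n x - u x))\<^sup>2) \<longlonglongrightarrow> 0"
    by (rule Lim_null_comparison[OF always_eventually[OF allI[OF bound]]])
  moreover have "integrable M (\<lambda>x. (cmod (u x))\<^sup>2)"
    using L2_diff(1)[of "U 0" M "\<lambda>x. U 0 x - u x"] int[of 0] dui[of 0] by simp
  ultimately show ?thesis
    by (intro bexI[of _ u]) auto
qed

text \<open>Schwartz functions approach \<open>f\<close> at the rate \<open>4^-n\<close>; by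
  Parseval their transforms are Cauchy at the same rate up to the factor 4, so
  \<open>L2_complete\<close> produces \<open>u\<close>. Both the defining identity of the transform
  and the equality of norms are limits of their Schwartz versions.\<close>

theorem plancherel:
  fixes f :: "real^'d::finite \<Rightarrow> complex"
  assumes "square_integrable f"
  shows "\<exists>u. square_integrable u \<and> fourier_rep (distr_of f) u \<and>
    (LINT \<xi>|lborel. (cmod (u \<xi>))\<^sup>2) = (LINT x|lborel. (cmod (f x))\<^sup>2)"
proof -
  have f[measurable]: "f \<in> borel_measurable borel" and fi: "integrable lborel (\<lambda>x. (cmod (f x))\<^sup>2)"
    using assms by (auto simp: square_integrable_def)
  interpret poly_weight "\<lambda>x::real^'d. 1"
  proof
    show "1 \<le> (1 + norm x)\<^sup>2" for x :: "real^'d"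
      by (rule one_le_power) simp
  qed auto
  have "\<forall>n::nat. \<exists>\<phi>. \<phi> \<in> schwartz \<and> integrable lborel (\<lambda>x. (cmod (f x - \<phi> x))\<^sup>2) \<and>
     (LINT x|lborel. (cmod (f x - \<phi> x))\<^sup>2) \<le> (1 / 4) ^ n"
  proof
    fix n :: nat
    show "\<exists>\<phi>. \<phi> \<in> schwartz \<and> integrable lborel (\<lambda>x. (cmod (f x - \<phi> x))\<^sup>2) \<and>
     (LINT x|lborel. (cmod (f x - \<phi> x))\<^sup>2) \<le> (1 / 4) ^ n"
      using schwartz_dense[OF f, of "(1 / 4) ^ n"] fi by auto
  qed
  from choice[OF this] obtain \<phi> where \<phi>: "\<And>n. \<phi> n \<in> schwartz" "\<And>n. integrable lborel (\<lambda>x. (cmod (f x - \<phi> n x))\<^sup>2)"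
    "\<And>n. (LINT x|lborel. (cmod (f x - \<phi> n x))\<^sup>2) \<le> (1 / 4) ^ n"
    by blast
  have sq: "integrable lborel (\<lambda>x. (cmod (\<psi> x))\<^sup>2)" if "\<psi> \<in> schwartz" for \<psi> :: "real^'d \<Rightarrow> complex"
    using square_integrable_schwartz[OF that] by (simp add: square_integrable_def)
  define U where "U = (\<lambda>n. fourier_integral (\<phi> n))"
  have U: "U n \<in> schwartz" for n
    unfolding U_def by (intro fourier_integral_schwartz \<phi>)
  have [measurable]: "\<phi> n \<in> borel_measurable borel" "U n \<in> borel_measurable borel" for n
    using \<phi>(1) U by (auto intro: borel_measurable_schwartz)
  have "(LINT x|lborel. (cmod (U m x - U n x))\<^sup>2) \<le> 4 * (1 / 4) ^ n" if "n \<le> m" for m n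
  proof -
    have "(LINT x|lborel. (cmod (U m x - U n x))\<^sup>2) = (LINT x|lborel. (cmod (\<phi> m x - \<phi> n x))\<^sup>2)"
      using parseval_schwartz[OF schwartz_diff[OF \<phi>(1)[of m] \<phi>(1)[of n]]]
      by (simp add: U_def fourier_integral_diff integrable_schwartz \<phi>)
    also have "\<dots> = (LINT x|lborel. (cmod ((f x - \<phi> n x) - (f x - \<phi> m x)))\<^sup>2)"
      by simp
    also have "\<dots> \<le> 2 * (LINT x|lborel. (cmod (f x - \<phi> n x))\<^sup>2) + 2 * (LINT x|lborel. (cmod (f x - \<phi> m x))\<^sup>2)"
      by (intro L2_diff(2) \<phi>) measurable
    also have "\<dots> \<le> 2 * (1 / 4) ^ n + 2 * (1 / 4) ^ m"
      using \<phi>(3)[of n] \<phi>(3)[of m] by simp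
    also have "\<dots> \<le> 4 * (1 / 4) ^ n"
      using power_decreasing[OF that, of "1 / 4 :: real"] by simp
    finally show ?thesis .
  qed
  then obtain u where [measurable]: "u \<in> borel_measurable lborel" and u: "integrable lborel (\<lambda>x. (cmod (u x))\<^sup>2)"
    and lim: "(\<lambda>n. LINT x|lborel. (cmod (U n x - u x))\<^sup>2) \<longlonglongrightarrow> 0"
    using L2_complete[of U lborel 4] sq[OF U] by auto
  have lim\<phi>: "(\<lambda>n. LINT x|lborel. (cmod (\<phi> n x - f x))\<^sup>2) \<longlonglongrightarrow> 0"
  proof (rule Lim_null_comparison[OF always_eventually[OF allI]])
    show "norm (LINT x|lborel. (cmod (\<phi> n x - f x))\<^sup>2) \<le> (1 / 4) ^ n" for n
      using \<phi>(3)[of n] by (simp add: norm_minus_commute)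
    show "(\<lambda>n. (1 / 4 :: real) ^ n) \<longlonglongrightarrow> 0"
      by (rule LIMSEQ_power_zero) simp
  qed
  have usq: "square_integrable u"
    using u by (simp add: square_integrable_def)
  have "fourier_rep (distr_of f) u"
    unfolding fourier_rep_def
  proof (intro conjI ballI)
    fix \<psi> :: "real^'d \<Rightarrow> complex" assume \<psi>: "\<psi> \<in> schwartz"
    then have [measurable]: "\<psi> \<in> borel_measurable borel" "fourier_integral \<psi> \<in> borel_measurable borel"
      by (auto intro: borel_measurable_schwartz fourier_integral_schwartz)
    show "integrable lborel (\<lambda>\<xi>. u \<xi> * \<psi> \<xi>)"
      using sq[OF \<psi>] u by (intro Cauchy_Schwarz_L2(1)) auto
    have "(\<lambda>n. LINT x|lborel. \<phi> n x * fourier_integral \<psi> x) \<longlonglongrightarrow> (LINT x|lborel. f x * fourier_integral \<psi> x)"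
      by (intro tendsto_L2_inner sq \<phi> fourier_integral_schwartz \<psi> fi lim\<phi>) measurable
    moreover have "(\<lambda>n. LINT x|lborel. U n x * \<psi> x) \<longlonglongrightarrow> (LINT x|lborel. u x * \<psi> x)"
      by (intro tendsto_L2_inner sq U \<psi> u lim) measurable
    moreover have "(LINT x|lborel. U n x * \<psi> x) = (LINT x|lborel. \<phi> n x * fourier_integral \<psi> x)" for n
      unfolding U_def by (intro fourier_integral_swap integrable_schwartz \<phi> \<psi>)
    ultimately show "fourier_distr (distr_of f) \<psi> = distr_of u \<psi>"
      unfolding fourier_distr_def distr_of_def using LIMSEQ_unique by auto
  qed measurable
  moreover have "(LINT \<xi>|lborel. (cmod (u \<xi>))\<^sup>2) = (LINT x|lborel. (cmod (f x))\<^sup>2)"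
  proof -
    have "(\<lambda>n. LINT x|lborel. (cmod (\<phi> n x))\<^sup>2) \<longlonglongrightarrow> (LINT x|lborel. (cmod (f x))\<^sup>2)"
      by (intro tendsto_L2_norm sq \<phi> fi lim\<phi>) measurable
    moreover have "(\<lambda>n. LINT x|lborel. (cmod (U n x))\<^sup>2) \<longlonglongrightarrow> (LINT x|lborel. (cmod (u x))\<^sup>2)"
      by (intro tendsto_L2_norm sq U u lim) measurable
    moreover have "(LINT x|lborel. (cmod (U n x))\<^sup>2) = (LINT x|lborel. (cmod (\<phi> n x))\<^sup>2)" for n
      unfolding U_def by (intro parseval_schwartz \<phi>)
    ultimately show ?thesis
      using LIMSEQ_unique by auto
  qed
  ultimately show ?thesis
    using usq by blast
qed

section \<open>Sobolev norms and the Stein--Fisher information\<close>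

lemma one_plus_norm_sq_pos [simp]: "1 + (norm \<xi>)\<^sup>2 > 0" "1 + (norm \<xi>)\<^sup>2 \<noteq> 0"
proof -
  show "1 + (norm \<xi>)\<^sup>2 > 0"
    by (simp add: add_pos_nonneg)
  then show "1 + (norm \<xi>)\<^sup>2 \<noteq> 0" by linarith
qed

lemma borel_measurable_cnj' [measurable]: "cnj \<in> borel_measurable borel"
  by (intro borel_measurable_continuous_onI continuous_intros)

lemma sobolev_weight:
  "(cmod (complex_of_real ((1 + (norm \<xi>)\<^sup>2) powr (s / 2)) * z))\<^sup>2 = (1 + (norm \<xi>)\<^sup>2) powr s * (cmod z)\<^sup>2"
proof -
  have "((1 + (norm \<xi>)\<^sup>2) powr (s / 2))\<^sup>2 = (1 + (norm \<xi>)\<^sup>2) powr s"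
    by (simp add: power2_eq_square powr_add[symmetric])
  then show ?thesis
    by (simp add: norm_mult power_mult_distrib)
qed

lemma fourier_rep_measurable:
  assumes "fourier_rep T g"
  shows "g \<in> borel_measurable borel"
  using assms by (simp add: fourier_rep_def)

lemma fourier_rep_apply:
  assumes "fourier_rep T g" "\<phi> \<in> schwartz"
  shows "T (fourier_integral \<phi>) = (LINT \<xi>|lborel. g \<xi> * \<phi> \<xi>)" "integrable lborel (\<lambda>\<xi>. g \<xi> * \<phi> \<xi>)"
  using assms by (auto simp: fourier_rep_def fourier_distr_def distr_of_def)

lemma fourier_rep_L1:
  fixes f :: "real^'d::finite \<Rightarrow> complex"
  assumes f: "integrable lborel f"
  shows "fourier_rep (distr_of f) (fourier_integral f)"
proof -
  have [measurable]: "f \<in> borel_measurable borel"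
    using f by auto
  have [measurable]: "fourier_integral f \<in> borel_measurable borel"
    unfolding fourier_integral_def[abs_def] cis_conv_exp by measurable
  show ?thesis
    unfolding fourier_rep_def
  proof (intro conjI ballI)
    fix \<phi> :: "real^'d \<Rightarrow> complex" assume \<phi>: "\<phi> \<in> schwartz"
    have [measurable]: "\<phi> \<in> borel_measurable borel"
      by (rule borel_measurable_schwartz[OF \<phi>])
    show "integrable lborel (\<lambda>\<xi>. fourier_integral f \<xi> * \<phi> \<xi>)"
    proof (rule Bochner_Integration.integrable_bound)
      show "integrable lborel (\<lambda>\<xi>. (LINT x|lborel. cmod (f x)) * cmod (\<phi> \<xi>))"
        by (intro integrable_mult_right integrable_norm integrable_schwartz \<phi>)
      show "AE \<xi> in lborel. cmod (fourier_integral f \<xi> * \<phi> \<xi>) \<le> norm ((LINT x|lborel. cmod (f x)) * cmod (\<phi> \<xi>))"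
        by (intro AE_I2) (auto simp: norm_mult abs_mult intro!: mult_right_mono norm_fourier_integral_le)
    qed measurable
    show "fourier_distr (distr_of f) \<phi> = distr_of (fourier_integral f) \<phi>"
      unfolding fourier_distr_def distr_of_def
      by (intro fourier_integral_swap[symmetric] f integrable_schwartz \<phi>)
  qed measurable
qed

text \<open>Representatives of one distribution agree almost everywhere, so the properties of the
  one built in \<open>plancherel\<close> pass to any other.\<close>

lemma fourier_rep_L2:
  assumes f: "square_integrable f" and u: "fourier_rep (distr_of f) u"
  shows "square_integrable u" and "(LINT \<xi>|lborel. (cmod (u \<xi>))\<^sup>2) = (LINT x|lborel. (cmod (f x))\<^sup>2)"
proof -
  obtain w where w: "square_integrable w" "fourier_rep (distr_of f) w"
    "(LINT \<xi>|lborel. (cmod (w \<xi>))\<^sup>2) = (LINT x|lborel. (cmod (f x))\<^sup>2)"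
    using plancherel[OF f] by blast
  have [measurable]: "u \<in> borel_measurable borel" "w \<in> borel_measurable borel"
    using u w(2) by (auto intro: fourier_rep_measurable)
  have ae: "AE \<xi> in lborel. (cmod (w \<xi>))\<^sup>2 = (cmod (u \<xi>))\<^sup>2"
    using fourier_rep_unique[OF w(2) u] by eventually_elim simp
  have "integrable lborel (\<lambda>\<xi>. (cmod (u \<xi>))\<^sup>2)"
    using w(1) by (subst integrable_cong_AE[OF _ _ ae, symmetric]) (auto simp: square_integrable_def)
  then show "square_integrable u"
    by (simp add: square_integrable_def)
  show "(LINT \<xi>|lborel. (cmod (u \<xi>))\<^sup>2) = (LINT x|lborel. (cmod (f x))\<^sup>2)"
    using integral_cong_AE[OF _ _ ae] w(3) by simp
qed

lemma fourier_rep_diff: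
  fixes f g u v :: "real^'d::finite \<Rightarrow> complex"
  assumes f: "square_integrable f" and u: "fourier_rep (distr_of f) u"
    and g: "square_integrable g" and v: "fourier_rep (distr_of g) v"
  shows "square_integrable (\<lambda>x. f x - g x)" and "fourier_rep (distr_of (\<lambda>x. f x - g x)) (\<lambda>\<xi>. u \<xi> - v \<xi>)"
proof -
  have [measurable]: "f \<in> borel_measurable borel" "g \<in> borel_measurable borel" "u \<in> borel_measurable borel" "v \<in> borel_measurable borel"
    using f g u v by (auto simp: square_integrable_def intro: fourier_rep_measurable)
  have fi: "integrable lborel (\<lambda>x. (cmod (f x))\<^sup>2)" and gi: "integrable lborel (\<lambda>x. (cmod (g x))\<^sup>2)"
    using f g by (auto simp: square_integrable_def)
  show "square_integrable (\<lambda>x. f x - g x)"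
    unfolding square_integrable_def using L2_diff(1)[OF _ _ fi gi] by auto
  show "fourier_rep (distr_of (\<lambda>x. f x - g x)) (\<lambda>\<xi>. u \<xi> - v \<xi>)"
    unfolding fourier_rep_def
  proof (intro conjI ballI)
    fix \<phi> :: "real^'d \<Rightarrow> complex" assume \<phi>: "\<phi> \<in> schwartz"
    have sq: "integrable lborel (\<lambda>x. (cmod (fourier_integral \<phi> x))\<^sup>2)"
      using square_integrable_schwartz[OF fourier_integral_schwartz[OF \<phi>]] by (simp add: square_integrable_def)
    have [measurable]: "fourier_integral \<phi> \<in> borel_measurable borel"
      by (intro borel_measurable_schwartz fourier_integral_schwartz \<phi>)
    have i: "integrable lborel (\<lambda>x. f x * fourier_integral \<phi> x)" "integrable lborel (\<lambda>x. g x * fourier_integral \<phi> x)"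
      by (intro Cauchy_Schwarz_L2(1) fi gi sq; measurable)+
    note a1 = fourier_rep_apply[OF u \<phi>] and a2 = fourier_rep_apply[OF v \<phi>]
    show "integrable lborel (\<lambda>\<xi>. (u \<xi> - v \<xi>) * \<phi> \<xi>)"
      unfolding left_diff_distrib by (intro Bochner_Integration.integrable_diff a1 a2)
    show "fourier_distr (distr_of (\<lambda>x. f x - g x)) \<phi> = distr_of (\<lambda>\<xi>. u \<xi> - v \<xi>) \<phi>"
      using i a1 a2 by (simp add: fourier_distr_def distr_of_def left_diff_distrib)
  qed measurable
qed

lemma plancherel_diff:
  fixes f g u v :: "real^'d::finite \<Rightarrow> complex"
  assumes "square_integrable f" "fourier_rep (distr_of f) u" "square_integrable g" "fourier_rep (distr_of g) v"
  shows "(LINT \<xi>|lborel. (cmod (u \<xi> - v \<xi>))\<^sup>2) = (LINT x|lborel. (cmod (f x - g x))\<^sup>2)"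
  using fourier_rep_L2(2)[OF fourier_rep_diff[OF assms]] .

lemma sobolev_norm_eq:
  assumes "fourier_rep T g"
  shows "sobolev_norm s T = sqrt (LINT \<xi>|lborel. (1 + (norm \<xi>)\<^sup>2) powr s * (cmod (g \<xi>))\<^sup>2)"
proof -
  have [measurable]: "g \<in> borel_measurable borel" "fourier_fun T \<in> borel_measurable borel"
    using assms fourier_rep_fourier_fun[OF assms] by (auto intro: fourier_rep_measurable)
  have "(LINT \<xi>|lborel. (1 + (norm \<xi>)\<^sup>2) powr s * (cmod (fourier_fun T \<xi>))\<^sup>2)
      = (LINT \<xi>|lborel. (1 + (norm \<xi>)\<^sup>2) powr s * (cmod (g \<xi>))\<^sup>2)"
    by (intro integral_cong_AE) (use fourier_fun_AE[OF assms] in auto)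
  then show ?thesis
    by (simp add: sobolev_norm_def sobolev_weight)
qed

lemma sobolev_minus_1_rep:
  assumes "T \<in> sobolev (-1)"
  shows "\<exists>g. fourier_rep T g \<and> integrable lborel (\<lambda>\<xi>. (cmod (g \<xi>))\<^sup>2 / (1 + (norm \<xi>)\<^sup>2))"
proof -
  obtain g where g: "fourier_rep T g"
    "square_integrable (\<lambda>\<xi>. complex_of_real ((1 + (norm \<xi>)\<^sup>2) powr (-1 / 2)) * g \<xi>)"
    using assms by (auto simp: sobolev_def)
  then have "integrable lborel (\<lambda>\<xi>. (1 + (norm \<xi>)\<^sup>2) powr (-1) * (cmod (g \<xi>))\<^sup>2)"
    by (simp add: square_integrable_def sobolev_weight[where s="-1", simplified])
  then show ?thesis
    using g(1) by (intro exI[of _ g]) (simp add: powr_minus divide_inverse mult.commute)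
qed

text \<open>The duality of \<open>H^-1\<close> and \<open>H^1\<close> on the Fourier side: the
  weight is split as a square root, dividing one factor and multiplying the other.\<close>

lemma Cauchy_Schwarz_weighted:
  fixes u v :: "real^'d::finite \<Rightarrow> complex"
  assumes [measurable]: "u \<in> borel_measurable borel" "v \<in> borel_measurable borel"
    and u: "integrable lborel (\<lambda>\<xi>. (cmod (u \<xi>))\<^sup>2 / (1 + (norm \<xi>)\<^sup>2))"
    and v: "integrable lborel (\<lambda>\<xi>. (1 + (norm \<xi>)\<^sup>2) * (cmod (v \<xi>))\<^sup>2)"
  shows "integrable lborel (\<lambda>\<xi>. u \<xi> * v \<xi>)"
    and "cmod (LINT \<xi>|lborel. u \<xi> * v \<xi>) \<le> sqrt (LINT \<xi>|lborel. (cmod (u \<xi>))\<^sup>2 / (1 + (norm \<xi>)\<^sup>2))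
       * sqrt (LINT \<xi>|lborel. (1 + (norm \<xi>)\<^sup>2) * (cmod (v \<xi>))\<^sup>2)"
proof -
  let ?r = "\<lambda>\<xi>::real^'d. sqrt (1 + (norm \<xi>)\<^sup>2)"
  let ?u = "\<lambda>\<xi>. u \<xi> / complex_of_real (?r \<xi>)" and ?v = "\<lambda>\<xi>. complex_of_real (?r \<xi>) * v \<xi>"
  have r: "?r \<xi> \<noteq> 0" "(?r \<xi>)\<^sup>2 = 1 + (norm \<xi>)\<^sup>2" "?r \<xi> \<ge> 0" for \<xi> :: "real^'d"
    by (simp_all add: less_imp_le)
  have e: "?u \<xi> * ?v \<xi> = u \<xi> * v \<xi>" for \<xi>
    using r(1)[of \<xi>] by simp
  have u2: "(cmod (?u \<xi>))\<^sup>2 = (cmod (u \<xi>))\<^sup>2 / (1 + (norm \<xi>)\<^sup>2)" for \<xi>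
    by (simp only: norm_divide norm_of_real power_divide power2_abs r)
  have v2: "(cmod (?v \<xi>))\<^sup>2 = (1 + (norm \<xi>)\<^sup>2) * (cmod (v \<xi>))\<^sup>2" for \<xi>
    by (simp only: norm_mult norm_of_real power_mult_distrib power2_abs r)
  have m: "?u \<in> borel_measurable lborel" "?v \<in> borel_measurable lborel"
    by measurable
  from Cauchy_Schwarz_L2[OF m, unfolded e u2 v2, OF u v]
  show "integrable lborel (\<lambda>\<xi>. u \<xi> * v \<xi>)"
    and "cmod (LINT \<xi>|lborel. u \<xi> * v \<xi>) \<le> sqrt (LINT \<xi>|lborel. (cmod (u \<xi>))\<^sup>2 / (1 + (norm \<xi>)\<^sup>2))
       * sqrt (LINT \<xi>|lborel. (1 + (norm \<xi>)\<^sup>2) * (cmod (v \<xi>))\<^sup>2)" by auto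
qed

lemma integrable_weighted_schwartz:
  assumes "\<phi> \<in> schwartz"
  shows "integrable lborel (\<lambda>\<xi>::real^'d::finite. (1 + (norm \<xi>)\<^sup>2) * (cmod (\<phi> \<xi>))\<^sup>2)"
proof (rule Bochner_Integration.integrable_bound[OF integrable_schwartz_poly_sq[OF assms, of 2]])
  have [measurable]: "\<phi> \<in> borel_measurable borel"
    by (rule borel_measurable_schwartz[OF assms])
  show "(\<lambda>\<xi>. (1 + (norm \<xi>)\<^sup>2) * (cmod (\<phi> \<xi>))\<^sup>2) \<in> borel_measurable lborel"
    by measurable
  have "1 + (norm \<xi>)\<^sup>2 \<le> (1 + norm \<xi>)\<^sup>2" for \<xi> :: "real^'d"
    by (simp add: power2_sum)
  then show "AE \<xi> in lborel. norm ((1 + (norm \<xi>)\<^sup>2) * (cmod (\<phi> \<xi>))\<^sup>2) \<le> norm ((1 + norm \<xi>)\<^sup>2 * (cmod (\<phi> \<xi>))\<^sup>2)"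
    by (intro AE_I2) (auto simp: abs_mult intro!: mult_right_mono)
qed

lemma poly_weight_sobolev: "poly_weight (\<lambda>\<xi>::real^'d::finite. 1 + (norm \<xi>)\<^sup>2)"
  by unfold_locales (auto simp: power2_sum)

text \<open>The candidate value is the integral of \<open>g\<close> against the conjugate of
  \<open>h\<close>, the transform of the convolution. Since the pairing is a definite description
  over all approximating sequences, two things are needed: along every such sequence the values
  converge to the candidate, by the weighted Cauchy-Schwarz inequality, and at least one such
  sequence exists, since otherwise the description would hold of every number.\<close>

lemma sobolev_pairing_convolve:
  fixes k :: "real^'d::finite \<Rightarrow> real" and F :: "'d distr"
  assumes \<kappa>: "fourier_rep (distr_of_real k) \<kappa>" and \<kappa>_real: "\<And>\<xi>. \<kappa> \<xi> \<in> \<real>"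
    and \<kappa>_bd: "\<And>\<xi>. \<bar>Re (\<kappa> \<xi>)\<bar> \<le> D / (1 + (norm \<xi>)\<^sup>2)"
    and g: "fourier_rep F g" and gi: "integrable lborel (\<lambda>\<xi>. (cmod (g \<xi>))\<^sup>2 / (1 + (norm \<xi>)\<^sup>2))"
  shows "sobolev_pairing 1 F (convolve k F) = complex_of_real (LINT \<xi>|lborel. Re (\<kappa> \<xi>) * (cmod (g \<xi>))\<^sup>2)"
    and "integrable lborel (\<lambda>\<xi>. Re (\<kappa> \<xi>) * (cmod (g \<xi>))\<^sup>2)"
proof -
  interpret poly_weight "\<lambda>\<xi>::real^'d. 1 + (norm \<xi>)\<^sup>2"
    by (rule poly_weight_sobolev)
  have [measurable]: "\<kappa> \<in> borel_measurable borel" "g \<in> borel_measurable borel"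
    "fourier_fun (distr_of_real k) \<in> borel_measurable borel" "fourier_fun F \<in> borel_measurable borel"
    using \<kappa> g fourier_rep_fourier_fun[OF \<kappa>] fourier_rep_fourier_fun[OF g] by (auto intro: fourier_rep_measurable)
  define h where "h = (\<lambda>\<xi>. \<kappa> \<xi> * g \<xi>)"
  have h[measurable]: "h \<in> borel_measurable borel"
    unfolding h_def by measurable
  have \<kappa>_Re: "\<kappa> \<xi> = complex_of_real (Re (\<kappa> \<xi>))" for \<xi>
    using \<kappa>_real[of \<xi>] by (simp add: complex_is_Real_iff complex_eq_iff)
  have \<kappa>_norm: "cmod (\<kappa> \<xi>) \<le> D / (1 + (norm \<xi>)\<^sup>2)" for \<xi>
    using \<kappa>_bd[of \<xi>] by (subst \<kappa>_Re) simp
  \<comment> \<open>The square of the decay of \<open>\<kappa>\<close> turns the weight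
    \<open>1 / (1 + |xi|^2)\<close> carried by \<open>g\<close> into the weight
    \<open>1 + |xi|^2\<close> on \<open>h\<close>: convolution gains two derivatives.\<close>
  have h_bd: "(1 + (norm \<xi>)\<^sup>2) * (cmod (h \<xi>))\<^sup>2 \<le> D\<^sup>2 * ((cmod (g \<xi>))\<^sup>2 / (1 + (norm \<xi>)\<^sup>2))" for \<xi>
  proof -
    have "(1 + (norm \<xi>)\<^sup>2) * (cmod (h \<xi>))\<^sup>2 \<le> (1 + (norm \<xi>)\<^sup>2) * ((D / (1 + (norm \<xi>)\<^sup>2))\<^sup>2 * (cmod (g \<xi>))\<^sup>2)"
      unfolding h_def norm_mult power_mult_distrib
      by (intro mult_left_mono mult_right_mono power_mono \<kappa>_norm) (auto simp: less_imp_le)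
    also have "\<dots> = D\<^sup>2 * ((cmod (g \<xi>))\<^sup>2 / (1 + (norm \<xi>)\<^sup>2))"
      by (simp add: power_divide power2_eq_square[of "1 + _"])
    finally show ?thesis .
  qed
  have hi: "integrable lborel (\<lambda>\<xi>. (1 + (norm \<xi>)\<^sup>2) * (cmod (h \<xi>))\<^sup>2)"
  proof (rule Bochner_Integration.integrable_bound)
    show "integrable lborel (\<lambda>\<xi>. D\<^sup>2 * ((cmod (g \<xi>))\<^sup>2 / (1 + (norm \<xi>)\<^sup>2)))"
      by (intro integrable_mult_right gi)
    show "AE \<xi> in lborel. norm ((1 + (norm \<xi>)\<^sup>2) * (cmod (h \<xi>))\<^sup>2) \<le> norm (D\<^sup>2 * ((cmod (g \<xi>))\<^sup>2 / (1 + (norm \<xi>)\<^sup>2)))"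
      using h_bd by (intro AE_I2) (simp add: abs_mult)
  qed measurable
  have h2: "integrable lborel (\<lambda>\<xi>. (cmod (h \<xi>))\<^sup>2)"
    by (rule Bochner_Integration.integrable_bound[OF hi])
      (auto intro!: AE_I2 simp: abs_mult mult_le_cancel_right1[of "(cmod (h _))\<^sup>2"])
  have conv: "convolve k F \<psi> = (LINT \<xi>|lborel. h \<xi> * inv_fourier_integral \<psi> \<xi>)"
    if [measurable]: "inv_fourier_integral \<psi> \<in> borel_measurable borel" for \<psi>
    unfolding convolve_def h_def
    by (intro integral_cong_AE) (use fourier_fun_AE[OF \<kappa>] fourier_fun_AE[OF g] in auto)
  have rep: "fourier_rep (\<lambda>\<psi>. convolve k F \<psi> - distr_of \<phi> \<psi>) (\<lambda>\<xi>. h \<xi> - fourier_integral \<phi> \<xi>)"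
    if \<phi>: "\<phi> \<in> schwartz" for \<phi>
    unfolding fourier_rep_def
  proof (intro conjI ballI)
    have [measurable]: "fourier_integral \<phi> \<in> borel_measurable borel"
      by (intro borel_measurable_schwartz fourier_integral_schwartz \<phi>)
    show "(\<lambda>\<xi>. h \<xi> - fourier_integral \<phi> \<xi>) \<in> borel_measurable lborel"
      by measurable
    fix \<psi> :: "real^'d \<Rightarrow> complex" assume \<psi>: "\<psi> \<in> schwartz"
    have [measurable]: "\<psi> \<in> borel_measurable borel"
      by (rule borel_measurable_schwartz[OF \<psi>])
    have sq: "integrable lborel (\<lambda>x. (cmod (\<psi> x))\<^sup>2)" if "\<psi> \<in> schwartz" for \<psi> :: "real^'d \<Rightarrow> complex"
      using square_integrable_schwartz[OF that] by (simp add: square_integrable_def)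
    have i1: "integrable lborel (\<lambda>\<xi>. h \<xi> * \<psi> \<xi>)"
      by (intro Cauchy_Schwarz_L2(1) h2 sq \<psi>) measurable
    have i2: "integrable lborel (\<lambda>\<xi>. fourier_integral \<phi> \<xi> * \<psi> \<xi>)"
      by (intro Cauchy_Schwarz_L2(1) sq fourier_integral_schwartz \<phi> \<psi>) measurable
    show "integrable lborel (\<lambda>\<xi>. (h \<xi> - fourier_integral \<phi> \<xi>) * \<psi> \<xi>)"
      unfolding left_diff_distrib by (intro Bochner_Integration.integrable_diff i1 i2)
    have inv: "inv_fourier_integral (fourier_integral \<psi>) = \<psi>"
      using fourier_inversion[OF \<psi>] by blast
    have "convolve k F (fourier_integral \<psi>) = (LINT \<xi>|lborel. h \<xi> * \<psi> \<xi>)"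
      by (subst conv) (simp_all add: inv)
    moreover have "distr_of \<phi> (fourier_integral \<psi>) = (LINT \<xi>|lborel. fourier_integral \<phi> \<xi> * \<psi> \<xi>)"
      unfolding distr_of_def by (intro fourier_integral_swap[symmetric] integrable_schwartz \<phi> \<psi>)
    ultimately show "fourier_distr (\<lambda>\<psi>. convolve k F \<psi> - distr_of \<phi> \<psi>) \<psi> = distr_of (\<lambda>\<xi>. h \<xi> - fourier_integral \<phi> \<xi>) \<psi>"
      using i1 i2 by (simp add: fourier_distr_def distr_of_def left_diff_distrib)
  qed
  have norm_eq: "sobolev_norm 1 (\<lambda>\<psi>. convolve k F \<psi> - distr_of \<phi> \<psi>)
      = sqrt (LINT \<xi>|lborel. (1 + (norm \<xi>)\<^sup>2) * (cmod (h \<xi> - fourier_integral \<phi> \<xi>))\<^sup>2)"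
    if "\<phi> \<in> schwartz" for \<phi>
    unfolding sobolev_norm_eq[OF rep[OF that]] by (simp add: powr_one less_imp_le)
  \<comment> \<open>By inversion the conjugate of a Schwartz function is itself a transform, which
    lets \<open>F\<close> act on it through its representative.\<close>
  have F_eq: "F (\<lambda>x. cnj (\<phi> x)) = (LINT \<xi>|lborel. g \<xi> * cnj (fourier_integral \<phi> \<xi>))" if "\<phi> \<in> schwartz" for \<phi>
    unfolding fourier_cnj_fourier[OF that, symmetric]
    by (intro fourier_rep_apply[OF g] schwartz_cnj fourier_integral_schwartz that)
  have gh: "integrable lborel (\<lambda>\<xi>. g \<xi> * cnj (h \<xi>))"
    using hi by (intro Cauchy_Schwarz_weighted(1) gi) auto
  let ?z = "LINT \<xi>|lborel. g \<xi> * cnj (h \<xi>)"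
  have lim: "(\<lambda>n. F (\<lambda>x. cnj (\<phi> n x))) \<longlonglongrightarrow> ?z"
    if \<phi>: "\<forall>n::nat. \<phi> n \<in> schwartz"
      and l: "(\<lambda>n. sobolev_norm 1 (\<lambda>\<psi>. convolve k F \<psi> - distr_of (\<phi> n) \<psi>)) \<longlonglongrightarrow> 0" for \<phi>
  proof -
    have FS: "fourier_integral (\<phi> n) \<in> schwartz" for n
      using \<phi> by (intro fourier_integral_schwartz) blast
    have [measurable]: "fourier_integral (\<phi> n) \<in> borel_measurable borel" for n
      using FS by (rule borel_measurable_schwartz)
    have bd: "cmod (F (\<lambda>x. cnj (\<phi> n x)) - ?z) \<le> sqrt (LINT \<xi>|lborel. (cmod (g \<xi>))\<^sup>2 / (1 + (norm \<xi>)\<^sup>2)) *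
       sobolev_norm 1 (\<lambda>\<psi>. convolve k F \<psi> - distr_of (\<phi> n) \<psi>)" for n
    proof -
      have S: "\<phi> n \<in> schwartz" using \<phi> by blast
      have i: "integrable lborel (\<lambda>\<xi>. g \<xi> * cnj (fourier_integral (\<phi> n) \<xi>))"
        by (intro fourier_rep_apply(2)[OF g] schwartz_cnj FS)
      have di: "integrable lborel (\<lambda>\<xi>. (1 + (norm \<xi>)\<^sup>2) * (cmod (cnj (fourier_integral (\<phi> n) \<xi> - h \<xi>)))\<^sup>2)"
      proof (rule Bochner_Integration.integrable_bound)
        show "integrable lborel (\<lambda>\<xi>. 2 * ((1 + (norm \<xi>)\<^sup>2) * (cmod (fourier_integral (\<phi> n) \<xi>))\<^sup>2) + 2 * ((1 + (norm \<xi>)\<^sup>2) * (cmod (h \<xi>))\<^sup>2))"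
          by (intro Bochner_Integration.integrable_add integrable_mult_right hi integrable_weighted_schwartz FS)
        have "(1 + (norm \<xi>)\<^sup>2) * (cmod (cnj (fourier_integral (\<phi> n) \<xi> - h \<xi>)))\<^sup>2
            \<le> (1 + (norm \<xi>)\<^sup>2) * (2 * (cmod (fourier_integral (\<phi> n) \<xi>))\<^sup>2 + 2 * (cmod (h \<xi>))\<^sup>2)" for \<xi>
          unfolding complex_mod_cnj by (intro mult_left_mono norm_diff_square_le) (simp add: less_imp_le)
        then have le: "(1 + (norm \<xi>)\<^sup>2) * (cmod (cnj (fourier_integral (\<phi> n) \<xi> - h \<xi>)))\<^sup>2
            \<le> 2 * ((1 + (norm \<xi>)\<^sup>2) * (cmod (fourier_integral (\<phi> n) \<xi>))\<^sup>2) + 2 * ((1 + (norm \<xi>)\<^sup>2) * (cmod (h \<xi>))\<^sup>2)" for \<xi>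
          by (simp add: algebra_simps)
        show "AE \<xi> in lborel. norm ((1 + (norm \<xi>)\<^sup>2) * (cmod (cnj (fourier_integral (\<phi> n) \<xi> - h \<xi>)))\<^sup>2)
           \<le> norm (2 * ((1 + (norm \<xi>)\<^sup>2) * (cmod (fourier_integral (\<phi> n) \<xi>))\<^sup>2) + 2 * ((1 + (norm \<xi>)\<^sup>2) * (cmod (h \<xi>))\<^sup>2))"
        proof (rule AE_I2)
          fix \<xi>
          have "norm ((1 + (norm \<xi>)\<^sup>2) * (cmod (cnj (fourier_integral (\<phi> n) \<xi> - h \<xi>)))\<^sup>2) = (1 + (norm \<xi>)\<^sup>2) * (cmod (cnj (fourier_integral (\<phi> n) \<xi> - h \<xi>)))\<^sup>2"
            by (simp add: abs_mult)
          also note le[of \<xi>]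
          finally show "norm ((1 + (norm \<xi>)\<^sup>2) * (cmod (cnj (fourier_integral (\<phi> n) \<xi> - h \<xi>)))\<^sup>2)
            \<le> norm (2 * ((1 + (norm \<xi>)\<^sup>2) * (cmod (fourier_integral (\<phi> n) \<xi>))\<^sup>2) + 2 * ((1 + (norm \<xi>)\<^sup>2) * (cmod (h \<xi>))\<^sup>2))"
            unfolding real_norm_def by (rule order_trans[OF _ abs_ge_self])
        qed
      qed measurable
      have "F (\<lambda>x. cnj (\<phi> n x)) - ?z = (LINT \<xi>|lborel. g \<xi> * cnj (fourier_integral (\<phi> n) \<xi> - h \<xi>))"
        unfolding F_eq[OF S] using i gh by (simp add: right_diff_distrib)
      also have "cmod \<dots> \<le> sqrt (LINT \<xi>|lborel. (cmod (g \<xi>))\<^sup>2 / (1 + (norm \<xi>)\<^sup>2)) *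
         sqrt (LINT \<xi>|lborel. (1 + (norm \<xi>)\<^sup>2) * (cmod (cnj (fourier_integral (\<phi> n) \<xi> - h \<xi>)))\<^sup>2)"
        by (intro Cauchy_Schwarz_weighted(2) gi di) measurable
      also have "sqrt (LINT \<xi>|lborel. (1 + (norm \<xi>)\<^sup>2) * (cmod (cnj (fourier_integral (\<phi> n) \<xi> - h \<xi>)))\<^sup>2) =
         sobolev_norm 1 (\<lambda>\<psi>. convolve k F \<psi> - distr_of (\<phi> n) \<psi>)"
        unfolding norm_eq[OF S] complex_mod_cnj by (simp add: norm_minus_commute)
      finally show ?thesis .
    qed
    have "(\<lambda>n. F (\<lambda>x. cnj (\<phi> n x)) - ?z) \<longlonglongrightarrow> 0"
      by (rule Lim_null_comparison[OF always_eventually[OF allI[OF bd]]])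
        (rule tendsto_mult_right_zero[OF l])
    then show ?thesis
      by (rule Lim_null[THEN iffD2])
  qed
  \<comment> \<open>An approximating sequence: density in the weighted space yields approximants of
    \<open>h\<close> on the Fourier side, and surjectivity of the transform on Schwartz functions
    pulls them back.\<close>
  have "\<forall>n::nat. \<exists>\<phi>. \<phi> \<in> schwartz \<and> sobolev_norm 1 (\<lambda>\<psi>. convolve k F \<psi> - distr_of \<phi> \<psi>) \<le> sqrt ((1 / 2) ^ n)"
  proof
    fix n :: nat
    obtain \<theta> where \<theta>: "\<theta> \<in> schwartz" "(LINT \<xi>|lborel. (1 + (norm \<xi>)\<^sup>2) * (cmod (h \<xi> - \<theta> \<xi>))\<^sup>2) \<le> (1 / 2) ^ n"
      using schwartz_dense[OF h hi, of "(1 / 2) ^ n"] by auto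
    obtain \<phi> where \<phi>: "\<phi> \<in> schwartz" "fourier_integral \<phi> = \<theta>"
      using fourier_integral_surj_schwartz[OF \<theta>(1)] by blast
    show "\<exists>\<phi>. \<phi> \<in> schwartz \<and> sobolev_norm 1 (\<lambda>\<psi>. convolve k F \<psi> - distr_of \<phi> \<psi>) \<le> sqrt ((1 / 2) ^ n)"
      using \<phi> \<theta>(2) norm_eq[OF \<phi>(1)] by (intro exI[of _ \<phi>]) simp
  qed
  from choice[OF this] obtain \<phi> where \<phi>: "\<forall>n. \<phi> n \<in> schwartz"
    and \<phi>_le: "\<And>n. sobolev_norm 1 (\<lambda>\<psi>. convolve k F \<psi> - distr_of (\<phi> n) \<psi>) \<le> sqrt ((1 / 2) ^ n)"
    by blast
  have "(\<lambda>n. sqrt ((1 / 2) ^ n)) \<longlonglongrightarrow> sqrt 0"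
    by (intro tendsto_intros LIMSEQ_power_zero) simp
  then have sq0: "(\<lambda>n. sqrt ((1 / 2) ^ n)) \<longlonglongrightarrow> 0" by simp
  have "norm (sobolev_norm 1 (\<lambda>\<psi>. convolve k F \<psi> - distr_of (\<phi> n) \<psi>)) \<le> sqrt ((1 / 2) ^ n)" for n
    using \<phi>_le[of n] by (simp add: sobolev_norm_def)
  then have l\<phi>: "(\<lambda>n. sobolev_norm 1 (\<lambda>\<psi>. convolve k F \<psi> - distr_of (\<phi> n) \<psi>)) \<longlonglongrightarrow> 0"
    by (intro Lim_null_comparison[OF always_eventually[OF allI] sq0])
  have "sobolev_pairing 1 F (convolve k F) = ?z"
    unfolding sobolev_pairing_def
  proof (rule the_equality)
    show "\<forall>\<phi>. (\<forall>n. \<phi> n \<in> schwartz) \<and> (\<lambda>n. sobolev_norm 1 (\<lambda>\<psi>. convolve k F \<psi> - distr_of (\<phi> n) \<psi>)) \<longlonglongrightarrow> 0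
       \<longrightarrow> (\<lambda>n. F (\<lambda>x. cnj (\<phi> n x))) \<longlonglongrightarrow> ?z"
      using lim by blast
    fix z assume z: "\<forall>\<phi>. (\<forall>n. \<phi> n \<in> schwartz) \<and> (\<lambda>n. sobolev_norm 1 (\<lambda>\<psi>. convolve k F \<psi> - distr_of (\<phi> n) \<psi>)) \<longlonglongrightarrow> 0
       \<longrightarrow> (\<lambda>n. F (\<lambda>x. cnj (\<phi> n x))) \<longlonglongrightarrow> z"
    have "(\<lambda>n. F (\<lambda>x. cnj (\<phi> n x))) \<longlonglongrightarrow> z"
      using z \<phi> l\<phi> by blast
    then show "z = ?z"
      using lim[OF \<phi> l\<phi>] by (rule LIMSEQ_unique)
  qed
  also have gh_eq: "g \<xi> * cnj (h \<xi>) = complex_of_real (Re (\<kappa> \<xi>) * (cmod (g \<xi>))\<^sup>2)" for \<xi>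
  proof -
    have "g \<xi> * cnj (h \<xi>) = cnj (\<kappa> \<xi>) * (g \<xi> * cnj (g \<xi>))"
      by (simp add: h_def)
    also have "\<dots> = complex_of_real (Re (\<kappa> \<xi>)) * complex_of_real ((cmod (g \<xi>))\<^sup>2)"
      unfolding complex_norm_square by (subst \<kappa>_Re) simp
    finally show ?thesis by simp
  qed
  then have "?z = complex_of_real (LINT \<xi>|lborel. Re (\<kappa> \<xi>) * (cmod (g \<xi>))\<^sup>2)"
    by (simp only: integral_complex_of_real)
  finally show "sobolev_pairing 1 F (convolve k F) = complex_of_real (LINT \<xi>|lborel. Re (\<kappa> \<xi>) * (cmod (g \<xi>))\<^sup>2)" .
  show "integrable lborel (\<lambda>\<xi>. Re (\<kappa> \<xi>) * (cmod (g \<xi>))\<^sup>2)"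
    using gh unfolding gh_eq by (rule complex_of_real_integrable_eq[THEN iffD1])
qed

section \<open>The Stein field on the Fourier side\<close>

lemma stein_field_rep:
  assumes u: "fourier_rep (distr_of_real (weighted V V0 \<rho>)) u"
    and \<gamma>: "fourier_rep (weighted_grad V V0 \<rho> i) \<gamma>"
  shows "fourier_rep (stein_field V V0 \<rho> i) (\<lambda>\<xi>. 2 * pi * \<i> * (\<xi> $ i) * u \<xi> + 1 / 2 * \<gamma> \<xi>)"
  unfolding fourier_rep_def
proof (intro conjI ballI)
  have [measurable]: "u \<in> borel_measurable borel" "\<gamma> \<in> borel_measurable borel"
    using u \<gamma> by (auto intro: fourier_rep_measurable)
  show "(\<lambda>\<xi>. 2 * pi * \<i> * (\<xi> $ i) * u \<xi> + 1 / 2 * \<gamma> \<xi>) \<in> borel_measurable lborel"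
    by measurable
  fix \<phi> :: "real^'a \<Rightarrow> complex" assume \<phi>: "\<phi> \<in> schwartz"
  let ?\<phi> = "\<lambda>x. - 2 * pi * \<i> * (x $ i) * \<phi> x"
  have \<phi>': "?\<phi> \<in> schwartz"
    using schwartz_cmult[OF schwartz_coord_mult[OF \<phi>, of i], of "- 2 * pi * \<i>"] by (simp add: mult_ac)
  have e: "(2 * pi * \<i> * (\<xi> $ i) * u \<xi> + 1 / 2 * \<gamma> \<xi>) * \<phi> \<xi> = - (u \<xi> * ?\<phi> \<xi>) + 1 / 2 * (\<gamma> \<xi> * \<phi> \<xi>)" for \<xi>
    by (simp add: algebra_simps)
  note i1 = fourier_rep_apply(2)[OF u \<phi>'] and i2 = fourier_rep_apply(2)[OF \<gamma> \<phi>]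
  show "integrable lborel (\<lambda>\<xi>. (2 * pi * \<i> * (\<xi> $ i) * u \<xi> + 1 / 2 * \<gamma> \<xi>) * \<phi> \<xi>)"
    unfolding e by (intro Bochner_Integration.integrable_add Bochner_Integration.integrable_minus integrable_mult_right i1 i2)
  have "stein_field V V0 \<rho> i (fourier_integral \<phi>) = - (LINT \<xi>|lborel. u \<xi> * ?\<phi> \<xi>) + 1 / 2 * (LINT \<xi>|lborel. \<gamma> \<xi> * \<phi> \<xi>)"
    unfolding stein_field_def distr_partial_def fourier_integral_coord_mult[OF \<phi>]
      fourier_rep_apply(1)[OF u \<phi>'] fourier_rep_apply(1)[OF \<gamma> \<phi>] ..
  also have "\<dots> = (LINT \<xi>|lborel. - (u \<xi> * ?\<phi> \<xi>) + 1 / 2 * (\<gamma> \<xi> * \<phi> \<xi>))"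
    by (subst Bochner_Integration.integral_add)
      (intro Bochner_Integration.integrable_minus integrable_mult_right i1 i2, intro Bochner_Integration.integrable_minus integrable_mult_right i1 i2, simp)
  finally show "fourier_distr (stein_field V V0 \<rho> i) \<phi> = distr_of (\<lambda>\<xi>. 2 * pi * \<i> * (\<xi> $ i) * u \<xi> + 1 / 2 * \<gamma> \<xi>) \<phi>"
    unfolding fourier_distr_def distr_of_def e .
qed

text \<open>The dissipation is the integral of \<open>\<kappa>\<close> times the squared transform
  of the field, summed over components. The lower bound on \<open>\<kappa>\<close> compares this
  with the weighted norm; the upper bound is what makes the pairing computable by
  \<open>sobolev_pairing_convolve\<close>.\<close>

lemma stein_fisher_lower_bound:
  fixes G :: "'d::finite \<Rightarrow> real^'d \<Rightarrow> complex"
  assumes k: "stein_kernel D k" and D: "D \<ge> 1"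
    and G: "\<And>i. fourier_rep (stein_field V V0 \<rho> i) (G i)"
    and Gi: "\<And>i. integrable lborel (\<lambda>\<xi>. (cmod (G i \<xi>))\<^sup>2 / (1 + (norm \<xi>)\<^sup>2))"
  shows "(\<Sum>i\<in>UNIV. LINT \<xi>|lborel. (cmod (G i \<xi>))\<^sup>2 / (1 + (norm \<xi>)\<^sup>2)) \<le> D * stein_fisher k V V0 \<rho>"
proof -
  obtain \<kappa> where \<kappa>: "fourier_rep (distr_of_real k) \<kappa>" "\<And>\<xi>. \<kappa> \<xi> \<in> \<real>"
    and lo: "\<And>\<xi>. 1 / D * (1 / (1 + (norm \<xi>)\<^sup>2)) \<le> Re (\<kappa> \<xi>)"
    and hi: "\<And>\<xi>. Re (\<kappa> \<xi>) \<le> D * (1 / (1 + (norm \<xi>)\<^sup>2))"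
    using k unfolding stein_kernel_def by blast
  have "0 \<le> 1 / D * (1 / (1 + (norm \<xi>)\<^sup>2))" for \<xi> :: "real^'d"
    using D by simp
  then have bd: "\<bar>Re (\<kappa> \<xi>)\<bar> \<le> D / (1 + (norm \<xi>)\<^sup>2)" for \<xi>
    using hi[of \<xi>] order_trans[OF _ lo[of \<xi>]] by simp
  note pair = sobolev_pairing_convolve[OF \<kappa> bd G Gi]
  have "(LINT \<xi>|lborel. (cmod (G i \<xi>))\<^sup>2 / (1 + (norm \<xi>)\<^sup>2)) \<le> D * (LINT \<xi>|lborel. Re (\<kappa> \<xi>) * (cmod (G i \<xi>))\<^sup>2)" for i
  proof -
    have "(LINT \<xi>|lborel. (cmod (G i \<xi>))\<^sup>2 / (1 + (norm \<xi>)\<^sup>2)) \<le> (LINT \<xi>|lborel. D * (Re (\<kappa> \<xi>) * (cmod (G i \<xi>))\<^sup>2))"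
    proof (intro integral_mono Gi integrable_mult_right pair(2))
      fix \<xi> :: "real^'d"
      have "D * (1 / D * (1 / (1 + (norm \<xi>)\<^sup>2))) \<le> D * Re (\<kappa> \<xi>)"
        using D by (intro mult_left_mono lo) auto
      then have "1 / (1 + (norm \<xi>)\<^sup>2) \<le> D * Re (\<kappa> \<xi>)"
        using D by simp
      then have "1 / (1 + (norm \<xi>)\<^sup>2) * (cmod (G i \<xi>))\<^sup>2 \<le> D * Re (\<kappa> \<xi>) * (cmod (G i \<xi>))\<^sup>2"
        by (rule mult_right_mono) simp
      then show "(cmod (G i \<xi>))\<^sup>2 / (1 + (norm \<xi>)\<^sup>2) \<le> D * (Re (\<kappa> \<xi>) * (cmod (G i \<xi>))\<^sup>2)"
        by (simp add: mult.assoc)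
    qed
    then show ?thesis by simp
  qed
  then have "(\<Sum>i\<in>UNIV. LINT \<xi>|lborel. (cmod (G i \<xi>))\<^sup>2 / (1 + (norm \<xi>)\<^sup>2)) \<le> (\<Sum>i\<in>UNIV. D * (LINT \<xi>|lborel. Re (\<kappa> \<xi>) * (cmod (G i \<xi>))\<^sup>2))"
    by (intro sum_mono)
  also have "\<dots> = D * stein_fisher k V V0 \<rho>"
    by (simp add: stein_fisher_def pair(1) sum_distrib_left)
  finally show ?thesis .
qed

text \<open>The gradient of the potential is affine in \<open>x\<close>, so multiplication by it can
  be moved onto the test function: \<open>\<theta> j\<close> is built so that its transform is
  \<open>x $ j - \<mu> $ j\<close> times that of \<open>\<phi>\<close>. Summing against row
  \<open>i\<close> of the inverse matrix recovers the gradient.\<close>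

lemma weighted_grad_rep_integral:
  fixes S :: "real^'d::finite^'d" and \<phi> :: "real^'d \<Rightarrow> complex"
  assumes S: "sym_pos_def S"
    and u: "fourier_rep (distr_of_real (weighted V (quad_potential \<mu> S) \<rho>)) u"
    and \<gamma>: "fourier_rep (weighted_grad V (quad_potential \<mu> S) \<rho> i) \<gamma>"
    and \<phi>: "\<phi> \<in> schwartz"
  defines "\<theta> \<equiv> \<lambda>j \<xi>. 1 / (2 * pi * \<i>) * partial j \<phi> \<xi> - \<mu> $ j * \<phi> \<xi>"
  shows "(LINT \<xi>|lborel. \<gamma> \<xi> * \<phi> \<xi>) = (LINT \<xi>|lborel. u \<xi> * (\<Sum>j\<in>UNIV. complex_of_real (matrix_inv S $ i $ j) * \<theta> j \<xi>))"
    and "(\<lambda>\<xi>. \<Sum>j\<in>UNIV. complex_of_real (matrix_inv S $ i $ j) * \<theta> j \<xi>) \<in> schwartz"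
proof -
  let ?M = "matrix_inv S" and ?V0 = "quad_potential \<mu> S"
  have \<theta>: "\<theta> j \<in> schwartz" for j
    unfolding \<theta>_def by (intro schwartz_diff schwartz_cmult schwartz_partial \<phi>)
  show \<Theta>: "(\<lambda>\<xi>. \<Sum>j\<in>UNIV. complex_of_real (?M $ i $ j) * \<theta> j \<xi>) \<in> schwartz"
    by (intro schwartz_sum schwartz_cmult \<theta>)
  have F\<theta>: "fourier_integral (\<theta> j) x = complex_of_real (x $ j - \<mu> $ j) * fourier_integral \<phi> x" for j x
  proof -
    have i: "integrable lborel (\<lambda>\<xi>. 1 / (2 * pi * \<i>) * partial j \<phi> \<xi>)" "integrable lborel (\<lambda>\<xi>. \<mu> $ j * \<phi> \<xi>)"
      by (intro integrable_schwartz schwartz_cmult schwartz_partial \<phi>)+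
    show ?thesis
      unfolding \<theta>_def fourier_integral_diff[OF i] fourier_integral_cmult fourier_integral_partial[OF \<phi>]
      by (simp add: algebra_simps)
  qed
  have F\<Theta>: "fourier_integral (\<lambda>\<xi>. \<Sum>j\<in>UNIV. complex_of_real (?M $ i $ j) * \<theta> j \<xi>) x
      = complex_of_real (partial i ?V0 x) * fourier_integral \<phi> x" for x
  proof -
    have "fourier_integral (\<lambda>\<xi>. \<Sum>j\<in>UNIV. complex_of_real (?M $ i $ j) * \<theta> j \<xi>) x
        = (\<Sum>j\<in>UNIV. fourier_integral (\<lambda>\<xi>. complex_of_real (?M $ i $ j) * \<theta> j \<xi>) x)"
      unfolding fourier_integral_def sum_distrib_left
      by (intro Bochner_Integration.integral_sum integrable_cis_mult integrable_schwartz schwartz_cmult \<theta>)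
    also have "\<dots> = (\<Sum>j\<in>UNIV. complex_of_real (?M $ i $ j) * (complex_of_real (x $ j - \<mu> $ j) * fourier_integral \<phi> x))"
      by (simp only: fourier_integral_cmult F\<theta>)
    also have "\<dots> = complex_of_real (partial i ?V0 x) * fourier_integral \<phi> x"
      by (simp add: partial_quad_potential[OF S] matrix_vector_mult_def sum_distrib_right mult.assoc)
    finally show ?thesis .
  qed
  have "(LINT \<xi>|lborel. \<gamma> \<xi> * \<phi> \<xi>) = weighted_grad V ?V0 \<rho> i (fourier_integral \<phi>)"
    by (rule fourier_rep_apply(1)[OF \<gamma> \<phi>, symmetric])
  also have "\<dots> = distr_of_real (weighted V ?V0 \<rho>) (fourier_integral (\<lambda>\<xi>. \<Sum>j\<in>UNIV. complex_of_real (?M $ i $ j) * \<theta> j \<xi>))"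
    by (simp add: weighted_grad_def distr_of_real_def distr_of_def F\<Theta> mult.assoc)
  also have "\<dots> = (LINT \<xi>|lborel. u \<xi> * (\<Sum>j\<in>UNIV. complex_of_real (?M $ i $ j) * \<theta> j \<xi>))"
    by (rule fourier_rep_apply(1)[OF u \<Theta>])
  finally show "(LINT \<xi>|lborel. \<gamma> \<xi> * \<phi> \<xi>) = (LINT \<xi>|lborel. u \<xi> * (\<Sum>j\<in>UNIV. complex_of_real (?M $ i $ j) * \<theta> j \<xi>))" .
qed

text \<open>\<open>weak_gauss_eq \<mu> S u b\<close> is the weak form of \<open>\<partial>\<^sub>l u + 8 \<pi>\<^sup>2 (S \<xi>)\<^sub>l u + 2 \<pi> \<i> \<mu>\<^sub>l u = b\<^sub>l\<close>,
  the system whose homogeneous solutions are the multiples of \<^const>\<open>gauss_hat\<close>.\<close>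

definition weak_gauss_eq :: "real^'d::finite \<Rightarrow> real^'d^'d \<Rightarrow> (real^'d \<Rightarrow> complex) \<Rightarrow> ('d \<Rightarrow> real^'d \<Rightarrow> complex) \<Rightarrow> bool" where
  "weak_gauss_eq \<mu> S u b \<longleftrightarrow> (\<forall>\<phi>\<in>schwartz. \<forall>l.
     (LINT \<xi>|lborel. b l \<xi> * \<phi> \<xi>) =
     (LINT \<xi>|lborel. u \<xi> * (complex_of_real (8 * pi\<^sup>2 * (S *v \<xi>) $ l) * \<phi> \<xi> - partial l \<phi> \<xi> + 2 * pi * \<i> * (\<mu> $ l) * \<phi> \<xi>)))"

text \<open>Once tested with \<open>\<phi>\<close>, each \<open>G i\<close> becomes an integral of
  \<open>u\<close> involving row \<open>i\<close> of the inverse matrix; contracting with row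
  \<open>l\<close> of \<open>S\<close> removes that matrix. The factor \<open>- 4 pi i\<close>
  normalises the derivative: it turns \<open>2 pi i\<close> into \<open>8 pi^2\<close> and
  \<open>1 / (4 pi i)\<close> into \<open>- 1\<close>, and leaves \<open>2 pi i\<close> in front of
  the mean.\<close>

lemma stein_weak_gauss_eq:
  fixes S :: "real^'d::finite^'d"
  assumes S: "sym_pos_def S"
    and u: "fourier_rep (distr_of_real (weighted V (quad_potential \<mu> S) \<rho>)) u"
    and \<gamma>: "\<And>i. fourier_rep (weighted_grad V (quad_potential \<mu> S) \<rho> i) (\<gamma> i)"
  defines "G \<equiv> \<lambda>i \<xi>. 2 * pi * \<i> * (\<xi> $ i) * u \<xi> + 1 / 2 * \<gamma> i \<xi>"
  shows "weak_gauss_eq \<mu> S u (\<lambda>l \<xi>. - 4 * pi * \<i> * (\<Sum>i\<in>UNIV. complex_of_real (S $ l $ i) * G i \<xi>))"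
  unfolding weak_gauss_eq_def
proof (intro ballI allI)
  fix \<phi> :: "real^'d \<Rightarrow> complex" and l assume \<phi>: "\<phi> \<in> schwartz"
  let ?M = "matrix_inv S"
  define \<theta> where "\<theta> = (\<lambda>j \<xi>. 1 / (2 * pi * \<i>) * partial j \<phi> \<xi> - \<mu> $ j * \<phi> \<xi>)"
  define \<Theta> where "\<Theta> = (\<lambda>i \<xi>. \<Sum>j\<in>UNIV. complex_of_real (?M $ i $ j) * \<theta> j \<xi>)"
  have \<Theta>: "\<Theta> i \<in> schwartz" "(LINT \<xi>|lborel. \<gamma> i \<xi> * \<phi> \<xi>) = (LINT \<xi>|lborel. u \<xi> * \<Theta> i \<xi>)" for i
    using weighted_grad_rep_integral[OF S u \<gamma> \<phi>, of i] unfolding \<Theta>_def \<theta>_def by auto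
  define \<psi> where "\<psi> = (\<lambda>i \<xi>. 2 * pi * \<i> * (complex_of_real (\<xi> $ i) * \<phi> \<xi>) + 1 / 2 * \<Theta> i \<xi>)"
  have \<psi>: "\<psi> i \<in> schwartz" for i
    unfolding \<psi>_def by (intro schwartz_add schwartz_cmult schwartz_coord_mult \<Theta> \<phi>)
  have x\<phi>: "(\<lambda>\<xi>. 2 * pi * \<i> * (complex_of_real (\<xi> $ i) * \<phi> \<xi>)) \<in> schwartz" for i
    by (intro schwartz_cmult schwartz_coord_mult \<phi>)
  have G\<phi>: "(LINT \<xi>|lborel. G i \<xi> * \<phi> \<xi>) = (LINT \<xi>|lborel. u \<xi> * \<psi> i \<xi>)" "integrable lborel (\<lambda>\<xi>. G i \<xi> * \<phi> \<xi>)" for i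
  proof -
    have e: "G i \<xi> * \<phi> \<xi> = u \<xi> * (2 * pi * \<i> * (complex_of_real (\<xi> $ i) * \<phi> \<xi>)) + 1 / 2 * (\<gamma> i \<xi> * \<phi> \<xi>)" for \<xi>
      by (simp add: G_def algebra_simps)
    have e': "u \<xi> * \<psi> i \<xi> = u \<xi> * (2 * pi * \<i> * (complex_of_real (\<xi> $ i) * \<phi> \<xi>)) + 1 / 2 * (u \<xi> * \<Theta> i \<xi>)" for \<xi>
      by (simp add: \<psi>_def algebra_simps)
    note i1 = fourier_rep_apply(2)[OF u x\<phi>[of i]] and i2 = fourier_rep_apply(2)[OF \<gamma>[of i] \<phi>]
      and i3 = fourier_rep_apply(2)[OF u \<Theta>(1)[of i]]
    show "integrable lborel (\<lambda>\<xi>. G i \<xi> * \<phi> \<xi>)"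
      unfolding e by (intro Bochner_Integration.integrable_add integrable_mult_right i1 i2)
    show "(LINT \<xi>|lborel. G i \<xi> * \<phi> \<xi>) = (LINT \<xi>|lborel. u \<xi> * \<psi> i \<xi>)"
      unfolding e e' using i1 i2 i3 \<Theta>(2)[of i]
      by (subst (1 2) Bochner_Integration.integral_add) (auto simp del: mult_eq_0_iff)
  qed
  have "(LINT \<xi>|lborel. - 4 * pi * \<i> * (\<Sum>i\<in>UNIV. complex_of_real (S $ l $ i) * G i \<xi>) * \<phi> \<xi>)
     = (LINT \<xi>|lborel. (\<Sum>i\<in>UNIV. (- 4 * pi * \<i> * complex_of_real (S $ l $ i)) * (G i \<xi> * \<phi> \<xi>)))"
    by (simp only: sum_distrib_left sum_distrib_right mult.assoc)
  also have "\<dots> = (\<Sum>i\<in>UNIV. (- 4 * pi * \<i> * complex_of_real (S $ l $ i)) * (LINT \<xi>|lborel. G i \<xi> * \<phi> \<xi>))"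
    using G\<phi>(2) by (subst Bochner_Integration.integral_sum) auto
  also have "\<dots> = (\<Sum>i\<in>UNIV. (- 4 * pi * \<i> * complex_of_real (S $ l $ i)) * (LINT \<xi>|lborel. u \<xi> * \<psi> i \<xi>))"
    by (simp only: G\<phi>(1))
  also have "\<dots> = (LINT \<xi>|lborel. (\<Sum>i\<in>UNIV. (- 4 * pi * \<i> * complex_of_real (S $ l $ i)) * (u \<xi> * \<psi> i \<xi>)))"
    using fourier_rep_apply(2)[OF u \<psi>] by (subst Bochner_Integration.integral_sum) auto
  also have "\<dots> = (LINT \<xi>|lborel. u \<xi> * (complex_of_real (8 * pi\<^sup>2 * (S *v \<xi>) $ l) * \<phi> \<xi> - partial l \<phi> \<xi> + 2 * pi * \<i> * (\<mu> $ l) * \<phi> \<xi>))"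
  proof (intro Bochner_Integration.integral_cong refl)
    fix \<xi>
    have "(\<Sum>i\<in>UNIV. complex_of_real (S $ l $ i) * \<Theta> i \<xi>) = (\<Sum>i\<in>UNIV. \<Sum>j\<in>UNIV. complex_of_real (S $ l $ i * ?M $ i $ j) * \<theta> j \<xi>)"
      by (simp add: \<Theta>_def sum_distrib_left mult.assoc)
    also have "\<dots> = (\<Sum>j\<in>UNIV. complex_of_real ((S ** ?M) $ l $ j) * \<theta> j \<xi>)"
      by (subst sum.swap) (simp add: matrix_matrix_mult_def sum_distrib_right)
    also have "\<dots> = \<theta> l \<xi>"
      using sym_pos_def_matrix_inv[OF S] by (simp add: mat_def if_distrib[of complex_of_real] if_distrib[of "\<lambda>x. x * _"] cong: if_cong)
    finally have S\<Theta>: "(\<Sum>i\<in>UNIV. complex_of_real (S $ l $ i) * \<Theta> i \<xi>) = \<theta> l \<xi>" .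
    have S\<xi>: "(\<Sum>i\<in>UNIV. complex_of_real (S $ l $ i) * complex_of_real (\<xi> $ i)) = complex_of_real ((S *v \<xi>) $ l)"
      by (simp add: matrix_vector_mult_def)
    have "(\<Sum>i\<in>UNIV. (- 4 * pi * \<i> * complex_of_real (S $ l $ i)) * (u \<xi> * \<psi> i \<xi>))
       = (\<Sum>i\<in>UNIV. u \<xi> * (8 * pi\<^sup>2 * \<phi> \<xi> * (complex_of_real (S $ l $ i) * complex_of_real (\<xi> $ i))
            - 2 * pi * \<i> * (complex_of_real (S $ l $ i) * \<Theta> i \<xi>)))"
      by (intro sum.cong refl) (simp add: \<psi>_def algebra_simps power2_eq_square)
    also have "\<dots> = u \<xi> * (8 * pi\<^sup>2 * \<phi> \<xi> * complex_of_real ((S *v \<xi>) $ l) - 2 * pi * \<i> * \<theta> l \<xi>)"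
      by (simp only: sum_distrib_left[symmetric] sum_subtractf S\<Theta> S\<xi>)
    also have "\<dots> = u \<xi> * (complex_of_real (8 * pi\<^sup>2 * (S *v \<xi>) $ l) * \<phi> \<xi> - partial l \<phi> \<xi> + 2 * pi * \<i> * (\<mu> $ l) * \<phi> \<xi>)"
      by (simp add: \<theta>_def algebra_simps)
    finally show "(\<Sum>i\<in>UNIV. (- 4 * pi * \<i> * complex_of_real (S $ l $ i)) * (u \<xi> * \<psi> i \<xi>)) =
      u \<xi> * (complex_of_real (8 * pi\<^sup>2 * (S *v \<xi>) $ l) * \<phi> \<xi> - partial l \<phi> \<xi> + 2 * pi * \<i> * (\<mu> $ l) * \<phi> \<xi>)" .
  qed
  finally show "(LINT \<xi>|lborel. - 4 * pi * \<i> * (\<Sum>i\<in>UNIV. complex_of_real (S $ l $ i) * G i \<xi>) * \<phi> \<xi>) =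
     (LINT \<xi>|lborel. u \<xi> * (complex_of_real (8 * pi\<^sup>2 * (S *v \<xi>) $ l) * \<phi> \<xi> - partial l \<phi> \<xi> + 2 * pi * \<i> * (\<mu> $ l) * \<phi> \<xi>))" .
qed

text \<open>The interface between condition (H) and the Fourier analysis: from here on only
  \<open>u\<close>, \<open>G\<close> and the inequalities relating them are used. The same
  \<open>u\<close> and \<open>G\<close> serve for all kernels, which is why the bound by the
  dissipation quantifies over \<open>D\<close> and \<open>k\<close> inside.\<close>

lemma stein_data:
  fixes S :: "real^'d::finite^'d"
  assumes S: "sym_pos_def S" and H: "condition_H V (quad_potential \<mu> S) \<rho>"
  obtains u G where
    "square_integrable u"
    "fourier_rep (distr_of_real (weighted V (quad_potential \<mu> S) \<rho>)) u"
    "(LINT \<xi>|lborel. (cmod (u \<xi>))\<^sup>2) = (LINT x|lborel. (weighted V (quad_potential \<mu> S) \<rho> x)\<^sup>2)"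
    "\<And>i. G i \<in> borel_measurable borel"
    "\<And>i. integrable lborel (\<lambda>\<xi>. (cmod (G i \<xi>))\<^sup>2 / (1 + (norm \<xi>)\<^sup>2))"
    "\<And>D k. stein_kernel D k \<Longrightarrow> D \<ge> 1 \<Longrightarrow>
       (\<Sum>i\<in>UNIV. LINT \<xi>|lborel. (cmod (G i \<xi>))\<^sup>2 / (1 + (norm \<xi>)\<^sup>2)) \<le> D * stein_fisher k V (quad_potential \<mu> S) \<rho>"
    "weak_gauss_eq \<mu> S u (\<lambda>l \<xi>. - 4 * pi * \<i> * (\<Sum>i\<in>UNIV. complex_of_real (S $ l $ i) * G i \<xi>))"
    "\<And>i. (sobolev_norm (-1) (weighted_grad V (quad_potential \<mu> S) \<rho> i))\<^sup>2 \<le>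
       8 * (LINT \<xi>|lborel. (cmod (G i \<xi>))\<^sup>2 / (1 + (norm \<xi>)\<^sup>2)) + 32 * pi\<^sup>2 * (LINT \<xi>|lborel. (cmod (u \<xi>))\<^sup>2)"
proof -
  let ?V0 = "quad_potential \<mu> S"
  let ?f = "\<lambda>x. complex_of_real (weighted V ?V0 \<rho> x)"
  have sq: "square_integrable (weighted V ?V0 \<rho>)" and sob: "\<And>i. weighted_grad V ?V0 \<rho> i \<in> sobolev (-1)"
    using H by (auto simp: condition_H_def)
  have [measurable]: "weighted V ?V0 \<rho> \<in> borel_measurable borel"
    using sq by (simp add: square_integrable_def)
  have "?f \<in> borel_measurable borel"
    by measurable
  then have "square_integrable ?f"
    using sq by (simp add: square_integrable_def)
  then obtain u where u: "square_integrable u" "fourier_rep (distr_of ?f) u"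
    and unorm: "(LINT \<xi>|lborel. (cmod (u \<xi>))\<^sup>2) = (LINT x|lborel. (cmod (?f x))\<^sup>2)"
    using plancherel by blast
  have urep: "fourier_rep (distr_of_real (weighted V ?V0 \<rho>)) u"
    using u(2) by (simp add: distr_of_real_def)
  have "\<forall>i. \<exists>g. fourier_rep (weighted_grad V ?V0 \<rho> i) g \<and> integrable lborel (\<lambda>\<xi>. (cmod (g \<xi>))\<^sup>2 / (1 + (norm \<xi>)\<^sup>2))"
    using sobolev_minus_1_rep[OF sob] by blast
  from choice[OF this] obtain \<gamma> where \<gamma>: "\<And>i. fourier_rep (weighted_grad V ?V0 \<rho> i) (\<gamma> i)"
    "\<And>i. integrable lborel (\<lambda>\<xi>. (cmod (\<gamma> i \<xi>))\<^sup>2 / (1 + (norm \<xi>)\<^sup>2))"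
    by blast
  define G where "G = (\<lambda>i \<xi>. 2 * pi * \<i> * (\<xi> $ i) * u \<xi> + 1 / 2 * \<gamma> i \<xi>)"
  have Grep: "fourier_rep (stein_field V ?V0 \<rho> i) (G i)" for i
    unfolding G_def by (rule stein_field_rep[OF urep \<gamma>(1)])
  have [measurable]: "u \<in> borel_measurable borel" "\<gamma> i \<in> borel_measurable borel" for i
    using urep \<gamma>(1) by (auto intro: fourier_rep_measurable)
  have Gm[measurable]: "G i \<in> borel_measurable borel" for i
    using Grep by (rule fourier_rep_measurable)
  have ui: "integrable lborel (\<lambda>\<xi>. (cmod (u \<xi>))\<^sup>2)"
    using u(1) by (simp add: square_integrable_def)
  \<comment> \<open>Multiplication by a coordinate costs one power of the weight, so the derivative
    part of the field is controlled by the \<open>L^2\<close> norm of \<open>u\<close>.\<close>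
  have coord: "(cmod (2 * pi * \<i> * (\<xi> $ i) * u \<xi>))\<^sup>2 / (1 + (norm \<xi>)\<^sup>2) \<le> 4 * pi\<^sup>2 * (cmod (u \<xi>))\<^sup>2" for \<xi> :: "real^'d" and i
  proof -
    have "(\<xi> $ i)\<^sup>2 \<le> (norm \<xi>)\<^sup>2"
      using component_le_norm_cart[of \<xi> i] by (metis abs_ge_zero power2_abs power_mono)
    then have "(\<xi> $ i)\<^sup>2 / (1 + (norm \<xi>)\<^sup>2) \<le> 1"
      by (simp add: divide_le_eq_1)
    then have "(\<xi> $ i)\<^sup>2 / (1 + (norm \<xi>)\<^sup>2) * (4 * pi\<^sup>2 * (cmod (u \<xi>))\<^sup>2) \<le> 1 * (4 * pi\<^sup>2 * (cmod (u \<xi>))\<^sup>2)"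
      by (intro mult_right_mono) auto
    then show ?thesis
      by (simp add: norm_mult power_mult_distrib mult_ac)
  qed
  have Gi: "integrable lborel (\<lambda>\<xi>. (cmod (G i \<xi>))\<^sup>2 / (1 + (norm \<xi>)\<^sup>2))" for i
  proof (rule Bochner_Integration.integrable_bound)
    show "integrable lborel (\<lambda>\<xi>. 8 * pi\<^sup>2 * (cmod (u \<xi>))\<^sup>2 + (cmod (\<gamma> i \<xi>))\<^sup>2 / (1 + (norm \<xi>)\<^sup>2))"
      by (intro Bochner_Integration.integrable_add integrable_mult_right ui \<gamma>)
    show "AE \<xi> in lborel. norm ((cmod (G i \<xi>))\<^sup>2 / (1 + (norm \<xi>)\<^sup>2)) \<le> norm (8 * pi\<^sup>2 * (cmod (u \<xi>))\<^sup>2 + (cmod (\<gamma> i \<xi>))\<^sup>2 / (1 + (norm \<xi>)\<^sup>2))"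
    proof (rule AE_I2)
      fix \<xi> :: "real^'d"
      have "(cmod (G i \<xi>))\<^sup>2 \<le> 2 * (cmod (2 * pi * \<i> * (\<xi> $ i) * u \<xi>))\<^sup>2 + 2 * (cmod (1 / 2 * \<gamma> i \<xi>))\<^sup>2"
        unfolding G_def by (rule norm_add_square_le)
      also have "(cmod (1 / 2 * \<gamma> i \<xi>))\<^sup>2 = 1 / 4 * (cmod (\<gamma> i \<xi>))\<^sup>2"
        by (simp add: norm_mult power_mult_distrib norm_divide power_divide)
      finally have "(cmod (G i \<xi>))\<^sup>2 / (1 + (norm \<xi>)\<^sup>2) \<le> (2 * (cmod (2 * pi * \<i> * (\<xi> $ i) * u \<xi>))\<^sup>2 + 2 * (1 / 4 * (cmod (\<gamma> i \<xi>))\<^sup>2)) / (1 + (norm \<xi>)\<^sup>2)"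
        by (intro divide_right_mono) (auto simp: less_imp_le)
      also have "\<dots> = 2 * ((cmod (2 * pi * \<i> * (\<xi> $ i) * u \<xi>))\<^sup>2 / (1 + (norm \<xi>)\<^sup>2)) + 1 / 2 * ((cmod (\<gamma> i \<xi>))\<^sup>2 / (1 + (norm \<xi>)\<^sup>2))"
        by (simp add: add_divide_distrib)
      also have "\<dots> \<le> 2 * (4 * pi\<^sup>2 * (cmod (u \<xi>))\<^sup>2) + 1 * ((cmod (\<gamma> i \<xi>))\<^sup>2 / (1 + (norm \<xi>)\<^sup>2))"
        by (intro add_mono mult_left_mono mult_right_mono coord) (auto simp: less_imp_le)
      finally have le: "(cmod (G i \<xi>))\<^sup>2 / (1 + (norm \<xi>)\<^sup>2) \<le> 8 * pi\<^sup>2 * (cmod (u \<xi>))\<^sup>2 + (cmod (\<gamma> i \<xi>))\<^sup>2 / (1 + (norm \<xi>)\<^sup>2)"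
        by simp
      have "norm ((cmod (G i \<xi>))\<^sup>2 / (1 + (norm \<xi>)\<^sup>2)) = (cmod (G i \<xi>))\<^sup>2 / (1 + (norm \<xi>)\<^sup>2)"
        by (simp add: less_imp_le)
      then show "norm ((cmod (G i \<xi>))\<^sup>2 / (1 + (norm \<xi>)\<^sup>2)) \<le> norm (8 * pi\<^sup>2 * (cmod (u \<xi>))\<^sup>2 + (cmod (\<gamma> i \<xi>))\<^sup>2 / (1 + (norm \<xi>)\<^sup>2))"
        using order_trans[OF le abs_ge_self] by simp
    qed
  qed measurable
  have sn: "(sobolev_norm (-1) (weighted_grad V ?V0 \<rho> i))\<^sup>2 \<le>
       8 * (LINT \<xi>|lborel. (cmod (G i \<xi>))\<^sup>2 / (1 + (norm \<xi>)\<^sup>2)) + 32 * pi\<^sup>2 * (LINT \<xi>|lborel. (cmod (u \<xi>))\<^sup>2)" for i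
  proof -
    have "(sobolev_norm (-1) (weighted_grad V ?V0 \<rho> i))\<^sup>2 = (LINT \<xi>|lborel. (cmod (\<gamma> i \<xi>))\<^sup>2 / (1 + (norm \<xi>)\<^sup>2))"
      unfolding sobolev_norm_eq[OF \<gamma>(1)]
      by (simp add: powr_minus divide_inverse mult.commute powr_one less_imp_le)
    also have "\<dots> \<le> (LINT \<xi>|lborel. 8 * ((cmod (G i \<xi>))\<^sup>2 / (1 + (norm \<xi>)\<^sup>2)) + 32 * pi\<^sup>2 * (cmod (u \<xi>))\<^sup>2)"
    proof (intro integral_mono \<gamma>)
      show "integrable lborel (\<lambda>\<xi>. 8 * ((cmod (G i \<xi>))\<^sup>2 / (1 + (norm \<xi>)\<^sup>2)) + 32 * pi\<^sup>2 * (cmod (u \<xi>))\<^sup>2)"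
        by (intro Bochner_Integration.integrable_add integrable_mult_right ui Gi)
      fix \<xi> :: "real^'d"
      \<comment> \<open>Solving for the transform of the weighted gradient. Squaring gives the
        factor 8 for each term, and \<open>coord\<close> turns the second one into
        \<open>8 * 4 pi^2\<close>.\<close>
      have "\<gamma> i \<xi> = 2 * G i \<xi> - 2 * (2 * pi * \<i> * (\<xi> $ i) * u \<xi>)"
        by (simp add: G_def)
      then have "(cmod (\<gamma> i \<xi>))\<^sup>2 \<le> 2 * (cmod (2 * G i \<xi>))\<^sup>2 + 2 * (cmod (2 * (2 * pi * \<i> * (\<xi> $ i) * u \<xi>)))\<^sup>2"
        by (simp only: norm_diff_square_le)
      also have "\<dots> = 8 * (cmod (G i \<xi>))\<^sup>2 + 8 * (cmod (2 * pi * \<i> * (\<xi> $ i) * u \<xi>))\<^sup>2"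
        by (simp add: norm_mult power_mult_distrib)
      finally have "(cmod (\<gamma> i \<xi>))\<^sup>2 / (1 + (norm \<xi>)\<^sup>2) \<le> (8 * (cmod (G i \<xi>))\<^sup>2 + 8 * (cmod (2 * pi * \<i> * (\<xi> $ i) * u \<xi>))\<^sup>2) / (1 + (norm \<xi>)\<^sup>2)"
        by (intro divide_right_mono) (auto simp: less_imp_le)
      also have "\<dots> = 8 * ((cmod (G i \<xi>))\<^sup>2 / (1 + (norm \<xi>)\<^sup>2)) + 8 * ((cmod (2 * pi * \<i> * (\<xi> $ i) * u \<xi>))\<^sup>2 / (1 + (norm \<xi>)\<^sup>2))"
        by (simp add: add_divide_distrib)
      also have "\<dots> \<le> 8 * ((cmod (G i \<xi>))\<^sup>2 / (1 + (norm \<xi>)\<^sup>2)) + 8 * (4 * pi\<^sup>2 * (cmod (u \<xi>))\<^sup>2)"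
        by (intro add_mono mult_left_mono coord) auto
      finally show "(cmod (\<gamma> i \<xi>))\<^sup>2 / (1 + (norm \<xi>)\<^sup>2) \<le> 8 * ((cmod (G i \<xi>))\<^sup>2 / (1 + (norm \<xi>)\<^sup>2)) + 32 * pi\<^sup>2 * (cmod (u \<xi>))\<^sup>2"
        by simp
    qed
    also have "\<dots> = 8 * (LINT \<xi>|lborel. (cmod (G i \<xi>))\<^sup>2 / (1 + (norm \<xi>)\<^sup>2)) + 32 * pi\<^sup>2 * (LINT \<xi>|lborel. (cmod (u \<xi>))\<^sup>2)"
      by (subst Bochner_Integration.integral_add) (intro integrable_mult_right ui Gi, intro integrable_mult_right ui Gi, simp only: integral_mult_right_zero)
    finally show ?thesis .
  qed
  show ?thesis
  proof (rule that[OF u(1) urep _ Gm Gi _ _ sn])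
    show "(LINT \<xi>|lborel. (cmod (u \<xi>))\<^sup>2) = (LINT x|lborel. (weighted V ?V0 \<rho> x)\<^sup>2)"
      using unorm by simp
    show "weak_gauss_eq \<mu> S u (\<lambda>l \<xi>. - 4 * pi * \<i> * (\<Sum>i\<in>UNIV. complex_of_real (S $ l $ i) * G i \<xi>))"
      unfolding G_def by (rule stein_weak_gauss_eq[OF S urep \<gamma>(1)])
  qed (rule stein_fisher_lower_bound[OF _ _ Grep Gi])
qed

section \<open>The weighted Poincare inequality for differentiable functions\<close>

definition grad_sq :: "(real^'d::finite \<Rightarrow> complex) \<Rightarrow> real^'d \<Rightarrow> real" where
  "grad_sq h x = (\<Sum>l\<in>UNIV. (cmod (partial l h x))\<^sup>2)"

lemma grad_sq_nonneg [simp]: "grad_sq h x \<ge> 0"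
  unfolding grad_sq_def by (intro sum_nonneg) auto

text \<open>The fundamental theorem of calculus along the segment, with Cauchy-Schwarz applied
  twice: over the coordinates, which separates the length of the segment from the gradient, and over
  the parameter in the unit interval.\<close>

lemma segment_bound:
  fixes h :: "real^'d::finite \<Rightarrow> complex"
  assumes diff: "\<And>x. h differentiable (at x)" and cont: "\<And>l. continuous_on UNIV (partial l h)"
  shows "ennreal ((cmod (h x - h y))\<^sup>2) \<le> ennreal ((norm (x - y))\<^sup>2) *
    (\<integral>\<^sup>+t. indicator {0..1} t * ennreal (grad_sq h (y + t *\<^sub>R (x - y))) \<partial>lborel)"
proof -
  define D where "D = (\<lambda>t::real. \<Sum>l\<in>UNIV. ((x - y) $ l) *\<^sub>R partial l h (y + t *\<^sub>R (x - y)))"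
  have contD: "continuous_on A D" for A
    unfolding D_def by (intro continuous_intros continuous_on_compose2[OF cont]) auto
  have [measurable]: "D \<in> borel_measurable borel"
    by (intro borel_measurable_continuous_onI contD)
  have FTC: "(LINT t|lborel. indicator {0..1} t *\<^sub>R D t) = h (y + 1 *\<^sub>R (x - y)) - h (y + 0 *\<^sub>R (x - y))"
    and int: "integrable lborel (\<lambda>t. indicator {0..1} t *\<^sub>R D t)"
  proof -
    have "has_bochner_integral lborel (\<lambda>t. indicator {0..1} t *\<^sub>R D t) (h (y + 1 *\<^sub>R (x - y)) - h (y + 0 *\<^sub>R (x - y)))"
    proof (rule has_bochner_integral_FTC_Icc)
      fix t :: real
      have "((\<lambda>t. y + t *\<^sub>R (x - y)) has_derivative (\<lambda>s. s *\<^sub>R (x - y))) (at t within {0..1})"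
        by (auto intro!: derivative_eq_intros)
      from has_derivative_compose[OF this has_derivative_partial[OF diff]]
      show "((\<lambda>t. h (y + t *\<^sub>R (x - y))) has_vector_derivative D t) (at t within {0..1})"
        by (simp add: has_vector_derivative_def D_def scaleR_sum_right)
    qed (auto intro: contD)
    then show "(LINT t|lborel. indicator {0..1} t *\<^sub>R D t) = h (y + 1 *\<^sub>R (x - y)) - h (y + 0 *\<^sub>R (x - y))"
      and "integrable lborel (\<lambda>t. indicator {0..1} t *\<^sub>R D t)"
      by (auto simp: has_bochner_integral_iff)
  qed
  have Dsq: "(cmod (D t))\<^sup>2 \<le> (norm (x - y))\<^sup>2 * grad_sq h (y + t *\<^sub>R (x - y))" for t
  proof -
    have "cmod (D t) \<le> (\<Sum>l\<in>UNIV. \<bar>(x - y) $ l\<bar> * cmod (partial l h (y + t *\<^sub>R (x - y))))"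
      unfolding D_def by (rule order_trans[OF norm_sum]) simp
    then have "(cmod (D t))\<^sup>2 \<le> (\<Sum>l\<in>UNIV. \<bar>(x - y) $ l\<bar> * cmod (partial l h (y + t *\<^sub>R (x - y))))\<^sup>2"
      by (intro power_mono) auto
    also have "\<dots> \<le> (\<Sum>l\<in>UNIV. \<bar>(x - y) $ l\<bar>\<^sup>2) * (\<Sum>l\<in>UNIV. (cmod (partial l h (y + t *\<^sub>R (x - y))))\<^sup>2)"
      by (rule Cauchy_Schwarz_ineq_sum)
    also have "(\<Sum>l\<in>UNIV. \<bar>(x - y) $ l\<bar>\<^sup>2) = (norm (x - y))\<^sup>2"
      by (simp add: norm_vec_def L2_set_def sum_nonneg)
    finally show ?thesis by (simp add: grad_sq_def)
  qed
  have "ennreal (cmod (h x - h y)) \<le> (\<integral>\<^sup>+t. ennreal (cmod (indicator {0..1} t *\<^sub>R D t)) \<partial>lborel)"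
    using integral_norm_bound_ennreal[OF int] unfolding FTC by simp
  also have "\<dots> = (\<integral>\<^sup>+t. (indicator {0..1} t * ennreal (cmod (D t))) * indicator {0..1} t \<partial>lborel)"
    by (intro nn_integral_cong) (auto simp: indicator_def)
  finally have "(ennreal (cmod (h x - h y)))\<^sup>2 \<le> (\<integral>\<^sup>+t. (indicator {0..1} t * ennreal (cmod (D t))) * indicator {0..1} t \<partial>lborel)\<^sup>2"
    by (intro power_mono) auto
  also have "\<dots> \<le> (\<integral>\<^sup>+t. (indicator {0..1} t * ennreal (cmod (D t)))\<^sup>2 \<partial>lborel) * (\<integral>\<^sup>+t. (indicator {0..1} t)\<^sup>2 \<partial>(lborel :: real measure))"
    by (rule Cauchy_Schwarz_nn_integral) measurable
  also have "(\<integral>\<^sup>+t. (indicator {0..1} t)\<^sup>2 \<partial>(lborel :: real measure)) = (\<integral>\<^sup>+t. indicator {0..1} t \<partial>(lborel :: real measure))"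
    by (intro nn_integral_cong) (auto simp: indicator_def)
  also have "\<dots> = 1" by simp
  also have "(\<integral>\<^sup>+t. (indicator {0..1} t * ennreal (cmod (D t)))\<^sup>2 \<partial>lborel) * 1
      \<le> (\<integral>\<^sup>+t. ennreal ((norm (x - y))\<^sup>2) * (indicator {0..1} t * ennreal (grad_sq h (y + t *\<^sub>R (x - y)))) \<partial>lborel)"
    unfolding mult_1_right
    by (intro nn_integral_mono) (use Dsq in \<open>auto simp: indicator_def ennreal_power ennreal_mult'[symmetric] intro!: ennreal_leI\<close>)
  also have "\<dots> = ennreal ((norm (x - y))\<^sup>2) * (\<integral>\<^sup>+t. indicator {0..1} t * ennreal (grad_sq h (y + t *\<^sub>R (x - y))) \<partial>lborel)"
  proof (rule nn_integral_cmult)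
    have "continuous_on UNIV (\<lambda>t. grad_sq h (y + t *\<^sub>R (x - y)))"
      unfolding grad_sq_def by (intro continuous_intros continuous_on_compose2[OF cont]) auto
    then have [measurable]: "(\<lambda>t. grad_sq h (y + t *\<^sub>R (x - y))) \<in> borel_measurable borel"
      by (rule borel_measurable_continuous_onI)
    show "(\<lambda>t. indicator {0..1} t * ennreal (grad_sq h (y + t *\<^sub>R (x - y)))) \<in> borel_measurable lborel"
      by measurable
  qed
  finally show ?thesis
    by (simp add: ennreal_power)
qed

text \<open>For fixed \<open>y\<close> and \<open>t\<close> at least 1/2, the map from
  \<open>x\<close> to the point \<open>y + t (x - y)\<close> keeps the convex set inside itself, and
  its Jacobian \<open>t^d\<close> is at least \<open>2^-d\<close>. Changing variables therefore
  costs at most \<open>2^d\<close>.\<close>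

lemma segment_average_bound:
  fixes g :: "'a::euclidean_space \<Rightarrow> ennreal"
  assumes [measurable]: "g \<in> borel_measurable borel" "B \<in> sets borel" and conv: "convex B"
    and t: "1 / 2 \<le> t" "t \<le> 1"
  shows "(\<integral>\<^sup>+y. \<integral>\<^sup>+x. indicator B x * indicator B y * g (y + t *\<^sub>R (x - y)) \<partial>lborel \<partial>lborel)
    \<le> 2 ^ DIM('a) * emeasure lborel B * (\<integral>\<^sup>+z. indicator B z * g z \<partial>lborel)"
proof -
  let ?\<Gamma> = "\<integral>\<^sup>+z. indicator B z * g z \<partial>lborel"
  have inner: "(\<integral>\<^sup>+x. indicator B x * indicator B y * g (y + t *\<^sub>R (x - y)) \<partial>lborel) \<le> indicator B y * (2 ^ DIM('a) * ?\<Gamma>)" for y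
  proof (cases "y \<in> B")
    case True
    have "(\<integral>\<^sup>+x. indicator B x * indicator B y * g (y + t *\<^sub>R (x - y)) \<partial>lborel)
       \<le> (\<integral>\<^sup>+x. indicator B ((y - t *\<^sub>R y) + t *\<^sub>R x) * g ((y - t *\<^sub>R y) + t *\<^sub>R x) \<partial>lborel)"
    proof (rule nn_integral_mono)
      fix x
      have e: "y + t *\<^sub>R (x - y) = (y - t *\<^sub>R y) + t *\<^sub>R x"
        by (simp add: algebra_simps)
      have "x \<in> B \<Longrightarrow> (1 - t) *\<^sub>R y + t *\<^sub>R x \<in> B"
        using t by (intro convexD[OF conv True]) auto
      then show "indicator B x * indicator B y * g (y + t *\<^sub>R (x - y)) \<le> indicator B ((y - t *\<^sub>R y) + t *\<^sub>R x) * g ((y - t *\<^sub>R y) + t *\<^sub>R x)"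
        unfolding e using True by (auto simp: indicator_def algebra_simps)
    qed
    also have "\<dots> = 1 * (\<integral>\<^sup>+x. indicator B ((y - t *\<^sub>R y) + t *\<^sub>R x) * g ((y - t *\<^sub>R y) + t *\<^sub>R x) \<partial>lborel)"
      by simp
    also have "\<dots> \<le> (2 ^ DIM('a) * ennreal (\<bar>t\<bar> ^ DIM('a))) * (\<integral>\<^sup>+x. indicator B ((y - t *\<^sub>R y) + t *\<^sub>R x) * g ((y - t *\<^sub>R y) + t *\<^sub>R x) \<partial>lborel)"
    proof (intro mult_right_mono)
      have "(1::real) \<le> (2 * \<bar>t\<bar>) ^ DIM('a)"
        using t by (intro one_le_power) auto
      then have "ennreal 1 \<le> ennreal (2 ^ DIM('a) * \<bar>t\<bar> ^ DIM('a))"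
        unfolding power_mult_distrib by (rule ennreal_leI)
      then show "1 \<le> 2 ^ DIM('a) * ennreal (\<bar>t\<bar> ^ DIM('a))"
        by (simp add: ennreal_mult' ennreal_power[symmetric])
    qed simp
    also have "\<dots> = 2 ^ DIM('a) * ?\<Gamma>"
      using t by (subst nn_integral_lborel_affine[where c=t and t="y - t *\<^sub>R y" and f="\<lambda>z. indicator B z * g z"]) (auto simp: mult.assoc)
    finally show ?thesis using True by simp
  qed simp
  have "(\<integral>\<^sup>+y. \<integral>\<^sup>+x. indicator B x * indicator B y * g (y + t *\<^sub>R (x - y)) \<partial>lborel \<partial>lborel)
     \<le> (\<integral>\<^sup>+y. indicator B y * (2 ^ DIM('a) * ?\<Gamma>) \<partial>lborel)"
    by (intro nn_integral_mono inner)
  also have "\<dots> = 2 ^ DIM('a) * emeasure lborel B * ?\<Gamma>"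
    by (subst nn_integral_multc) (auto simp: mult_ac)
  finally show ?thesis .
qed

text \<open>\<open>segment_bound\<close> is integrated over pairs of points and over the parameter
  \<open>t\<close>. The change of variables would degenerate as \<open>t\<close> tends to 0 if
  always made in \<open>x\<close>; exchanging the two points replaces \<open>t\<close> by
  \<open>1 - t\<close>, so one of the two choices always has a parameter of at least 1/2.\<close>

lemma double_integral_poincare:
  fixes h :: "real^'d::finite \<Rightarrow> complex"
  assumes diff: "\<And>x. h differentiable (at x)" and cont: "\<And>l. continuous_on UNIV (partial l h)"
    and B[measurable]: "B \<in> sets borel" and conv: "convex B"
    and diam: "\<And>x y. x \<in> B \<Longrightarrow> y \<in> B \<Longrightarrow> norm (x - y) \<le> L"
  shows "(\<integral>\<^sup>+x. \<integral>\<^sup>+y. indicator B x * indicator B y * ennreal ((cmod (h x - h y))\<^sup>2) \<partial>lborel \<partial>lborel)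
    \<le> ennreal (L\<^sup>2) * (2 ^ DIM(real^'d) * emeasure lborel B *
        (\<integral>\<^sup>+z. indicator B z * ennreal (grad_sq h z) \<partial>lborel))"
proof -
  let ?K = "2 ^ DIM(real^'d) * emeasure lborel B * (\<integral>\<^sup>+z. indicator B z * ennreal (grad_sq h z) \<partial>lborel)"
  let ?g = "\<lambda>x. ennreal (grad_sq h x)"
  have "continuous_on UNIV (grad_sq h)"
    unfolding grad_sq_def[abs_def] by (intro continuous_intros cont)
  then have [measurable]: "grad_sq h \<in> borel_measurable borel"
    by (rule borel_measurable_continuous_onI)
  have seg: "(\<integral>\<^sup>+x. \<integral>\<^sup>+y. indicator B x * indicator B y * ?g (y + t *\<^sub>R (x - y)) \<partial>lborel \<partial>lborel) \<le> ?K"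
    if t: "t \<in> {0..1}" for t
  proof (cases "t \<ge> 1 / 2")
    case True
    have "(\<integral>\<^sup>+x. \<integral>\<^sup>+y. indicator B x * indicator B y * ?g (y + t *\<^sub>R (x - y)) \<partial>lborel \<partial>lborel)
       = (\<integral>\<^sup>+y. \<integral>\<^sup>+x. indicator B x * indicator B y * ?g (y + t *\<^sub>R (x - y)) \<partial>lborel \<partial>lborel)"
      by (rule lborel_pair.Fubini'[symmetric]) measurable
    also have "\<dots> \<le> ?K"
      using True t by (intro segment_average_bound conv) auto
    finally show ?thesis .
  next
    case False
    have "(\<integral>\<^sup>+x. \<integral>\<^sup>+y. indicator B x * indicator B y * ?g (y + t *\<^sub>R (x - y)) \<partial>lborel \<partial>lborel)
       = (\<integral>\<^sup>+x. \<integral>\<^sup>+y. indicator B y * indicator B x * ?g (x + (1 - t) *\<^sub>R (y - x)) \<partial>lborel \<partial>lborel)"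
    proof (intro nn_integral_cong)
      fix x y :: "real^'d"
      have "y + t *\<^sub>R (x - y) = x + (1 - t) *\<^sub>R (y - x)"
        by (simp add: algebra_simps)
      then show "indicator B x * indicator B y * ?g (y + t *\<^sub>R (x - y)) = indicator B y * indicator B x * ?g (x + (1 - t) *\<^sub>R (y - x))"
        by (simp only: mult_ac)
    qed
    also have "\<dots> \<le> ?K"
      using False t by (intro segment_average_bound conv) auto
    finally show ?thesis .
  qed
  have "(\<integral>\<^sup>+x. \<integral>\<^sup>+y. indicator B x * indicator B y * ennreal ((cmod (h x - h y))\<^sup>2) \<partial>lborel \<partial>lborel)
    \<le> (\<integral>\<^sup>+x. \<integral>\<^sup>+y. ennreal (L\<^sup>2) * (\<integral>\<^sup>+t. indicator {0..1} t * (indicator B x * indicator B y * ?g (y + t *\<^sub>R (x - y))) \<partial>lborel) \<partial>lborel \<partial>lborel)"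
  proof (intro nn_integral_mono)
    fix x y :: "real^'d"
    show "indicator B x * indicator B y * ennreal ((cmod (h x - h y))\<^sup>2) \<le>
       ennreal (L\<^sup>2) * (\<integral>\<^sup>+t. indicator {0..1} t * (indicator B x * indicator B y * ?g (y + t *\<^sub>R (x - y))) \<partial>lborel)"
    proof (cases "x \<in> B \<and> y \<in> B")
      case True
      then have "norm (x - y) \<le> L"
        using diam by blast
      then have "ennreal ((norm (x - y))\<^sup>2) \<le> ennreal (L\<^sup>2)"
        by (intro ennreal_leI power_mono) auto
      then have "ennreal ((norm (x - y))\<^sup>2) * (\<integral>\<^sup>+t. indicator {0..1} t * ?g (y + t *\<^sub>R (x - y)) \<partial>lborel)
         \<le> ennreal (L\<^sup>2) * (\<integral>\<^sup>+t. indicator {0..1} t * ?g (y + t *\<^sub>R (x - y)) \<partial>lborel)"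
        by (rule mult_right_mono) simp
      with segment_bound[OF diff cont, of x y] True show ?thesis
        by (auto intro: order_trans)
    qed auto
  qed
  also have "\<dots> = ennreal (L\<^sup>2) * (\<integral>\<^sup>+x. \<integral>\<^sup>+y. \<integral>\<^sup>+t. indicator {0..1} t * (indicator B x * indicator B y * ?g (y + t *\<^sub>R (x - y))) \<partial>lborel \<partial>lborel \<partial>lborel)"
    by (simp add: nn_integral_cmult)
  also have "(\<integral>\<^sup>+x. \<integral>\<^sup>+y. \<integral>\<^sup>+t. indicator {0..1} t * (indicator B x * indicator B y * ?g (y + t *\<^sub>R (x - y))) \<partial>lborel \<partial>lborel \<partial>lborel)
     = (\<integral>\<^sup>+x. \<integral>\<^sup>+t. \<integral>\<^sup>+y. indicator {0..1} t * (indicator B x * indicator B y * ?g (y + t *\<^sub>R (x - y))) \<partial>lborel \<partial>lborel \<partial>lborel)"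
    by (intro nn_integral_cong lborel_pair.Fubini') measurable
  also have "\<dots> = (\<integral>\<^sup>+t. \<integral>\<^sup>+x. \<integral>\<^sup>+y. indicator {0..1} t * (indicator B x * indicator B y * ?g (y + t *\<^sub>R (x - y))) \<partial>lborel \<partial>lborel \<partial>lborel)"
    by (rule lborel_pair.Fubini') measurable
  also have "\<dots> = (\<integral>\<^sup>+t. indicator {0..1} t * (\<integral>\<^sup>+x. \<integral>\<^sup>+y. indicator B x * indicator B y * ?g (y + t *\<^sub>R (x - y)) \<partial>lborel \<partial>lborel) \<partial>lborel)"
    by (simp add: nn_integral_cmult)
  also have "\<dots> \<le> (\<integral>\<^sup>+t. indicator {0..1::real} t * ?K \<partial>lborel)"
    by (intro nn_integral_mono) (use seg in \<open>auto simp: indicator_def\<close>)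
  also have "\<dots> = ?K"
    by (subst nn_integral_multc) auto
  finally show ?thesis
    by (simp add: mult_left_mono)
qed

section \<open>The drift operators and their kernel\<close>

definition gauss_op :: "real^'d::finite \<Rightarrow> real^'d^'d \<Rightarrow> (real^'d \<Rightarrow> complex) \<Rightarrow> 'd \<Rightarrow> real^'d \<Rightarrow> complex" where
  "gauss_op \<mu> S v l \<xi> = partial l v \<xi> + (complex_of_real (8 * pi\<^sup>2 * (S *v \<xi>) $ l) + 2 * pi * \<i> * (\<mu> $ l)) * v \<xi>"

lemma gauss_hat_differentiable:
  assumes "sym_pos_def S"
  shows "gauss_hat \<mu> S differentiable (at \<xi>)"
  unfolding differentiable_def using gauss_hat_has_derivative[OF assms] by blast

text \<open>\<open>poly_exp_schwartz\<close> treats real exponents, but the mean contributes a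
  complex phase. The function is instead recognised as the transform of a Schwartz function divided
  by its nonzero mass.\<close>

lemma gauss_hat_schwartz:
  fixes S :: "real^'d::finite^'d"
  assumes S: "sym_pos_def S"
  shows "gauss_hat \<mu> S \<in> schwartz"
proof -
  let ?g = "\<lambda>x. exp (- quad_potential \<mu> S x / 2)"
  let ?c = "LINT x|lborel. ?g x"
  have g: "(\<lambda>x. complex_of_real (?g x)) \<in> schwartz"
    using exp_quad_potential_schwartz[OF S, of "1/2"] by simp
  have "(\<lambda>\<xi>. complex_of_real ?c * gauss_hat \<mu> S \<xi>) \<in> schwartz"
    unfolding fourier_exp_quad_potential[OF S, symmetric] by (rule fourier_integral_schwartz[OF g])
  from schwartz_cmult[OF this, of "1 / complex_of_real ?c"]
  have "?c \<noteq> 0 \<Longrightarrow> gauss_hat \<mu> S \<in> schwartz"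
    by simp
  moreover have "?c \<noteq> 0"
  proof
    assume "?c = 0"
    moreover have gi: "integrable lborel ?g"
      using integrable_schwartz[OF g] by (simp only: complex_of_real_integrable_eq)
    ultimately have "AE x in lborel. ?g x = 0"
      using integral_nonneg_eq_0_iff_AE[OF gi] by simp
    then have "AE x in (lborel :: (real^'d) measure). False"
      by simp
    then have "emeasure (lborel :: (real^'d) measure) UNIV = 0"
      by (simp add: AE_iff_measurable[OF _ refl])
    then show False by simp
  qed
  ultimately show ?thesis by blast
qed

lemma borel_measurable_gauss_hat:
  assumes "sym_pos_def S"
  shows "gauss_hat \<mu> S \<in> borel_measurable borel"
  by (rule borel_measurable_schwartz[OF gauss_hat_schwartz[OF assms]])

lemma norm_gauss_hat_le_1:
  assumes "sym_pos_def S"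
  shows "cmod (gauss_hat \<mu> S \<xi>) \<le> 1"
proof -
  have "\<xi> \<bullet> (S *v \<xi>) \<ge> 0"
    using assms by (cases "\<xi> = 0") (auto simp: sym_pos_def_def less_imp_le)
  then show ?thesis by (simp add: norm_gauss_hat)
qed

lemma gauss_op_cont:
  assumes "\<And>x. v differentiable (at x)" "\<And>l. continuous_on UNIV (partial l v)"
  shows "continuous_on A (gauss_op \<mu> S v l)"
proof -
  have v: "continuous_on UNIV v"
    using assms(1) by (simp add: continuous_at_imp_continuous_on differentiable_imp_continuous_within)
  have "continuous_on UNIV (\<lambda>\<xi>. S *v \<xi>)"
    by (intro linear_continuous_on matrix_vector_mul_bounded_linear)
  then have "continuous_on UNIV (gauss_op \<mu> S v l)"
    unfolding gauss_op_def[abs_def] using v assms(2) by (intro continuous_intros)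
  then show ?thesis
    by (rule continuous_on_subset) simp
qed

text \<open>The operators annihilate the Gaussian, so the subtraction that centres \<open>v\<close>
  leaves the right-hand side of the inequality unchanged.\<close>

lemma gauss_op_diff_gauss_hat:
  assumes S: "sym_pos_def S" and v: "v differentiable (at \<xi>)"
  shows "gauss_op \<mu> S (\<lambda>\<xi>. v \<xi> - \<tau> * gauss_hat \<mu> S \<xi>) l \<xi> = gauss_op \<mu> S v l \<xi>"
    and "partial l (\<lambda>\<xi>. v \<xi> - \<tau> * gauss_hat \<mu> S \<xi>) \<xi> = partial l v \<xi> - \<tau> * partial l (gauss_hat \<mu> S) \<xi>"
proof -
  have "partial l (\<lambda>\<xi>. v \<xi> + (- \<tau>) * gauss_hat \<mu> S \<xi>) \<xi> = partial l v \<xi> + (- \<tau>) * partial l (gauss_hat \<mu> S) \<xi>"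
  proof -
    have "(\<lambda>\<xi>. (- \<tau>) * gauss_hat \<mu> S \<xi>) differentiable (at \<xi>)"
      by (intro differentiable_mult differentiable_const gauss_hat_differentiable S)
    from partial_add[OF v this] show ?thesis
      unfolding partial_cmult[OF gauss_hat_differentiable[OF S]] .
  qed
  then show *: "partial l (\<lambda>\<xi>. v \<xi> - \<tau> * gauss_hat \<mu> S \<xi>) \<xi> = partial l v \<xi> - \<tau> * partial l (gauss_hat \<mu> S) \<xi>"
    by simp
  show "gauss_op \<mu> S (\<lambda>\<xi>. v \<xi> - \<tau> * gauss_hat \<mu> S \<xi>) l \<xi> = gauss_op \<mu> S v l \<xi>"
    unfolding gauss_op_def * partial_gauss_hat[OF S] by (simp add: algebra_simps)
qed

lemma integrable_continuous_ball:
  fixes f :: "'a::euclidean_space \<Rightarrow> 'b::{banach, second_countable_topology}"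
  assumes "continuous_on UNIV f"
  shows "integrable lborel (\<lambda>x. indicator (ball c r) x *\<^sub>R f x)"
proof (rule Bochner_Integration.integrable_bound)
  have [measurable]: "f \<in> borel_measurable borel"
    using assms by (rule borel_measurable_continuous_onI)
  have [measurable]: "ball c r \<in> sets borel" by simp
  show "integrable lborel (\<lambda>x. indicator (cball c r) x *\<^sub>R f x)"
    by (intro borel_integrable_compact continuous_on_subset[OF assms]) auto
  show "(\<lambda>x. indicator (ball c r) x *\<^sub>R f x) \<in> borel_measurable lborel"
    by measurable
  show "AE x in lborel. norm (indicator (ball c r) x *\<^sub>R f x) \<le> norm (indicator (cball c r) x *\<^sub>R f x)"
    by (intro AE_I2) (auto simp: indicator_def)
qed

text \<open>For the quotient \<open>h = v / E\<close> the operators become plain partials: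
  \<open>gauss_op\<close> applied to \<open>v\<close> is \<open>E\<close> times the partial of
  \<open>h\<close>. On a ball \<open>E\<close> is bounded away from 0, so the weights are
  comparable. Moreover \<open>\<tau>\<close> is exactly the average of \<open>h\<close> over the
  small ball with weight \<open>E\<close>, hence subtracting it is controlled by the double integral
  of differences of \<open>h\<close>.\<close>

lemma local_poincare:
  fixes S :: "real^'d::finite^'d"
  assumes S: "sym_pos_def S" and R: "\<epsilon> \<le> R"
    and Z: "(LINT \<xi>:ball 0 \<epsilon>|lborel. gauss_hat \<mu> S \<xi>) \<noteq> 0"
  shows "\<exists>K<\<infinity>. \<forall>v. (\<forall>x. v differentiable (at x)) \<longrightarrow> (\<forall>l. continuous_on UNIV (partial l v)) \<longrightarrow>
    (\<integral>\<^sup>+x. indicator (ball 0 R) x * ennreal ((cmod (v x - (LINT \<xi>:ball 0 \<epsilon>|lborel. v \<xi>) / (LINT \<xi>:ball 0 \<epsilon>|lborel. gauss_hat \<mu> S \<xi>) * gauss_hat \<mu> S x))\<^sup>2) \<partial>lborel)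
     \<le> K * (\<integral>\<^sup>+x. ennreal (\<Sum>l\<in>UNIV. (cmod (gauss_op \<mu> S v l x))\<^sup>2 / (1 + (norm x)\<^sup>2)) \<partial>lborel)"
proof -
  let ?E = "gauss_hat \<mu> S" and ?B = "ball (0::real^'d) R" and ?B' = "ball (0::real^'d) \<epsilon>"
  define Z where "Z = (LINT \<xi>:?B'|lborel. ?E \<xi>)"
  have Z0: "Z \<noteq> 0" using Z by (simp add: Z_def)
  have [measurable]: "?E \<in> borel_measurable borel"
    by (rule borel_measurable_gauss_hat[OF S])
  have [measurable]: "?B \<in> sets borel" by simp
  have contE: "continuous_on UNIV ?E"
    using gauss_hat_schwartz[OF S] by (rule continuous_on_schwartz)
  have "continuous_on (cball 0 R) (\<lambda>x. (cmod (inverse (?E x)))\<^sup>2 * (1 + (norm x)\<^sup>2))"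
    by (intro continuous_intros continuous_on_subset[OF contE]) auto
  then have "bounded ((\<lambda>x. (cmod (inverse (?E x)))\<^sup>2 * (1 + (norm x)\<^sup>2)) ` cball 0 R)"
    by (intro compact_imp_bounded compact_continuous_image) auto
  then obtain M where M: "M > 0" "\<And>x. x \<in> cball 0 R \<Longrightarrow> norm ((cmod (inverse (?E x)))\<^sup>2 * (1 + (norm x)\<^sup>2)) \<le> M"
    by (auto simp: bounded_pos)
  \<comment> \<open>The factors arise in this order: normalisation of the average, Cauchy-Schwarz on
    the ball, its diameter, the volume and Jacobian from \<open>double_integral_poincare\<close>,
    and the comparison of gradient and operators through \<open>M\<close>.\<close>
  define K where "K = ennreal ((1 / cmod Z)\<^sup>2) * emeasure lborel ?B * (ennreal ((2 * R)\<^sup>2) * (2 ^ DIM(real^'d) * emeasure lborel ?B * ennreal M))"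
  have "K < \<infinity>"
    unfolding K_def using emeasure_lborel_ball_finite[of "0::real^'d" R]
    by (auto simp: ennreal_mult_less_top power_less_top_ennreal)
  moreover have "(\<integral>\<^sup>+x. indicator ?B x * ennreal ((cmod (v x - (LINT \<xi>:?B'|lborel. v \<xi>) / Z * ?E x))\<^sup>2) \<partial>lborel)
     \<le> K * (\<integral>\<^sup>+x. ennreal (\<Sum>l\<in>UNIV. (cmod (gauss_op \<mu> S v l x))\<^sup>2 / (1 + (norm x)\<^sup>2)) \<partial>lborel)"
    if dv: "\<forall>x. v differentiable (at x)" and cv: "\<forall>l. continuous_on UNIV (partial l v)" for v
  proof -
    define \<tau> where "\<tau> = (LINT \<xi>:?B'|lborel. v \<xi>) / Z"
    define h where "h = (\<lambda>x. v x * inverse (?E x))"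
    have vh: "v x = h x * ?E x" for x
      by (simp add: h_def)
    have dI: "(\<lambda>\<xi>. inverse (?E \<xi>)) differentiable (at x)" for x
      unfolding differentiable_def using inverse_gauss_hat_has_derivative[OF S] by blast
    have contv: "continuous_on UNIV v"
      using dv by (simp add: continuous_at_imp_continuous_on differentiable_imp_continuous_within)
    have dh: "h differentiable (at x)" for x
      unfolding h_def using dv dI by (intro differentiable_mult) auto
    have ph: "partial l h x = inverse (?E x) * gauss_op \<mu> S v l x" for l x
      unfolding h_def using partial_mult[of v x "\<lambda>x. inverse (?E x)" l] dv dI
      by (simp add: gauss_op_def partial_inverse_gauss_hat[OF S] algebra_simps)
    have contb: "continuous_on UNIV (gauss_op \<mu> S v l)" for l
      using dv cv by (intro gauss_op_cont) auto
    have ch: "continuous_on UNIV (partial l h)" for l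
      unfolding ph[abs_def] by (intro continuous_intros contb contE) auto
    have conth: "continuous_on UNIV h"
      using dh by (simp add: continuous_at_imp_continuous_on differentiable_imp_continuous_within)
    have [measurable]: "v \<in> borel_measurable borel" "h \<in> borel_measurable borel" "gauss_op \<mu> S v l \<in> borel_measurable borel" for l
      using contv conth contb by (auto intro: borel_measurable_continuous_onI)
    \<comment> \<open>\<open>Z * (h x - \<tau>)\<close> is the integral of
      \<open>(h x - h y) * E y\<close> over the small ball. As \<open>E\<close> is at most 1 in
      modulus and the small ball lies in the large one, Cauchy-Schwarz over the large ball applies;
      \<open>E\<close> enters unsquared, so its oscillation matters only through
      \<open>Z\<close>.\<close>
    have avg: "ennreal ((cmod (h x - \<tau>))\<^sup>2) \<le> ennreal ((1 / cmod Z)\<^sup>2) * (emeasure lborel ?B * (\<integral>\<^sup>+y. indicator ?B y * ennreal ((cmod (h x - h y))\<^sup>2) \<partial>lborel))" for x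
    proof -
      have i1: "integrable lborel (\<lambda>y. indicator ?B' y *\<^sub>R ?E y)" and i2: "integrable lborel (\<lambda>y. indicator ?B' y *\<^sub>R v y)"
        by (intro integrable_continuous_ball contE contv)+
      have e: "indicator ?B' y *\<^sub>R ((h x - h y) * ?E y) = h x * (indicator ?B' y *\<^sub>R ?E y) - indicator ?B' y *\<^sub>R v y" for y
        by (simp add: vh algebra_simps)
      have int: "integrable lborel (\<lambda>y. indicator ?B' y *\<^sub>R ((h x - h y) * ?E y))"
        unfolding e using i1 i2 by (intro Bochner_Integration.integrable_diff integrable_mult_right)
      have "(LINT y|lborel. indicator ?B' y *\<^sub>R ((h x - h y) * ?E y)) = h x * Z - (LINT \<xi>:?B'|lborel. v \<xi>)"
        unfolding e Z_def set_lebesgue_integral_def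
        by (subst Bochner_Integration.integral_diff) (intro integrable_mult_right i1, rule i2, simp only: integral_mult_right_zero)
      also have "\<dots> = Z * (h x - \<tau>)"
        using Z0 by (simp add: \<tau>_def algebra_simps)
      finally have "ennreal (cmod (Z * (h x - \<tau>))) \<le> (\<integral>\<^sup>+y. ennreal (cmod (indicator ?B' y *\<^sub>R ((h x - h y) * ?E y))) \<partial>lborel)"
        using integral_norm_bound_ennreal[OF int] by simp
      also have "\<dots> \<le> (\<integral>\<^sup>+y. indicator ?B y * ennreal (cmod (h x - h y)) * indicator ?B y \<partial>lborel)"
      proof (intro nn_integral_mono)
        fix y
        have "cmod (h x - h y) * cmod (?E y) \<le> cmod (h x - h y)"
          using norm_gauss_hat_le_1[OF S, of \<mu> y] by (simp add: mult_left_le)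
        then show "ennreal (cmod (indicator ?B' y *\<^sub>R ((h x - h y) * ?E y))) \<le> indicator ?B y * ennreal (cmod (h x - h y)) * indicator ?B y"
          using R by (auto simp: indicator_def norm_mult intro!: ennreal_leI)
      qed
      finally have "(ennreal (cmod (Z * (h x - \<tau>))))\<^sup>2 \<le> (\<integral>\<^sup>+y. indicator ?B y * ennreal (cmod (h x - h y)) * indicator ?B y \<partial>lborel)\<^sup>2"
        by (intro power_mono) auto
      also have "\<dots> \<le> (\<integral>\<^sup>+y. (indicator ?B y * ennreal (cmod (h x - h y)))\<^sup>2 \<partial>lborel) * (\<integral>\<^sup>+y. (indicator ?B y)\<^sup>2 \<partial>lborel)"
        by (rule Cauchy_Schwarz_nn_integral) measurable
      also have "(\<integral>\<^sup>+y. (indicator ?B y)\<^sup>2 \<partial>lborel) = (\<integral>\<^sup>+y. indicator ?B y \<partial>lborel)"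
        by (intro nn_integral_cong) (auto simp: indicator_def)
      also have "\<dots> = emeasure lborel ?B" by simp
      also have "(\<integral>\<^sup>+y. (indicator ?B y * ennreal (cmod (h x - h y)))\<^sup>2 \<partial>lborel) = (\<integral>\<^sup>+y. indicator ?B y * ennreal ((cmod (h x - h y))\<^sup>2) \<partial>lborel)"
        by (intro nn_integral_cong) (auto simp: indicator_def ennreal_power)
      finally have le: "ennreal ((cmod Z)\<^sup>2 * (cmod (h x - \<tau>))\<^sup>2) \<le> (\<integral>\<^sup>+y. indicator ?B y * ennreal ((cmod (h x - h y))\<^sup>2) \<partial>lborel) * emeasure lborel ?B"
        by (simp add: ennreal_power norm_mult power_mult_distrib)
      have "(cmod (h x - \<tau>))\<^sup>2 = (1 / cmod Z)\<^sup>2 * ((cmod Z)\<^sup>2 * (cmod (h x - \<tau>))\<^sup>2)"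
        using Z0 by (simp add: power_divide)
      then have "ennreal ((cmod (h x - \<tau>))\<^sup>2) = ennreal ((1 / cmod Z)\<^sup>2) * ennreal ((cmod Z)\<^sup>2 * (cmod (h x - \<tau>))\<^sup>2)"
        by (metis ennreal_mult' zero_le_power2)
      also have "\<dots> \<le> ennreal ((1 / cmod Z)\<^sup>2) * ((\<integral>\<^sup>+y. indicator ?B y * ennreal ((cmod (h x - h y))\<^sup>2) \<partial>lborel) * emeasure lborel ?B)"
        by (intro mult_left_mono le) simp
      finally show ?thesis
        by (simp only: mult_ac)
    qed
    have "(\<integral>\<^sup>+x. indicator ?B x * ennreal ((cmod (v x - \<tau> * ?E x))\<^sup>2) \<partial>lborel)
      \<le> (\<integral>\<^sup>+x. ennreal ((1 / cmod Z)\<^sup>2) * (emeasure lborel ?B * (\<integral>\<^sup>+y. indicator ?B x * indicator ?B y * ennreal ((cmod (h x - h y))\<^sup>2) \<partial>lborel)) \<partial>lborel)"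
    proof (intro nn_integral_mono)
      fix x
      have "v x - \<tau> * ?E x = (h x - \<tau>) * ?E x"
        by (simp add: vh algebra_simps)
      then have "cmod (v x - \<tau> * ?E x) \<le> cmod (h x - \<tau>)"
        using norm_gauss_hat_le_1[OF S, of \<mu> x] by (simp add: norm_mult mult_left_le)
      then have "ennreal ((cmod (v x - \<tau> * ?E x))\<^sup>2) \<le> ennreal ((cmod (h x - \<tau>))\<^sup>2)"
        by (intro ennreal_leI power_mono) auto
      also note avg
      finally show "indicator ?B x * ennreal ((cmod (v x - \<tau> * ?E x))\<^sup>2) \<le> ennreal ((1 / cmod Z)\<^sup>2) * (emeasure lborel ?B * (\<integral>\<^sup>+y. indicator ?B x * indicator ?B y * ennreal ((cmod (h x - h y))\<^sup>2) \<partial>lborel))"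
        by (cases "x \<in> ?B") auto
    qed
    also have "\<dots> = ennreal ((1 / cmod Z)\<^sup>2) * (emeasure lborel ?B * (\<integral>\<^sup>+x. \<integral>\<^sup>+y. indicator ?B x * indicator ?B y * ennreal ((cmod (h x - h y))\<^sup>2) \<partial>lborel \<partial>lborel))"
      by (simp add: nn_integral_cmult)
    also have "\<dots> \<le> ennreal ((1 / cmod Z)\<^sup>2) * (emeasure lborel ?B * (ennreal ((2 * R)\<^sup>2) * (2 ^ DIM(real^'d) * emeasure lborel ?B *
        (\<integral>\<^sup>+z. indicator ?B z * ennreal (grad_sq h z) \<partial>lborel))))"
    proof (intro mult_left_mono double_integral_poincare dh ch)
      fix x y :: "real^'d" assume "x \<in> ?B" "y \<in> ?B"
      then show "norm (x - y) \<le> 2 * R"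
        using norm_triangle_ineq4[of x y] by auto
    qed auto
    also have "(\<integral>\<^sup>+z. indicator ?B z * ennreal (grad_sq h z) \<partial>lborel)
       \<le> ennreal M * (\<integral>\<^sup>+x. ennreal (\<Sum>l\<in>UNIV. (cmod (gauss_op \<mu> S v l x))\<^sup>2 / (1 + (norm x)\<^sup>2)) \<partial>lborel)"
    proof -
      have "(\<integral>\<^sup>+z. indicator ?B z * ennreal (grad_sq h z) \<partial>lborel)
         \<le> (\<integral>\<^sup>+x. ennreal M * ennreal (\<Sum>l\<in>UNIV. (cmod (gauss_op \<mu> S v l x))\<^sup>2 / (1 + (norm x)\<^sup>2)) \<partial>lborel)"
      proof (intro nn_integral_mono)
        fix z
        have nn: "0 \<le> (\<Sum>l\<in>UNIV. (cmod (gauss_op \<mu> S v l z))\<^sup>2 / (1 + (norm z)\<^sup>2))"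
          by (intro sum_nonneg) (auto simp: less_imp_le)
        have "grad_sq h z \<le> M * (\<Sum>l\<in>UNIV. (cmod (gauss_op \<mu> S v l z))\<^sup>2 / (1 + (norm z)\<^sup>2))" if "z \<in> ?B"
        proof -
          have "grad_sq h z = (cmod (inverse (?E z)))\<^sup>2 * (\<Sum>l\<in>UNIV. (cmod (gauss_op \<mu> S v l z))\<^sup>2)"
            by (simp add: grad_sq_def ph norm_mult power_mult_distrib sum_distrib_left)
          also have "\<dots> = ((cmod (inverse (?E z)))\<^sup>2 * (1 + (norm z)\<^sup>2)) * ((\<Sum>l\<in>UNIV. (cmod (gauss_op \<mu> S v l z))\<^sup>2) / (1 + (norm z)\<^sup>2))"
            by simp
          also have "(\<Sum>l\<in>UNIV. (cmod (gauss_op \<mu> S v l z))\<^sup>2) / (1 + (norm z)\<^sup>2) = (\<Sum>l\<in>UNIV. (cmod (gauss_op \<mu> S v l z))\<^sup>2 / (1 + (norm z)\<^sup>2))"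
            by (rule sum_divide_distrib)
          also have "((cmod (inverse (?E z)))\<^sup>2 * (1 + (norm z)\<^sup>2)) * (\<Sum>l\<in>UNIV. (cmod (gauss_op \<mu> S v l z))\<^sup>2 / (1 + (norm z)\<^sup>2))
              \<le> M * (\<Sum>l\<in>UNIV. (cmod (gauss_op \<mu> S v l z))\<^sup>2 / (1 + (norm z)\<^sup>2))"
            using M(2)[of z] that by (intro mult_right_mono nn) auto
          finally show ?thesis .
        qed
        then show "indicator ?B z * ennreal (grad_sq h z) \<le> ennreal M * ennreal (\<Sum>l\<in>UNIV. (cmod (gauss_op \<mu> S v l z))\<^sup>2 / (1 + (norm z)\<^sup>2))"
          using M(1) nn by (auto simp: indicator_def ennreal_mult'[symmetric] less_imp_le intro!: ennreal_leI)
      qed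
      also have "\<dots> = ennreal M * (\<integral>\<^sup>+x. ennreal (\<Sum>l\<in>UNIV. (cmod (gauss_op \<mu> S v l x))\<^sup>2 / (1 + (norm x)\<^sup>2)) \<partial>lborel)"
        by (rule nn_integral_cmult) measurable
      finally show ?thesis .
    qed
    finally show ?thesis
      by (simp add: \<tau>_def[symmetric] K_def mult_left_mono mult.assoc)
  qed
  ultimately show ?thesis
    unfolding Z_def[symmetric] by blast
qed

section \<open>The virial identity and the estimate at infinity\<close>

lemma virial_has_derivative:
  fixes v :: "real^'d::finite \<Rightarrow> complex"
  assumes v: "v differentiable (at \<xi>)"
  shows "((\<lambda>\<xi>. \<xi> $ l / (1 + (norm \<xi>)\<^sup>2) * (cmod (v \<xi>))\<^sup>2) has_derivative
    (\<lambda>h. \<xi> $ l / (1 + (norm \<xi>)\<^sup>2) * (2 * (v \<xi> \<bullet> frechet_derivative v (at \<xi>) h)) +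
         (h $ l * (1 + (norm \<xi>)\<^sup>2) - \<xi> $ l * (2 * (\<xi> \<bullet> h))) / ((1 + (norm \<xi>)\<^sup>2) * (1 + (norm \<xi>)\<^sup>2)) * (cmod (v \<xi>))\<^sup>2)) (at \<xi>)"
proof -
  let ?D = "frechet_derivative v (at \<xi>)"
  have D: "(v has_derivative ?D) (at \<xi>)"
    using v frechet_derivative_works by blast
  have 1: "((\<lambda>\<xi>::real^'d. \<xi> $ l) has_derivative (\<lambda>h. h $ l)) (at \<xi>)"
    by (rule bounded_linear_imp_has_derivative[OF bounded_linear_vec_nth])
  have "((\<lambda>\<xi>::real^'d. 1 + \<xi> \<bullet> \<xi>) has_derivative (\<lambda>h. 0 + (\<xi> \<bullet> h + h \<bullet> \<xi>))) (at \<xi>)"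
    by (intro has_derivative_add has_derivative_const has_derivative_inner has_derivative_ident)
  then have 2: "((\<lambda>\<xi>::real^'d. 1 + (norm \<xi>)\<^sup>2) has_derivative (\<lambda>h. 2 * (\<xi> \<bullet> h))) (at \<xi>)"
    by (simp add: dot_square_norm inner_commute[of _ \<xi>])
  have "((\<lambda>\<xi>. v \<xi> \<bullet> v \<xi>) has_derivative (\<lambda>h. v \<xi> \<bullet> ?D h + ?D h \<bullet> v \<xi>)) (at \<xi>)"
    by (intro has_derivative_inner D)
  then have 3: "((\<lambda>\<xi>. (cmod (v \<xi>))\<^sup>2) has_derivative (\<lambda>h. 2 * (v \<xi> \<bullet> ?D h))) (at \<xi>)"
    by (simp add: dot_square_norm inner_commute[of _ "v \<xi>"])
  show ?thesis
    by (intro has_derivative_mult has_derivative_divide' 1 2 3) simp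
qed

lemma virial_partial:
  fixes S :: "real^'d::finite^'d"
  assumes v: "v differentiable (at \<xi>)"
  shows "partial l (\<lambda>\<xi>. \<xi> $ l / (1 + (norm \<xi>)\<^sup>2) * (cmod (v \<xi>))\<^sup>2) \<xi> =
    2 * (\<xi> $ l) / (1 + (norm \<xi>)\<^sup>2) * (v \<xi> \<bullet> gauss_op \<mu> S v l \<xi>)
    - 16 * pi\<^sup>2 * (\<xi> $ l * (S *v \<xi>) $ l) / (1 + (norm \<xi>)\<^sup>2) * (cmod (v \<xi>))\<^sup>2
    + (1 / (1 + (norm \<xi>)\<^sup>2) - 2 * (\<xi> $ l)\<^sup>2 / (1 + (norm \<xi>)\<^sup>2)\<^sup>2) * (cmod (v \<xi>))\<^sup>2"
proof -
  let ?J = "1 + (norm \<xi>)\<^sup>2"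
  \<comment> \<open>In the real inner product \<open>v\<close> and \<open>\<i> * v\<close> are
    orthogonal, so the drift coming from the mean drops out of the derivative of the squared
    modulus.\<close>
  have "v \<xi> \<bullet> (\<i> * v \<xi>) = 0"
    by (simp add: inner_complex_def)
  moreover have "2 * pi * \<i> * (\<mu> $ l) * v \<xi> = (2 * pi * \<mu> $ l) *\<^sub>R (\<i> * v \<xi>)"
    by (simp add: scaleR_conv_of_real)
  ultimately have z: "v \<xi> \<bullet> (2 * pi * \<i> * (\<mu> $ l) * v \<xi>) = 0"
    by simp
  have e: "complex_of_real r * v \<xi> = r *\<^sub>R v \<xi>" for r
    by (simp add: scaleR_conv_of_real)
  have "partial l v \<xi> = gauss_op \<mu> S v l \<xi> - (8 * pi\<^sup>2 * (S *v \<xi>) $ l) *\<^sub>R v \<xi> - 2 * pi * \<i> * (\<mu> $ l) * v \<xi>"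
    unfolding gauss_op_def e[symmetric] by (simp add: algebra_simps)
  then have "v \<xi> \<bullet> partial l v \<xi> = v \<xi> \<bullet> gauss_op \<mu> S v l \<xi> - 8 * pi\<^sup>2 * (S *v \<xi>) $ l * (cmod (v \<xi>))\<^sup>2"
    by (simp only: inner_diff_right z inner_scaleR_right dot_square_norm diff_zero)
  then have *: "v \<xi> \<bullet> frechet_derivative v (at \<xi>) (axis l 1) = v \<xi> \<bullet> gauss_op \<mu> S v l \<xi> - 8 * pi\<^sup>2 * (S *v \<xi>) $ l * (cmod (v \<xi>))\<^sup>2"
    by (simp only: partial_def)
  have "(1 * j - x * (2 * x)) / (j * j) = 1 / j - 2 * x\<^sup>2 / j\<^sup>2" if "j \<noteq> 0" for j x :: real
    using that by (simp add: diff_divide_distrib power2_eq_square)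
  note E = this[where j="?J" and x="\<xi> $ l", OF one_plus_norm_sq_pos(2)]
  have F: "x / j * (2 * (X - 8 * pi\<^sup>2 * s * q)) = 2 * x / j * X - 16 * pi\<^sup>2 * (x * s) / j * q" for x j X s q :: real
    by (simp add: algebra_simps diff_divide_distrib)
  have i: "axis l 1 $ l = (1::real)" "\<xi> \<bullet> axis l 1 = \<xi> $ l"
    by (simp_all add: inner_axis)
  show ?thesis
    unfolding partial_eq[OF virial_has_derivative[OF v]] * i E F ..
qed

text \<open>The divergence of \<open>\<xi> |v|\<^sup>2 / (1 + |\<xi>|\<^sup>2)\<close> integrates to zero, while the Gaussian drift makes it
  at most \<open>- \<alpha> |v|\<^sup>2\<close> far out; this is what yields the gain of the weight \<open>1 / (1 + |\<xi>|\<^sup>2)\<close>.\<close>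

lemma virial_estimate:
  fixes S :: "real^'d::finite^'d"
  assumes a: "a > 0" "\<And>\<xi>. \<xi> \<bullet> (S *v \<xi>) \<ge> a * (norm \<xi>)\<^sup>2"
    and dv: "\<And>x. v differentiable (at x)" and cv: "\<And>l. continuous_on UNIV (partial l v)"
    and vi: "integrable lborel (\<lambda>\<xi>. (cmod (v \<xi>))\<^sup>2)"
    and bi: "\<And>l. integrable lborel (\<lambda>\<xi>. (cmod (gauss_op \<mu> S v l \<xi>))\<^sup>2 / (1 + (norm \<xi>)\<^sup>2))"
  defines "\<alpha> \<equiv> 8 * pi\<^sup>2 * a"
  assumes R: "(real CARD('d) + \<alpha>) / (1 + R\<^sup>2) \<le> \<alpha> / 2" "R \<ge> 0"
  shows "\<alpha> / 2 * (LINT \<xi>|lborel. (cmod (v \<xi>))\<^sup>2) \<le>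
    (real CARD('d) + \<alpha>) * (LINT \<xi>|lborel. indicator (ball 0 R) \<xi> * (cmod (v \<xi>))\<^sup>2)
    + 1 / \<alpha> * (\<Sum>l\<in>UNIV. LINT \<xi>|lborel. (cmod (gauss_op \<mu> S v l \<xi>))\<^sup>2 / (1 + (norm \<xi>)\<^sup>2))"
proof -
  let ?J = "\<lambda>\<xi>::real^'d. 1 + (norm \<xi>)\<^sup>2" and ?b = "gauss_op \<mu> S v" and ?d = "real CARD('d)"
  let ?q = "\<lambda>\<xi>. (cmod (v \<xi>))\<^sup>2"
  define Y where "Y = (\<lambda>l (\<xi>::real^'d). \<xi> $ l / ?J \<xi> * ?q \<xi>)"
  define P where "P = (\<lambda>l (\<xi>::real^'d). 2 * (\<xi> $ l) / ?J \<xi> * (v \<xi> \<bullet> ?b l \<xi>)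
    - 16 * pi\<^sup>2 * (\<xi> $ l * (S *v \<xi>) $ l) / ?J \<xi> * ?q \<xi> + (1 / ?J \<xi> - 2 * (\<xi> $ l)\<^sup>2 / (?J \<xi>)\<^sup>2) * ?q \<xi>)"
  have \<alpha>: "\<alpha> > 0"
    using a by (simp add: \<alpha>_def)
  have PY: "partial l (Y l) = P l" for l
    unfolding Y_def P_def by (rule ext) (rule virial_partial[OF dv])
  have contv: "continuous_on UNIV v"
    using dv by (simp add: continuous_at_imp_continuous_on differentiable_imp_continuous_within)
  have contb: "continuous_on UNIV (?b l)" for l
    using dv cv by (intro gauss_op_cont)
  have contS: "continuous_on UNIV (\<lambda>\<xi>. (S *v \<xi>) $ l)" for l
    by (intro continuous_intros linear_continuous_on matrix_vector_mul_bounded_linear)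
  have contP: "continuous_on UNIV (P l)" for l
    unfolding P_def by (intro continuous_intros contv contb contS) auto
  have [measurable]: "v \<in> borel_measurable borel" "?b l \<in> borel_measurable borel" "P l \<in> borel_measurable borel" for l
    using contv contb contP by (auto intro: borel_measurable_continuous_onI)
  have [measurable]: "ball (0::real^'d) R \<in> sets borel" by simp
  obtain K where K: "K > 0" "\<And>\<xi>. norm (S *v \<xi>) \<le> norm \<xi> * K"
    using bounded_linear.pos_bounded[OF matrix_vector_mul_bounded_linear] by blast
  have J1: "?J \<xi> \<ge> 1" for \<xi> by simp
  have comp: "(\<xi> $ l)\<^sup>2 \<le> (norm \<xi>)\<^sup>2" for \<xi> :: "real^'d" and l
    using component_le_norm_cart[of \<xi> l] by (metis abs_ge_zero power2_abs power_mono)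
  \<comment> \<open>Young's inequality with a free parameter: \<open>\<beta> = 1\<close> is enough
    for integrability, while \<open>\<beta> = \<alpha>\<close> balances the cross term against the
    drift.\<close>
  have cross: "\<bar>2 * (\<xi> $ l) * (v \<xi> \<bullet> ?b l \<xi>)\<bar> \<le> \<beta> * (\<xi> $ l)\<^sup>2 * ?q \<xi> + (cmod (?b l \<xi>))\<^sup>2 / \<beta>"
    if "\<beta> > 0" for l \<xi> \<beta>
  proof -
    have "\<bar>v \<xi> \<bullet> ?b l \<xi>\<bar> \<le> cmod (v \<xi>) * cmod (?b l \<xi>)"
      by (rule Cauchy_Schwarz_ineq2)
    then have "2 * \<bar>\<xi> $ l\<bar> * \<bar>v \<xi> \<bullet> ?b l \<xi>\<bar> \<le> 2 * \<bar>\<xi> $ l\<bar> * (cmod (v \<xi>) * cmod (?b l \<xi>))"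
      by (intro mult_left_mono) auto
    also have "\<dots> = 2 * (sqrt \<beta> * \<bar>\<xi> $ l\<bar> * cmod (v \<xi>)) * (cmod (?b l \<xi>) / sqrt \<beta>)"
      using that by simp
    also have "\<dots> \<le> (sqrt \<beta> * \<bar>\<xi> $ l\<bar> * cmod (v \<xi>))\<^sup>2 + (cmod (?b l \<xi>) / sqrt \<beta>)\<^sup>2"
      by (rule sum_squares_bound)
    also have "\<dots> = \<beta> * (\<xi> $ l)\<^sup>2 * ?q \<xi> + (cmod (?b l \<xi>))\<^sup>2 / \<beta>"
      using that by (simp add: power_mult_distrib power_divide)
    finally show ?thesis
      by (simp add: abs_mult)
  qed
  \<comment> \<open>In the majorant the number 4 collects 1 from the cross term and 3 from
    differentiating the weight; \<open>K\<close> is an operator bound for \<open>S\<close>.\<close>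
  have Pi: "integrable lborel (P l)" for l
  proof (rule Bochner_Integration.integrable_bound)
    show "integrable lborel (\<lambda>\<xi>. (4 + 16 * pi\<^sup>2 * K) * ?q \<xi> + (cmod (?b l \<xi>))\<^sup>2 / ?J \<xi>)"
      by (intro Bochner_Integration.integrable_add integrable_mult_right vi bi)
    show "AE \<xi> in lborel. norm (P l \<xi>) \<le> norm ((4 + 16 * pi\<^sup>2 * K) * ?q \<xi> + (cmod (?b l \<xi>))\<^sup>2 / ?J \<xi>)"
    proof (rule AE_I2)
      fix \<xi> :: "real^'d"
      have "\<bar>2 * (\<xi> $ l) * (v \<xi> \<bullet> ?b l \<xi>)\<bar> \<le> ?J \<xi> * ?q \<xi> + (cmod (?b l \<xi>))\<^sup>2"
        using cross[of 1 \<xi> l] mult_right_mono[of "(\<xi> $ l)\<^sup>2" "?J \<xi>" "?q \<xi>"] comp[of \<xi> l] by simp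
      then have "\<bar>2 * (\<xi> $ l) * (v \<xi> \<bullet> ?b l \<xi>)\<bar> / ?J \<xi> \<le> (?J \<xi> * ?q \<xi> + (cmod (?b l \<xi>))\<^sup>2) / ?J \<xi>"
        by (intro divide_right_mono) (auto simp: less_imp_le)
      also have "\<dots> = ?q \<xi> + (cmod (?b l \<xi>))\<^sup>2 / ?J \<xi>"
        by (simp add: add_divide_distrib)
      finally have 1: "\<bar>2 * (\<xi> $ l) / ?J \<xi> * (v \<xi> \<bullet> ?b l \<xi>)\<bar> \<le> ?q \<xi> + (cmod (?b l \<xi>))\<^sup>2 / ?J \<xi>"
        by (simp add: abs_mult abs_divide less_imp_le)
      have "\<bar>\<xi> $ l * (S *v \<xi>) $ l\<bar> \<le> norm \<xi> * (norm \<xi> * K)"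
        unfolding abs_mult using component_le_norm_cart[of \<xi> l] order_trans[OF component_le_norm_cart[of "S *v \<xi>" l] K(2)]
        by (intro mult_mono) auto
      also have "\<dots> \<le> ?J \<xi> * K"
        using K(1) by (simp add: power2_eq_square algebra_simps)
      finally have "\<bar>\<xi> $ l * (S *v \<xi>) $ l\<bar> / ?J \<xi> \<le> ?J \<xi> * K / ?J \<xi>"
        by (intro divide_right_mono) (auto simp: less_imp_le)
      then have "16 * pi\<^sup>2 * (\<bar>\<xi> $ l * (S *v \<xi>) $ l\<bar> / ?J \<xi>) * ?q \<xi> \<le> 16 * pi\<^sup>2 * K * ?q \<xi>"
        by (intro mult_right_mono mult_left_mono) auto
      then have 2: "\<bar>16 * pi\<^sup>2 * (\<xi> $ l * (S *v \<xi>) $ l) / ?J \<xi> * ?q \<xi>\<bar> \<le> 16 * pi\<^sup>2 * K * ?q \<xi>"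
        by (simp add: abs_mult abs_divide less_imp_le)
      have "2 * (\<xi> $ l)\<^sup>2 / (?J \<xi>)\<^sup>2 \<le> 2 * ?J \<xi> / (?J \<xi>)\<^sup>2"
        using comp[of \<xi> l] by (intro divide_right_mono) auto
      also have "\<dots> = 2 / ?J \<xi>"
      proof -
        have "2 * j / j\<^sup>2 = 2 / j" if "j \<noteq> 0" for j :: real
          using that by (simp add: power2_eq_square)
        then show ?thesis using one_plus_norm_sq_pos(2) by blast
      qed
      also have "\<dots> \<le> 2"
        using J1[of \<xi>] by (simp add: divide_le_eq)
      finally have "2 * (\<xi> $ l)\<^sup>2 / (?J \<xi>)\<^sup>2 \<le> 2" .
      moreover have "0 \<le> 2 * (\<xi> $ l)\<^sup>2 / (?J \<xi>)\<^sup>2" by simp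
      moreover have "0 \<le> 1 / ?J \<xi>" "1 / ?J \<xi> \<le> 1"
        using J1[of \<xi>] by (auto simp: divide_le_eq less_imp_le)
      ultimately have "\<bar>1 / ?J \<xi> - 2 * (\<xi> $ l)\<^sup>2 / (?J \<xi>)\<^sup>2\<bar> \<le> 3"
        by linarith
      then have 3: "\<bar>(1 / ?J \<xi> - 2 * (\<xi> $ l)\<^sup>2 / (?J \<xi>)\<^sup>2) * ?q \<xi>\<bar> \<le> 3 * ?q \<xi>"
        unfolding abs_mult by (intro mult_mono) auto
      have "\<bar>P l \<xi>\<bar> \<le> (?q \<xi> + (cmod (?b l \<xi>))\<^sup>2 / ?J \<xi>) + 16 * pi\<^sup>2 * K * ?q \<xi> + 3 * ?q \<xi>"
        unfolding P_def using 1 2 3 by linarith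
      also have "\<dots> = (4 + 16 * pi\<^sup>2 * K) * ?q \<xi> + (cmod (?b l \<xi>))\<^sup>2 / ?J \<xi>"
        by (simp add: algebra_simps)
      finally show "norm (P l \<xi>) \<le> norm ((4 + 16 * pi\<^sup>2 * K) * ?q \<xi> + (cmod (?b l \<xi>))\<^sup>2 / ?J \<xi>)"
        unfolding real_norm_def by (rule order_trans[OF _ abs_ge_self])
    qed
  qed measurable
  have Yi: "integrable lborel (Y l)" for l
  proof (rule Bochner_Integration.integrable_bound[OF vi])
    show "Y l \<in> borel_measurable lborel"
      unfolding Y_def by measurable
    show "AE \<xi> in lborel. norm (Y l \<xi>) \<le> norm (?q \<xi>)"
    proof (rule AE_I2)
      fix \<xi> :: "real^'d"
      have "\<bar>\<xi> $ l\<bar> \<le> ?J \<xi>"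
        using component_le_norm_cart[of \<xi> l] sum_squares_bound[of 1 "norm \<xi>"] norm_ge_zero[of \<xi>] by simp
      then have "\<bar>\<xi> $ l\<bar> / ?J \<xi> \<le> 1"
        by (simp add: divide_le_eq)
      then have "\<bar>\<xi> $ l\<bar> / ?J \<xi> * ?q \<xi> \<le> 1 * ?q \<xi>"
        by (intro mult_right_mono) auto
      then show "norm (Y l \<xi>) \<le> norm (?q \<xi>)"
        by (simp add: Y_def abs_mult abs_divide less_imp_le)
    qed
  qed
  have zero: "(LINT \<xi>|lborel. P l \<xi>) = 0" for l
  proof -
    have "(LINT \<xi>|lborel. partial l (Y l) \<xi>) = 0"
    proof (rule integral_partial_eq_0)
      show "Y l differentiable (at \<xi>)" for \<xi>
        unfolding Y_def differentiable_def using virial_has_derivative[OF dv] by blast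
    qed (use contP Yi Pi PY in auto)
    then show ?thesis by (simp add: PY)
  qed
  \<comment> \<open>Coercivity makes the drift contribute at most
    \<open>- 2 \<alpha> |xi|^2 / J\<close> times \<open>|v|^2\<close>, where \<open>J\<close> is
    \<open>1 + |xi|^2\<close>. Half of it absorbs the cross term; the other half equals
    \<open>- \<alpha> + \<alpha> / J\<close>. With the dimension from the divergence of
    \<open>xi\<close> there remains \<open>(d + \<alpha>) / J\<close>, which is at most
    \<open>\<alpha> / 2\<close> outside the ball by the choice of \<open>R\<close> and at most
    \<open>d + \<alpha>\<close> inside.\<close>
  have pt: "(\<Sum>l\<in>UNIV. P l \<xi>) \<le> - \<alpha> * ?q \<xi> + (?d + \<alpha>) * (indicator (ball 0 R) \<xi> * ?q \<xi>) + \<alpha> / 2 * ?q \<xi>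
      + 1 / \<alpha> * (\<Sum>l\<in>UNIV. (cmod (?b l \<xi>))\<^sup>2 / ?J \<xi>)" for \<xi>
  proof -
    have nsq: "(\<Sum>l\<in>UNIV. (\<xi> $ l)\<^sup>2) = (norm \<xi>)\<^sup>2"
      by (simp add: norm_vec_def L2_set_def sum_nonneg)
    have "P l \<xi> \<le> (\<alpha> * (\<xi> $ l)\<^sup>2 * ?q \<xi> + (cmod (?b l \<xi>))\<^sup>2 / \<alpha>) / ?J \<xi>
       - 16 * pi\<^sup>2 * (\<xi> $ l * (S *v \<xi>) $ l) / ?J \<xi> * ?q \<xi> + 1 / ?J \<xi> * ?q \<xi>" for l
    proof -
      have "2 * (\<xi> $ l) * (v \<xi> \<bullet> ?b l \<xi>) / ?J \<xi> \<le> (\<alpha> * (\<xi> $ l)\<^sup>2 * ?q \<xi> + (cmod (?b l \<xi>))\<^sup>2 / \<alpha>) / ?J \<xi>"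
        using cross[OF \<alpha>, of \<xi> l] by (intro divide_right_mono) (auto simp: less_imp_le)
      moreover have "(1 / ?J \<xi> - 2 * (\<xi> $ l)\<^sup>2 / (?J \<xi>)\<^sup>2) * ?q \<xi> \<le> 1 / ?J \<xi> * ?q \<xi>"
        by (intro mult_right_mono) auto
      ultimately show ?thesis
        unfolding P_def by simp
    qed
    then have "(\<Sum>l\<in>UNIV. P l \<xi>) \<le> (\<Sum>l\<in>UNIV. (\<alpha> * (\<xi> $ l)\<^sup>2 * ?q \<xi> + (cmod (?b l \<xi>))\<^sup>2 / \<alpha>) / ?J \<xi>
       - 16 * pi\<^sup>2 * (\<xi> $ l * (S *v \<xi>) $ l) / ?J \<xi> * ?q \<xi> + 1 / ?J \<xi> * ?q \<xi>)"
      by (intro sum_mono)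
    also have "\<dots> = (\<alpha> * (\<Sum>l\<in>UNIV. (\<xi> $ l)\<^sup>2) * ?q \<xi> - 16 * pi\<^sup>2 * (\<Sum>l\<in>UNIV. \<xi> $ l * (S *v \<xi>) $ l) * ?q \<xi> + ?d * ?q \<xi>) / ?J \<xi>
        + 1 / \<alpha> * (\<Sum>l\<in>UNIV. (cmod (?b l \<xi>))\<^sup>2 / ?J \<xi>)"
      by (simp add: sum.distrib sum_subtractf sum_distrib_left sum_distrib_right sum_divide_distrib add_divide_distrib diff_divide_distrib mult_ac)
    also have "(\<Sum>l\<in>UNIV. \<xi> $ l * (S *v \<xi>) $ l) = \<xi> \<bullet> (S *v \<xi>)"
      by (simp add: inner_vec_def)
    also have "(\<alpha> * (\<Sum>l\<in>UNIV. (\<xi> $ l)\<^sup>2) * ?q \<xi> - 16 * pi\<^sup>2 * (\<xi> \<bullet> (S *v \<xi>)) * ?q \<xi> + ?d * ?q \<xi>) / ?J \<xi>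
        \<le> - \<alpha> * ?q \<xi> + (?d + \<alpha>) * (?q \<xi> / ?J \<xi>)"
    proof -
      have "16 * pi\<^sup>2 * (a * (norm \<xi>)\<^sup>2) * ?q \<xi> \<le> 16 * pi\<^sup>2 * (\<xi> \<bullet> (S *v \<xi>)) * ?q \<xi>"
        by (intro mult_right_mono mult_left_mono a) auto
      then have "\<alpha> * (norm \<xi>)\<^sup>2 * ?q \<xi> - 16 * pi\<^sup>2 * (\<xi> \<bullet> (S *v \<xi>)) * ?q \<xi> + ?d * ?q \<xi> \<le> - \<alpha> * ?q \<xi> * ?J \<xi> + (?d + \<alpha>) * ?q \<xi>"
        by (simp add: \<alpha>_def algebra_simps)
      then have "(\<alpha> * (norm \<xi>)\<^sup>2 * ?q \<xi> - 16 * pi\<^sup>2 * (\<xi> \<bullet> (S *v \<xi>)) * ?q \<xi> + ?d * ?q \<xi>) / ?J \<xi> \<le> (- \<alpha> * ?q \<xi> * ?J \<xi> + (?d + \<alpha>) * ?q \<xi>) / ?J \<xi>"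
        by (intro divide_right_mono) (auto simp: less_imp_le)
      also have "\<dots> = - \<alpha> * ?q \<xi> + (?d + \<alpha>) * (?q \<xi> / ?J \<xi>)"
        by (subst add_divide_distrib) simp
      finally show ?thesis unfolding nsq .
    qed
    also have "(?d + \<alpha>) * (?q \<xi> / ?J \<xi>) \<le> (?d + \<alpha>) * (indicator (ball 0 R) \<xi> * ?q \<xi>) + \<alpha> / 2 * ?q \<xi>"
    proof (cases "\<xi> \<in> ball 0 R")
      case True
      have "?q \<xi> / ?J \<xi> \<le> ?q \<xi> / 1"
        by (intro divide_left_mono) auto
      then have "(?d + \<alpha>) * (?q \<xi> / ?J \<xi>) \<le> (?d + \<alpha>) * ?q \<xi>"
        using \<alpha> by (intro mult_left_mono) auto
      moreover have "0 \<le> \<alpha> / 2 * ?q \<xi>" using \<alpha> by simp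
      ultimately show ?thesis using True by simp
    next
      case False
      then have "R\<^sup>2 \<le> (norm \<xi>)\<^sup>2"
        using R(2) by (intro power_mono) auto
      then have "(?d + \<alpha>) / ?J \<xi> \<le> (?d + \<alpha>) / (1 + R\<^sup>2)"
        using \<alpha> by (intro divide_left_mono) (auto simp: add_pos_nonneg)
      also note R(1)
      finally have "(?d + \<alpha>) / ?J \<xi> * ?q \<xi> \<le> \<alpha> / 2 * ?q \<xi>"
        by (rule mult_right_mono) simp
      then show ?thesis using False by simp
    qed
    finally show ?thesis by simp
  qed
  have Bi: "integrable lborel (\<lambda>\<xi>. indicator (ball 0 R) \<xi> * ?q \<xi>)"
    using integrable_mult_indicator[OF _ vi, of "ball 0 R"] by simp
  have bsi: "integrable lborel (\<lambda>\<xi>. \<Sum>l\<in>UNIV. (cmod (?b l \<xi>))\<^sup>2 / ?J \<xi>)"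
    by (intro Bochner_Integration.integrable_sum bi)
  have "0 = (LINT \<xi>|lborel. (\<Sum>l\<in>UNIV. P l \<xi>))"
    using Pi zero by (subst Bochner_Integration.integral_sum) auto
  also have "\<dots> \<le> (LINT \<xi>|lborel. - \<alpha> * ?q \<xi> + (?d + \<alpha>) * (indicator (ball 0 R) \<xi> * ?q \<xi>) + \<alpha> / 2 * ?q \<xi>
      + 1 / \<alpha> * (\<Sum>l\<in>UNIV. (cmod (?b l \<xi>))\<^sup>2 / ?J \<xi>))"
    by (intro integral_mono Bochner_Integration.integrable_add Bochner_Integration.integrable_sum integrable_mult_right vi Bi bsi Pi bi pt)
  also have "\<dots> = - \<alpha> * (LINT \<xi>|lborel. ?q \<xi>) + (?d + \<alpha>) * (LINT \<xi>|lborel. indicator (ball 0 R) \<xi> * ?q \<xi>) + \<alpha> / 2 * (LINT \<xi>|lborel. ?q \<xi>)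
      + 1 / \<alpha> * (LINT \<xi>|lborel. (\<Sum>l\<in>UNIV. (cmod (?b l \<xi>))\<^sup>2 / ?J \<xi>))"
    by (simp only: Bochner_Integration.integral_add Bochner_Integration.integrable_add integrable_mult_right vi Bi bsi integral_mult_right_zero)
  also have "(LINT \<xi>|lborel. (\<Sum>l\<in>UNIV. (cmod (?b l \<xi>))\<^sup>2 / ?J \<xi>)) = (\<Sum>l\<in>UNIV. LINT \<xi>|lborel. (cmod (?b l \<xi>))\<^sup>2 / ?J \<xi>)"
    by (intro Bochner_Integration.integral_sum bi)
  finally show ?thesis
  proof -
    have "- \<alpha> * Q = - (\<alpha> / 2 * Q) - \<alpha> / 2 * Q" for Q
      by simp
    note this[of "LINT \<xi>|lborel. ?q \<xi>"]
    moreover assume "0 \<le> - \<alpha> * (LINT \<xi>|lborel. ?q \<xi>) + (?d + \<alpha>) * (LINT \<xi>|lborel. indicator (ball 0 R) \<xi> * ?q \<xi>) + \<alpha> / 2 * (LINT \<xi>|lborel. ?q \<xi>)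
      + 1 / \<alpha> * (\<Sum>l\<in>UNIV. LINT \<xi>|lborel. (cmod (?b l \<xi>))\<^sup>2 / ?J \<xi>)"
    ultimately show ?thesis by linarith
  qed
qed

text \<open>Both estimates are applied to the centred function \<open>v'\<close>. The virial
  estimate controls its full norm by its mass on a ball and the operators;
  \<open>local_poincare\<close> controls that mass by the operators alone, as the centring is the
  one it requires. No smallness is involved, so the two simply add up.\<close>

lemma gauss_poincare_classical:
  fixes S :: "real^'d::finite^'d"
  assumes S: "sym_pos_def S" and Z: "(LINT \<xi>:ball 0 \<epsilon>|lborel. gauss_hat \<mu> S \<xi>) \<noteq> 0"
  shows "\<exists>C>0. \<forall>v. (\<forall>x. v differentiable (at x)) \<longrightarrow> (\<forall>l. continuous_on UNIV (partial l v)) \<longrightarrow>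
    integrable lborel (\<lambda>\<xi>. (cmod (v \<xi>))\<^sup>2) \<longrightarrow>
    (\<forall>l. integrable lborel (\<lambda>\<xi>. (cmod (gauss_op \<mu> S v l \<xi>))\<^sup>2 / (1 + (norm \<xi>)\<^sup>2))) \<longrightarrow>
    (LINT \<xi>|lborel. (cmod (v \<xi> - (LINT \<xi>:ball 0 \<epsilon>|lborel. v \<xi>) / (LINT \<xi>:ball 0 \<epsilon>|lborel. gauss_hat \<mu> S \<xi>) * gauss_hat \<mu> S \<xi>))\<^sup>2)
      \<le> C * (\<Sum>l\<in>UNIV. LINT \<xi>|lborel. (cmod (gauss_op \<mu> S v l \<xi>))\<^sup>2 / (1 + (norm \<xi>)\<^sup>2))"
proof -
  let ?E = "gauss_hat \<mu> S" and ?d = "real CARD('d)"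
  obtain a where a: "a > 0" "\<And>\<xi>. \<xi> \<bullet> (S *v \<xi>) \<ge> a * (norm \<xi>)\<^sup>2"
    using sym_pos_def_coercive[OF S] by blast
  define \<alpha> where "\<alpha> = 8 * pi\<^sup>2 * a"
  have \<alpha>: "\<alpha> > 0" using a by (simp add: \<alpha>_def)
  \<comment> \<open>The radius must contain the averaging ball and satisfy
    \<open>2 (d + \<alpha>) / \<alpha> \<le> 1 + R^2\<close>, the condition under which the virial
    remainder outside is absorbed.\<close>
  define R where "R = max \<epsilon> (sqrt (2 * (?d + \<alpha>) / \<alpha>))"
  have s0: "0 \<le> 2 * (?d + \<alpha>) / \<alpha>" using \<alpha> by simp
  have R0: "R \<ge> 0" unfolding R_def using real_sqrt_ge_zero[OF s0] by linarith
  have "(sqrt (2 * (?d + \<alpha>) / \<alpha>))\<^sup>2 \<le> R\<^sup>2"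
    unfolding R_def using s0 by (intro power_mono) auto
  then have "2 * (?d + \<alpha>) / \<alpha> \<le> 1 + R\<^sup>2"
    using s0 by simp
  then have "2 * (?d + \<alpha>) \<le> \<alpha> * (1 + R\<^sup>2)"
    using \<alpha> by (simp add: divide_le_eq mult.commute)
  moreover have "1 + R\<^sup>2 > 0" by (simp add: add_pos_nonneg)
  ultimately have R1: "(?d + \<alpha>) / (1 + R\<^sup>2) \<le> \<alpha> / 2"
    by (simp add: divide_le_eq)
  have "\<epsilon> \<le> R" by (simp add: R_def)
  from local_poincare[OF S this Z] obtain K where K: "K < \<infinity>"
    and local: "\<And>v. (\<forall>x. v differentiable (at x)) \<Longrightarrow> (\<forall>l. continuous_on UNIV (partial l v)) \<Longrightarrow>
    (\<integral>\<^sup>+x. indicator (ball 0 R) x * ennreal ((cmod (v x - (LINT \<xi>:ball 0 \<epsilon>|lborel. v \<xi>) / (LINT \<xi>:ball 0 \<epsilon>|lborel. ?E \<xi>) * ?E x))\<^sup>2) \<partial>lborel)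
     \<le> K * (\<integral>\<^sup>+x. ennreal (\<Sum>l\<in>UNIV. (cmod (gauss_op \<mu> S v l x))\<^sup>2 / (1 + (norm x)\<^sup>2)) \<partial>lborel)"
    by blast
  define k where "k = enn2real K"
  have Kk: "K = ennreal k" and k0: "k \<ge> 0"
    using K by (auto simp: k_def less_top)
  \<comment> \<open>Inserting the local bound \<open>k\<close> into the virial estimate and dividing
    by \<open>\<alpha> / 2\<close>.\<close>
  define C where "C = 2 / \<alpha> * ((?d + \<alpha>) * k + 1 / \<alpha>)"
  have "C > 0"
    unfolding C_def using \<alpha> k0 by (intro mult_pos_pos add_nonneg_pos mult_nonneg_nonneg) auto
  moreover have "(LINT \<xi>|lborel. (cmod (v \<xi> - (LINT \<xi>:ball 0 \<epsilon>|lborel. v \<xi>) / (LINT \<xi>:ball 0 \<epsilon>|lborel. ?E \<xi>) * ?E \<xi>))\<^sup>2)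
      \<le> C * (\<Sum>l\<in>UNIV. LINT \<xi>|lborel. (cmod (gauss_op \<mu> S v l \<xi>))\<^sup>2 / (1 + (norm \<xi>)\<^sup>2))"
    if dv: "\<forall>x. v differentiable (at x)" and cv: "\<forall>l. continuous_on UNIV (partial l v)"
      and vi: "integrable lborel (\<lambda>\<xi>. (cmod (v \<xi>))\<^sup>2)"
      and bi: "\<forall>l. integrable lborel (\<lambda>\<xi>. (cmod (gauss_op \<mu> S v l \<xi>))\<^sup>2 / (1 + (norm \<xi>)\<^sup>2))" for v
  proof -
    define \<tau> where "\<tau> = (LINT \<xi>:ball 0 \<epsilon>|lborel. v \<xi>) / (LINT \<xi>:ball 0 \<epsilon>|lborel. ?E \<xi>)"
    define v' where "v' = (\<lambda>\<xi>. v \<xi> - \<tau> * ?E \<xi>)"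
    let ?T = "\<Sum>l\<in>UNIV. LINT \<xi>|lborel. (cmod (gauss_op \<mu> S v l \<xi>))\<^sup>2 / (1 + (norm \<xi>)\<^sup>2)"
    have op: "gauss_op \<mu> S v' l = gauss_op \<mu> S v l" for l
      unfolding v'_def using dv by (intro ext gauss_op_diff_gauss_hat S) auto
    have part: "partial l v' = (\<lambda>\<xi>. partial l v \<xi> - \<tau> * partial l ?E \<xi>)" for l
      unfolding v'_def using dv by (intro ext gauss_op_diff_gauss_hat(2)[OF S]) auto
    have dv': "v' differentiable (at x)" for x
      unfolding v'_def using dv gauss_hat_differentiable[OF S] by (intro differentiable_diff differentiable_mult differentiable_const) auto
    have cv': "continuous_on UNIV (partial l v')" for l
    proof -
      have "continuous_on UNIV (partial l ?E)"
        by (intro continuous_on_schwartz schwartz_partial gauss_hat_schwartz S)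
      then show ?thesis
        unfolding part using cv by (intro continuous_intros) auto
    qed
    have contv: "continuous_on UNIV v"
      using dv by (simp add: continuous_at_imp_continuous_on differentiable_imp_continuous_within)
    have [measurable]: "v \<in> borel_measurable borel" "?E \<in> borel_measurable borel"
      using contv borel_measurable_gauss_hat[OF S] by (auto intro: borel_measurable_continuous_onI)
    have ball[measurable]: "ball (0::real^'d) R \<in> sets borel" by simp
    have Ei: "integrable lborel (\<lambda>\<xi>. (cmod (\<tau> * ?E \<xi>))\<^sup>2)"
      using square_integrable_schwartz[OF schwartz_cmult[OF gauss_hat_schwartz[OF S]]] by (simp add: square_integrable_def)
    have vi': "integrable lborel (\<lambda>\<xi>. (cmod (v' \<xi>))\<^sup>2)"
      unfolding v'_def by (intro L2_diff(1) vi Ei) measurable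
    have bi': "integrable lborel (\<lambda>\<xi>. (cmod (gauss_op \<mu> S v' l \<xi>))\<^sup>2 / (1 + (norm \<xi>)\<^sup>2))" for l
      unfolding op using bi by blast
    have vir: "\<alpha> / 2 * (LINT \<xi>|lborel. (cmod (v' \<xi>))\<^sup>2) \<le> (?d + \<alpha>) * (LINT \<xi>|lborel. indicator (ball 0 R) \<xi> * (cmod (v' \<xi>))\<^sup>2) + 1 / \<alpha> * ?T"
      using virial_estimate[OF a dv' cv' vi' bi' R1[unfolded \<alpha>_def] R0] unfolding op \<alpha>_def by simp
    have Bi: "integrable lborel (\<lambda>\<xi>. indicator (ball 0 R) \<xi> * (cmod (v' \<xi>))\<^sup>2)"
      using integrable_mult_indicator[OF _ vi', of "ball 0 R"] by simp
    have bsi: "integrable lborel (\<lambda>\<xi>. \<Sum>l\<in>UNIV. (cmod (gauss_op \<mu> S v l \<xi>))\<^sup>2 / (1 + (norm \<xi>)\<^sup>2))"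
      using bi by (intro Bochner_Integration.integrable_sum) auto
    have T0: "?T \<ge> 0"
      by (intro sum_nonneg Bochner_Integration.integral_nonneg) (auto simp: less_imp_le)
    have "ennreal (LINT \<xi>|lborel. indicator (ball 0 R) \<xi> * (cmod (v' \<xi>))\<^sup>2) = (\<integral>\<^sup>+\<xi>. ennreal (indicator (ball 0 R) \<xi> * (cmod (v' \<xi>))\<^sup>2) \<partial>lborel)"
      by (rule nn_integral_eq_integral[OF Bi, symmetric]) simp
    also have "\<dots> = (\<integral>\<^sup>+\<xi>. indicator (ball 0 R) \<xi> * ennreal ((cmod (v' \<xi>))\<^sup>2) \<partial>lborel)"
      by (intro nn_integral_cong) (simp add: indicator_def)
    also have "\<dots> \<le> K * (\<integral>\<^sup>+x. ennreal (\<Sum>l\<in>UNIV. (cmod (gauss_op \<mu> S v l x))\<^sup>2 / (1 + (norm x)\<^sup>2)) \<partial>lborel)"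
      using local[OF dv cv] by (simp add: v'_def \<tau>_def)
    also have "(\<integral>\<^sup>+x. ennreal (\<Sum>l\<in>UNIV. (cmod (gauss_op \<mu> S v l x))\<^sup>2 / (1 + (norm x)\<^sup>2)) \<partial>lborel) = ennreal ?T"
      using bi by (subst nn_integral_eq_integral[OF bsi]) (auto intro!: sum_nonneg simp: less_imp_le Bochner_Integration.integral_sum)
    also have "K * ennreal ?T = ennreal (k * ?T)"
      using k0 T0 by (simp add: Kk ennreal_mult)
    finally have "(LINT \<xi>|lborel. indicator (ball 0 R) \<xi> * (cmod (v' \<xi>))\<^sup>2) \<le> k * ?T"
      using k0 T0 by (simp add: ennreal_le_iff mult_nonneg_nonneg)
    then have "(?d + \<alpha>) * (LINT \<xi>|lborel. indicator (ball 0 R) \<xi> * (cmod (v' \<xi>))\<^sup>2) \<le> (?d + \<alpha>) * (k * ?T)"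
      using \<alpha> by (intro mult_left_mono) auto
    with vir have "\<alpha> / 2 * (LINT \<xi>|lborel. (cmod (v' \<xi>))\<^sup>2) \<le> (?d + \<alpha>) * (k * ?T) + 1 / \<alpha> * ?T"
      by linarith
    then have "2 / \<alpha> * (\<alpha> / 2 * (LINT \<xi>|lborel. (cmod (v' \<xi>))\<^sup>2)) \<le> 2 / \<alpha> * ((?d + \<alpha>) * (k * ?T) + 1 / \<alpha> * ?T)"
      using \<alpha> by (intro mult_left_mono) auto
    also have "\<dots> = C * ?T"
      unfolding C_def by (simp only: distrib_right distrib_left mult.assoc)
    finally show ?thesis
      using \<alpha> by (simp add: v'_def \<tau>_def)
  qed
  ultimately show ?thesis by blast
qed

text \<open>Peetre's inequality, from \<open>|xi|^2 \<le> 2 |zeta|^2 + 2 |zeta - xi|^2\<close>. It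
  lets the weight pass through a convolution at the cost of a second moment of the kernel.\<close>

lemma peetre: "1 / (1 + (norm \<zeta>)\<^sup>2) \<le> 2 * (1 + (norm (\<zeta> - \<xi>))\<^sup>2) / (1 + (norm \<xi>)\<^sup>2)"
proof -
  have "(norm \<xi>)\<^sup>2 \<le> 2 * (norm \<zeta>)\<^sup>2 + 2 * (norm (\<zeta> - \<xi>))\<^sup>2"
    using norm_diff_square_le[of \<zeta> "\<zeta> - \<xi>"] by simp
  moreover have "0 \<le> (norm \<zeta>)\<^sup>2 * (norm (\<zeta> - \<xi>))\<^sup>2" by simp
  moreover have e: "2 * (1 + p) * (1 + q) = 2 + 2 * q + 2 * p + 2 * (q * p)" for p q :: real
    by (simp add: algebra_simps)
  ultimately have "1 + (norm \<xi>)\<^sup>2 \<le> 2 * (1 + (norm (\<zeta> - \<xi>))\<^sup>2) * (1 + (norm \<zeta>)\<^sup>2)"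
    unfolding e by linarith
  then show ?thesis
    by (simp add: field_simps add_pos_nonneg)
qed

text \<open>Young's inequality for a convolution of an integrable kernel with a function in the
  weighted \<open>L^2\<close> space. Writing the kernel as a product of square roots, Cauchy-Schwarz
  extracts its mass; after Tonelli, \<open>peetre\<close> moves the weight from the outer to the
  inner variable and leaves the weighted mass of the kernel.\<close>

lemma weighted_young:
  fixes \<kappa> B :: "real^'d::finite \<Rightarrow> real"
  assumes [measurable]: "\<kappa> \<in> borel_measurable borel" "B \<in> borel_measurable borel"
    and \<kappa>0: "\<And>z. \<kappa> z \<ge> 0" and B0: "\<And>z. B z \<ge> 0"
  shows "(\<integral>\<^sup>+\<zeta>. (\<integral>\<^sup>+\<xi>. ennreal (B \<xi> * \<kappa> (\<zeta> - \<xi>)) \<partial>lborel)\<^sup>2 * ennreal (1 / (1 + (norm \<zeta>)\<^sup>2)) \<partial>lborel)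
    \<le> (\<integral>\<^sup>+z. ennreal (\<kappa> z) \<partial>lborel) * (\<integral>\<^sup>+z. ennreal (2 * (1 + (norm z)\<^sup>2) * \<kappa> z) \<partial>lborel)
      * (\<integral>\<^sup>+\<xi>. ennreal ((B \<xi>)\<^sup>2 / (1 + (norm \<xi>)\<^sup>2)) \<partial>lborel)"
proof -
  let ?A = "\<integral>\<^sup>+z. ennreal (\<kappa> z) \<partial>lborel" and ?A' = "\<integral>\<^sup>+z. ennreal (2 * (1 + (norm z)\<^sup>2) * \<kappa> z) \<partial>lborel"
  have shift: "(\<integral>\<^sup>+\<xi>. g (\<zeta> - \<xi>) \<partial>lborel) = (\<integral>\<^sup>+z. g z \<partial>lborel)" if [measurable]: "g \<in> borel_measurable borel"
    for g :: "real^'d \<Rightarrow> ennreal" and \<zeta>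
    using nn_integral_lborel_affine[of g "-1" \<zeta>] by simp
  have shift': "(\<integral>\<^sup>+\<zeta>. g (\<zeta> - \<xi>) \<partial>lborel) = (\<integral>\<^sup>+z. g z \<partial>lborel)" if [measurable]: "g \<in> borel_measurable borel"
    for g :: "real^'d \<Rightarrow> ennreal" and \<xi>
    using nn_integral_lborel_affine[of g 1 "- \<xi>"] by simp
  have CS: "(\<integral>\<^sup>+\<xi>. ennreal (B \<xi> * \<kappa> (\<zeta> - \<xi>)) \<partial>lborel)\<^sup>2 \<le> (\<integral>\<^sup>+\<xi>. ennreal ((B \<xi>)\<^sup>2 * \<kappa> (\<zeta> - \<xi>)) \<partial>lborel) * ?A" for \<zeta>
  proof -
    have "(\<integral>\<^sup>+\<xi>. ennreal (B \<xi> * \<kappa> (\<zeta> - \<xi>)) \<partial>lborel) = (\<integral>\<^sup>+\<xi>. ennreal (B \<xi> * sqrt (\<kappa> (\<zeta> - \<xi>))) * ennreal (sqrt (\<kappa> (\<zeta> - \<xi>))) \<partial>lborel)"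
      using B0 \<kappa>0 by (intro nn_integral_cong) (simp add: ennreal_mult'[symmetric] mult.assoc)
    then have "(\<integral>\<^sup>+\<xi>. ennreal (B \<xi> * \<kappa> (\<zeta> - \<xi>)) \<partial>lborel)\<^sup>2 \<le>
      (\<integral>\<^sup>+\<xi>. (ennreal (B \<xi> * sqrt (\<kappa> (\<zeta> - \<xi>))))\<^sup>2 \<partial>lborel) * (\<integral>\<^sup>+\<xi>. (ennreal (sqrt (\<kappa> (\<zeta> - \<xi>))))\<^sup>2 \<partial>lborel)"
      by (simp only:) (rule Cauchy_Schwarz_nn_integral, measurable)
    also have "(\<integral>\<^sup>+\<xi>. (ennreal (sqrt (\<kappa> (\<zeta> - \<xi>))))\<^sup>2 \<partial>lborel) = ?A"
      using \<kappa>0 shift[of "\<lambda>z. ennreal (\<kappa> z)" \<zeta>] by (simp add: ennreal_power)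
    also have "(\<integral>\<^sup>+\<xi>. (ennreal (B \<xi> * sqrt (\<kappa> (\<zeta> - \<xi>))))\<^sup>2 \<partial>lborel) = (\<integral>\<^sup>+\<xi>. ennreal ((B \<xi>)\<^sup>2 * \<kappa> (\<zeta> - \<xi>)) \<partial>lborel)"
      using B0 \<kappa>0 by (simp add: ennreal_power power_mult_distrib)
    finally show ?thesis .
  qed
  have "(\<integral>\<^sup>+\<zeta>. \<integral>\<^sup>+\<xi>. ennreal ((B \<xi>)\<^sup>2 * \<kappa> (\<zeta> - \<xi>)) * ennreal (1 / (1 + (norm \<zeta>)\<^sup>2)) \<partial>lborel \<partial>lborel)
     = (\<integral>\<^sup>+\<xi>. \<integral>\<^sup>+\<zeta>. ennreal ((B \<xi>)\<^sup>2 * \<kappa> (\<zeta> - \<xi>)) * ennreal (1 / (1 + (norm \<zeta>)\<^sup>2)) \<partial>lborel \<partial>lborel)"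
    by (rule lborel_pair.Fubini') measurable
  also have "\<dots> \<le> (\<integral>\<^sup>+\<xi>. \<integral>\<^sup>+\<zeta>. ennreal ((B \<xi>)\<^sup>2 / (1 + (norm \<xi>)\<^sup>2)) * ennreal (2 * (1 + (norm (\<zeta> - \<xi>))\<^sup>2) * \<kappa> (\<zeta> - \<xi>)) \<partial>lborel \<partial>lborel)"
  proof (intro nn_integral_mono)
    fix \<xi> \<zeta> :: "real^'d"
    have "((B \<xi>)\<^sup>2 * \<kappa> (\<zeta> - \<xi>)) * (1 / (1 + (norm \<zeta>)\<^sup>2)) \<le> ((B \<xi>)\<^sup>2 * \<kappa> (\<zeta> - \<xi>)) * (2 * (1 + (norm (\<zeta> - \<xi>))\<^sup>2) / (1 + (norm \<xi>)\<^sup>2))"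
      using \<kappa>0 by (intro mult_left_mono peetre mult_nonneg_nonneg) auto
    also have "\<dots> = ((B \<xi>)\<^sup>2 / (1 + (norm \<xi>)\<^sup>2)) * (2 * (1 + (norm (\<zeta> - \<xi>))\<^sup>2) * \<kappa> (\<zeta> - \<xi>))"
      by simp
    finally have "ennreal (((B \<xi>)\<^sup>2 * \<kappa> (\<zeta> - \<xi>)) * (1 / (1 + (norm \<zeta>)\<^sup>2))) \<le> ennreal (((B \<xi>)\<^sup>2 / (1 + (norm \<xi>)\<^sup>2)) * (2 * (1 + (norm (\<zeta> - \<xi>))\<^sup>2) * \<kappa> (\<zeta> - \<xi>)))"
      by (rule ennreal_leI)
    then show "ennreal ((B \<xi>)\<^sup>2 * \<kappa> (\<zeta> - \<xi>)) * ennreal (1 / (1 + (norm \<zeta>)\<^sup>2)) \<le>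
       ennreal ((B \<xi>)\<^sup>2 / (1 + (norm \<xi>)\<^sup>2)) * ennreal (2 * (1 + (norm (\<zeta> - \<xi>))\<^sup>2) * \<kappa> (\<zeta> - \<xi>))"
      using \<kappa>0[of "\<zeta> - \<xi>"] by (subst (1 2) ennreal_mult[symmetric]) (auto simp: less_imp_le)
  qed
  also have "\<dots> = (\<integral>\<^sup>+\<xi>. ennreal ((B \<xi>)\<^sup>2 / (1 + (norm \<xi>)\<^sup>2)) * ?A' \<partial>lborel)"
    by (intro nn_integral_cong, subst nn_integral_cmult, measurable)
      (subst shift'[of "\<lambda>z. ennreal (2 * (1 + (norm z)\<^sup>2) * \<kappa> z)"], measurable)
  also have "\<dots> = (\<integral>\<^sup>+\<xi>. ennreal ((B \<xi>)\<^sup>2 / (1 + (norm \<xi>)\<^sup>2)) \<partial>lborel) * ?A'"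
    by (rule nn_integral_multc) measurable
  finally have tonelli: "(\<integral>\<^sup>+\<zeta>. \<integral>\<^sup>+\<xi>. ennreal ((B \<xi>)\<^sup>2 * \<kappa> (\<zeta> - \<xi>)) * ennreal (1 / (1 + (norm \<zeta>)\<^sup>2)) \<partial>lborel \<partial>lborel)
     \<le> (\<integral>\<^sup>+\<xi>. ennreal ((B \<xi>)\<^sup>2 / (1 + (norm \<xi>)\<^sup>2)) \<partial>lborel) * ?A'" .
  have "(\<integral>\<^sup>+\<zeta>. (\<integral>\<^sup>+\<xi>. ennreal (B \<xi> * \<kappa> (\<zeta> - \<xi>)) \<partial>lborel)\<^sup>2 * ennreal (1 / (1 + (norm \<zeta>)\<^sup>2)) \<partial>lborel)
     \<le> (\<integral>\<^sup>+\<zeta>. ?A * (\<integral>\<^sup>+\<xi>. ennreal ((B \<xi>)\<^sup>2 * \<kappa> (\<zeta> - \<xi>)) * ennreal (1 / (1 + (norm \<zeta>)\<^sup>2)) \<partial>lborel) \<partial>lborel)"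
  proof (intro nn_integral_mono)
    fix \<zeta> :: "real^'d"
    have "(\<integral>\<^sup>+\<xi>. ennreal (B \<xi> * \<kappa> (\<zeta> - \<xi>)) \<partial>lborel)\<^sup>2 * ennreal (1 / (1 + (norm \<zeta>)\<^sup>2))
       \<le> ((\<integral>\<^sup>+\<xi>. ennreal ((B \<xi>)\<^sup>2 * \<kappa> (\<zeta> - \<xi>)) \<partial>lborel) * ?A) * ennreal (1 / (1 + (norm \<zeta>)\<^sup>2))"
      by (intro mult_right_mono CS) simp
    also have "\<dots> = ?A * ((\<integral>\<^sup>+\<xi>. ennreal ((B \<xi>)\<^sup>2 * \<kappa> (\<zeta> - \<xi>)) \<partial>lborel) * ennreal (1 / (1 + (norm \<zeta>)\<^sup>2)))"
      by (simp only: mult_ac)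
    also have "\<dots> = ?A * (\<integral>\<^sup>+\<xi>. ennreal ((B \<xi>)\<^sup>2 * \<kappa> (\<zeta> - \<xi>)) * ennreal (1 / (1 + (norm \<zeta>)\<^sup>2)) \<partial>lborel)"
      by (subst nn_integral_multc) auto
    finally show "(\<integral>\<^sup>+\<xi>. ennreal (B \<xi> * \<kappa> (\<zeta> - \<xi>)) \<partial>lborel)\<^sup>2 * ennreal (1 / (1 + (norm \<zeta>)\<^sup>2)) \<le> \<dots>" .
  qed
  also have "\<dots> = ?A * (\<integral>\<^sup>+\<zeta>. \<integral>\<^sup>+\<xi>. ennreal ((B \<xi>)\<^sup>2 * \<kappa> (\<zeta> - \<xi>)) * ennreal (1 / (1 + (norm \<zeta>)\<^sup>2)) \<partial>lborel \<partial>lborel)"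
    by (rule nn_integral_cmult) measurable
  also have "\<dots> \<le> ?A * ((\<integral>\<^sup>+\<xi>. ennreal ((B \<xi>)\<^sup>2 / (1 + (norm \<xi>)\<^sup>2)) \<partial>lborel) * ?A')"
    by (intro mult_left_mono tonelli) simp
  finally show ?thesis
    by (simp only: mult_ac)
qed

section \<open>The weighted Poincare inequality for weak solutions\<close>

text \<open>A Gaussian of mass 1 for positive \<open>a\<close>, concentrating at the origin as
  \<open>a\<close> grows.\<close>

definition mollifier :: "real \<Rightarrow> real^'d::finite \<Rightarrow> real" where
  "mollifier a z = a ^ CARD('d) * gaussian a 0 z"

lemma borel_measurable_mollifier [measurable]: "mollifier a \<in> borel_measurable borel"
  unfolding mollifier_def[abs_def] by measurable

lemma mollifier_nonneg: "a > 0 \<Longrightarrow> mollifier a z \<ge> 0"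
  by (simp add: mollifier_def)

lemma mollifier_moment:
  fixes p :: "real^'d::finite \<Rightarrow> real"
  assumes a: "a > 0" and [measurable]: "p \<in> borel_measurable borel"
  shows "(\<integral>\<^sup>+z. ennreal (p z * mollifier a z) \<partial>lborel) = (\<integral>\<^sup>+z. ennreal (p ((1 / a) *\<^sub>R z) * gaussian 1 0 z) \<partial>lborel)"
proof -
  have g: "gaussian a 0 ((1 / a) *\<^sub>R z) = gaussian 1 0 z" for z :: "real^'d"
    using gaussian_affine[OF a, of 0 z] by simp
  have "(\<integral>\<^sup>+z. ennreal (p z * mollifier a z) \<partial>lborel)
      = ennreal (\<bar>1 / a\<bar> ^ DIM(real^'d)) * (\<integral>\<^sup>+z. ennreal (p (0 + (1 / a) *\<^sub>R z) * mollifier a (0 + (1 / a) *\<^sub>R z)) \<partial>lborel)"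
    using a by (intro nn_integral_lborel_affine) auto
  also have "\<dots> = (\<integral>\<^sup>+z. ennreal (\<bar>1 / a\<bar> ^ DIM(real^'d)) * ennreal (p (0 + (1 / a) *\<^sub>R z) * mollifier a (0 + (1 / a) *\<^sub>R z)) \<partial>lborel)"
    by (rule nn_integral_cmult[symmetric]) measurable
  also have "\<dots> = (\<integral>\<^sup>+z. ennreal (p ((1 / a) *\<^sub>R z) * gaussian 1 0 z) \<partial>lborel)"
    using a by (intro nn_integral_cong, subst ennreal_mult'[symmetric])
      (auto simp: mollifier_def g power_divide)
  finally show ?thesis .
qed

text \<open>One crude constant for all the moments that occur: the factor 2 is the one from
  \<open>peetre\<close>, and the cube covers the largest moment, that of
  \<open>|z| (1 + |z|^2)\<close>. The type argument carries the dimension.\<close>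

definition gauss_mass :: "('d::finite) itself \<Rightarrow> ennreal" where
  "gauss_mass _ = (\<integral>\<^sup>+z. ennreal (2 * (1 + norm z) ^ 3 * gaussian 1 0 (z::real^'d)) \<partial>lborel)"

lemma gauss_mass_finite: "gauss_mass TYPE('d::finite) < \<infinity>"
proof -
  have "integrable lborel (\<lambda>z::real^'d. (1 + norm z) ^ 3 * cmod (complex_of_real (gaussian 1 0 z)))"
    by (intro integrable_schwartz_poly gaussian_schwartz) simp
  then have "integrable lborel (\<lambda>z::real^'d. 2 * ((1 + norm z) ^ 3 * gaussian 1 0 z))"
    by simp
  then have "integrable lborel (\<lambda>z::real^'d. 2 * (1 + norm z) ^ 3 * gaussian 1 0 z)"
    by (simp only: mult.assoc)
  then show ?thesis
    unfolding gauss_mass_def by (simp add: integrable_iff_bounded abs_mult)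
qed

lemma mollifier_moment_le:
  fixes p :: "real^'d::finite \<Rightarrow> real"
  assumes a: "a \<ge> 1" and [measurable]: "p \<in> borel_measurable borel" and c: "c \<ge> 0"
    and p: "\<And>z. p ((1 / a) *\<^sub>R z) \<le> c * (2 * (1 + norm z) ^ 3)"
  shows "(\<integral>\<^sup>+z. ennreal (p z * mollifier a z) \<partial>lborel) \<le> ennreal c * gauss_mass TYPE('d)"
proof -
  have "(\<integral>\<^sup>+z. ennreal (p z * mollifier a z) \<partial>lborel) = (\<integral>\<^sup>+z. ennreal (p ((1 / a) *\<^sub>R z) * gaussian 1 0 z) \<partial>lborel)"
    using a by (intro mollifier_moment) auto
  also have "\<dots> \<le> (\<integral>\<^sup>+z. ennreal c * ennreal (2 * (1 + norm z) ^ 3 * gaussian 1 0 (z::real^'d)) \<partial>lborel)"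
  proof (intro nn_integral_mono)
    fix z :: "real^'d"
    have "p ((1 / a) *\<^sub>R z) * gaussian 1 0 z \<le> (c * (2 * (1 + norm z) ^ 3)) * gaussian 1 0 z"
      by (intro mult_right_mono p) simp
    then show "ennreal (p ((1 / a) *\<^sub>R z) * gaussian 1 0 z) \<le> ennreal c * ennreal (2 * (1 + norm z) ^ 3 * gaussian 1 0 z)"
      using c by (subst ennreal_mult'[symmetric]) (auto intro!: ennreal_leI simp: mult.assoc)
  qed
  also have "\<dots> = ennreal c * gauss_mass TYPE('d)"
    unfolding gauss_mass_def by (rule nn_integral_cmult) measurable
  finally show ?thesis .
qed

text \<open>Rescaling to the unit Gaussian gives each factor \<open>norm z\<close> a factor
  \<open>1 / a\<close>, which is at most 1. In the last two moments one such factor is kept; it is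
  what makes the commutator vanish in the limit.\<close>

lemma mollifier_moments:
  fixes a :: real
  assumes a: "a \<ge> 1"
  shows "(\<integral>\<^sup>+z. ennreal (mollifier a (z::real^'d)) \<partial>lborel) \<le> gauss_mass TYPE('d::finite)" (is ?g1)
    and "(\<integral>\<^sup>+z. ennreal (2 * (1 + (norm z)\<^sup>2) * mollifier a (z::real^'d)) \<partial>lborel) \<le> gauss_mass TYPE('d)" (is ?g2)
    and "(\<integral>\<^sup>+z. ennreal (norm z * mollifier a (z::real^'d)) \<partial>lborel) \<le> ennreal (1 / a) * gauss_mass TYPE('d)" (is ?g3)
    and "(\<integral>\<^sup>+z. ennreal (2 * (1 + (norm z)\<^sup>2) * (norm z * mollifier a (z::real^'d))) \<partial>lborel) \<le> ennreal (1 / a) * gauss_mass TYPE('d)" (is ?g4)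
proof -
  have cube: "(1 + t) ^ 3 = 1 + 3 * t + 3 * t\<^sup>2 + t ^ 3" for t :: real
    by (simp add: power3_eq_cube power2_eq_square algebra_simps)
  have s: "norm ((1 / a) *\<^sub>R z) = norm z / a" for z :: "real^'d"
    using a by simp
  have le: "norm z / a \<le> norm z" for z :: "real^'d"
    using a mult_left_mono[of 1 a "norm z"] by (simp add: divide_le_eq)
  have sq: "(norm z / a)\<^sup>2 \<le> (norm z)\<^sup>2" for z :: "real^'d"
    using a by (intro power_mono le) auto
  have lin: "1 \<le> 1 * (2 * (1 + 3 * p + 3 * q + r))" "s \<le> q \<Longrightarrow> 2 * (1 + s) \<le> 1 * (2 * (1 + 3 * p + 3 * q + r))"
    "p \<le> 2 * (1 + 3 * p + 3 * q + r)" "2 * (p + r) \<le> 2 * (1 + 3 * p + 3 * q + r)"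
    if "0 \<le> p" "0 \<le> q" "0 \<le> r" for p q r s :: real
    using that by simp_all
  have b1: "1 \<le> 1 * (2 * (1 + norm z) ^ 3)" for z :: "real^'d"
    unfolding cube by (rule lin(1)) auto
  have b2: "2 * (1 + (norm ((1 / a) *\<^sub>R z))\<^sup>2) \<le> 1 * (2 * (1 + norm z) ^ 3)" for z :: "real^'d"
    unfolding s cube using sq[of z] by (rule lin(2)[rotated 3]) auto
  have b3: "norm ((1 / a) *\<^sub>R z) \<le> 1 / a * (2 * (1 + norm z) ^ 3)" for z :: "real^'d"
  proof -
    have "1 / a * norm z \<le> 1 / a * (2 * (1 + norm z) ^ 3)"
      unfolding cube using a by (intro mult_left_mono lin(3)) auto
    then show ?thesis unfolding s by simp
  qed
  have b4: "2 * (1 + (norm ((1 / a) *\<^sub>R z))\<^sup>2) * norm ((1 / a) *\<^sub>R z) \<le> 1 / a * (2 * (1 + norm z) ^ 3)" for z :: "real^'d"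
  proof -
    have "2 * (1 + (norm z / a)\<^sup>2) * norm z \<le> 2 * (1 + (norm z)\<^sup>2) * norm z"
      using sq[of z] by (intro mult_right_mono) auto
    also have "\<dots> = 2 * (norm z + norm z ^ 3)"
      by (simp add: power3_eq_cube power2_eq_square algebra_simps)
    also have "\<dots> \<le> 2 * (1 + norm z) ^ 3"
      unfolding cube by (rule lin(4)) auto
    finally have "1 / a * (2 * (1 + (norm z / a)\<^sup>2) * norm z) \<le> 1 / a * (2 * (1 + norm z) ^ 3)"
      using a by (intro mult_left_mono) auto
    then show ?thesis
      unfolding s by (simp add: mult_ac)
  qed
  have "0 \<le> 1 / a" using a by simp
  show ?g1
    using mollifier_moment_le[OF a, of "\<lambda>z::real^'d. 1" 1] b1 by simp
  show ?g2
    using mollifier_moment_le[OF a, of "\<lambda>z::real^'d. 2 * (1 + (norm z)\<^sup>2)" 1, OF _ _ b2] by simp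
  show ?g3
    using mollifier_moment_le[OF a, of "\<lambda>z::real^'d. norm z" "1 / a", OF _ \<open>0 \<le> 1 / a\<close> b3] by simp
  show ?g4
    using mollifier_moment_le[OF a, of "\<lambda>z::real^'d. 2 * (1 + (norm z)\<^sup>2) * norm z" "1 / a", OF _ \<open>0 \<le> 1 / a\<close> b4]
    by (simp only: mult.assoc) simp
qed

section \<open>Mollifying weak solutions\<close>

lemma integrable_gaussian_cutoff:
  fixes f :: "real^'d::finite \<Rightarrow> complex"
  assumes f: "square_integrable f" and c: "c > 0"
  shows "integrable lborel (\<lambda>x. (1 + norm x) ^ N * cmod (f x * complex_of_real (gaussian c 0 x)))"
proof -
  have [measurable]: "f \<in> borel_measurable borel"
    using f by (simp add: square_integrable_def)
  have "integrable lborel (\<lambda>x. cmod (f x) * ((1 + norm x) ^ N * gaussian c 0 x))"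
  proof (rule integrable_mult_L2)
    show "integrable lborel (\<lambda>x. (cmod (f x))\<^sup>2)"
      using f by (simp add: square_integrable_def)
    have "integrable lborel (\<lambda>x::real^'d. (1 + norm x) ^ (2 * N) * (cmod (complex_of_real (gaussian c 0 x)))\<^sup>2)"
      by (intro integrable_schwartz_poly_sq gaussian_schwartz c)
    then show "integrable lborel (\<lambda>x::real^'d. ((1 + norm x) ^ N * gaussian c 0 x)\<^sup>2)"
      by (simp add: power_mult_distrib power_mult[symmetric] mult.commute[of N 2])
  qed measurable
  then show ?thesis
    by (simp add: norm_mult mult_ac)
qed

text \<open>Mollification seen from the side of \<open>f\<close>: multiplying \<open>f\<close> by a
  Gaussian of width \<open>a\<close> convolves its transform with \<open>mollifier a\<close>. This
  side gives regularity at once, since the product has all moments.\<close>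

definition gaussian_cutoff :: "(real^'d::finite \<Rightarrow> complex) \<Rightarrow> real \<Rightarrow> real^'d \<Rightarrow> complex" where
  "gaussian_cutoff f a x = f x * complex_of_real (gaussian (1 / a) 0 x)"

lemma gaussian_cutoff_smooth:
  fixes f :: "real^'d::finite \<Rightarrow> complex"
  assumes f: "square_integrable f" and a: "a > 0"
  defines "v \<equiv> fourier_integral (gaussian_cutoff f a)"
  shows "v differentiable (at \<zeta>)" and "continuous_on UNIV (partial l v)"
    and "partial l v \<zeta> = fourier_integral (\<lambda>x. - 2 * pi * \<i> * (x $ l) * gaussian_cutoff f a x) \<zeta>"
proof -
  let ?F = "gaussian_cutoff f a"
  have [measurable]: "f \<in> borel_measurable borel"
    using f by (simp add: square_integrable_def)
  have Fm[measurable]: "?F \<in> borel_measurable borel"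
    unfolding gaussian_cutoff_def[abs_def] by measurable
  have Fi: "integrable lborel (\<lambda>x. (1 + norm x) ^ N * cmod (?F x))" for N
    unfolding gaussian_cutoff_def using a by (intro integrable_gaussian_cutoff f) simp
  show "v differentiable (at \<zeta>)"
    unfolding v_def by (intro fourier_integral_differentiable Fm Fi)
  show p: "partial l v \<zeta> = fourier_integral (\<lambda>x. - 2 * pi * \<i> * (x $ l) * ?F x) \<zeta>" for \<zeta>
    unfolding v_def by (intro partial_fourier_integral Fm Fi)
  \<comment> \<open>Continuity of the partial is obtained from its differentiability, which needs
    two moments more than the coordinate factor: in all a third moment.\<close>
  have "integrable lborel (\<lambda>x. (1 + norm x)\<^sup>2 * cmod (- 2 * pi * \<i> * (x $ l) * ?F x))"
  proof (rule Bochner_Integration.integrable_bound)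
    show "integrable lborel (\<lambda>x. 2 * pi * ((1 + norm x) ^ 3 * cmod (?F x)))"
      by (intro integrable_mult_right Fi)
    show "AE x in lborel. norm ((1 + norm x)\<^sup>2 * cmod (- 2 * pi * \<i> * (x $ l) * ?F x)) \<le> norm (2 * pi * ((1 + norm x) ^ 3 * cmod (?F x)))"
    proof (rule AE_I2)
      fix x :: "real^'d"
      have "\<bar>x $ l\<bar> \<le> 1 + norm x"
        using component_le_norm_cart[of x l] by simp
      then have "(2 * pi * (1 + norm x)\<^sup>2 * cmod (?F x)) * \<bar>x $ l\<bar> \<le> (2 * pi * (1 + norm x)\<^sup>2 * cmod (?F x)) * (1 + norm x)"
        by (rule mult_left_mono) auto
      then show "norm ((1 + norm x)\<^sup>2 * cmod (- 2 * pi * \<i> * (x $ l) * ?F x)) \<le> norm (2 * pi * ((1 + norm x) ^ 3 * cmod (?F x)))"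
        by (simp add: norm_mult abs_mult power3_eq_cube power2_eq_square mult_ac del: distrib_left_numeral distrib_right_numeral)
    qed
  qed measurable
  then have "fourier_integral (\<lambda>x. - 2 * pi * \<i> * (x $ l) * ?F x) differentiable (at \<zeta>)" for \<zeta>
    by (intro fourier_integral_differentiable) measurable
  then have "continuous_on UNIV (fourier_integral (\<lambda>x. - 2 * pi * \<i> * (x $ l) * ?F x))"
    by (simp add: continuous_at_imp_continuous_on differentiable_imp_continuous_within)
  moreover have "partial l v = fourier_integral (\<lambda>x. - 2 * pi * \<i> * (x $ l) * ?F x)"
    by (rule ext) (rule p)
  ultimately show "continuous_on UNIV (partial l v)"
    by simp
qed

lemma gaussian_cutoff_square_integrable:
  fixes f :: "real^'d::finite \<Rightarrow> complex"
  assumes f: "square_integrable f"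
  shows "square_integrable (gaussian_cutoff f a)"
  unfolding square_integrable_def
proof
  have [measurable]: "f \<in> borel_measurable borel" and fi: "integrable lborel (\<lambda>x. (cmod (f x))\<^sup>2)"
    using f by (auto simp: square_integrable_def)
  show m: "gaussian_cutoff f a \<in> borel_measurable lborel"
    unfolding gaussian_cutoff_def[abs_def] by measurable
  show "integrable lborel (\<lambda>x. (cmod (gaussian_cutoff f a x))\<^sup>2)"
  proof (rule Bochner_Integration.integrable_bound[OF fi])
    show "(\<lambda>x. (cmod (gaussian_cutoff f a x))\<^sup>2) \<in> borel_measurable lborel"
      using m by measurable
    have "cmod (gaussian_cutoff f a x) \<le> cmod (f x)" for x
      by (simp add: gaussian_cutoff_def norm_mult gaussian_def mult_left_le)
    then show "AE x in lborel. norm ((cmod (gaussian_cutoff f a x))\<^sup>2) \<le> norm ((cmod (f x))\<^sup>2)"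
      by (intro AE_I2) (simp add: power_mono)
  qed
qed

lemma gaussian_cutoff_fourier_rep:
  fixes f :: "real^'d::finite \<Rightarrow> complex"
  assumes f: "square_integrable f" and a: "a > 0"
  shows "fourier_rep (distr_of (gaussian_cutoff f a)) (fourier_integral (gaussian_cutoff f a))"
    and "square_integrable (fourier_integral (gaussian_cutoff f a))"
proof -
  let ?F = "gaussian_cutoff f a" and ?v = "fourier_integral (gaussian_cutoff f a)"
  have "integrable lborel ?F"
    using integrable_gaussian_cutoff[OF f, of "1 / a" 0] a gaussian_cutoff_square_integrable[OF f, of a]
    by (auto simp: gaussian_cutoff_def[symmetric] square_integrable_def intro: integrable_norm_cancel)
  then show "fourier_rep (distr_of ?F) ?v"
    by (rule fourier_rep_L1)
  then show "square_integrable ?v"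
    by (rule fourier_rep_L2(1)[OF gaussian_cutoff_square_integrable[OF f]])
qed

lemma gaussian_cutoff_tendsto:
  fixes f :: "real^'d::finite \<Rightarrow> complex"
  assumes f: "square_integrable f"
  shows "(\<lambda>n. LINT x|lborel. (cmod (gaussian_cutoff f (real (Suc n)) x - f x))\<^sup>2) \<longlonglongrightarrow> 0"
proof -
  have [measurable]: "f \<in> borel_measurable borel" and fi: "integrable lborel (\<lambda>x. (cmod (f x))\<^sup>2)"
    using f by (auto simp: square_integrable_def)
  have [measurable]: "gaussian_cutoff f a \<in> borel_measurable borel" for a
    unfolding gaussian_cutoff_def[abs_def] by measurable
  have "(\<lambda>n. LINT x|lborel. (cmod (gaussian_cutoff f (real (Suc n)) x - f x))\<^sup>2) \<longlonglongrightarrow> (LINT x|(lborel :: (real^'d) measure). 0)"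
  proof (rule integral_dominated_convergence)
    show "integrable lborel (\<lambda>x. 4 * (cmod (f x))\<^sup>2)"
      by (intro integrable_mult_right fi)
    show "AE x in lborel. (\<lambda>n. (cmod (gaussian_cutoff f (real (Suc n)) x - f x))\<^sup>2) \<longlonglongrightarrow> 0"
    proof (rule AE_I2)
      fix x :: "real^'d"
      have "(\<lambda>n. 1 / real (Suc n)) \<longlonglongrightarrow> 0"
        by (rule LIMSEQ_Suc[OF lim_1_over_n])
      then have "(\<lambda>n. (cmod (f x * complex_of_real (exp (- pi * (1 / real (Suc n))\<^sup>2 * (norm (x - 0))\<^sup>2)) - f x))\<^sup>2)
         \<longlonglongrightarrow> (cmod (f x * complex_of_real (exp (- pi * 0\<^sup>2 * (norm (x - 0))\<^sup>2)) - f x))\<^sup>2"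
        by (intro tendsto_intros)
      then show "(\<lambda>n. (cmod (gaussian_cutoff f (real (Suc n)) x - f x))\<^sup>2) \<longlonglongrightarrow> 0"
        by (simp add: gaussian_cutoff_def gaussian_def)
    qed
    show "AE x in lborel. norm ((cmod (gaussian_cutoff f (real (Suc n)) x - f x))\<^sup>2) \<le> 4 * (cmod (f x))\<^sup>2" for n
    proof (rule AE_I2)
      fix x
      define y where "y = gaussian_cutoff f (real (Suc n)) x"
      have "cmod y \<le> cmod (f x)"
        by (simp add: y_def gaussian_cutoff_def norm_mult gaussian_def mult_left_le)
      then have "(cmod y)\<^sup>2 \<le> (cmod (f x))\<^sup>2"
        by (intro power_mono) auto
      with norm_diff_square_le[of y "f x"] have "(cmod (y - f x))\<^sup>2 \<le> 4 * (cmod (f x))\<^sup>2"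
        by linarith
      then show "norm ((cmod (gaussian_cutoff f (real (Suc n)) x - f x))\<^sup>2) \<le> 4 * (cmod (f x))\<^sup>2"
        by (simp only: y_def real_norm_def abs_power2)
    qed
  qed measurable
  then show ?thesis by simp
qed

text \<open>The weak equation is tested with the mollifier centred at \<open>\<zeta>\<close>. The
  derivative and the constant term commute with the mollification, but the drift is evaluated at
  \<open>\<zeta>\<close> outside and at \<open>\<xi>\<close> inside; by linearity the difference is
  the drift at \<open>\<zeta> - \<xi>\<close>, and that is the whole commutator.\<close>

lemma gauss_op_mollified:
  fixes f u :: "real^'d::finite \<Rightarrow> complex"
  assumes f: "square_integrable f" and u: "fourier_rep (distr_of f) u"
    and bm[measurable]: "\<And>l. b l \<in> borel_measurable borel"
    and bi: "\<And>l. integrable lborel (\<lambda>\<xi>. (cmod (b l \<xi>))\<^sup>2 / (1 + (norm \<xi>)\<^sup>2))"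
    and weak: "weak_gauss_eq \<mu> S u b" and a: "a > 0"
  defines "v \<equiv> fourier_integral (gaussian_cutoff f a)"
  shows "gauss_op \<mu> S v l \<zeta> = (LINT \<xi>|lborel. b l \<xi> * complex_of_real (mollifier a (\<zeta> - \<xi>))
      + u \<xi> * complex_of_real (8 * pi\<^sup>2 * (S *v (\<zeta> - \<xi>)) $ l * mollifier a (\<zeta> - \<xi>)))"
    and "integrable lborel (\<lambda>\<xi>. b l \<xi> * complex_of_real (mollifier a (\<zeta> - \<xi>))
      + u \<xi> * complex_of_real (8 * pi\<^sup>2 * (S *v (\<zeta> - \<xi>)) $ l * mollifier a (\<zeta> - \<xi>)))"
proof -
  have [measurable]: "u \<in> borel_measurable borel"
    using u by (rule fourier_rep_measurable)
  define \<phi> where "\<phi> = (\<lambda>\<xi>. complex_of_real (mollifier a (\<zeta> - \<xi>)))"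
  have \<phi>_eq: "\<phi> = (\<lambda>\<xi>. complex_of_real (a ^ CARD('d)) * complex_of_real (gaussian a \<zeta> \<xi>))"
    by (rule ext) (simp add: \<phi>_def mollifier_def gaussian_def norm_minus_commute)
  have \<phi>: "\<phi> \<in> schwartz"
    unfolding \<phi>_eq by (intro schwartz_cmult gaussian_schwartz a)
  have F\<phi>: "fourier_integral \<phi> x = complex_of_real (gaussian (1 / a) 0 x) * cis (- 2 * pi * (\<zeta> \<bullet> x))" for x
    unfolding \<phi>_eq fourier_integral_cmult fourier_gaussian[OF a] using a by (simp add: power_divide)
  have "v \<zeta> = distr_of f (fourier_integral \<phi>)"
    unfolding distr_of_def v_def fourier_integral_def[of "gaussian_cutoff f a"] F\<phi> gaussian_cutoff_def
    by (simp add: inner_commute mult_ac)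
  then have v: "v \<zeta> = (LINT \<xi>|lborel. u \<xi> * \<phi> \<xi>)"
    unfolding fourier_rep_apply(1)[OF u \<phi>] .
  have pv: "partial l v \<zeta> = - (LINT \<xi>|lborel. u \<xi> * partial l \<phi> \<xi>)"
  proof -
    have "partial l v \<zeta> = (LINT x|lborel. cis (- 2 * pi * (x \<bullet> \<zeta>)) * (- 2 * pi * \<i> * (x $ l) * gaussian_cutoff f a x))"
      unfolding v_def gaussian_cutoff_smooth(3)[OF f a] fourier_integral_def ..
    also have "\<dots> = (LINT x|lborel. - (f x * fourier_integral (partial l \<phi>) x))"
      unfolding fourier_integral_partial[OF \<phi>] F\<phi> gaussian_cutoff_def by (simp add: inner_commute mult_ac)
    also have "\<dots> = - distr_of f (fourier_integral (partial l \<phi>))"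
      unfolding distr_of_def by simp
    also have "\<dots> = - (LINT \<xi>|lborel. u \<xi> * partial l \<phi> \<xi>)"
      unfolding fourier_rep_apply(1)[OF u schwartz_partial[OF \<phi>]] ..
    finally show ?thesis .
  qed
  define s where "s = (\<lambda>\<xi>. complex_of_real (8 * pi\<^sup>2 * (S *v \<xi>) $ l))"
  have s_sum: "(\<lambda>\<xi>. s \<xi> * \<phi> \<xi>) = (\<lambda>\<xi>. \<Sum>j\<in>UNIV. complex_of_real (8 * pi\<^sup>2 * S $ l $ j) * (complex_of_real (\<xi> $ j) * \<phi> \<xi>))"
    by (rule ext) (simp add: s_def matrix_vector_mult_def sum_distrib_left sum_distrib_right mult_ac)
  have s\<phi>: "(\<lambda>\<xi>. s \<xi> * \<phi> \<xi>) \<in> schwartz"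
    unfolding s_sum by (intro schwartz_sum schwartz_cmult schwartz_coord_mult \<phi>)
  let ?m = "2 * pi * \<i> * complex_of_real (\<mu> $ l)"
  note iu = fourier_rep_apply(2)[OF u \<phi>] and ip = fourier_rep_apply(2)[OF u schwartz_partial[OF \<phi>, of l]]
    and isp = fourier_rep_apply(2)[OF u s\<phi>]
  have ib: "integrable lborel (\<lambda>\<xi>. b l \<xi> * \<phi> \<xi>)"
    by (intro Cauchy_Schwarz_weighted(1) bi integrable_weighted_schwartz \<phi>)
      (use borel_measurable_schwartz[OF \<phi>] in measurable)
  have weak': "(LINT \<xi>|lborel. b l \<xi> * \<phi> \<xi>) = (LINT \<xi>|lborel. u \<xi> * (s \<xi> * \<phi> \<xi>)) - (LINT \<xi>|lborel. u \<xi> * partial l \<phi> \<xi>) + ?m * (LINT \<xi>|lborel. u \<xi> * \<phi> \<xi>)"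
  proof -
    have "(LINT \<xi>|lborel. b l \<xi> * \<phi> \<xi>) = (LINT \<xi>|lborel. u \<xi> * (s \<xi> * \<phi> \<xi> - partial l \<phi> \<xi> + ?m * \<phi> \<xi>))"
      using weak \<phi> unfolding weak_gauss_eq_def s_def by blast
    also have "\<dots> = (LINT \<xi>|lborel. (u \<xi> * (s \<xi> * \<phi> \<xi>) - u \<xi> * partial l \<phi> \<xi>) + ?m * (u \<xi> * \<phi> \<xi>))"
      by (simp add: algebra_simps)
    also have "\<dots> = (LINT \<xi>|lborel. u \<xi> * (s \<xi> * \<phi> \<xi>)) - (LINT \<xi>|lborel. u \<xi> * partial l \<phi> \<xi>) + ?m * (LINT \<xi>|lborel. u \<xi> * \<phi> \<xi>)"
      using iu ip isp by (subst Bochner_Integration.integral_add) auto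
    finally show ?thesis .
  qed
  \<comment> \<open>The integrand in the claim, split by linearity of \<open>S\<close> into three
    products with test functions, each separately integrable.\<close>
  have e: "b l \<xi> * complex_of_real (mollifier a (\<zeta> - \<xi>)) + u \<xi> * complex_of_real (8 * pi\<^sup>2 * (S *v (\<zeta> - \<xi>)) $ l * mollifier a (\<zeta> - \<xi>))
     = b l \<xi> * \<phi> \<xi> + (s \<zeta> * (u \<xi> * \<phi> \<xi>) - u \<xi> * (s \<xi> * \<phi> \<xi>))" for \<xi>
    by (simp add: \<phi>_def s_def matrix_vector_mult_diff_distrib algebra_simps)
  show "integrable lborel (\<lambda>\<xi>. b l \<xi> * complex_of_real (mollifier a (\<zeta> - \<xi>))
      + u \<xi> * complex_of_real (8 * pi\<^sup>2 * (S *v (\<zeta> - \<xi>)) $ l * mollifier a (\<zeta> - \<xi>)))"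
    unfolding e by (intro Bochner_Integration.integrable_add Bochner_Integration.integrable_diff integrable_mult_right ib iu isp)
  have "gauss_op \<mu> S v l \<zeta> = - (LINT \<xi>|lborel. u \<xi> * partial l \<phi> \<xi>) + (s \<zeta> + ?m) * (LINT \<xi>|lborel. u \<xi> * \<phi> \<xi>)"
    unfolding gauss_op_def pv v s_def ..
  also have "\<dots> = (LINT \<xi>|lborel. b l \<xi> * \<phi> \<xi>) + (s \<zeta> * (LINT \<xi>|lborel. u \<xi> * \<phi> \<xi>) - (LINT \<xi>|lborel. u \<xi> * (s \<xi> * \<phi> \<xi>)))"
    unfolding weak' by (simp add: algebra_simps)
  also have "\<dots> = (LINT \<xi>|lborel. b l \<xi> * \<phi> \<xi> + (s \<zeta> * (u \<xi> * \<phi> \<xi>) - u \<xi> * (s \<xi> * \<phi> \<xi>)))"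
    using ib iu isp by (subst Bochner_Integration.integral_add) auto
  finally show "gauss_op \<mu> S v l \<zeta> = (LINT \<xi>|lborel. b l \<xi> * complex_of_real (mollifier a (\<zeta> - \<xi>))
      + u \<xi> * complex_of_real (8 * pi\<^sup>2 * (S *v (\<zeta> - \<xi>)) $ l * mollifier a (\<zeta> - \<xi>)))"
    unfolding e .
qed

lemma ennreal_add_square_le: "((x::ennreal) + y)\<^sup>2 \<le> 2 * x\<^sup>2 + 2 * y\<^sup>2"
proof -
  have "(x + y)\<^sup>2 = (x\<^sup>2 + y\<^sup>2) + 2 * x * y"
    by (rule power2_sum)
  also have "\<dots> \<le> (x\<^sup>2 + y\<^sup>2) + (x\<^sup>2 + y\<^sup>2)"
    by (intro add_left_mono sum_of_squares_ge_ennreal)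
  also have "\<dots> = 2 * x\<^sup>2 + 2 * y\<^sup>2"
    by (simp only: mult_2 ac_simps)
  finally show ?thesis .
qed

text \<open>Both terms of \<open>gauss_op_mollified\<close> are dominated by convolutions, and
  \<open>weighted_young\<close> bounds them in the weighted space. The kernel of the commutator
  carries an additional factor \<open>|z|\<close>; each of its two moments is of order
  \<open>1 / a\<close>, so its squared contribution is of order \<open>1 / a^2\<close>.\<close>

lemma gauss_op_mollified_bound:
  fixes f u :: "real^'d::finite \<Rightarrow> complex"
  assumes f: "square_integrable f" and u: "fourier_rep (distr_of f) u"
    and bm[measurable]: "\<And>l. b l \<in> borel_measurable borel"
    and bi: "\<And>l. integrable lborel (\<lambda>\<xi>. (cmod (b l \<xi>))\<^sup>2 / (1 + (norm \<xi>)\<^sup>2))"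
    and weak: "weak_gauss_eq \<mu> S u b" and a: "a \<ge> 1"
    and K: "K > 0" "\<And>x. norm (S *v x) \<le> norm x * K"
  defines "v \<equiv> fourier_integral (gaussian_cutoff f a)"
  shows "(\<integral>\<^sup>+\<zeta>. ennreal ((cmod (gauss_op \<mu> S v l \<zeta>))\<^sup>2 / (1 + (norm \<zeta>)\<^sup>2)) \<partial>lborel)
    \<le> 2 * ((gauss_mass TYPE('d))\<^sup>2 * (\<integral>\<^sup>+\<xi>. ennreal ((cmod (b l \<xi>))\<^sup>2 / (1 + (norm \<xi>)\<^sup>2)) \<partial>lborel))
      + 2 * (ennreal ((8 * pi\<^sup>2 * K / a)\<^sup>2) * ((gauss_mass TYPE('d))\<^sup>2 * (\<integral>\<^sup>+\<xi>. ennreal ((cmod (u \<xi>))\<^sup>2 / (1 + (norm \<xi>)\<^sup>2)) \<partial>lborel)))"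
proof -
  let ?m = "gauss_mass TYPE('d)" and ?c = "8 * pi\<^sup>2 * K"
  have [measurable]: "u \<in> borel_measurable borel"
    using u by (rule fourier_rep_measurable)
  have a0: "a > 0" using a by simp
  note m0 = mollifier_nonneg[OF a0]
  have c0: "?c \<ge> 0" using K by simp
  let ?X = "\<lambda>\<zeta>. \<integral>\<^sup>+\<xi>. ennreal (cmod (b l \<xi>) * mollifier a (\<zeta> - \<xi>)) \<partial>lborel"
  let ?Y = "\<lambda>\<zeta>. \<integral>\<^sup>+\<xi>. ennreal (cmod (u \<xi>) * (norm (\<zeta> - \<xi>) * mollifier a (\<zeta> - \<xi>))) \<partial>lborel"
  have pt: "ennreal (cmod (gauss_op \<mu> S v l \<zeta>)) \<le> ?X \<zeta> + ennreal ?c * ?Y \<zeta>" for \<zeta>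
  proof -
    note g = gauss_op_mollified[OF f u bm bi weak a0, of l \<zeta>, folded v_def]
    have "ennreal (cmod (gauss_op \<mu> S v l \<zeta>)) \<le> (\<integral>\<^sup>+\<xi>. ennreal (cmod (b l \<xi> * complex_of_real (mollifier a (\<zeta> - \<xi>))
      + u \<xi> * complex_of_real (8 * pi\<^sup>2 * (S *v (\<zeta> - \<xi>)) $ l * mollifier a (\<zeta> - \<xi>)))) \<partial>lborel)"
      unfolding g(1) by (rule integral_norm_bound_ennreal[OF g(2)])
    also have "\<dots> \<le> (\<integral>\<^sup>+\<xi>. ennreal (cmod (b l \<xi>) * mollifier a (\<zeta> - \<xi>)) + ennreal ?c * ennreal (cmod (u \<xi>) * (norm (\<zeta> - \<xi>) * mollifier a (\<zeta> - \<xi>))) \<partial>lborel)"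
    proof (intro nn_integral_mono)
      fix \<xi>
      have "\<bar>(S *v (\<zeta> - \<xi>)) $ l\<bar> \<le> norm (\<zeta> - \<xi>) * K"
        by (rule order_trans[OF component_le_norm_cart K(2)])
      then have "cmod (u \<xi>) * (8 * pi\<^sup>2 * \<bar>(S *v (\<zeta> - \<xi>)) $ l\<bar> * mollifier a (\<zeta> - \<xi>)) \<le> cmod (u \<xi>) * (8 * pi\<^sup>2 * (norm (\<zeta> - \<xi>) * K) * mollifier a (\<zeta> - \<xi>))"
        by (intro mult_left_mono mult_right_mono m0) auto
      then have "cmod (b l \<xi> * complex_of_real (mollifier a (\<zeta> - \<xi>)) + u \<xi> * complex_of_real (8 * pi\<^sup>2 * (S *v (\<zeta> - \<xi>)) $ l * mollifier a (\<zeta> - \<xi>)))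
         \<le> cmod (b l \<xi>) * mollifier a (\<zeta> - \<xi>) + ?c * (cmod (u \<xi>) * (norm (\<zeta> - \<xi>) * mollifier a (\<zeta> - \<xi>)))"
        by (intro order_trans[OF norm_triangle_ineq] add_mono) (simp_all add: norm_mult norm_power abs_mult m0 mult_ac)
      then have "ennreal (cmod (b l \<xi> * complex_of_real (mollifier a (\<zeta> - \<xi>)) + u \<xi> * complex_of_real (8 * pi\<^sup>2 * (S *v (\<zeta> - \<xi>)) $ l * mollifier a (\<zeta> - \<xi>))))
         \<le> ennreal (cmod (b l \<xi>) * mollifier a (\<zeta> - \<xi>) + ?c * (cmod (u \<xi>) * (norm (\<zeta> - \<xi>) * mollifier a (\<zeta> - \<xi>))))"
        by (rule ennreal_leI)
      then show "ennreal (cmod (b l \<xi> * complex_of_real (mollifier a (\<zeta> - \<xi>)) + u \<xi> * complex_of_real (8 * pi\<^sup>2 * (S *v (\<zeta> - \<xi>)) $ l * mollifier a (\<zeta> - \<xi>))))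
         \<le> ennreal (cmod (b l \<xi>) * mollifier a (\<zeta> - \<xi>)) + ennreal ?c * ennreal (cmod (u \<xi>) * (norm (\<zeta> - \<xi>) * mollifier a (\<zeta> - \<xi>)))"
        using c0 m0[of "\<zeta> - \<xi>"] by (subst ennreal_mult'[symmetric], simp, subst ennreal_plus[symmetric]) auto
    qed
    also have "\<dots> = ?X \<zeta> + ennreal ?c * ?Y \<zeta>"
      by (subst nn_integral_add) (auto simp: nn_integral_cmult)
    finally show ?thesis .
  qed
  have X: "(\<integral>\<^sup>+\<zeta>. (?X \<zeta>)\<^sup>2 * ennreal (1 / (1 + (norm \<zeta>)\<^sup>2)) \<partial>lborel) \<le> ?m\<^sup>2 * (\<integral>\<^sup>+\<xi>. ennreal ((cmod (b l \<xi>))\<^sup>2 / (1 + (norm \<xi>)\<^sup>2)) \<partial>lborel)"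
    (is "_ \<le> _ * ?B")
  proof -
    have "(\<integral>\<^sup>+\<zeta>. (?X \<zeta>)\<^sup>2 * ennreal (1 / (1 + (norm \<zeta>)\<^sup>2)) \<partial>lborel)
      \<le> (\<integral>\<^sup>+z. ennreal (mollifier a (z::real^'d)) \<partial>lborel) * (\<integral>\<^sup>+z. ennreal (2 * (1 + (norm z)\<^sup>2) * mollifier a (z::real^'d)) \<partial>lborel) * ?B"
      by (intro weighted_young m0) auto
    also have "\<dots> \<le> ?m * ?m * ?B"
      by (intro mult_mono mollifier_moments a) auto
    finally show ?thesis by (simp only: power2_eq_square)
  qed
  have Y: "(\<integral>\<^sup>+\<zeta>. (?Y \<zeta>)\<^sup>2 * ennreal (1 / (1 + (norm \<zeta>)\<^sup>2)) \<partial>lborel) \<le> ennreal ((1 / a)\<^sup>2) * (?m\<^sup>2 * (\<integral>\<^sup>+\<xi>. ennreal ((cmod (u \<xi>))\<^sup>2 / (1 + (norm \<xi>)\<^sup>2)) \<partial>lborel))"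
    (is "_ \<le> _ * (_ * ?U)")
  proof -
    have "(\<integral>\<^sup>+\<zeta>. (?Y \<zeta>)\<^sup>2 * ennreal (1 / (1 + (norm \<zeta>)\<^sup>2)) \<partial>lborel)
      \<le> (\<integral>\<^sup>+z. ennreal (norm z * mollifier a (z::real^'d)) \<partial>lborel) * (\<integral>\<^sup>+z. ennreal (2 * (1 + (norm z)\<^sup>2) * (norm z * mollifier a (z::real^'d))) \<partial>lborel) * ?U"
      by (intro weighted_young mult_nonneg_nonneg m0) auto
    also have "\<dots> \<le> (ennreal (1 / a) * ?m) * (ennreal (1 / a) * ?m) * ?U"
      by (intro mult_mono mollifier_moments a) auto
    also have "\<dots> = (ennreal (1 / a) * ennreal (1 / a)) * (?m\<^sup>2 * ?U)"
      by (simp only: power2_eq_square mult_ac)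
    also have "ennreal (1 / a) * ennreal (1 / a) = ennreal ((1 / a)\<^sup>2)"
      using a0 by (simp add: ennreal_mult'[symmetric] power2_eq_square)
    finally show ?thesis .
  qed
  have "(\<integral>\<^sup>+\<zeta>. ennreal ((cmod (gauss_op \<mu> S v l \<zeta>))\<^sup>2 / (1 + (norm \<zeta>)\<^sup>2)) \<partial>lborel)
     \<le> (\<integral>\<^sup>+\<zeta>. 2 * ((?X \<zeta>)\<^sup>2 * ennreal (1 / (1 + (norm \<zeta>)\<^sup>2))) + 2 * (ennreal (?c\<^sup>2) * ((?Y \<zeta>)\<^sup>2 * ennreal (1 / (1 + (norm \<zeta>)\<^sup>2)))) \<partial>lborel)"
  proof (intro nn_integral_mono)
    fix \<zeta> :: "real^'d"
    let ?w = "ennreal (1 / (1 + (norm \<zeta>)\<^sup>2))"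
    have "ennreal ((cmod (gauss_op \<mu> S v l \<zeta>))\<^sup>2 / (1 + (norm \<zeta>)\<^sup>2)) = (ennreal (cmod (gauss_op \<mu> S v l \<zeta>)))\<^sup>2 * ?w"
      by (simp add: ennreal_power ennreal_mult'[symmetric])
    also have "\<dots> \<le> (?X \<zeta> + ennreal ?c * ?Y \<zeta>)\<^sup>2 * ?w"
      by (intro mult_right_mono power_mono pt) auto
    also have "\<dots> \<le> (2 * (?X \<zeta>)\<^sup>2 + 2 * (ennreal ?c * ?Y \<zeta>)\<^sup>2) * ?w"
      by (intro mult_right_mono ennreal_add_square_le) simp
    also have "\<dots> = 2 * ((?X \<zeta>)\<^sup>2 * ?w) + 2 * ((ennreal ?c)\<^sup>2 * ((?Y \<zeta>)\<^sup>2 * ?w))"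
      by (simp only: distrib_right power_mult_distrib mult.assoc)
    also have "(ennreal ?c)\<^sup>2 = ennreal (?c\<^sup>2)"
      using c0 by (simp add: ennreal_power)
    finally show "ennreal ((cmod (gauss_op \<mu> S v l \<zeta>))\<^sup>2 / (1 + (norm \<zeta>)\<^sup>2)) \<le> 2 * ((?X \<zeta>)\<^sup>2 * ?w) + 2 * (ennreal (?c\<^sup>2) * ((?Y \<zeta>)\<^sup>2 * ?w))" .
  qed
  also have "\<dots> = 2 * (\<integral>\<^sup>+\<zeta>. (?X \<zeta>)\<^sup>2 * ennreal (1 / (1 + (norm \<zeta>)\<^sup>2)) \<partial>lborel)
     + 2 * (ennreal (?c\<^sup>2) * (\<integral>\<^sup>+\<zeta>. (?Y \<zeta>)\<^sup>2 * ennreal (1 / (1 + (norm \<zeta>)\<^sup>2)) \<partial>lborel))"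
    by (subst nn_integral_add, measurable) (subst nn_integral_cmult, measurable)+
  also have "\<dots> \<le> 2 * (?m\<^sup>2 * ?B) + 2 * (ennreal (?c\<^sup>2) * (ennreal ((1 / a)\<^sup>2) * (?m\<^sup>2 * ?U)))"
    by (intro add_mono mult_left_mono X Y) auto
  also have "ennreal (?c\<^sup>2) * (ennreal ((1 / a)\<^sup>2) * (?m\<^sup>2 * ?U)) = ennreal ((?c / a)\<^sup>2) * (?m\<^sup>2 * ?U)"
    by (simp add: mult.assoc[symmetric] ennreal_mult'[symmetric] power_divide)
  finally show ?thesis .
qed

lemma integral_le_if_nn_integral_le:
  fixes f :: "'a \<Rightarrow> real"
  assumes [measurable]: "f \<in> borel_measurable M" and nonneg: "\<And>x. 0 \<le> f x" and c: "0 \<le> c"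
    and le: "(\<integral>\<^sup>+x. ennreal (f x) \<partial>M) \<le> ennreal c"
  shows "integrable M f" and "integral\<^sup>L M f \<le> c"
proof -
  show i: "integrable M f"
  proof (rule integrableI_nonneg)
    show "(\<integral>\<^sup>+x. ennreal (f x) \<partial>M) < \<infinity>"
      using le by (rule le_less_trans) simp
  qed (auto simp: nonneg)
  show "integral\<^sup>L M f \<le> c"
    using le c unfolding nn_integral_eq_integral[OF i AE_I2[OF nonneg]] by simp
qed

text \<open>\<open>gauss_poincare_classical\<close> is applied to the mollified functions
  \<open>v n\<close>, which are regular enough, and the limit is taken. The operators on
  \<open>v n\<close> are bounded by \<open>b\<close> up to the commutator error, which tends to 0;
  by Plancherel \<open>v n\<close> tends to \<open>u\<close> in norm, and so do the coefficients of
  the Gaussian. Mollifying costs the factor \<open>2 m^2\<close>, independent of the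
  function.\<close>

lemma weighted_poincare:
  fixes S :: "real^'d::finite^'d"
  assumes S: "sym_pos_def S" and Z: "(LINT \<xi>:ball 0 \<epsilon>|lborel. gauss_hat \<mu> S \<xi>) \<noteq> 0"
  shows "\<exists>C>0. \<forall>f u b. square_integrable f \<longrightarrow> fourier_rep (distr_of f) u \<longrightarrow>
    (\<forall>l. b l \<in> borel_measurable borel) \<longrightarrow> (\<forall>l. integrable lborel (\<lambda>\<xi>. (cmod (b l \<xi>))\<^sup>2 / (1 + (norm \<xi>)\<^sup>2))) \<longrightarrow>
    weak_gauss_eq \<mu> S u b \<longrightarrow>
    (LINT \<xi>|lborel. (cmod (u \<xi> - (LINT \<xi>:ball 0 \<epsilon>|lborel. u \<xi>) / (LINT \<xi>:ball 0 \<epsilon>|lborel. gauss_hat \<mu> S \<xi>) * gauss_hat \<mu> S \<xi>))\<^sup>2)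
      \<le> C * (\<Sum>l\<in>UNIV. LINT \<xi>|lborel. (cmod (b l \<xi>))\<^sup>2 / (1 + (norm \<xi>)\<^sup>2))"
proof -
  let ?E = "gauss_hat \<mu> S"
  let ?z = "LINT \<xi>:ball 0 \<epsilon>|lborel. ?E \<xi>"
  obtain C where C: "C > 0" and poincare: "\<And>v. (\<And>x. v differentiable (at x)) \<Longrightarrow> (\<And>l. continuous_on UNIV (partial l v)) \<Longrightarrow>
    integrable lborel (\<lambda>\<xi>. (cmod (v \<xi>))\<^sup>2) \<Longrightarrow>
    (\<And>l. integrable lborel (\<lambda>\<xi>. (cmod (gauss_op \<mu> S v l \<xi>))\<^sup>2 / (1 + (norm \<xi>)\<^sup>2))) \<Longrightarrow>
    (LINT \<xi>|lborel. (cmod (v \<xi> - (LINT \<xi>:ball 0 \<epsilon>|lborel. v \<xi>) / ?z * ?E \<xi>))\<^sup>2)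
      \<le> C * (\<Sum>l\<in>UNIV. LINT \<xi>|lborel. (cmod (gauss_op \<mu> S v l \<xi>))\<^sup>2 / (1 + (norm \<xi>)\<^sup>2))"
    using gauss_poincare_classical[OF S Z] by blast
  obtain K where K: "K > 0" "\<And>x. norm (S *v x) \<le> norm x * K"
    using bounded_linear.pos_bounded[OF matrix_vector_mul_bounded_linear[of S]] by blast
  obtain m where m: "m \<ge> 0" "gauss_mass TYPE('d) = ennreal m"
    using gauss_mass_finite[where 'd='d] by (cases "gauss_mass TYPE('d)") auto
  have Em[measurable]: "?E \<in> borel_measurable borel" and Ei: "integrable lborel (\<lambda>\<xi>. (cmod (?E \<xi>))\<^sup>2)"
    using square_integrable_schwartz[OF gauss_hat_schwartz[OF S]] by (auto simp: square_integrable_def)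
  have [measurable]: "ball (0::real^'d) \<epsilon> \<in> sets borel" by simp
  have hi: "integrable lborel (\<lambda>\<xi>. (cmod (indicator (ball (0::real^'d) \<epsilon>) \<xi>))\<^sup>2)"
  proof -
    have "(\<lambda>\<xi>. (cmod (indicator (ball (0::real^'d) \<epsilon>) \<xi>))\<^sup>2) = (indicator (ball 0 \<epsilon>) :: real^'d \<Rightarrow> real)"
      by (auto simp: fun_eq_iff indicator_def)
    then show ?thesis
      using integrable_real_indicator[OF _ emeasure_lborel_ball_finite, of "0::real^'d" \<epsilon>] by simp
  qed
  \<comment> \<open>The ball average is an \<open>L^2\<close> pairing with an indicator, hence
    continuous under convergence in norm.\<close>
  have ball_eq: "(LINT \<xi>:ball 0 \<epsilon>|lborel. w \<xi>) = (LINT \<xi>|lborel. w \<xi> * indicator (ball 0 \<epsilon>) \<xi>)" for w :: "real^'d \<Rightarrow> complex"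
    unfolding set_lebesgue_integral_def by (intro Bochner_Integration.integral_cong refl) (simp add: indicator_def)
  show ?thesis
  \<comment> \<open>\<open>2 m^2\<close> comes from \<open>gauss_op_mollified_bound\<close>; the
    summand 1 only ensures that the constant is positive.\<close>
  proof (intro exI[of _ "C * (2 * m\<^sup>2 + 1)"] conjI allI impI)
    show "0 < C * (2 * m\<^sup>2 + 1)"
      using C by (intro mult_pos_pos add_nonneg_pos) auto
    fix f u :: "real^'d \<Rightarrow> complex" and b :: "'d \<Rightarrow> real^'d \<Rightarrow> complex"
    assume f: "square_integrable f" and u: "fourier_rep (distr_of f) u"
      and bm: "\<forall>l. b l \<in> borel_measurable borel"
      and bi': "\<forall>l. integrable lborel (\<lambda>\<xi>. (cmod (b l \<xi>))\<^sup>2 / (1 + (norm \<xi>)\<^sup>2))"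
      and weak: "weak_gauss_eq \<mu> S u b"
    have bm'[measurable]: "b l \<in> borel_measurable borel" for l using bm by blast
    have bi: "integrable lborel (\<lambda>\<xi>. (cmod (b l \<xi>))\<^sup>2 / (1 + (norm \<xi>)\<^sup>2))" for l using bi' by blast
    have um[measurable]: "u \<in> borel_measurable borel"
      using u by (rule fourier_rep_measurable)
    have ui: "integrable lborel (\<lambda>\<xi>. (cmod (u \<xi>))\<^sup>2)"
      using fourier_rep_L2(1)[OF f u] by (simp add: square_integrable_def)
    have uJ: "integrable lborel (\<lambda>\<xi>. (cmod (u \<xi>))\<^sup>2 / (1 + (norm \<xi>)\<^sup>2))"
      by (rule Bochner_Integration.integrable_bound[OF ui]) (auto simp: divide_le_eq one_plus_norm_sq_pos mult_left_le abs_of_nonneg algebra_simps)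
    let ?B = "\<lambda>l. LINT \<xi>|lborel. (cmod (b l \<xi>))\<^sup>2 / (1 + (norm \<xi>)\<^sup>2)"
    let ?U = "LINT \<xi>|lborel. (cmod (u \<xi>))\<^sup>2 / (1 + (norm \<xi>)\<^sup>2)"
    have B0: "?B l \<ge> 0" for l by (intro Bochner_Integration.integral_nonneg) simp
    have U0: "?U \<ge> 0" by (intro Bochner_Integration.integral_nonneg) simp
    define v where "v = (\<lambda>n. fourier_integral (gaussian_cutoff f (real (Suc n))))"
    have vd: "v n differentiable (at x)" and vp: "continuous_on UNIV (partial l (v n))" for n x l
      using gaussian_cutoff_smooth[OF f, of "real (Suc n)"] by (auto simp: v_def)
    have vc: "continuous_on UNIV (v n)" for n
      using vd by (simp add: continuous_at_imp_continuous_on differentiable_imp_continuous_within)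
    then have vm[measurable]: "v n \<in> borel_measurable borel" for n
      by (rule borel_measurable_continuous_onI)
    have vi: "integrable lborel (\<lambda>\<xi>. (cmod (v n \<xi>))\<^sup>2)" for n
      using gaussian_cutoff_fourier_rep(2)[OF f, of "real (Suc n)"] by (simp add: v_def square_integrable_def)
    have lim: "(\<lambda>n. LINT \<xi>|lborel. (cmod (v n \<xi> - u \<xi>))\<^sup>2) \<longlonglongrightarrow> 0"
    proof -
      have "(LINT \<xi>|lborel. (cmod (v n \<xi> - u \<xi>))\<^sup>2) = (LINT x|lborel. (cmod (gaussian_cutoff f (real (Suc n)) x - f x))\<^sup>2)" for n
        unfolding v_def
        by (intro plancherel_diff gaussian_cutoff_square_integrable gaussian_cutoff_fourier_rep f u) simp_all
      then show ?thesis
        using gaussian_cutoff_tendsto[OF f] by simp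
    qed
    define A where "A = (\<lambda>n l. LINT \<xi>|lborel. (cmod (gauss_op \<mu> S (v n) l \<xi>))\<^sup>2 / (1 + (norm \<xi>)\<^sup>2))"
    \<comment> \<open>The commutator error. It depends on \<open>u\<close>, but for fixed
      \<open>u\<close> it vanishes as \<open>n\<close> grows and therefore leaves no term in the
      final inequality.\<close>
    define r where "r = (\<lambda>n. 2 * ((8 * pi\<^sup>2 * K / real (Suc n))\<^sup>2 * (m\<^sup>2 * ?U)))"
    have gm[measurable]: "gauss_op \<mu> S (v n) l \<in> borel_measurable borel" for n l
    proof -
      have "continuous_on UNIV (gauss_op \<mu> S (v n) l)"
        unfolding gauss_op_def[abs_def]
        by (intro continuous_intros vp vc linear_continuous_on matrix_vector_mul_bounded_linear)
      then show ?thesis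
        by (rule borel_measurable_continuous_onI)
    qed
    have op_bound: "integrable lborel (\<lambda>\<xi>. (cmod (gauss_op \<mu> S (v n) l \<xi>))\<^sup>2 / (1 + (norm \<xi>)\<^sup>2))"
      "A n l \<le> 2 * (m\<^sup>2 * ?B l) + r n" for n l
    proof -
      have nn: "(\<integral>\<^sup>+\<xi>. ennreal ((cmod (w \<xi>))\<^sup>2 / (1 + (norm \<xi>)\<^sup>2)) \<partial>lborel) = ennreal (LINT \<xi>|lborel. (cmod (w \<xi>))\<^sup>2 / (1 + (norm \<xi>)\<^sup>2))"
        if "integrable lborel (\<lambda>\<xi>. (cmod (w \<xi>))\<^sup>2 / (1 + (norm \<xi>)\<^sup>2))" for w :: "real^'d \<Rightarrow> complex"
        using that by (intro nn_integral_eq_integral) auto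
      have "(\<integral>\<^sup>+\<zeta>. ennreal ((cmod (gauss_op \<mu> S (v n) l \<zeta>))\<^sup>2 / (1 + (norm \<zeta>)\<^sup>2)) \<partial>lborel)
        \<le> 2 * ((ennreal m)\<^sup>2 * ennreal (?B l)) + 2 * (ennreal ((8 * pi\<^sup>2 * K / real (Suc n))\<^sup>2) * ((ennreal m)\<^sup>2 * ennreal ?U))"
        using gauss_op_mollified_bound[OF f u bm' bi weak _ K, of "real (Suc n)" l]
        unfolding nn[OF bi] nn[OF uJ] m(2) v_def by simp
      also have "\<dots> = ennreal (2 * (m\<^sup>2 * ?B l) + r n)"
        unfolding r_def using m(1) B0[of l] U0
        by (simp add: ennreal_power ennreal_mult'[symmetric] ennreal_plus[symmetric] ennreal_numeral[symmetric] del: ennreal_plus ennreal_numeral)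
      finally have le: "(\<integral>\<^sup>+\<zeta>. ennreal ((cmod (gauss_op \<mu> S (v n) l \<zeta>))\<^sup>2 / (1 + (norm \<zeta>)\<^sup>2)) \<partial>lborel) \<le> ennreal (2 * (m\<^sup>2 * ?B l) + r n)" .
      have c: "0 \<le> 2 * (m\<^sup>2 * ?B l) + r n"
        using B0[of l] U0 by (simp add: r_def)
      show "integrable lborel (\<lambda>\<xi>. (cmod (gauss_op \<mu> S (v n) l \<xi>))\<^sup>2 / (1 + (norm \<xi>)\<^sup>2))"
        by (rule integral_le_if_nn_integral_le(1)[OF _ _ c le]) auto
      show "A n l \<le> 2 * (m\<^sup>2 * ?B l) + r n"
        unfolding A_def by (rule integral_le_if_nn_integral_le(2)[OF _ _ c le]) auto
    qed
    define t where "t = (\<lambda>n. (LINT \<xi>:ball 0 \<epsilon>|lborel. v n \<xi>) / ?z)"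
    let ?t = "(LINT \<xi>:ball 0 \<epsilon>|lborel. u \<xi>) / ?z"
    have t: "t \<longlonglongrightarrow> ?t"
      unfolding t_def ball_eq[of u] ball_eq[of "v _"]
      by (intro tendsto_divide tendsto_const Z tendsto_L2_inner[OF _ _ _ vi ui hi lim]) measurable
    have P: "(LINT \<xi>|lborel. (cmod (v n \<xi> - t n * ?E \<xi>))\<^sup>2) \<le> C * (\<Sum>l\<in>UNIV. 2 * (m\<^sup>2 * ?B l) + r n)" for n
    proof -
      have "(LINT \<xi>|lborel. (cmod (v n \<xi> - t n * ?E \<xi>))\<^sup>2) \<le> C * (\<Sum>l\<in>UNIV. A n l)"
        unfolding t_def A_def by (rule poincare[OF vd vp vi op_bound(1)])
      also have "\<dots> \<le> C * (\<Sum>l\<in>UNIV. 2 * (m\<^sup>2 * ?B l) + r n)"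
        using C by (intro mult_left_mono sum_mono op_bound) auto
      finally show ?thesis .
    qed
    have tEi: "integrable lborel (\<lambda>\<xi>. (cmod (s * ?E \<xi>))\<^sup>2)" for s
      using Ei by (simp add: norm_mult power_mult_distrib)
    have i: "integrable lborel (\<lambda>\<xi>. (cmod (v n \<xi> - t n * ?E \<xi>))\<^sup>2)" "integrable lborel (\<lambda>\<xi>. (cmod (u \<xi> - ?t * ?E \<xi>))\<^sup>2)" for n
      by (intro L2_diff(1) vi ui tEi; measurable)+
    have lim2: "(\<lambda>n. LINT \<xi>|lborel. (cmod ((v n \<xi> - t n * ?E \<xi>) - (u \<xi> - ?t * ?E \<xi>)))\<^sup>2) \<longlonglongrightarrow> 0"
    proof (rule tendsto_sandwich[OF _ _ tendsto_const])
      show "\<forall>\<^sub>F n in sequentially. 0 \<le> (LINT \<xi>|lborel. (cmod ((v n \<xi> - t n * ?E \<xi>) - (u \<xi> - ?t * ?E \<xi>)))\<^sup>2)"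
        by (intro always_eventually allI Bochner_Integration.integral_nonneg) simp
      show "\<forall>\<^sub>F n in sequentially. (LINT \<xi>|lborel. (cmod ((v n \<xi> - t n * ?E \<xi>) - (u \<xi> - ?t * ?E \<xi>)))\<^sup>2)
         \<le> 2 * (LINT \<xi>|lborel. (cmod (v n \<xi> - u \<xi>))\<^sup>2) + 2 * ((cmod (t n - ?t))\<^sup>2 * (LINT \<xi>|lborel. (cmod (?E \<xi>))\<^sup>2))"
      proof (intro always_eventually allI)
        fix n
        have e: "(v n \<xi> - t n * ?E \<xi>) - (u \<xi> - ?t * ?E \<xi>) = (v n \<xi> - u \<xi>) - (t n - ?t) * ?E \<xi>" for \<xi>
          by (simp add: left_diff_distrib)
        have "(LINT \<xi>|lborel. (cmod ((v n \<xi> - u \<xi>) - (t n - ?t) * ?E \<xi>))\<^sup>2)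
          \<le> 2 * (LINT \<xi>|lborel. (cmod (v n \<xi> - u \<xi>))\<^sup>2) + 2 * (LINT \<xi>|lborel. (cmod ((t n - ?t) * ?E \<xi>))\<^sup>2)"
          by (intro L2_diff(2) L2_diff(1) vi ui tEi; measurable)
        then show "(LINT \<xi>|lborel. (cmod ((v n \<xi> - t n * ?E \<xi>) - (u \<xi> - ?t * ?E \<xi>)))\<^sup>2)
         \<le> 2 * (LINT \<xi>|lborel. (cmod (v n \<xi> - u \<xi>))\<^sup>2) + 2 * ((cmod (t n - ?t))\<^sup>2 * (LINT \<xi>|lborel. (cmod (?E \<xi>))\<^sup>2))"
          unfolding e by (simp only: norm_mult power_mult_distrib integral_mult_right_zero)
      qed
      have "(\<lambda>n. 2 * (LINT \<xi>|lborel. (cmod (v n \<xi> - u \<xi>))\<^sup>2) + 2 * ((cmod (t n - ?t))\<^sup>2 * (LINT \<xi>|lborel. (cmod (?E \<xi>))\<^sup>2)))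
         \<longlonglongrightarrow> 2 * 0 + 2 * ((cmod (?t - ?t))\<^sup>2 * (LINT \<xi>|lborel. (cmod (?E \<xi>))\<^sup>2))"
        by (intro tendsto_intros lim t)
      then show "(\<lambda>n. 2 * (LINT \<xi>|lborel. (cmod (v n \<xi> - u \<xi>))\<^sup>2) + 2 * ((cmod (t n - ?t))\<^sup>2 * (LINT \<xi>|lborel. (cmod (?E \<xi>))\<^sup>2))) \<longlonglongrightarrow> 0"
        by simp
    qed
    have L: "(\<lambda>n. LINT \<xi>|lborel. (cmod (v n \<xi> - t n * ?E \<xi>))\<^sup>2) \<longlonglongrightarrow> (LINT \<xi>|lborel. (cmod (u \<xi> - ?t * ?E \<xi>))\<^sup>2)"
      by (rule tendsto_L2_norm[OF _ _ i lim2]) measurable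
    have "(\<lambda>n. inverse (real (Suc n))) \<longlonglongrightarrow> 0"
      by (rule LIMSEQ_inverse_real_of_nat)
    then have "(\<lambda>n. 2 * ((8 * pi\<^sup>2 * K * inverse (real (Suc n)))\<^sup>2 * (m\<^sup>2 * ?U))) \<longlonglongrightarrow> 2 * ((8 * pi\<^sup>2 * K * 0)\<^sup>2 * (m\<^sup>2 * ?U))"
      by (intro tendsto_intros)
    then have "r \<longlonglongrightarrow> 0"
      unfolding r_def by (simp only: divide_inverse) simp
    then have "(\<lambda>n. C * (\<Sum>l\<in>UNIV. 2 * (m\<^sup>2 * ?B l) + r n)) \<longlonglongrightarrow> C * (\<Sum>l\<in>UNIV. 2 * (m\<^sup>2 * ?B l) + 0)"
      by (intro tendsto_intros)
    with L have "(LINT \<xi>|lborel. (cmod (u \<xi> - ?t * ?E \<xi>))\<^sup>2) \<le> C * (\<Sum>l\<in>UNIV. 2 * (m\<^sup>2 * ?B l) + 0)"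
      by (rule LIMSEQ_le) (use P in blast)
    also have "(\<Sum>l\<in>UNIV. 2 * (m\<^sup>2 * ?B l) + 0) = 2 * m\<^sup>2 * (\<Sum>l\<in>UNIV. ?B l)"
      by (simp add: sum_distrib_left mult.assoc)
    also have "C * (2 * m\<^sup>2 * (\<Sum>l\<in>UNIV. ?B l)) \<le> C * ((2 * m\<^sup>2 + 1) * (\<Sum>l\<in>UNIV. ?B l))"
      using C by (intro mult_left_mono mult_right_mono sum_nonneg B0) auto
    finally show "(LINT \<xi>|lborel. (cmod (u \<xi> - ?t * ?E \<xi>))\<^sup>2) \<le> C * (2 * m\<^sup>2 + 1) * (\<Sum>l\<in>UNIV. ?B l)"
      by (simp only: mult.assoc)
  qed
qed

section \<open>The Stein--Poincare inequality\<close>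

text \<open>Applying the transform twice is reflection. This places the reflected function among the
  Schwartz functions without a chain rule for iterated partials.\<close>

lemma fourier_reflect_schwartz:
  assumes \<phi>: "\<phi> \<in> schwartz"
  shows "(\<lambda>\<xi>. cnj (\<phi> (- \<xi>))) \<in> schwartz"
    and "fourier_integral (\<lambda>\<xi>. cnj (\<phi> (- \<xi>))) x = cnj (fourier_integral \<phi> x)"
proof -
  have e: "(\<lambda>\<xi>. cnj (\<phi> (- \<xi>))) = (\<lambda>\<xi>. cnj (fourier_integral (fourier_integral \<phi>) \<xi>))"
  proof
    fix \<xi>
    have "fourier_integral (fourier_integral \<phi>) \<xi> = inv_fourier_integral (fourier_integral \<phi>) (- \<xi>)"
      unfolding fourier_integral_def[of "fourier_integral \<phi>"] inv_fourier_integral_def by (simp add: inner_commute)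
    then show "cnj (\<phi> (- \<xi>)) = cnj (fourier_integral (fourier_integral \<phi>) \<xi>)"
      using fourier_inversion[OF \<phi>, of "- \<xi>"] by simp
  qed
  show "(\<lambda>\<xi>. cnj (\<phi> (- \<xi>))) \<in> schwartz"
    unfolding e by (intro schwartz_cnj fourier_integral_schwartz \<phi>)
  show "fourier_integral (\<lambda>\<xi>. cnj (\<phi> (- \<xi>))) x = cnj (fourier_integral \<phi> x)"
    unfolding e fourier_cnj_fourier[OF fourier_integral_schwartz[OF \<phi>]] ..
qed

text \<open>The Hermitian symmetry of the transform of a real function. For a distribution it is
  expressed by a second representative, to be compared with the first by uniqueness.\<close>

lemma fourier_rep_real_reflect:
  fixes u :: "real^'d::finite \<Rightarrow> complex"
  assumes u: "fourier_rep (distr_of_real f) u"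
  shows "fourier_rep (distr_of_real f) (\<lambda>\<xi>. cnj (u (- \<xi>)))"
  unfolding fourier_rep_def
proof (intro conjI ballI)
  have [measurable]: "u \<in> borel_measurable borel"
    using u by (rule fourier_rep_measurable)
  show "(\<lambda>\<xi>. cnj (u (- \<xi>))) \<in> borel_measurable lborel"
    by measurable
  fix \<phi> :: "real^'d \<Rightarrow> complex" assume \<phi>: "\<phi> \<in> schwartz"
  define w where "w = (\<lambda>\<xi>. u \<xi> * cnj (\<phi> (- \<xi>)))"
  note a = fourier_rep_apply[OF u fourier_reflect_schwartz(1)[OF \<phi>]]
  have wi: "integrable lborel w"
    unfolding w_def by (rule a(2))
  have e: "cnj (u (- \<xi>)) * \<phi> \<xi> = cnj (w (0 + (- 1) *\<^sub>R \<xi>))" for \<xi>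
    by (simp add: w_def)
  show "integrable lborel (\<lambda>\<xi>. cnj (u (- \<xi>)) * \<phi> \<xi>)"
    unfolding e by (intro integrable_cnj integrable_lborel_affine wi) simp
  have "(LINT \<xi>|lborel. w \<xi>) = (LINT \<xi>|lborel. w (0 + (- 1) *\<^sub>R \<xi>))"
    using integral_lborel_affine[OF wi, of "- 1" 0] by simp
  then have "distr_of (\<lambda>\<xi>. cnj (u (- \<xi>))) \<phi> = cnj (LINT \<xi>|lborel. w \<xi>)"
    unfolding distr_of_def e by simp
  also have "\<dots> = cnj (distr_of_real f (\<lambda>x. cnj (fourier_integral \<phi> x)))"
    using a(1) unfolding w_def fourier_reflect_schwartz(2)[OF \<phi>] by simp
  also have "\<dots> = fourier_distr (distr_of_real f) \<phi>"
    unfolding distr_of_real_def distr_of_def fourier_distr_def Bochner_Integration.integral_cnj[symmetric] by simp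
  finally show "fourier_distr (distr_of_real f) \<phi> = distr_of (\<lambda>\<xi>. cnj (u (- \<xi>))) \<phi>" ..
qed

lemma fourier_ball_eq:
  fixes u :: "real^'d::finite \<Rightarrow> complex"
  assumes u: "fourier_rep (distr_of_real f) u"
  shows "fourier_ball \<epsilon> f = (LINT \<xi>:ball 0 \<epsilon>|lborel. u \<xi>)"
proof -
  have [measurable]: "u \<in> borel_measurable borel" "fourier_fun (distr_of_real f) \<in> borel_measurable borel"
    using u fourier_rep_fourier_fun[OF u] by (auto intro: fourier_rep_measurable)
  have [measurable]: "ball (0::real^'d) \<epsilon> \<in> sets borel" by simp
  show ?thesis
    unfolding fourier_ball_def set_lebesgue_integral_def
    by (intro integral_cong_AE) (use fourier_fun_AE[OF u] in auto)
qed

text \<open>The ball is symmetric about the origin, so Hermitian symmetry makes the integral over it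
  real. Square integrability enters through integrability of \<open>u\<close> on the ball, which the
  reflection of the integral needs.\<close>

lemma fourier_ball_real:
  fixes u :: "real^'d::finite \<Rightarrow> complex"
  assumes u: "fourier_rep (distr_of_real f) u" and sq: "square_integrable u"
  shows "cnj (fourier_ball \<epsilon> f) = fourier_ball \<epsilon> f"
proof -
  have [measurable]: "u \<in> borel_measurable borel"
    using u by (rule fourier_rep_measurable)
  have [measurable]: "ball (0::real^'d) \<epsilon> \<in> sets borel" by simp
  define w where "w = (\<lambda>\<xi>. indicator (ball 0 \<epsilon>) \<xi> *\<^sub>R u \<xi>)"
  have wi: "integrable lborel w"
  proof (rule Bochner_Integration.integrable_bound)
    show "integrable lborel (\<lambda>\<xi>. indicator (ball (0::real^'d) \<epsilon>) \<xi> + (cmod (u \<xi>))\<^sup>2)"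
      using sq integrable_real_indicator[OF _ emeasure_lborel_ball_finite, of "0::real^'d" \<epsilon>]
      by (intro Bochner_Integration.integrable_add) (auto simp: square_integrable_def)
    have "cmod (u \<xi>) \<le> 1 + (cmod (u \<xi>))\<^sup>2" for \<xi>
    proof -
      have "2 * cmod (u \<xi>) \<le> (cmod (u \<xi>))\<^sup>2 + 1"
        using sum_squares_bound[of "cmod (u \<xi>)" 1] by simp
      then show ?thesis
        using zero_le_power2[of "cmod (u \<xi>)"] by linarith
    qed
    then show "AE \<xi> in lborel. cmod (w \<xi>) \<le> norm (indicator (ball 0 \<epsilon>) \<xi> + (cmod (u \<xi>))\<^sup>2)"
      by (intro AE_I2) (auto simp: w_def indicator_def)
    show "w \<in> borel_measurable lborel"
      unfolding w_def by measurable
  qed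
  have "fourier_ball \<epsilon> f = (LINT \<xi>:ball 0 \<epsilon>|lborel. cnj (u (- \<xi>)))"
    by (intro fourier_ball_eq fourier_rep_real_reflect u)
  also have "\<dots> = (LINT \<xi>|lborel. cnj (w (0 + (- 1) *\<^sub>R \<xi>)))"
    unfolding set_lebesgue_integral_def w_def by (intro Bochner_Integration.integral_cong refl) (simp add: indicator_def)
  also have "\<dots> = cnj (LINT \<xi>|lborel. w \<xi>)"
    using integral_lborel_affine[OF wi, of "- 1" 0] by simp
  also have "(LINT \<xi>|lborel. w \<xi>) = fourier_ball \<epsilon> f"
    unfolding w_def set_lebesgue_integral_def[symmetric] by (rule fourier_ball_eq[OF u, symmetric])
  finally show ?thesis ..
qed

section \<open>Mass and ball averages of the Gaussian\<close>

lemma integral_exp_pos: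
  fixes h :: "'a::euclidean_space \<Rightarrow> real"
  assumes "integrable lborel (\<lambda>x. exp (h x))"
  shows "(LINT x|lborel. exp (h x)) > 0"
proof -
  have "(LINT x|lborel. exp (h x)) \<noteq> 0"
  proof
    assume "(LINT x|lborel. exp (h x)) = 0"
    then have "AE x in lborel. exp (h x) = 0"
      using integral_nonneg_eq_0_iff_AE[OF assms] by simp
    then have "AE x in (lborel :: 'a measure). False"
      by eventually_elim simp
    then have "emeasure lborel (space (lborel :: 'a measure)) = 0"
      by (simp add: AE_iff_measurable[OF _ refl])
    then show False by simp
  qed
  moreover have "(LINT x|lborel. exp (h x)) \<ge> 0"
    by (intro Bochner_Integration.integral_nonneg) simp
  ultimately show ?thesis by linarith
qed

lemma integrable_exp_quad_potential:
  fixes S :: "real^'d::finite^'d"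
  assumes "sym_pos_def S" "c > 0"
  shows "integrable lborel (\<lambda>x. exp (- c * quad_potential \<mu> S x))"
  using integrable_schwartz[OF exp_quad_potential_schwartz[OF assms]]
  unfolding complex_of_real_integrable_eq .

lemma fourier_rep_exp_quad_potential:
  fixes S :: "real^'d::finite^'d"
  assumes S: "sym_pos_def S"
  shows "fourier_rep (distr_of_real (\<lambda>x. exp (- quad_potential \<mu> S x / 2)))
    (\<lambda>\<xi>. complex_of_real (LINT x|lborel. exp (- quad_potential \<mu> S x / 2)) * gauss_hat \<mu> S \<xi>)"
  using fourier_rep_L1[OF integrable_schwartz[OF exp_quad_potential_schwartz[OF S, of "1 / 2" \<mu>]]]
  unfolding distr_of_real_def fourier_exp_quad_potential[OF S, symmetric] by simp

lemma fourier_ball_exp_quad_potential: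
  fixes S :: "real^'d::finite^'d"
  assumes S: "sym_pos_def S"
  shows "fourier_ball \<epsilon> (\<lambda>x. exp (- quad_potential \<mu> S x / 2))
    = complex_of_real (LINT x|lborel. exp (- quad_potential \<mu> S x / 2)) * (LINT \<xi>:ball 0 \<epsilon>|lborel. gauss_hat \<mu> S \<xi>)"
  unfolding fourier_ball_eq[OF fourier_rep_exp_quad_potential[OF S]] by simp

lemma integral_exp_quad_potential_pos:
  fixes S :: "real^'d::finite^'d"
  assumes "sym_pos_def S"
  shows "(LINT x|lborel. exp (- quad_potential \<mu> S x / 2)) > 0"
  using integrable_exp_quad_potential[OF assms, of "1 / 2" \<mu>] by (intro integral_exp_pos) simp

text \<open>By continuity the real part stays above 1/2 near the origin, where the value is 1. On
  larger balls the phase coming from the mean may cause cancellation, so smallness of the radius is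
  used.\<close>

lemma gauss_hat_ball_nonzero:
  fixes S :: "real^'d::finite^'d"
  assumes S: "sym_pos_def S"
  shows "\<exists>\<epsilon>>0. (LINT \<xi>:ball 0 \<epsilon>|lborel. gauss_hat \<mu> S \<xi>) \<noteq> 0"
proof -
  have cont: "continuous_on UNIV (gauss_hat \<mu> S)"
    using gauss_hat_differentiable[OF S] by (simp add: continuous_at_imp_continuous_on differentiable_imp_continuous_within)
  then have "isCont (gauss_hat \<mu> S) 0"
    by (simp add: continuous_on_eq_continuous_at)
  then obtain e where e: "e > 0" "\<And>\<xi>. dist \<xi> 0 < e \<Longrightarrow> dist (gauss_hat \<mu> S \<xi>) (gauss_hat \<mu> S 0) < 1 / 2"
    unfolding continuous_at_eps_delta by (metis half_gt_zero_iff zero_less_one)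
  let ?B = "ball (0::real^'d) e"
  have [measurable]: "?B \<in> sets borel" by simp
  have i: "integrable lborel (\<lambda>\<xi>. indicator ?B \<xi> *\<^sub>R gauss_hat \<mu> S \<xi>)"
    using integrable_continuous_ball[OF cont] .
  have ib: "integrable lborel (indicator ?B :: real^'d \<Rightarrow> real)"
    using integrable_real_indicator[OF _ emeasure_lborel_ball_finite, of "0::real^'d" e] by simp
  have "Re (LINT \<xi>:?B|lborel. gauss_hat \<mu> S \<xi>) = (LINT \<xi>|lborel. indicator ?B \<xi> * Re (gauss_hat \<mu> S \<xi>))"
    unfolding set_lebesgue_integral_def using i by (simp flip: integral_Re)
  also have "\<dots> \<ge> (LINT \<xi>|lborel. indicator ?B \<xi> * (1 / 2))"
  proof (rule integral_mono)
    show "integrable lborel (\<lambda>\<xi>. indicator ?B \<xi> * (1 / 2) :: real)"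
      using ib by (rule integrable_mult_left)
    show "integrable lborel (\<lambda>\<xi>. indicator ?B \<xi> * Re (gauss_hat \<mu> S \<xi>))"
      using integrable_Re[OF i] by simp
    show "indicator ?B \<xi> * (1 / 2) \<le> indicator ?B \<xi> * Re (gauss_hat \<mu> S \<xi>)" for \<xi>
    proof (cases "\<xi> \<in> ?B")
      case True
      then have "\<bar>Re (gauss_hat \<mu> S \<xi>) - 1\<bar> < 1 / 2"
        using e(2)[of \<xi>] abs_Re_le_cmod[of "gauss_hat \<mu> S \<xi> - 1"] by (simp add: dist_norm)
      with True show ?thesis by (simp add: abs_if split: if_splits)
    qed simp
  qed
  finally have "Re (LINT \<xi>:?B|lborel. gauss_hat \<mu> S \<xi>) \<ge> measure lborel ?B / 2"
    by simp
  moreover have "measure lborel ?B > 0"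
    using e(1) by (rule content_ball_pos)
  ultimately have "Re (LINT \<xi>:?B|lborel. gauss_hat \<mu> S \<xi>) > 0" by linarith
  then show ?thesis
    using e(1) by (intro exI[of _ e]) auto
qed

lemma sum_mult_norm_square_le:
  fixes s :: "'i \<Rightarrow> real" and z :: "'i \<Rightarrow> complex"
  shows "(cmod (\<Sum>i\<in>I. complex_of_real (s i) * z i))\<^sup>2 \<le> (\<Sum>i\<in>I. (s i)\<^sup>2) * (\<Sum>i\<in>I. (cmod (z i))\<^sup>2)"
proof -
  have "cmod (\<Sum>i\<in>I. complex_of_real (s i) * z i) \<le> (\<Sum>i\<in>I. \<bar>s i\<bar> * cmod (z i))"
    by (rule order_trans[OF norm_sum]) (simp add: norm_mult)
  then have "(cmod (\<Sum>i\<in>I. complex_of_real (s i) * z i))\<^sup>2 \<le> (\<Sum>i\<in>I. \<bar>s i\<bar> * cmod (z i))\<^sup>2"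
    by (rule power_mono) simp
  also have "\<dots> \<le> (\<Sum>i\<in>I. \<bar>s i\<bar>\<^sup>2) * (\<Sum>i\<in>I. (cmod (z i))\<^sup>2)"
    by (rule Cauchy_Schwarz_ineq_sum)
  finally show ?thesis by simp
qed

text \<open>Plancherel turns the left-hand side into the centred norm of
  \<open>weighted_poincare\<close>, whose right-hand side is a linear image of the field and hence
  bounded by the dissipation. The constant is fixed before \<open>V\<close>, \<open>\<rho>\<close>,
  \<open>D\<close> and \<open>k\<close>; the kernel enters only through the factor
  \<open>D\<close>.\<close>

theorem stein_poincare:
  fixes S :: "real^'d::finite^'d"
  assumes S: "sym_pos_def S" and Z: "fourier_ball \<epsilon> (\<lambda>x. exp (- quad_potential \<mu> S x / 2)) \<noteq> 0"
  shows "\<exists>C>0. \<forall>V \<rho> D k. condition_H V (quad_potential \<mu> S) \<rho> \<longrightarrow> stein_kernel D k \<longrightarrow> D \<ge> 1 \<longrightarrow>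
    (\<exists>\<tau>. complex_of_real \<tau> = fourier_ball \<epsilon> (weighted V (quad_potential \<mu> S) \<rho>) / fourier_ball \<epsilon> (\<lambda>x. exp (- quad_potential \<mu> S x / 2)) \<and>
      (LINT x|lborel. (weighted V (quad_potential \<mu> S) \<rho> x - \<tau> * exp (- quad_potential \<mu> S x / 2))\<^sup>2)
        \<le> C * D * stein_fisher k V (quad_potential \<mu> S) \<rho>)"
proof -
  let ?V0 = "quad_potential \<mu> S" and ?E = "gauss_hat \<mu> S"
  let ?g = "\<lambda>x. exp (- ?V0 x / 2)"
  define c where "c = (LINT x|lborel. ?g x)"
  have c0: "c > 0"
    unfolding c_def by (rule integral_exp_quad_potential_pos[OF S])
  let ?z = "LINT \<xi>:ball 0 \<epsilon>|lborel. ?E \<xi>"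
  have fg: "fourier_ball \<epsilon> ?g = complex_of_real c * ?z"
    unfolding c_def by (rule fourier_ball_exp_quad_potential[OF S])
  have z0: "?z \<noteq> 0"
    using Z unfolding fg by auto
  obtain C where C: "C > 0" and poincare: "\<And>f u b. square_integrable f \<Longrightarrow> fourier_rep (distr_of f) u \<Longrightarrow>
    (\<And>l. b l \<in> borel_measurable borel) \<Longrightarrow> (\<And>l. integrable lborel (\<lambda>\<xi>. (cmod (b l \<xi>))\<^sup>2 / (1 + (norm \<xi>)\<^sup>2))) \<Longrightarrow>
    weak_gauss_eq \<mu> S u b \<Longrightarrow>
    (LINT \<xi>|lborel. (cmod (u \<xi> - (LINT \<xi>:ball 0 \<epsilon>|lborel. u \<xi>) / ?z * ?E \<xi>))\<^sup>2)
      \<le> C * (\<Sum>l\<in>UNIV. LINT \<xi>|lborel. (cmod (b l \<xi>))\<^sup>2 / (1 + (norm \<xi>)\<^sup>2))"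
    using weighted_poincare[OF S z0] by blast
  \<comment> \<open>The squared Frobenius norm of \<open>S\<close>, from Cauchy-Schwarz in
    \<open>b = - 4 pi i S G\<close>.\<close>
  define K where "K = (\<Sum>l\<in>UNIV. \<Sum>i\<in>UNIV. (S $ l $ i)\<^sup>2)"
  have K0: "K \<ge> 0"
    unfolding K_def by (intro sum_nonneg) simp
  show ?thesis
  proof (rule exI[of _ "C * (16 * pi\<^sup>2 * K + 1)"], rule conjI; (intro allI impI)?)
    show "0 < C * (16 * pi\<^sup>2 * K + 1)"
      using C K0 by (intro mult_pos_pos add_nonneg_pos) auto
    fix V \<rho> :: "real^'d \<Rightarrow> real" and D and k :: "real^'d \<Rightarrow> real"
    assume H: "condition_H V ?V0 \<rho>" and k: "stein_kernel D k" and D: "D \<ge> 1"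
    let ?f = "weighted V ?V0 \<rho>"
    obtain u G where u: "square_integrable u" "fourier_rep (distr_of_real ?f) u"
      and Gm[measurable]: "\<And>i. G i \<in> borel_measurable borel"
      and Gi: "\<And>i. integrable lborel (\<lambda>\<xi>. (cmod (G i \<xi>))\<^sup>2 / (1 + (norm \<xi>)\<^sup>2))"
      and Gb: "\<And>D k. stein_kernel D k \<Longrightarrow> D \<ge> 1 \<Longrightarrow>
        (\<Sum>i\<in>UNIV. LINT \<xi>|lborel. (cmod (G i \<xi>))\<^sup>2 / (1 + (norm \<xi>)\<^sup>2)) \<le> D * stein_fisher k V ?V0 \<rho>"
      and weak: "weak_gauss_eq \<mu> S u (\<lambda>l \<xi>. - 4 * pi * \<i> * (\<Sum>i\<in>UNIV. complex_of_real (S $ l $ i) * G i \<xi>))"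
      by (rule stein_data[OF S H]) (rule that; assumption)
    define b where "b = (\<lambda>l \<xi>. - 4 * pi * \<i> * (\<Sum>i\<in>UNIV. complex_of_real (S $ l $ i) * G i \<xi>))"
    let ?J = "\<lambda>\<xi>. 1 + (norm (\<xi>::real^'d))\<^sup>2"
    have bm[measurable]: "b l \<in> borel_measurable borel" for l
      unfolding b_def by measurable
    let ?h = "\<lambda>l \<xi>. 16 * pi\<^sup>2 * (\<Sum>i\<in>UNIV. (S $ l $ i)\<^sup>2) * (\<Sum>i\<in>UNIV. (cmod (G i \<xi>))\<^sup>2 / ?J \<xi>)"
    have bh: "(cmod (b l \<xi>))\<^sup>2 / ?J \<xi> \<le> ?h l \<xi>" for l \<xi>
    proof -
      have "(cmod (b l \<xi>))\<^sup>2 = 16 * pi\<^sup>2 * (cmod (\<Sum>i\<in>UNIV. complex_of_real (S $ l $ i) * G i \<xi>))\<^sup>2"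
        unfolding b_def by (simp add: norm_mult power_mult_distrib)
      also have "\<dots> \<le> 16 * pi\<^sup>2 * ((\<Sum>i\<in>UNIV. (S $ l $ i)\<^sup>2) * (\<Sum>i\<in>UNIV. (cmod (G i \<xi>))\<^sup>2))"
        by (intro mult_left_mono sum_mult_norm_square_le) simp
      finally have "(cmod (b l \<xi>))\<^sup>2 / ?J \<xi> \<le> 16 * pi\<^sup>2 * ((\<Sum>i\<in>UNIV. (S $ l $ i)\<^sup>2) * (\<Sum>i\<in>UNIV. (cmod (G i \<xi>))\<^sup>2)) / ?J \<xi>"
        by (intro divide_right_mono) (auto simp: less_imp_le)
      also have "\<dots> = ?h l \<xi>"
        by (simp add: sum_divide_distrib[symmetric])
      finally show ?thesis .
    qed
    have hi: "integrable lborel (?h l)" for l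
      by (intro integrable_mult_right Bochner_Integration.integrable_sum Gi)
    have bi: "integrable lborel (\<lambda>\<xi>. (cmod (b l \<xi>))\<^sup>2 / ?J \<xi>)" for l
      by (rule Bochner_Integration.integrable_bound[OF hi[of l]])
        (use bh in \<open>auto simp: less_imp_le intro!: AE_I2 order_trans[OF _ abs_ge_self]\<close>)
    have B: "(\<Sum>l\<in>UNIV. LINT \<xi>|lborel. (cmod (b l \<xi>))\<^sup>2 / ?J \<xi>) \<le> (16 * pi\<^sup>2 * K) * (\<Sum>i\<in>UNIV. LINT \<xi>|lborel. (cmod (G i \<xi>))\<^sup>2 / ?J \<xi>)"
    proof -
      have "(\<Sum>l\<in>UNIV. LINT \<xi>|lborel. (cmod (b l \<xi>))\<^sup>2 / ?J \<xi>) \<le> (\<Sum>l\<in>UNIV. LINT \<xi>|lborel. ?h l \<xi>)"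
        by (intro sum_mono integral_mono bi hi bh)
      also have "\<dots> = (16 * pi\<^sup>2 * K) * (\<Sum>i\<in>UNIV. LINT \<xi>|lborel. (cmod (G i \<xi>))\<^sup>2 / ?J \<xi>)"
        unfolding integral_mult_right_zero Bochner_Integration.integral_sum[OF Gi] K_def
        by (simp only: sum_distrib_left[symmetric] sum_distrib_right[symmetric])
      finally show ?thesis .
    qed
    have G0: "0 \<le> (\<Sum>i\<in>UNIV. LINT \<xi>|lborel. (cmod (G i \<xi>))\<^sup>2 / ?J \<xi>)"
      by (intro sum_nonneg Bochner_Integration.integral_nonneg) (simp add: less_imp_le)
    let ?F = "\<lambda>x. complex_of_real (?f x)"
    have sqf: "square_integrable ?F"
      using H unfolding condition_H_def square_integrable_def by auto
    have rep: "fourier_rep (distr_of ?F) u"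
      using u(2) unfolding distr_of_real_def .
    define t where "t = fourier_ball \<epsilon> ?f / fourier_ball \<epsilon> ?g"
    \<comment> \<open>Numerator and denominator are ball averages of transforms of real functions,
      so \<open>\<tau>\<close> is a real number although its formula involves complex
      integrals.\<close>
    have "cnj t = t"
    proof -
      have "cnj (fourier_ball \<epsilon> ?g) = fourier_ball \<epsilon> ?g"
        by (rule fourier_ball_real[OF fourier_rep_exp_quad_potential[OF S]])
          (use square_integrable_schwartz[OF schwartz_cmult[OF gauss_hat_schwartz[OF S]]] in blast)
      then show ?thesis
        unfolding t_def complex_cnj_divide fourier_ball_real[OF u(2,1)] by simp
    qed
    then have "t \<in> \<real>"
      by (simp add: Reals_cnj_iff)
    then obtain \<tau> where \<tau>: "complex_of_real \<tau> = t"
      by (auto elim: Reals_cases)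
    \<comment> \<open>\<open>weighted_poincare\<close> uses the Gaussian normalised to 1 at the
      origin, while the transform of \<open>?g\<close> is \<open>c\<close> times it; the
      coefficients differ by that factor.\<close>
    have tz: "(LINT \<xi>:ball 0 \<epsilon>|lborel. u \<xi>) / ?z = t * c"
      unfolding t_def fg fourier_ball_eq[OF u(2)] using c0 by simp
    let ?g' = "\<lambda>x. complex_of_real (\<tau> * ?g x)"
    have g's: "?g' \<in> schwartz"
      using schwartz_cmult[OF exp_quad_potential_schwartz[OF S, of "1 / 2" \<mu>], of "complex_of_real \<tau>"] by simp
    have g'F: "fourier_integral ?g' \<xi> = t * (complex_of_real c * ?E \<xi>)" for \<xi>
      unfolding of_real_mult fourier_integral_cmult fourier_exp_quad_potential[OF S] c_def[symmetric] \<tau> ..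
    have "(LINT x|lborel. (?f x - \<tau> * ?g x)\<^sup>2) = (LINT x|lborel. (cmod (?F x - ?g' x))\<^sup>2)"
      by (simp only: of_real_diff[symmetric] norm_of_real power2_abs)
    also have "\<dots> = (LINT \<xi>|lborel. (cmod (u \<xi> - fourier_integral ?g' \<xi>))\<^sup>2)"
      by (intro plancherel_diff[symmetric] sqf rep square_integrable_schwartz g's fourier_rep_L1 integrable_schwartz)
    also have "\<dots> = (LINT \<xi>|lborel. (cmod (u \<xi> - (LINT \<xi>:ball 0 \<epsilon>|lborel. u \<xi>) / ?z * ?E \<xi>))\<^sup>2)"
      unfolding tz g'F by (simp only: mult.assoc)
    also have "\<dots> \<le> C * (\<Sum>l\<in>UNIV. LINT \<xi>|lborel. (cmod (b l \<xi>))\<^sup>2 / ?J \<xi>)"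
      by (rule poincare[OF sqf rep bm bi weak[folded b_def]])
    also have "\<dots> \<le> C * ((16 * pi\<^sup>2 * K + 1) * (\<Sum>i\<in>UNIV. LINT \<xi>|lborel. (cmod (G i \<xi>))\<^sup>2 / ?J \<xi>))"
      using C B G0 by (intro mult_left_mono) (auto simp: distrib_right)
    also have "\<dots> \<le> C * ((16 * pi\<^sup>2 * K + 1) * (D * stein_fisher k V ?V0 \<rho>))"
      using C K0 by (intro mult_left_mono Gb k D) auto
    finally have "(LINT x|lborel. (?f x - \<tau> * ?g x)\<^sup>2) \<le> C * (16 * pi\<^sup>2 * K + 1) * D * stein_fisher k V ?V0 \<rho>"
      by (simp only: mult.assoc)
    with \<tau> show "\<exists>\<tau>. complex_of_real \<tau> = fourier_ball \<epsilon> ?f / fourier_ball \<epsilon> ?g \<and>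
      (LINT x|lborel. (?f x - \<tau> * ?g x)\<^sup>2) \<le> C * (16 * pi\<^sup>2 * K + 1) * D * stein_fisher k V ?V0 \<rho>"
      unfolding t_def by blast
  qed
qed

section \<open>Relative entropy and mass\<close>

text \<open>With \<open>r\<close> the density relative to the equilibrium measure,
  \<open>ln r \<le> r - 1\<close> gives an entropy of at most the integral of \<open>r^2\<close>
  minus 1. As \<open>r\<close> has mean 1, that is the variance of \<open>r\<close>, the minimum
  over \<open>c\<close> of the integral of \<open>(r - c)^2\<close>. Hence any \<open>\<tau>\<close>
  is admissible on the right, in particular the ball average rather than the probabilistic
  normalisation.\<close>

lemma KL_le_chi_square:
  fixes V \<rho> :: "real^'d::finite \<Rightarrow> real"
  assumes [measurable]: "V \<in> borel_measurable borel" "\<rho> \<in> borel_measurable borel"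
    and Vi: "integrable lborel (\<lambda>x. exp (- V x))" and \<rho>: "probability_density \<rho>"
    and sq: "integrable lborel (\<lambda>x. (\<rho> x)\<^sup>2 * exp (V x))"
  shows "KL (measure_of_density \<rho>) (measure_of_density (rho_inf V))
    \<le> ereal ((LINT x|lborel. exp (- V x)) * (LINT x|lborel. (\<rho> x * exp (V x) - \<tau>)\<^sup>2 * exp (- V x)))"
proof -
  define Z where "Z = (LINT x|lborel. exp (- V x))"
  have Z: "Z > 0"
    unfolding Z_def by (rule integral_exp_pos[OF Vi])
  define q where "q = (\<lambda>x. exp (- V x) / Z)"
  have q0: "q x > 0" for x using Z by (simp add: q_def)
  have [measurable]: "q \<in> borel_measurable borel" unfolding q_def by measurable
  define Q where "Q = density lborel (\<lambda>x. ennreal (q x))"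
  have Q: "measure_of_density (rho_inf V) = Q"
    by (simp add: measure_of_density_def Q_def q_def rho_inf_def[abs_def] Z_def)
  define P where "P = measure_of_density \<rho>"
  have \<rho>0: "AE x in lborel. \<rho> x \<ge> 0" and P1: "prob_space P"
    using \<rho> by (auto simp: probability_density_def P_def)
  \<comment> \<open>The truncation makes \<open>r\<close> nonnegative everywhere, whereas
    \<open>\<rho>\<close> is so only almost everywhere.\<close>
  define r where "r = (\<lambda>x. max 0 (\<rho> x) * exp (V x) * Z)"
  have r0: "r x \<ge> 0" for x using Z by (simp add: r_def)
  have [measurable]: "r \<in> borel_measurable borel" unfolding r_def by measurable
  have qr: "q x * r x = max 0 (\<rho> x)" for x
    using Z by (simp add: q_def r_def exp_minus field_simps)
  have sQ[measurable_cong]: "sets Q = sets borel" by (simp add: Q_def)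
  have PQ: "density Q (\<lambda>x. ennreal (r x)) = P"
  proof -
    have "density Q (\<lambda>x. ennreal (r x)) = density lborel (\<lambda>x. ennreal (q x) * ennreal (r x))"
      unfolding Q_def by (rule density_density_eq) measurable
    also have "\<dots> = density lborel (\<lambda>x. ennreal (\<rho> x))"
    proof (rule density_cong)
      show "AE x in lborel. ennreal (q x) * ennreal (r x) = ennreal (\<rho> x)"
        using \<rho>0 by eventually_elim (simp add: ennreal_mult'[symmetric] q0 less_imp_le qr max_def)
    qed measurable
    finally show ?thesis unfolding P_def measure_of_density_def .
  qed
  have iQ: "integrable Q h \<longleftrightarrow> integrable lborel (\<lambda>x. q x * h x)" and eQ: "(LINT x|Q. h x) = (LINT x|lborel. q x * h x)"
    if "h \<in> borel_measurable borel" for h :: "real^'d \<Rightarrow> real"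
    using that integrable_density[of h lborel q] integral_density[of h lborel q] q0
    by (auto simp: Q_def less_imp_le)
  interpret Q: prob_space Q
  proof
    have "integrable lborel q"
      unfolding q_def using Vi by simp
    then have "(\<integral>\<^sup>+x. ennreal (q x) \<partial>lborel) = ennreal (LINT x|lborel. q x)"
      using q0 by (intro nn_integral_eq_integral) (auto simp: less_imp_le)
    also have "(LINT x|lborel. q x) = 1"
      unfolding q_def using Z by (simp add: Z_def[symmetric])
    finally show "emeasure Q (space Q) = 1"
      unfolding Q_def by (subst emeasure_density) auto
  qed
  have RN: "AE x in Q. enn2real (RN_deriv Q P x) = r x"
  proof -
    have "AE x in Q. ennreal (r x) = RN_deriv Q P x"
      by (rule Q.RN_deriv_unique[OF _ PQ]) measurable
    then show ?thesis
      by eventually_elim (use r0 enn2real_ennreal in metis)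
  qed
  have ac: "absolutely_continuous Q P"
    unfolding PQ[symmetric] by (rule absolutely_continuousI_density) measurable
  have RNm[measurable]: "RN_deriv Q P \<in> borel_measurable Q"
    by (rule borel_measurable_RN_deriv)
  have r2: "integrable Q (\<lambda>x. (r x)\<^sup>2)"
  proof -
    have "AE x in lborel. Z * ((\<rho> x)\<^sup>2 * exp (V x)) = q x * (r x)\<^sup>2"
      using \<rho>0
    proof eventually_elim
      case (elim x)
      have "q x * (r x)\<^sup>2 = (q x * r x) * r x"
        by (simp only: power2_eq_square mult.assoc)
      also have "\<dots> = \<rho> x * (\<rho> x * exp (V x) * Z)"
        unfolding qr using elim by (simp add: r_def)
      finally show ?case
        by (simp add: power2_eq_square)
    qed
    from integrable_cong_AE[OF _ _ this] have "integrable lborel (\<lambda>x. q x * (r x)\<^sup>2)"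
      using integrable_mult_right[OF sq, of Z] by simp
    then show ?thesis
      by (subst iQ) measurable
  qed
  have r1: "integrable Q r"
  proof (rule Bochner_Integration.integrable_bound)
    show "integrable Q (\<lambda>x. 1 + (r x)\<^sup>2)"
      by (intro Bochner_Integration.integrable_add r2) simp
    have "r x \<le> 1 + (r x)\<^sup>2" for x
      using sum_squares_bound[of "r x" 1] r0[of x] by simp
    then show "AE x in Q. norm (r x) \<le> norm (1 + (r x)\<^sup>2)"
      by (intro AE_I2) (simp add: r0)
  qed measurable
  have int_r: "(LINT x|Q. r x) = 1"
  proof -
    have "(\<integral>\<^sup>+x. ennreal (r x) \<partial>Q) = emeasure P (space P)"
      unfolding PQ[symmetric] by (subst emeasure_density) (auto intro!: nn_integral_cong)
    also have "\<dots> = 1"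
      by (rule prob_space.emeasure_space_1[OF P1])
    finally show ?thesis
      using integral_eq_nn_integral[of r Q] by (simp add: r0)
  qed
  have ln_le: "ln (r x) * r x \<le> (r x)\<^sup>2 - r x" for x
  proof (cases "r x = 0")
    case False
    with r0[of x] have "r x > 0" by simp
    then have "ln (r x) * r x \<le> (r x - 1) * r x"
      by (intro mult_right_mono ln_le_minus_one) auto
    then show ?thesis by (simp add: power2_eq_square algebra_simps)
  qed simp
  \<comment> \<open>The lower bound makes the integrand absolutely integrable, which decides between
    the finite and the infinite case of \<open>KL\<close>.\<close>
  have ln_ge: "ln (r x) * r x \<ge> - 1" for x
  proof (cases "r x = 0")
    case False
    with r0[of x] have p: "r x > 0" by simp
    then have "- ln (r x) \<le> 1 / r x - 1"
      using ln_le_minus_one[of "1 / r x"] by (simp add: ln_div)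
    then have "- ln (r x) * r x \<le> (1 / r x - 1) * r x"
      using p by (intro mult_right_mono) auto
    also have "\<dots> \<le> 1" using p by (simp add: left_diff_distrib)
    finally show ?thesis by simp
  qed simp
  have li: "integrable Q (\<lambda>x. ln (r x) * r x)"
  proof (rule Bochner_Integration.integrable_bound)
    show "integrable Q (\<lambda>x. 1 + (r x)\<^sup>2)"
      by (intro Bochner_Integration.integrable_add r2) simp
    have "\<bar>ln (r x) * r x\<bar> \<le> 1 + (r x)\<^sup>2" for x
      using ln_le[of x] ln_ge[of x] r0[of x] zero_le_power2[of "r x"] by linarith
    then show "AE x in Q. norm (ln (r x) * r x) \<le> norm (1 + (r x)\<^sup>2)"
      by (intro AE_I2) simp
  qed measurable
  have "integrable Q (\<lambda>x. enn2real (RN_deriv Q P x) * ln (enn2real (RN_deriv Q P x)))"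
  proof -
    have "AE x in Q. ln (r x) * r x = enn2real (RN_deriv Q P x) * ln (enn2real (RN_deriv Q P x))"
      using RN by eventually_elim (simp add: mult.commute)
    from integrable_cong_AE[OF _ _ this] show ?thesis
      using li by simp
  qed
  then have "KL P Q = ereal (LINT x|Q. ln (enn2real (RN_deriv Q P x)) * enn2real (RN_deriv Q P x))"
    using ac by (simp add: KL_def)
  also have "(LINT x|Q. ln (enn2real (RN_deriv Q P x)) * enn2real (RN_deriv Q P x)) = (LINT x|Q. ln (r x) * r x)"
  proof (rule integral_cong_AE)
    show "AE x in Q. ln (enn2real (RN_deriv Q P x)) * enn2real (RN_deriv Q P x) = ln (r x) * r x"
      using RN by eventually_elim simp
  qed measurable
  finally have KL: "KL P Q = ereal (LINT x|Q. ln (r x) * r x)" .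
  \<comment> \<open>In terms of \<open>r\<close> the shift by \<open>\<tau>\<close> becomes a shift
    by \<open>\<tau> * Z\<close>, since \<open>r\<close> is \<open>Z\<close> times the quotient
    \<open>\<rho> exp V\<close>.\<close>
  define c where "c = \<tau> * Z"
  have "(LINT x|Q. ln (r x) * r x) \<le> (LINT x|Q. (r x)\<^sup>2 - r x)"
    using r1 r2 by (intro integral_mono li ln_le) auto
  also have "\<dots> = (LINT x|Q. (r x)\<^sup>2) - 1"
    using r1 r2 int_r by simp
  also have "\<dots> \<le> (LINT x|Q. (r x)\<^sup>2) - 2 * c + c\<^sup>2"
    using zero_le_power2[of "c - 1"] by (simp add: power2_diff)
  also have "\<dots> = (LINT x|Q. (r x)\<^sup>2 - 2 * c * r x + c\<^sup>2)"
    using r1 r2 int_r by (simp add: Q.prob_space)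
  also have "\<dots> = (LINT x|lborel. q x * ((r x)\<^sup>2 - 2 * c * r x + c\<^sup>2))"
    by (rule eQ) measurable
  also have "\<dots> = (LINT x|lborel. Z * ((\<rho> x * exp (V x) - \<tau>)\<^sup>2 * exp (- V x)))"
  proof (rule integral_cong_AE)
    show "AE x in lborel. q x * ((r x)\<^sup>2 - 2 * c * r x + c\<^sup>2) = Z * ((\<rho> x * exp (V x) - \<tau>)\<^sup>2 * exp (- V x))"
      using \<rho>0
    proof eventually_elim
      case (elim x)
      then have "r x = Z * (\<rho> x * exp (V x))" by (simp add: r_def)
      then have "(r x)\<^sup>2 - 2 * c * r x + c\<^sup>2 = Z * (Z * (\<rho> x * exp (V x) - \<tau>)\<^sup>2)"
        by (simp add: c_def power2_eq_square algebra_simps)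
      then show ?case
        using Z by (simp add: q_def)
    qed
  qed measurable
  finally have "(LINT x|Q. ln (r x) * r x) \<le> Z * (LINT x|lborel. (\<rho> x * exp (V x) - \<tau>)\<^sup>2 * exp (- V x))"
    by simp
  then show ?thesis
    unfolding Q P_def[symmetric] KL Z_def by simp
qed

lemma borel_measurable_quad_potential [measurable]: "quad_potential \<mu> S \<in> borel_measurable borel"
  using continuous_real_polymonial_function[OF quad_potential_polynomial]
  by (intro borel_measurable_continuous_onI continuous_at_imp_continuous_on ballI)

lemma integrable_exp_minus:
  fixes S :: "real^'d::finite^'d"
  assumes S: "sym_pos_def S" and [measurable]: "V \<in> borel_measurable borel"
    and V: "AE x in lborel. V x \<ge> C + quad_potential \<mu> S x"
  shows "integrable lborel (\<lambda>x. exp (- V x))"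
proof (rule Bochner_Integration.integrable_bound)
  show "integrable lborel (\<lambda>x. exp (- C) * exp (- 1 * quad_potential \<mu> S x))"
    by (intro integrable_mult_right integrable_exp_quad_potential S) simp
  show "AE x in lborel. norm (exp (- V x)) \<le> norm (exp (- C) * exp (- 1 * quad_potential \<mu> S x))"
    using V by eventually_elim (simp flip: exp_add)
qed measurable

text \<open>The weights of the two squared distances differ by \<open>exp (- V + V0)\<close>, which
  the lower bound on \<open>V\<close> keeps below \<open>exp (- C)\<close>. The same comparison
  gives the integrability required by \<open>KL_le_chi_square\<close>.\<close>

lemma KL_le_weighted_L2:
  fixes S :: "real^'d::finite^'d"
  assumes S: "sym_pos_def S" and Vm[measurable]: "V \<in> borel_measurable borel"
    and V: "AE x in lborel. V x \<ge> C + quad_potential \<mu> S x"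
    and \<rho>: "probability_density \<rho>" and H: "condition_H V (quad_potential \<mu> S) \<rho>"
  shows "KL (measure_of_density \<rho>) (measure_of_density (rho_inf V))
    \<le> ereal ((LINT x|lborel. exp (- V x)) * exp (- C) *
        (LINT x|lborel. (weighted V (quad_potential \<mu> S) \<rho> x - \<tau> * exp (- quad_potential \<mu> S x / 2))\<^sup>2))"
proof -
  let ?V0 = "quad_potential \<mu> S" let ?f = "weighted V ?V0 \<rho>" and ?g = "\<lambda>x. exp (- ?V0 x / 2)"
  have \<rho>m[measurable]: "\<rho> \<in> borel_measurable borel" and fm[measurable]: "?f \<in> borel_measurable borel"
    and fi: "integrable lborel (\<lambda>x. (?f x)\<^sup>2)"
    using H by (auto simp: condition_H_def square_integrable_def)
  have gi: "integrable lborel (\<lambda>x. (?g x)\<^sup>2)"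
    using integrable_exp_quad_potential[OF S, of 1 \<mu>] by (simp add: power2_eq_square flip: exp_add)
  note Vi = integrable_exp_minus[OF S Vm V]
  have di: "integrable lborel (\<lambda>x. (?f x - \<tau> * ?g x)\<^sup>2)"
  proof (rule Bochner_Integration.integrable_bound)
    show "integrable lborel (\<lambda>x. 2 * (?f x)\<^sup>2 + 2 * (\<tau>\<^sup>2 * (?g x)\<^sup>2))"
      by (intro Bochner_Integration.integrable_add integrable_mult_right fi gi)
    have "(?f x - \<tau> * ?g x)\<^sup>2 \<le> 2 * (?f x)\<^sup>2 + 2 * (\<tau>\<^sup>2 * (?g x)\<^sup>2)" for x
      using norm_diff_square_le[of "?f x" "\<tau> * ?g x"] by (simp add: power_mult_distrib abs_mult)
    then show "AE x in lborel. norm ((?f x - \<tau> * ?g x)\<^sup>2) \<le> norm (2 * (?f x)\<^sup>2 + 2 * (\<tau>\<^sup>2 * (?g x)\<^sup>2))"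
      by (intro AE_I2) simp
  qed measurable
  have e: "exp (- V x + ?V0 x) \<le> exp (- C)" if "V x \<ge> C + ?V0 x" for x
    using that by simp
  have fe: "(\<rho> x)\<^sup>2 * exp (V x) = (?f x)\<^sup>2 * exp (- V x + ?V0 x)" for x
  proof -
    have "exp (V x) = (exp (V x - ?V0 x / 2))\<^sup>2 * exp (- V x + ?V0 x)"
      by (simp add: power2_eq_square flip: exp_add)
    then show ?thesis by (simp add: weighted_def power_mult_distrib mult_ac)
  qed
  have de: "(\<rho> x * exp (V x) - \<tau>)\<^sup>2 * exp (- V x) = (?f x - \<tau> * ?g x)\<^sup>2 * exp (- V x + ?V0 x)" for x
  proof -
    have "?f x - \<tau> * ?g x = (\<rho> x * exp (V x) - \<tau>) * ?g x"
      by (simp add: weighted_def left_diff_distrib mult.assoc flip: exp_add)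
    moreover have "(?g x)\<^sup>2 * exp (- V x + ?V0 x) = exp (- V x)"
      by (simp add: power2_eq_square flip: exp_add)
    ultimately show ?thesis
      by (simp add: power_mult_distrib mult.assoc)
  qed
  have si: "integrable lborel (\<lambda>x. (\<rho> x)\<^sup>2 * exp (V x))"
    unfolding fe
  proof (rule Bochner_Integration.integrable_bound)
    show "integrable lborel (\<lambda>x. (?f x)\<^sup>2 * exp (- C))"
      using fi by (rule integrable_mult_left)
    show "AE x in lborel. norm ((?f x)\<^sup>2 * exp (- V x + ?V0 x)) \<le> norm ((?f x)\<^sup>2 * exp (- C))"
      using V by eventually_elim (auto intro!: mult_left_mono)
  qed measurable
  have "(LINT x|lborel. (\<rho> x * exp (V x) - \<tau>)\<^sup>2 * exp (- V x)) \<le> (LINT x|lborel. exp (- C) * (?f x - \<tau> * ?g x)\<^sup>2)"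
    unfolding de
  proof (rule integral_mono_AE')
    show "integrable lborel (\<lambda>x. exp (- C) * (?f x - \<tau> * ?g x)\<^sup>2)"
      using di by (rule integrable_mult_right)
    show "AE x in lborel. (?f x - \<tau> * ?g x)\<^sup>2 * exp (- V x + ?V0 x) \<le> exp (- C) * (?f x - \<tau> * ?g x)\<^sup>2"
      using V
    proof eventually_elim
      case (elim x)
      show ?case
        using mult_left_mono[OF e[OF elim] zero_le_power2[of "?f x - \<tau> * ?g x"]] by (simp only: mult.commute)
    qed
  qed auto
  then have "(LINT x|lborel. exp (- V x)) * (LINT x|lborel. (\<rho> x * exp (V x) - \<tau>)\<^sup>2 * exp (- V x))
     \<le> (LINT x|lborel. exp (- V x)) * (exp (- C) * (LINT x|lborel. (?f x - \<tau> * ?g x)\<^sup>2))"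
    using integral_exp_pos[OF Vi] by (intro mult_left_mono) auto
  then have "ereal ((LINT x|lborel. exp (- V x)) * (LINT x|lborel. (\<rho> x * exp (V x) - \<tau>)\<^sup>2 * exp (- V x)))
     \<le> ereal ((LINT x|lborel. exp (- V x)) * exp (- C) * (LINT x|lborel. (?f x - \<tau> * ?g x)\<^sup>2))"
    by (simp only: ereal_less_eq mult.assoc)
  with KL_le_chi_square[OF Vm \<rho>m Vi \<rho> si, of \<tau>] show ?thesis
    by (rule order_trans)
qed

text \<open>Pairing \<open>\<rho> e\<^sup>V\<^sup>-\<^sup>V\<^sup>0\<^sup>/\<^sup>2 - \<tau> e\<^sup>-\<^sup>V\<^sup>0\<^sup>/\<^sup>2\<close> with \<open>e\<^sup>-\<^sup>V\<^sup>+\<^sup>V\<^sup>0\<^sup>/\<^sup>2\<close> bounds \<open>\<tau>\<close> by the mass of \<open>\<rho>\<close>.\<close>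

lemma weighted_L2_le:
  fixes S :: "real^'d::finite^'d"
  assumes S: "sym_pos_def S" and Vm[measurable]: "V \<in> borel_measurable borel"
    and V: "AE x in lborel. V x \<ge> C + quad_potential \<mu> S x"
  shows "\<exists>K>0. \<forall>\<rho> \<tau>. condition_H V (quad_potential \<mu> S) \<rho> \<longrightarrow>
    (LINT x|lborel. (weighted V (quad_potential \<mu> S) \<rho> x)\<^sup>2) \<le> K * ((LINT x|lborel. \<bar>\<rho> x\<bar>)\<^sup>2 +
      (LINT x|lborel. (weighted V (quad_potential \<mu> S) \<rho> x - \<tau> * exp (- quad_potential \<mu> S x / 2))\<^sup>2))"
proof -
  let ?V0 = "quad_potential \<mu> S" let ?g = "\<lambda>x. exp (- ?V0 x / 2)" and ?h = "\<lambda>x. exp (- V x + ?V0 x / 2)"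
  note Vi = integrable_exp_minus[OF S Vm V]
  define Z where "Z = (LINT x|lborel. exp (- V x))"
  have Z: "Z > 0"
    unfolding Z_def by (rule integral_exp_pos[OF Vi])
  have gi: "integrable lborel (\<lambda>x. (?g x)\<^sup>2)"
    using integrable_exp_quad_potential[OF S, of 1 \<mu>] by (simp add: power2_eq_square flip: exp_add)
  \<comment> \<open>\<open>exp (- 2 V + V0)\<close> is at most \<open>exp (- C) exp (- V)\<close> by
    the lower bound on \<open>V\<close>, so the function paired with below is square
    integrable.\<close>
  have hle: "AE x in lborel. (?h x)\<^sup>2 \<le> exp (- C) * exp (- V x)"
    using V by eventually_elim (simp add: power2_eq_square flip: exp_add)
  have hi: "integrable lborel (\<lambda>x. (?h x)\<^sup>2)"
  proof (rule Bochner_Integration.integrable_bound)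
    show "integrable lborel (\<lambda>x. exp (- C) * exp (- V x))"
      using Vi by (rule integrable_mult_right)
    show "AE x in lborel. norm ((?h x)\<^sup>2) \<le> norm (exp (- C) * exp (- V x))"
      using hle by eventually_elim simp
  qed measurable
  define N where "N = (LINT x|lborel. (?h x)\<^sup>2)"
  define M where "M = (LINT x|lborel. (?g x)\<^sup>2)"
  have N0: "N \<ge> 0" and M0: "M \<ge> 0" by (auto simp: N_def M_def)
  \<comment> \<open>From \<open>f = d + \<tau> g\<close> the norm is at most
    \<open>2 X + 2 M \<tau>^2\<close>, and the pairing bounds \<open>\<tau>^2\<close> by
    \<open>2 (1 + N) (m^2 + X) / Z^2\<close>.\<close>
  define K where "K = 2 + 4 * M * (1 + N) / Z\<^sup>2"
  show ?thesis
  proof (rule exI[of _ K], rule conjI; (intro allI impI)?)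
    show "K > 0"
      unfolding K_def using M0 N0 Z by (intro add_pos_nonneg) auto
    fix \<rho> \<tau> assume H: "condition_H V ?V0 \<rho>"
    let ?f = "weighted V ?V0 \<rho>"
    let ?d = "\<lambda>x. ?f x - \<tau> * ?g x"
    define X where "X = (LINT x|lborel. (?d x)\<^sup>2)"
    define m where "m = (LINT x|lborel. \<bar>\<rho> x\<bar>)"
    have \<rho>i: "integrable lborel \<rho>" and fm[measurable]: "?f \<in> borel_measurable borel"
      and fi: "integrable lborel (\<lambda>x. (?f x)\<^sup>2)"
      using H by (auto simp: condition_H_def square_integrable_def)
    have di: "integrable lborel (\<lambda>x. (?d x)\<^sup>2)"
    proof (rule Bochner_Integration.integrable_bound)
      show "integrable lborel (\<lambda>x. 2 * (?f x)\<^sup>2 + 2 * (\<tau>\<^sup>2 * (?g x)\<^sup>2))"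
        by (intro Bochner_Integration.integrable_add integrable_mult_right fi gi)
      have "(?d x)\<^sup>2 \<le> 2 * (?f x)\<^sup>2 + 2 * (\<tau>\<^sup>2 * (?g x)\<^sup>2)" for x
        using norm_diff_square_le[of "?f x" "\<tau> * ?g x"] by (simp add: power_mult_distrib abs_mult)
      then show "AE x in lborel. norm ((?d x)\<^sup>2) \<le> norm (2 * (?f x)\<^sup>2 + 2 * (\<tau>\<^sup>2 * (?g x)\<^sup>2))"
        by (intro AE_I2) simp
    qed measurable
    have X0: "X \<ge> 0" by (simp add: X_def)
    \<comment> \<open>The exponentials cancel: the pairing sees the mass of \<open>\<rho>\<close>
      minus \<open>\<tau>\<close> times the normalisation, so \<open>\<tau>\<close> is controlled by
      the mass and the distance.\<close>
    have dh: "?d x * ?h x = \<rho> x - \<tau> * exp (- V x)" for x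
      by (simp add: weighted_def left_diff_distrib mult.assoc flip: exp_add)
    have "\<bar>(LINT x|lborel. ?d x * ?h x)\<bar> \<le> (LINT x|lborel. \<bar>?d x\<bar> * \<bar>?h x\<bar>)"
      using integral_abs_bound[of lborel "\<lambda>x. ?d x * ?h x"] by (simp add: abs_mult)
    also have "\<dots> \<le> sqrt X * sqrt N"
      unfolding X_def N_def by (intro Cauchy_Schwarz_integral di hi) measurable
    finally have "\<bar>(LINT x|lborel. \<rho> x) - \<tau> * Z\<bar> \<le> sqrt X * sqrt N"
      unfolding dh using \<rho>i Vi by (simp add: Z_def)
    moreover have "\<bar>LINT x|lborel. \<rho> x\<bar> \<le> m"
      unfolding m_def by (rule integral_abs_bound)
    ultimately have "\<bar>\<tau> * Z\<bar> \<le> m + sqrt X * sqrt N" by linarith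
    then have "(\<tau> * Z)\<^sup>2 \<le> (m + sqrt X * sqrt N)\<^sup>2"
      by (rule abs_le_square_iff[THEN iffD1, OF order_trans]) simp
    also have "\<dots> \<le> 2 * m\<^sup>2 + 2 * (X * N)"
      using norm_add_square_le[of m "sqrt X * sqrt N"] X0 N0 by (simp add: power_mult_distrib abs_mult)
    also have "\<dots> \<le> 2 * (1 + N) * (m\<^sup>2 + X)"
      using N0 X0 by (simp add: algebra_simps)
    finally have \<tau>: "\<tau>\<^sup>2 \<le> 2 * (1 + N) * (m\<^sup>2 + X) / Z\<^sup>2"
      using Z by (simp add: power_mult_distrib pos_le_divide_eq)
    have "(LINT x|lborel. (?f x)\<^sup>2) \<le> (LINT x|lborel. 2 * (?d x)\<^sup>2 + 2 * (\<tau>\<^sup>2 * (?g x)\<^sup>2))"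
    proof (intro integral_mono fi Bochner_Integration.integrable_add integrable_mult_right di gi)
      show "(?f x)\<^sup>2 \<le> 2 * (?d x)\<^sup>2 + 2 * (\<tau>\<^sup>2 * (?g x)\<^sup>2)" for x
        using norm_add_square_le[of "?d x" "\<tau> * ?g x"] by (simp add: power_mult_distrib abs_mult)
    qed
    also have "\<dots> = 2 * X + 2 * (\<tau>\<^sup>2 * M)"
      unfolding X_def M_def using di gi by simp
    also have "\<dots> \<le> 2 * (m\<^sup>2 + X) + 2 * (2 * (1 + N) * (m\<^sup>2 + X) / Z\<^sup>2 * M)"
      using \<tau> M0 by (intro add_mono mult_left_mono mult_right_mono) auto
    also have "\<dots> = K * (m\<^sup>2 + X)"
      unfolding K_def by (simp add: algebra_simps add_divide_distrib)
    finally show "(LINT x|lborel. (?f x)\<^sup>2) \<le> K * ((LINT x|lborel. \<bar>\<rho> x\<bar>)\<^sup>2 + (LINT x|lborel. (?d x)\<^sup>2))"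
      unfolding X_def m_def .
  qed
qed

text \<open>The radius is a function of the kernel, chosen before the potential, so it cannot avoid
  a zero of the Gaussian's ball average for every mean and covariance. The statement therefore
  prescribes \<open>eps k\<close> whenever the quotient makes sense there and permits another radius
  with nonzero denominator otherwise. The factor \<open>lam\<close> is fixed before the kernel,
  which records that only \<open>D\<close> matters.\<close>

theorem theorem1p1:
  shows "\<exists>eps :: (real^'d::finite \<Rightarrow> real) \<Rightarrow> real. (\<forall>k. eps k > 0) \<and>
    (\<forall>(\<mu> :: real^'d) (C :: real) (S :: real^'d^'d) (V :: real^'d \<Rightarrow> real) (V0 :: real^'d \<Rightarrow> real) (D :: real).
       sym_pos_def S \<longrightarrow> V0 = quad_potential \<mu> S \<longrightarrow>
       loc_ess_bounded V \<longrightarrow> (AE x in lborel. V x \<ge> 0) \<longrightarrow> (AE x in lborel. V x \<ge> C + V0 x) \<longrightarrow>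
       D \<ge> 1 \<longrightarrow>
       (\<exists>lam>0. \<forall>k. stein_kernel D k \<longrightarrow>
          (\<exists>\<epsilon>>0. fourier_ball \<epsilon> (\<lambda>x. exp (- V0 x / 2)) \<noteq> 0 \<and>
             (fourier_ball (eps k) (\<lambda>x. exp (- V0 x / 2)) \<noteq> 0 \<longrightarrow> \<epsilon> = eps k) \<and>
             (\<forall>\<rho>. condition_H V V0 \<rho> \<longrightarrow>
                (\<exists>\<tau>::real.
                   complex_of_real \<tau> =
                     fourier_ball \<epsilon> (\<lambda>x. \<rho> x * exp (V x - V0 x / 2)) /
                     fourier_ball \<epsilon> (\<lambda>x. exp (- V0 x / 2)) \<and>
                   lam * (LINT x|lborel. \<bar>\<rho> x * exp (V x - V0 x / 2) - \<tau> * exp (- V0 x / 2)\<bar>\<^sup>2)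
                     \<le> stein_fisher k V V0 \<rho>))) \<and>
          (\<forall>\<rho>. condition_H V V0 \<rho> \<longrightarrow> probability_density \<rho> \<longrightarrow>
             ereal lam * KL (measure_of_density \<rho>) (measure_of_density (rho_inf V))
               \<le> ereal (stein_fisher k V V0 \<rho>))) \<and>
       (\<forall>k. stein_kernel D k \<longrightarrow>
          (\<exists>C'>0. \<forall>\<rho>. condition_H V V0 \<rho> \<longrightarrow>
             (LINT x|lborel. \<bar>\<rho> x * exp (V x - V0 x / 2)\<bar>\<^sup>2) +
             (\<Sum>i\<in>UNIV. (sobolev_norm (-1) (weighted_grad V V0 \<rho> i))\<^sup>2)
               \<le> C' * ((LINT x|lborel. \<bar>\<rho> x\<bar>)\<^sup>2 + stein_fisher k V V0 \<rho>))))"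
proof (intro exI[of _ "\<lambda>k. 1"] conjI allI impI)
  show "(0::real) < 1" for k :: "real^'d \<Rightarrow> real" by simp
  fix \<mu> :: "real^'d" and C :: real and S :: "real^'d^'d" and V V0 :: "real^'d \<Rightarrow> real" and D :: real
  assume S: "sym_pos_def S" and V0: "V0 = quad_potential \<mu> S" and Vb: "loc_ess_bounded V"
    and V: "AE x in lborel. V x \<ge> C + V0 x" and D: "D \<ge> 1"
  have Vm: "V \<in> borel_measurable borel"
    using Vb by (simp add: loc_ess_bounded_def)
  note V' = V[unfolded V0]
  let ?g = "\<lambda>x. exp (- V0 x / 2)"
  let ?fb = "\<lambda>\<epsilon>. fourier_ball \<epsilon> ?g"
  obtain e where e: "e > 0" "?fb e \<noteq> 0"
    using gauss_hat_ball_nonzero[OF S, of \<mu>] integral_exp_quad_potential_pos[OF S, of \<mu>]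
    unfolding V0 fourier_ball_exp_quad_potential[OF S] by auto
  \<comment> \<open>The constant choice \<open>eps k = 1\<close> is kept whenever the denominator is
    nonzero; otherwise the small radius \<open>e\<close> takes over.\<close>
  define \<epsilon> where "\<epsilon> = (if ?fb 1 \<noteq> 0 then 1 else e)"
  have \<epsilon>: "\<epsilon> > 0" "?fb \<epsilon> \<noteq> 0" "?fb 1 \<noteq> 0 \<longrightarrow> \<epsilon> = 1"
    using e by (auto simp: \<epsilon>_def)
  let ?f = "\<lambda>\<rho>. weighted V V0 \<rho>" and ?\<Phi> = "\<lambda>k \<rho>. stein_fisher k V V0 \<rho>"
  obtain B where B: "B > 0" and poincare: "\<And>\<rho> D k. condition_H V V0 \<rho> \<Longrightarrow> stein_kernel D k \<Longrightarrow> D \<ge> 1 \<Longrightarrow>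
    \<exists>\<tau>. complex_of_real \<tau> = fourier_ball \<epsilon> (?f \<rho>) / ?fb \<epsilon> \<and>
      (LINT x|lborel. (?f \<rho> x - \<tau> * ?g x)\<^sup>2) \<le> B * D * ?\<Phi> k \<rho>"
    using stein_poincare[OF S \<epsilon>(2)[unfolded V0]] unfolding V0 by blast
  have BD: "B * D > 0"
    using B D by simp
  \<comment> \<open>Nonnegativity of the dissipation is read off from the Poincare inequality, whose
    left-hand side is a square.\<close>
  have \<Phi>0: "?\<Phi> k \<rho> \<ge> 0" if H: "condition_H V V0 \<rho>" and k: "stein_kernel D k" for k \<rho>
  proof -
    obtain \<tau> where "(LINT x|lborel. (?f \<rho> x - \<tau> * ?g x)\<^sup>2) \<le> B * D * ?\<Phi> k \<rho>"
      using poincare[OF H k D] by blast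
    moreover have "0 \<le> (LINT x|lborel. (?f \<rho> x - \<tau> * ?g x)\<^sup>2)"
      by (intro Bochner_Integration.integral_nonneg) simp
    ultimately have "0 \<le> B * D * ?\<Phi> k \<rho>" by linarith
    then show ?thesis
      using BD by (simp add: zero_le_mult_iff)
  qed
  define w where "w = (LINT x|lborel. exp (- V x)) * exp (- C)"
  have w: "w > 0"
    unfolding w_def using integral_exp_pos[OF integrable_exp_minus[OF S Vm V']] by simp
  \<comment> \<open>One factor for two inequalities: the distance costs \<open>B * D\<close>, the
    entropy an additional \<open>w\<close>, and \<open>1 + w\<close> dominates both 1 and
    \<open>w\<close>.\<close>
  define lam where "lam = 1 / (B * D * (1 + w))"
  have lam: "lam > 0"
    unfolding lam_def using BD w by simp
  have lam_le: "lam * X \<le> p" "lam * (w * X) \<le> p" if "X \<le> B * D * p" "p \<ge> 0" for X p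
  proof -
    have "lam * X \<le> lam * (B * D * p)" "lam * (w * X) \<le> lam * (w * (B * D * p))"
      using that lam w by (auto intro!: mult_left_mono)
    moreover have "lam * (B * D * p) = p / (1 + w)" "lam * (w * (B * D * p)) = p * (w / (1 + w))"
      unfolding lam_def using BD by auto
    moreover have "p / (1 + w) \<le> p" "p * (w / (1 + w)) \<le> p"
      using that w by (auto simp: divide_le_eq distrib_left)
    ultimately show "lam * X \<le> p" "lam * (w * X) \<le> p" by linarith+
  qed
  show "\<exists>lam>0. \<forall>k. stein_kernel D k \<longrightarrow>
          (\<exists>\<epsilon>>0. fourier_ball \<epsilon> (\<lambda>x. exp (- V0 x / 2)) \<noteq> 0 \<and>
             (fourier_ball 1 (\<lambda>x. exp (- V0 x / 2)) \<noteq> 0 \<longrightarrow> \<epsilon> = 1) \<and>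
             (\<forall>\<rho>. condition_H V V0 \<rho> \<longrightarrow>
                (\<exists>\<tau>::real.
                   complex_of_real \<tau> =
                     fourier_ball \<epsilon> (\<lambda>x. \<rho> x * exp (V x - V0 x / 2)) /
                     fourier_ball \<epsilon> (\<lambda>x. exp (- V0 x / 2)) \<and>
                   lam * (LINT x|lborel. \<bar>\<rho> x * exp (V x - V0 x / 2) - \<tau> * exp (- V0 x / 2)\<bar>\<^sup>2)
                     \<le> stein_fisher k V V0 \<rho>))) \<and>
          (\<forall>\<rho>. condition_H V V0 \<rho> \<longrightarrow> probability_density \<rho> \<longrightarrow>
             ereal lam * KL (measure_of_density \<rho>) (measure_of_density (rho_inf V))
               \<le> ereal (stein_fisher k V V0 \<rho>))"
  proof (rule exI[of _ lam], intro conjI lam allI impI)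
    fix k :: "real^'d \<Rightarrow> real" assume k: "stein_kernel D k"
    show "\<exists>\<epsilon>>0. fourier_ball \<epsilon> (\<lambda>x. exp (- V0 x / 2)) \<noteq> 0 \<and>
             (fourier_ball 1 (\<lambda>x. exp (- V0 x / 2)) \<noteq> 0 \<longrightarrow> \<epsilon> = 1) \<and>
             (\<forall>\<rho>. condition_H V V0 \<rho> \<longrightarrow>
                (\<exists>\<tau>::real.
                   complex_of_real \<tau> =
                     fourier_ball \<epsilon> (\<lambda>x. \<rho> x * exp (V x - V0 x / 2)) /
                     fourier_ball \<epsilon> (\<lambda>x. exp (- V0 x / 2)) \<and>
                   lam * (LINT x|lborel. \<bar>\<rho> x * exp (V x - V0 x / 2) - \<tau> * exp (- V0 x / 2)\<bar>\<^sup>2)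
                     \<le> stein_fisher k V V0 \<rho>))"
    proof (rule exI[of _ \<epsilon>], intro conjI \<epsilon> allI impI)
      fix \<rho> :: "real^'d \<Rightarrow> real" assume H: "condition_H V V0 \<rho>"
      obtain \<tau> where \<tau>: "complex_of_real \<tau> = fourier_ball \<epsilon> (?f \<rho>) / ?fb \<epsilon>"
        "(LINT x|lborel. (?f \<rho> x - \<tau> * ?g x)\<^sup>2) \<le> B * D * ?\<Phi> k \<rho>"
        using poincare[OF H k D] by blast
      from \<tau>(1) lam_le(1)[OF \<tau>(2) \<Phi>0[OF H k]]
      show "\<exists>\<tau>::real.
          complex_of_real \<tau> = fourier_ball \<epsilon> (\<lambda>x. \<rho> x * exp (V x - V0 x / 2)) / fourier_ball \<epsilon> (\<lambda>x. exp (- V0 x / 2)) \<and>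
          lam * (LINT x|lborel. \<bar>\<rho> x * exp (V x - V0 x / 2) - \<tau> * exp (- V0 x / 2)\<bar>\<^sup>2) \<le> stein_fisher k V V0 \<rho>"
        unfolding weighted_def[abs_def] power2_abs by blast
    qed
    fix \<rho> :: "real^'d \<Rightarrow> real" assume H: "condition_H V V0 \<rho>" and \<rho>: "probability_density \<rho>"
    obtain \<tau> where \<tau>: "(LINT x|lborel. (?f \<rho> x - \<tau> * ?g x)\<^sup>2) \<le> B * D * ?\<Phi> k \<rho>"
      using poincare[OF H k D] by blast
    have "ereal lam * KL (measure_of_density \<rho>) (measure_of_density (rho_inf V))
       \<le> ereal lam * ereal (w * (LINT x|lborel. (?f \<rho> x - \<tau> * ?g x)\<^sup>2))"
      using KL_le_weighted_L2[OF S Vm V' \<rho> H[unfolded V0], of \<tau>] lam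
      unfolding V0 w_def by (intro ereal_mult_left_mono) auto
    also have "\<dots> \<le> ereal (?\<Phi> k \<rho>)"
      using lam_le(2)[OF \<tau> \<Phi>0[OF H k]] by simp
    finally show "ereal lam * KL (measure_of_density \<rho>) (measure_of_density (rho_inf V)) \<le> ereal (stein_fisher k V V0 \<rho>)" .
  qed
  fix k :: "real^'d \<Rightarrow> real" assume k: "stein_kernel D k"
  obtain K where K: "K > 0" and mass: "\<And>\<rho> \<tau>. condition_H V V0 \<rho> \<Longrightarrow>
    (LINT x|lborel. (?f \<rho> x)\<^sup>2) \<le> K * ((LINT x|lborel. \<bar>\<rho> x\<bar>)\<^sup>2 + (LINT x|lborel. (?f \<rho> x - \<tau> * ?g x)\<^sup>2))"
    using weighted_L2_le[OF S Vm V'] unfolding V0 by blast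
  \<comment> \<open>The total multiplicity of the squared norm of \<open>f\<close>: once by itself,
    and \<open>32 pi^2\<close> for each of the \<open>d\<close> components of the weighted
    gradient.\<close>
  define q where "q = 1 + 32 * pi\<^sup>2 * real CARD('d)"
  have q: "q \<ge> 0" by (simp add: q_def)
  show "\<exists>C'>0. \<forall>\<rho>. condition_H V V0 \<rho> \<longrightarrow>
             (LINT x|lborel. \<bar>\<rho> x * exp (V x - V0 x / 2)\<bar>\<^sup>2) +
             (\<Sum>i\<in>UNIV. (sobolev_norm (-1) (weighted_grad V V0 \<rho> i))\<^sup>2)
               \<le> C' * ((LINT x|lborel. \<bar>\<rho> x\<bar>)\<^sup>2 + stein_fisher k V V0 \<rho>)"
  \<comment> \<open>The norm of \<open>f\<close> contributes \<open>q K\<close> times the mass and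
    \<open>q K B D\<close> times the dissipation; the gradient adds \<open>8 D\<close> through the
    bound on \<open>G\<close>. A single constant for both terms is their sum.\<close>
  proof (rule exI[of _ "q * K * (1 + B * D) + 8 * D"], intro conjI allI impI)
    show "0 < q * K * (1 + B * D) + 8 * D"
      using q K BD D by (intro add_nonneg_pos mult_nonneg_nonneg) auto
    fix \<rho> :: "real^'d \<Rightarrow> real" assume H: "condition_H V V0 \<rho>"
    let ?m = "(LINT x|lborel. \<bar>\<rho> x\<bar>)\<^sup>2" and ?F = "LINT x|lborel. (?f \<rho> x)\<^sup>2"
    obtain u :: "real^'d \<Rightarrow> complex" and G :: "'d \<Rightarrow> real^'d \<Rightarrow> complex" where u: "(LINT \<xi>|lborel. (cmod (u \<xi>))\<^sup>2) = ?F"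
      and G: "\<And>D k. stein_kernel D k \<Longrightarrow> D \<ge> 1 \<Longrightarrow>
        (\<Sum>i\<in>UNIV. LINT \<xi>|lborel. (cmod (G i \<xi>))\<^sup>2 / (1 + (norm \<xi>)\<^sup>2)) \<le> D * ?\<Phi> k \<rho>"
      and grad: "\<And>i. (sobolev_norm (-1) (weighted_grad V V0 \<rho> i))\<^sup>2 \<le>
       8 * (LINT \<xi>|lborel. (cmod (G i \<xi>))\<^sup>2 / (1 + (norm \<xi>)\<^sup>2)) + 32 * pi\<^sup>2 * (LINT \<xi>|lborel. (cmod (u \<xi>))\<^sup>2)"
      by (rule stein_data[OF S H[unfolded V0], folded V0]) (rule that; assumption)
    have "?F + (\<Sum>i\<in>UNIV. (sobolev_norm (-1) (weighted_grad V V0 \<rho> i))\<^sup>2)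
      \<le> ?F + (\<Sum>i\<in>UNIV. 8 * (LINT \<xi>|lborel. (cmod (G i \<xi>))\<^sup>2 / (1 + (norm \<xi>)\<^sup>2)) + 32 * pi\<^sup>2 * ?F)"
      by (intro add_left_mono sum_mono grad[unfolded u])
    also have "\<dots> = q * ?F + 8 * (\<Sum>i\<in>UNIV. LINT \<xi>|lborel. (cmod (G i \<xi>))\<^sup>2 / (1 + (norm \<xi>)\<^sup>2))"
      by (simp add: q_def sum.distrib sum_distrib_left algebra_simps)
    also have "\<dots> \<le> q * (K * (?m + B * D * ?\<Phi> k \<rho>)) + 8 * (D * ?\<Phi> k \<rho>)"
    proof -
      obtain \<tau> where \<tau>: "(LINT x|lborel. (?f \<rho> x - \<tau> * ?g x)\<^sup>2) \<le> B * D * ?\<Phi> k \<rho>"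
        using poincare[OF H k D] by blast
      have "?F \<le> K * (?m + (LINT x|lborel. (?f \<rho> x - \<tau> * ?g x)\<^sup>2))"
        by (rule mass[OF H])
      also have "\<dots> \<le> K * (?m + B * D * ?\<Phi> k \<rho>)"
        using K \<tau> by (intro mult_left_mono) auto
      finally show ?thesis
        using q G[OF k D] by (intro add_mono mult_left_mono) auto
    qed
    also have "\<dots> \<le> (q * K * (1 + B * D) + 8 * D) * (?m + ?\<Phi> k \<rho>)"
    proof -
      have "0 \<le> q * K * ?\<Phi> k \<rho>" "0 \<le> q * K * (B * D) * ?m" "0 \<le> D * ?m"
        using q K BD D \<Phi>0[OF H k] by auto
      then show ?thesis by (simp add: algebra_simps)
    qed
    finally show "(LINT x|lborel. \<bar>\<rho> x * exp (V x - V0 x / 2)\<bar>\<^sup>2) +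
        (\<Sum>i\<in>UNIV. (sobolev_norm (-1) (weighted_grad V V0 \<rho> i))\<^sup>2)
      \<le> (q * K * (1 + B * D) + 8 * D) * ((LINT x|lborel. \<bar>\<rho> x\<bar>)\<^sup>2 + stein_fisher k V V0 \<rho>)"
      unfolding weighted_def power2_abs .
  qed
qed

end
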